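(* Let $E$ be an elliptic curve defined over a number field $\mathcal{K}$. Let $\mathfrak{p}$ be a good prime of $E$, let $\tilde{E}_{\mathfrak{p}}$ be the reduction of $E$ modulo $\mathfrak{p}$, let $\mathbb{F}_{\mathfrak{p}}(\tilde{E}_{\mathfrak{p}})$ be its function field, with constant field $\mathbb{F}_q=\mathbb{F}_{\mathfrak{p}}$, and let $a_{\mathfrak{p}}\in\mathbb{Z}$ be defined by $\#\tilde{E}_{\mathfrak{p}}(\mathbb{F}_{\mathfrak{p}})=1-a_{\mathfrak{p}}+q$. Then $$a_{\mathfrak{p}}=1-q\cdot\lim_{n\to\infty}\sum_{\substack{2\le\deg D\le n\\ D\in\mathfrak{D}(\mathbb{F}_{\mathfrak{p}}(\tilde{E}_{\mathfrak{p}}),\mathcal{P})}}\frac{\mu(D)}{|D|}.$$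
   Context: A prime ideal $\mathfrak{p}$ of the ring of integers of $\mathcal{K}$ is good for $E$ if it does not divide the discriminant ideal of (a Weierstrass model $Y^2=X^3+aX+b$, $a,b$ integral, of) $E$; then the reduction $\tilde{E}_{\mathfrak{p}}$ is an elliptic curve over the residue field $\mathbb{F}_{\mathfrak{p}}$, of cardinality $q$. For the function field $F=\mathbb{F}_{\mathfrak{p}}(\tilde{E}_{\mathfrak{p}})$: $\mathcal{P}$ is its set of prime divisors (places), $|P|=q^{\deg P}$; effective divisors $D=\sum a_PP$ ($a_P\ge0$), $|D|=q^{\deg D}$; $\mu(D)$ is the Möbius function ($\mu(0)=1$, $(-1)^k$ for a sum of $k$ distinct primes, $0$ otherwise); $D\ne0$ is distinguishable if exactly one prime factor attains the minimal degree among its prime factors; $\mathfrak{D}(F,\mathcal{P})$ is the set of effective distinguishable divisors of $F$. *)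

theory Defs
  imports Complex_Main "HOL-Library.Multiset" "HOL-Algebra.Algebra"
begin

section \<open>Number fields, rings of integers and residue fields\<close>

text \<open>The field generated by the empty set is the prime field, which is a copy of the
  rationals in characteristic 0.\<close>

definition number_field :: "('a, 'm) ring_scheme \<Rightarrow> bool" where
  "number_field K \<longleftrightarrow>
     field K \<and>
     (\<forall>n::nat. n > 0 \<longrightarrow> add_pow K n \<one>\<^bsub>K\<^esub> \<noteq> \<zero>\<^bsub>K\<^esub>) \<and>
     ring.finite_dimension K (generate_field K {}) (carrier K)"

text \<open>Polynomials are coefficient lists, leading coefficient first.\<close>

definition integral_element :: "('a, 'm) ring_scheme \<Rightarrow> 'a \<Rightarrow> bool" where
  "integral_element K x \<longleftrightarrow>
     (\<exists>f. f \<noteq> [] \<and> hd f = \<one>\<^bsub>K\<^esub> \<and>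
          set f \<subseteq> range (\<lambda>n::int. add_pow K n \<one>\<^bsub>K\<^esub>) \<and>
          ring.eval K f x = \<zero>\<^bsub>K\<^esub>)"

definition ring_of_integers :: "('a, 'm) ring_scheme \<Rightarrow> ('a, 'm) ring_scheme" where
  "ring_of_integers K = K \<lparr>carrier := {x \<in> carrier K. integral_element K x}\<rparr>"

definition residue_field :: "('a, 'm) ring_scheme \<Rightarrow> 'a set \<Rightarrow> 'a set ring" where
  "residue_field K p = ring_of_integers K Quot p"

definition reduce :: "('a, 'm) ring_scheme \<Rightarrow> 'a set \<Rightarrow> 'a \<Rightarrow> 'a set" where
  "reduce K p x = p +>\<^bsub>ring_of_integers K\<^esub> x"


section \<open>Elliptic curves in short Weierstrass form\<close>

text \<open>The pair \<open>a\<close>, \<open>b\<close> stands for the curve $Y^2 = X^3 + aX + b$.\<close>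

definition discriminant :: "('a, 'm) ring_scheme \<Rightarrow> 'a \<Rightarrow> 'a \<Rightarrow> 'a" where
  "discriminant R a b =
     \<ominus>\<^bsub>R\<^esub> (add_pow R (16::nat) (add_pow R (4::nat) (a [^]\<^bsub>R\<^esub> (3::nat)) \<oplus>\<^bsub>R\<^esub>
                             add_pow R (27::nat) (b [^]\<^bsub>R\<^esub> (2::nat))))"

definition elliptic_curve :: "('a, 'm) ring_scheme \<Rightarrow> 'a \<Rightarrow> 'a \<Rightarrow> bool" where
  "elliptic_curve K a b \<longleftrightarrow>
     a \<in> carrier K \<and> b \<in> carrier K \<and> discriminant K a b \<noteq> \<zero>\<^bsub>K\<^esub>"

text \<open>The isomorphisms between short Weierstrass equations are
  $(X, Y) \mapsto (u^2 X, u^3 Y)$ with $u \neq 0$.\<close>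

definition integral_model ::
    "('a, 'm) ring_scheme \<Rightarrow> 'a \<Rightarrow> 'a \<Rightarrow> 'a \<Rightarrow> 'a \<Rightarrow> bool" where
  "integral_model K A B a b \<longleftrightarrow>
     a \<in> carrier (ring_of_integers K) \<and> b \<in> carrier (ring_of_integers K) \<and>
     (\<exists>u \<in> carrier K - {\<zero>\<^bsub>K\<^esub>}.
        a = u [^]\<^bsub>K\<^esub> (4::nat) \<otimes>\<^bsub>K\<^esub> A \<and> b = u [^]\<^bsub>K\<^esub> (6::nat) \<otimes>\<^bsub>K\<^esub> B)"

text \<open>An ideal divides another one iff it contains it.\<close>

definition good_prime :: "('a, 'm) ring_scheme \<Rightarrow> 'a \<Rightarrow> 'a \<Rightarrow> 'a set \<Rightarrow> bool" where
  "good_prime K a b p \<longleftrightarrow>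
     primeideal p (ring_of_integers K) \<and> p \<noteq> {\<zero>\<^bsub>K\<^esub>} \<and>
     \<not> PIdl\<^bsub>ring_of_integers K\<^esub> (discriminant (ring_of_integers K) a b) \<subseteq> p"

text \<open>The rational points; \<open>None\<close> is the point at infinity.\<close>

definition ec_points :: "('a, 'm) ring_scheme \<Rightarrow> 'a \<Rightarrow> 'a \<Rightarrow> ('a \<times> 'a) option set" where
  "ec_points k a b = insert None (Some `
     {(x, y). x \<in> carrier k \<and> y \<in> carrier k \<and>
        y [^]\<^bsub>k\<^esub> (2::nat) = x [^]\<^bsub>k\<^esub> (3::nat) \<oplus>\<^bsub>k\<^esub> a \<otimes>\<^bsub>k\<^esub> x \<oplus>\<^bsub>k\<^esub> b})"


section \<open>The function field of an elliptic curve\<close>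

definition frac_rel :: "('a, 'm) ring_scheme \<Rightarrow> (('a \<times> 'a) \<times> ('a \<times> 'a)) set" where
  "frac_rel R = {((a, b), (c, d)).
     a \<in> carrier R \<and> b \<in> carrier R - {\<zero>\<^bsub>R\<^esub>} \<and> c \<in> carrier R \<and> d \<in> carrier R - {\<zero>\<^bsub>R\<^esub>} \<and>
     a \<otimes>\<^bsub>R\<^esub> d = c \<otimes>\<^bsub>R\<^esub> b}"

definition frac_class :: "('a, 'm) ring_scheme \<Rightarrow> 'a \<Rightarrow> 'a \<Rightarrow> ('a \<times> 'a) set" where
  "frac_class R a b = frac_rel R `` {(a, b)}"

definition fraction_field :: "('a, 'm) ring_scheme \<Rightarrow> ('a \<times> 'a) set ring" where
  "fraction_field R =
     \<lparr>carrier = {frac_class R a b | a b. a \<in> carrier R \<and> b \<in> carrier R - {\<zero>\<^bsub>R\<^esub>}},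
      monoid.mult = (\<lambda>S T. \<Union>(a, b)\<in>S. \<Union>(c, d)\<in>T. frac_class R (a \<otimes>\<^bsub>R\<^esub> c) (b \<otimes>\<^bsub>R\<^esub> d)),
      monoid.one = frac_class R \<one>\<^bsub>R\<^esub> \<one>\<^bsub>R\<^esub>,
      ring.zero = frac_class R \<zero>\<^bsub>R\<^esub> \<one>\<^bsub>R\<^esub>,
      ring.add = (\<lambda>S T. \<Union>(a, b)\<in>S. \<Union>(c, d)\<in>T.
               frac_class R (a \<otimes>\<^bsub>R\<^esub> d \<oplus>\<^bsub>R\<^esub> c \<otimes>\<^bsub>R\<^esub> b) (b \<otimes>\<^bsub>R\<^esub> d))\<rparr>"

abbreviation bivariate :: "('a, 'm) ring_scheme \<Rightarrow> 'a list list ring" where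
  "bivariate k \<equiv> univ_poly (univ_poly k (carrier k)) (carrier (univ_poly k (carrier k)))"

text \<open>The ideal generated by $Y^2 - (X^3 + aX + b)$ in $k[X][Y]$.\<close>

definition curve_ideal :: "('a, 'm) ring_scheme \<Rightarrow> 'a \<Rightarrow> 'a \<Rightarrow> 'a list list set" where
  "curve_ideal k a b = PIdl\<^bsub>bivariate k\<^esub>
     [\<one>\<^bsub>univ_poly k (carrier k)\<^esub>, \<zero>\<^bsub>univ_poly k (carrier k)\<^esub>,
      \<ominus>\<^bsub>univ_poly k (carrier k)\<^esub> [\<one>\<^bsub>k\<^esub>, \<zero>\<^bsub>k\<^esub>, a, b]]"

definition coordinate_ring :: "('a, 'm) ring_scheme \<Rightarrow> 'a \<Rightarrow> 'a \<Rightarrow> 'a list list set ring" where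
  "coordinate_ring k a b = bivariate k Quot curve_ideal k a b"

definition function_field ::
    "('a, 'm) ring_scheme \<Rightarrow> 'a \<Rightarrow> 'a \<Rightarrow> ('a list list set \<times> 'a list list set) set ring" where
  "function_field k a b = fraction_field (coordinate_ring k a b)"

text \<open>The copy of \<open>k\<close> inside its function field.\<close>

definition constant_field ::
    "('a, 'm) ring_scheme \<Rightarrow> 'a \<Rightarrow> 'a \<Rightarrow> ('a list list set \<times> 'a list list set) set set" where
  "constant_field k a b =
     (\<lambda>c. frac_class (coordinate_ring k a b)
        (curve_ideal k a b +>\<^bsub>bivariate k\<^esub>
           ring.poly_of_const (univ_poly k (carrier k)) (ring.poly_of_const k c))
        \<one>\<^bsub>coordinate_ring k a b\<^esub>) ` carrier k"


section \<open>Places and effective divisors\<close>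

text \<open>Throughout, \<open>F\<close> is a function field and \<open>C \<subseteq> carrier F\<close> its finite field of constants.\<close>

definition valuation_ring :: "('f, 'm) ring_scheme \<Rightarrow> 'f set \<Rightarrow> 'f set \<Rightarrow> bool" where
  "valuation_ring F C V \<longleftrightarrow>
     subring V F \<and> C \<subset> V \<and> V \<subset> carrier F \<and>
     (\<forall>z \<in> carrier F - {\<zero>\<^bsub>F\<^esub>}. z \<in> V \<or> inv\<^bsub>F\<^esub> z \<in> V)"

definition places :: "('f, 'm) ring_scheme \<Rightarrow> 'f set \<Rightarrow> 'f set set" where
  "places F C = {P. \<exists>V. valuation_ring F C V \<and> maximalideal P (F \<lparr>carrier := V\<rparr>)}"

definition place_ring :: "('f, 'm) ring_scheme \<Rightarrow> 'f set \<Rightarrow> 'f set \<Rightarrow> ('f, 'm) ring_scheme" where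
  "place_ring F C P =
     F \<lparr>carrier := (THE V. valuation_ring F C V \<and> maximalideal P (F \<lparr>carrier := V\<rparr>))\<rparr>"

definition place_degree :: "('f, 'm) ring_scheme \<Rightarrow> 'f set \<Rightarrow> 'f set \<Rightarrow> nat" where
  "place_degree F C P =
     ring.dim (place_ring F C P Quot P)
       ((\<lambda>c. P +>\<^bsub>place_ring F C P\<^esub> c) ` C) (carrier (place_ring F C P Quot P))"

text \<open>An effective divisor is a finite multiset of places.\<close>

definition effective_divisors :: "('f, 'm) ring_scheme \<Rightarrow> 'f set \<Rightarrow> 'f set multiset set" where
  "effective_divisors F C = {D. set_mset D \<subseteq> places F C}"

definition div_degree :: "('f, 'm) ring_scheme \<Rightarrow> 'f set \<Rightarrow> 'f set multiset \<Rightarrow> nat" where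
  "div_degree F C D = (\<Sum>P\<in>#D. place_degree F C P)"

definition div_norm :: "('f, 'm) ring_scheme \<Rightarrow> 'f set \<Rightarrow> 'f set multiset \<Rightarrow> nat" where
  "div_norm F C D = card C ^ div_degree F C D"

definition div_moebius :: "'p multiset \<Rightarrow> int" where
  "div_moebius D = (if \<forall>P. count D P \<le> 1 then (-1) ^ size D else 0)"

definition distinguishable :: "('f, 'm) ring_scheme \<Rightarrow> 'f set \<Rightarrow> 'f set multiset \<Rightarrow> bool" where
  "distinguishable F C D \<longleftrightarrow>
     D \<noteq> {#} \<and>
     (\<exists>!P. P \<in># D \<and> (\<forall>Q. Q \<in># D \<longrightarrow> place_degree F C P \<le> place_degree F C Q))"

definition distinguishable_divisors ::
    "('f, 'm) ring_scheme \<Rightarrow> 'f set \<Rightarrow> 'f set multiset set" where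
  "distinguishable_divisors F C = {D \<in> effective_divisors F C. distinguishable F C D}"

end

theory Submission
  imports Defs "HOL-Decision_Procs.Commutative_Ring" "HOL-Analysis.Uniform_Limit"
    "HOL-Computational_Algebra.Formal_Power_Series"
begin

unbundle fps_syntax
unbundle no vec_syntax
hide_const (open) Commutative_Ring.norm Commutative_Ring.Pow

text \<open>
  Write \<open>q\<close> for the order of the residue field \<open>k\<close> and \<open>N\<close> for the number of points of the curve over \<open>k\<close>.
  Removing the unique prime of least degree \<open>d\<close> from a distinguishable divisor leaves a divisor
  supported in degrees above \<open>d\<close>, so the sum of \<open>\<mu>(D)/|D|\<close> over distinguishable divisors telescopes along
  the partial Euler products; it tends to \<open>-1\<close>, because the product of \<open>1 - |P|\<^sup>-\<^sup>1\<close> over all primes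
  vanishes. The divisors of degree 1 contribute \<open>-N/q\<close>, hence the sum from degree 2 on tends to
  \<open>N/q - 1\<close>.

  The analytic input is that \<open>\<Prod>(1 - t\<^sup>d\<^sup>e\<^sup>g \<^sup>P)\<close> equals \<open>(1 - t)(1 - qt)/L(t)\<close> with
  \<open>L(t) = 1 + (N - 1 - q)t + qt\<^sup>2\<close>, and that \<open>1/L(u/q)\<close> has absolutely summable coefficients, for which
  the trivial bound \<open>|N - 1 - q| \<le> q\<close> suffices. The product is computed from the classification of the
  places: apart from the one at infinity they lie over the monic irreducible \<open>P \<in> k[X]\<close>, and
  their number is governed by whether \<open>f = X\<^sup>3 + aX + b\<close> is a square modulo \<open>P\<close>, that is by a quadratic
  character \<open>\<chi>(P)\<close>. Extended multiplicatively by \<open>\<chi>(g) = \<plusminus> Res(g, f)\<^sup>(\<^sup>q\<^sup>-\<^sup>1\<^sup>)\<^sup>/\<^sup>2\<close>, its sum over the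
  monic polynomials of degree \<open>n\<close> is \<open>N - 1 - q\<close>, \<open>q\<close> and \<open>0\<close> for \<open>n = 1\<close>, \<open>n = 2\<close> and \<open>n \<ge> 3\<close>.
\<close>

section \<open>Power series with summable coefficients\<close>

definition l1_bound :: "'a::{real_normed_field,banach} fps \<Rightarrow> real \<Rightarrow> bool" where
  "l1_bound f B \<longleftrightarrow> (\<forall>N. (\<Sum>n<N. norm (f $ n)) \<le> B)"

lemma l1_bound_nonneg: "l1_bound f B \<Longrightarrow> 0 \<le> B"
  unfolding l1_bound_def by (metis lessThan_0 sum.empty)

lemma l1_bound_coeffs_tendsto_0:
  assumes "l1_bound f B" shows "(\<lambda>n. f $ n) \<longlonglongrightarrow> 0"
proof -
  have "summable (\<lambda>n. norm (f $ n))"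
    by (rule summableI_nonneg_bounded[where x = B]) (use assms in \<open>auto simp: l1_bound_def\<close>)
  then show ?thesis by (blast intro: summable_LIMSEQ_zero dest: summable_norm_cancel)
qed

lemma l1_bound_add:
  assumes "l1_bound f B" "l1_bound g C" shows "l1_bound (f + g) (B + C)"
  unfolding l1_bound_def
proof
  fix N
  have "(\<Sum>n<N. norm ((f + g) $ n)) \<le> (\<Sum>n<N. norm (f $ n) + norm (g $ n))"
    by (intro sum_mono) (simp add: norm_triangle_ineq)
  also have "\<dots> \<le> B + C"
    using assms by (auto simp: l1_bound_def sum.distrib intro: add_mono)
  finally show "(\<Sum>n<N. norm ((f + g) $ n)) \<le> B + C" .
qed

lemma l1_bound_mult:
  assumes "l1_bound f B" "l1_bound g C" shows "l1_bound (f * g) (B * C)"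
  unfolding l1_bound_def
proof
  fix N
  have "(\<Sum>n<N. norm ((f * g) $ n)) \<le> (\<Sum>n<N. \<Sum>i\<in>{0..n}. norm (f $ i) * norm (g $ (n - i)))"
    unfolding fps_mult_nth by (intro sum_mono order.trans[OF norm_sum]) (simp add: norm_mult)
  also have "\<dots> = (\<Sum>(n, i)\<in>(SIGMA n:{..<N}. {0..n}). norm (f $ i) * norm (g $ (n - i)))"
    by (rule sum.Sigma) auto
  also have "\<dots> = (\<Sum>(i, j)\<in>(\<lambda>(n, i). (i, n - i)) ` (SIGMA n:{..<N}. {0..n}).
      norm (f $ i) * norm (g $ j))"
    by (subst sum.reindex) (auto simp: inj_on_def case_prod_unfold)
  also have "\<dots> \<le> (\<Sum>(i, j)\<in>{..<N} \<times> {..<N}. norm (f $ i) * norm (g $ j))"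
    by (rule sum_mono2) auto
  also have "\<dots> = (\<Sum>i<N. norm (f $ i)) * (\<Sum>j<N. norm (g $ j))"
    by (simp add: sum_product sum.cartesian_product)
  also have "\<dots> \<le> B * C"
    using assms l1_bound_nonneg[OF assms(1)]
    by (intro mult_mono) (auto simp: l1_bound_def sum_nonneg)
  finally show "(\<Sum>n<N. norm ((f * g) $ n)) \<le> B * C" .
qed

lemma l1_bound_monomial: "l1_bound (fps_const c * fps_X ^ k) (norm c)"
proof -
  have "(\<Sum>n<N. norm ((fps_const c * fps_X ^ k) $ n)) = (\<Sum>n<N. if n = k then norm c else 0)" for N
    by (intro sum.cong) (auto simp: fps_X_power_nth)
  then show ?thesis by (simp add: l1_bound_def)
qed

lemma l1_bound_one: "l1_bound 1 1"
  using l1_bound_monomial[of 1 0] by simp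

lemma l1_bound_mono: "l1_bound f B \<Longrightarrow> B \<le> C \<Longrightarrow> l1_bound f C"
  unfolding l1_bound_def by (meson order.trans)

lemma l1_bound_power: "l1_bound f B \<Longrightarrow> l1_bound (f ^ n) (B ^ n)"
  by (induction n) (auto simp: l1_bound_one l1_bound_mult)

lemma l1_bound_prod:
  "(\<And>i. i \<in> I \<Longrightarrow> l1_bound (f i) (B i)) \<Longrightarrow> l1_bound (prod f I) (prod B I)"
  by (induction I rule: infinite_finite_induct) (auto simp: l1_bound_one l1_bound_mult)

lemma l1_bound_geometric:
  fixes c :: "'a::{real_normed_field,banach}"
  assumes "norm c < 1" shows "l1_bound (Abs_fps (\<lambda>n. c ^ n)) (1 / (1 - norm c))"
  unfolding l1_bound_def
proof
  fix N
  have "(\<Sum>n<N. norm (Abs_fps (\<lambda>n. c ^ n) $ n)) = (\<Sum>n<N. norm c ^ n)" by (simp add: norm_power)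
  also have "\<dots> = (1 - norm c ^ N) / (1 - norm c)" using assms by (simp add: sum_gp_strict)
  also have "\<dots> \<le> 1 / (1 - norm c)" using assms by (intro divide_right_mono) auto
  finally show "(\<Sum>n<N. norm (Abs_fps (\<lambda>n. c ^ n) $ n)) \<le> 1 / (1 - norm c)" .
qed

lemma norm_mult_nth_le:
  assumes "l1_bound f B" "\<And>n. norm (g $ n) \<le> C"
  shows "norm ((f * g) $ n) \<le> B * C"
proof -
  have "0 \<le> C" using assms(2) norm_ge_zero order.trans by blast
  have "norm ((f * g) $ n) \<le> (\<Sum>i\<in>{0..n}. norm (f $ i) * C)"
    unfolding fps_mult_nth
    by (intro order.trans[OF norm_sum] sum_mono) (simp add: norm_mult mult_left_mono assms(2))
  also have "\<dots> = (\<Sum>i<Suc n. norm (f $ i)) * C"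
    by (simp add: sum_distrib_right atLeast0AtMost lessThan_Suc_atMost)
  also have "\<dots> \<le> B * C"
    using assms(1) \<open>0 \<le> C\<close> unfolding l1_bound_def by (intro mult_right_mono) blast+
  finally show ?thesis .
qed

lemma fps_mult_nth_eq_0:
  assumes "\<And>i. i \<le> n \<Longrightarrow> g $ i = 0" shows "(f * g) $ n = (0::'a::comm_ring_1)"
  unfolding fps_mult_nth using assms by (intro sum.neutral) auto

lemma fps_mult_nth_cong:
  assumes "\<And>i. i \<le> n \<Longrightarrow> f $ i = f' $ i" "\<And>i. i \<le> n \<Longrightarrow> g $ i = g' $ i"
  shows "(f * g) $ n = (f' * g') $ n"
  unfolding fps_mult_nth using assms by (intro sum.cong) auto

lemma fps_inverse_nth_cong:
  fixes f g :: "'a::field fps"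
  assumes "\<And>i. i \<le> n \<Longrightarrow> f $ i = g $ i" "f $ 0 \<noteq> 0" "g $ 0 \<noteq> 0"
  shows "inverse f $ n = inverse g $ n"
proof -
  have "inverse f * inverse g * (g - f) = inverse f * (inverse g * g) - inverse g * (inverse f * f)"
    by (simp only: algebra_simps)
  then have "inverse f - inverse g = inverse f * inverse g * (g - f)"
    by (simp only: inverse_mult_eq_1[OF assms(2)] inverse_mult_eq_1[OF assms(3)] mult_1_right)
  then have "(inverse f - inverse g) $ n = 0"
    using fps_mult_nth_eq_0[of n "g - f" "inverse f * inverse g"] assms(1) by simp
  then show ?thesis by simp
qed

lemma fps_nonneg_mult:
  "(\<And>n. f $ n \<ge> 0) \<Longrightarrow> (\<And>n. g $ n \<ge> 0) \<Longrightarrow> (f * g) $ n \<ge> (0::real)"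
  by (simp add: fps_mult_nth sum_nonneg)

lemma fps_nonneg_power:
  assumes "\<And>n. f $ n \<ge> (0::real)" shows "(f ^ k) $ n \<ge> 0"
proof (induction k arbitrary: n)
  case (Suc k) then show ?case using assms by (simp add: fps_nonneg_mult)
qed simp

lemma fps_nonneg_prod:
  fixes f :: "'b \<Rightarrow> real fps"
  shows "(\<And>i n. i \<in> I \<Longrightarrow> f i $ n \<ge> 0) \<Longrightarrow> (prod f I) $ n \<ge> 0"
proof (induction I arbitrary: n rule: infinite_finite_induct)
  case (insert x F) then show ?case by (simp add: fps_nonneg_mult)
qed simp_all

lemma sum_one_minus_X_mult_nth: "(\<Sum>m\<le>n. ((1 - fps_X) * f) $ m) = (f $ n :: 'a::comm_ring_1)"
  by (induction n) (auto simp: algebra_simps)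

section \<open>Euler factors\<close>

abbreviation euler_factor :: "'a::comm_ring_1 \<Rightarrow> nat \<Rightarrow> 'a fps" where
  "euler_factor c d \<equiv> 1 - fps_const c * fps_X ^ d"

lemma inverse_euler_factor:
  fixes c :: real
  assumes "0 \<le> c" "c < 1" "d > 0"
  defines "g \<equiv> inverse (euler_factor c d)"
  shows "g $ n \<ge> 0" "l1_bound g (1 / (1 - c))"
proof -
  have "euler_factor c d * g = 1"
    unfolding g_def by (rule inverse_mult_eq_1') (use assms in auto)
  then have g_rec: "g = 1 + fps_const c * (fps_X ^ d * g)"
    by (simp add: algebra_simps)
  have nth_rec: "g $ n = (if n = 0 then 1 else 0) + c * (if n < d then 0 else g $ (n - d))" for n
    by (subst g_rec) (simp add: fps_X_power_mult_nth)
  show nonneg: "g $ n \<ge> 0" for n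
  proof (induction n rule: less_induct)
    case (less n) then show ?case using assms by (subst nth_rec) auto
  qed
  show "l1_bound g (1 / (1 - c))"
    unfolding l1_bound_def
  proof
    fix N
    let ?s = "\<Sum>n<N. g $ n"
    have "?s = (\<Sum>n<N. if n = 0 then 1 else 0) + c * (\<Sum>n<N. if n < d then 0 else g $ (n - d))"
      by (subst nth_rec) (simp add: sum.distrib sum_distrib_left)
    also have "(\<Sum>n<N. if n < d then 0 else g $ (n - d)) = (\<Sum>n\<in>{..<N} - {..<d}. g $ (n - d))"
      by (rule sum.mono_neutral_cong_right) auto
    also have "\<dots> = sum (($) g) ((\<lambda>n. n - d) ` ({..<N} - {..<d}))"
      by (subst sum.reindex) (auto simp: inj_on_def)
    also have "\<dots> \<le> ?s"
      by (rule sum_mono2) (auto simp: nonneg)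
    also have "(\<Sum>n<N. if n = 0 then 1 else (0::real)) \<le> 1" by simp
    finally have "?s \<le> 1 + c * ?s" using assms by (simp add: mult_left_mono)
    then have "?s \<le> 1 / (1 - c)" using assms by (simp add: field_simps)
    then show "(\<Sum>n<N. norm (g $ n)) \<le> 1 / (1 - c)" using nonneg by simp
  qed
qed

lemma l1_bound_euler_factor_power_remainder:
  fixes x :: real
  assumes "0 \<le> x"
  shows "l1_bound (euler_factor x d ^ a - 1 + fps_const (real a * x) * fps_X ^ d)
           ((1 + x) ^ a - 1 - real a * x)"
proof (induction a)
  case 0 then show ?case by (simp add: l1_bound_def)
next
  case (Suc a)
  let ?R = "\<lambda>a. euler_factor x d ^ a - 1 + fps_const (real a * x) * fps_X ^ d"
  let ?m = "fps_const x * fps_X ^ d"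
  have linear: "fps_const (real a * x) * fps_X ^ d = of_nat a * ?m" for a
    by (simp only: fps_of_nat [symmetric] fps_const_mult [symmetric] mult.assoc)
  have "?m ^ 2 = fps_const (x ^ 2) * fps_X ^ (2 * d)"
    by (simp only: power_mult_distrib fps_const_power power_mult [symmetric] mult.commute[of 2 d])
  then have square: "fps_const (real a * x ^ 2) * fps_X ^ (2 * d) = of_nat a * ?m ^ 2"
    by (simp only: fps_of_nat [symmetric] fps_const_mult [symmetric] mult.assoc)
  have negate: "fps_const (- x) * fps_X ^ d = - ?m" by (simp flip: fps_const_neg)
  have expand: "(1 - m) * p - 1 + (1 + k) * m = (p - 1 + k * m) * (1 + - m) + k * m ^ 2"
    for m p k :: "real fps"
    by (simp add: algebra_simps power2_eq_square)
  have "?R (Suc a) = ?R a * (1 + fps_const (- x) * fps_X ^ d)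
      + fps_const (real a * x ^ 2) * fps_X ^ (2 * d)"
    unfolding linear square negate by (simp only: power_Suc of_nat_Suc expand)
  moreover have "l1_bound \<dots> (((1 + x) ^ a - 1 - real a * x) * (1 + norm (- x)) + norm (real a * x ^ 2))"
    by (intro l1_bound_add l1_bound_mult Suc l1_bound_one l1_bound_monomial)
  moreover have "((1 + x) ^ a - 1 - real a * x) * (1 + norm (- x)) + norm (real a * x ^ 2) =
      (1 + x) ^ Suc a - 1 - real (Suc a) * x"
    using assms by (simp add: algebra_simps power2_eq_square)
  ultimately show ?case by simp
qed

lemma binomial_remainder_le_exp:
  fixes x :: real
  assumes "0 \<le> x"
  shows "(1 + x) ^ a - 1 - real a * x \<le> (real a * x)\<^sup>2 * exp (real a * x)"
proof -
  define w where "w = real a * x"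
  have "0 \<le> w" using assms by (simp add: w_def)
  have "(1 + x) ^ a \<le> exp x ^ a"
    using assms by (intro power_mono) (auto simp: exp_ge_add_one_self)
  then have power_le: "(1 + x) ^ a \<le> exp w" by (simp add: w_def exp_of_nat_mult)
  have "1 - w \<le> exp (- w)" using exp_ge_add_one_self[of "-w"] by simp
  then have "exp w * (1 - w) \<le> exp w * exp (- w)" by (rule mult_left_mono) simp
  then have exp_le: "exp w - 1 \<le> w * exp w" by (simp add: exp_minus algebra_simps)
  then have "w * (exp w - 1) \<le> w * (w * exp w)" using \<open>0 \<le> w\<close> by (rule mult_left_mono)
  with power_le exp_le show ?thesis unfolding w_def [symmetric]
    by (simp add: algebra_simps power2_eq_square)
qed

lemma euler_factor_power_nth_0:
  "d > 0 \<Longrightarrow> (euler_factor c d ^ a) $ 0 = (1::'a::comm_ring_1)"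
  by (simp add: fps_power_zeroth zero_power)

lemma euler_factor_power_nth_small:
  fixes c :: "'a::comm_ring_1"
  assumes "0 < i" "i < d" shows "(euler_factor c d ^ a) $ i = 0"
proof (induction a)
  case (Suc a)
  have "(euler_factor c d ^ Suc a) $ i =
     (euler_factor c d ^ a) $ i - (fps_X ^ d * (fps_const c * euler_factor c d ^ a)) $ i"
    by (simp add: algebra_simps)
  also have "\<dots> = 0" using Suc assms by (subst fps_X_power_mult_nth) auto
  finally show ?case .
qed (use assms in auto)

lemma euler_factor_power_nth_1: "(euler_factor c 1 ^ m) $ 1 = - (of_nat m * c :: 'a::comm_ring_1)"
proof (induction m)
  case (Suc m)
  then show ?case
    using euler_factor_power_nth_0[of 1 c m] by (simp add: fps_mult_nth_1 algebra_simps)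
qed simp

lemma mult_prod_euler_factors_nth:
  fixes f :: "'a::comm_ring_1 fps"
  assumes "finite E" "\<And>x. x \<in> E \<Longrightarrow> n < d x"
  shows "(f * (\<Prod>x\<in>E. euler_factor (c x) (d x))) $ n = f $ n"
  using assms
proof (induction E arbitrary: f rule: finite_induct)
  case (insert x E)
  let ?g = "\<Prod>x\<in>E. euler_factor (c x) (d x)"
  have "f * (\<Prod>x\<in>insert x E. euler_factor (c x) (d x)) = f * ?g - fps_X ^ d x * (fps_const (c x) * (f * ?g))"
    using insert.hyps by (simp add: algebra_simps)
  then have "(f * (\<Prod>x\<in>insert x E. euler_factor (c x) (d x))) $ n = (f * ?g) $ n"
    using insert.prems[of x] by (simp add: fps_X_power_mult_nth)
  then show ?case using insert by simp
qed simp

locale summable_euler_product =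
  fixes a :: "nat \<Rightarrow> nat" and q c B C :: real and H :: "real fps"
  assumes q_gt_1: "q > 1" and weight_le: "d > 0 \<Longrightarrow> real (a d) / q ^ d \<le> c / real d"
    and l1_bound_H: "l1_bound H B" and inverse_le: "inverse ((1 - fps_X) * H) $ n \<le> C"
    and product_nth: "n \<le> N \<Longrightarrow>
      ((1 - fps_X) * H) $ n = (\<Prod>d\<in>{1..N}. euler_factor (1 / q ^ d) d ^ a d) $ n"
begin

definition weight :: "nat \<Rightarrow> real" where "weight d = real (a d) / q ^ d"

definition factor :: "nat \<Rightarrow> real fps" where "factor d = euler_factor (1 / q ^ d) d ^ a d"

definition inverse_factor :: "nat \<Rightarrow> real fps" where
  "inverse_factor d = inverse (euler_factor (1 / q ^ d) d) ^ a d"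

definition inverse_upto :: "nat \<Rightarrow> real fps" where
  "inverse_upto d = (\<Prod>e\<in>{1..d}. inverse_factor e)"

definition cofactor :: "nat \<Rightarrow> real fps" where
  "cofactor d = (1 - fps_X) * H * inverse_upto d"

definition remainder :: "nat \<Rightarrow> real fps" where
  "remainder d = factor d - 1 + fps_const (weight d) * fps_X ^ d"

lemma weight_nonneg: "0 \<le> weight d"
  using q_gt_1 by (simp add: weight_def)

lemma inverse_power_q_bounds: assumes "d > 0" shows "0 \<le> 1 / q ^ d" "1 / q ^ d < 1"
  using q_gt_1 assms by (auto simp: field_simps one_less_power)

lemma inverse_factor_nonneg: "d > 0 \<Longrightarrow> inverse_factor d $ n \<ge> 0"
  unfolding inverse_factor_def
  by (intro fps_nonneg_power inverse_euler_factor inverse_power_q_bounds)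

lemma factor_mult_inverse_factor: assumes "d > 0" shows "factor d * inverse_factor d = 1"
proof -
  have "euler_factor (1 / q ^ d) d * inverse (euler_factor (1 / q ^ d) d) = 1"
    by (rule inverse_mult_eq_1') (use assms in auto)
  then show ?thesis by (simp add: factor_def inverse_factor_def power_mult_distrib [symmetric])
qed

lemma inverse_factor_nth_0: "d > 0 \<Longrightarrow> inverse_factor d $ 0 = 1"
  by (simp add: inverse_factor_def fps_power_zeroth zero_power)

lemma prod_factor_nth_0: "(\<Prod>e\<in>{1..d}. factor e) $ 0 = 1"
  unfolding factor_def by (simp add: fps_prod_nth' fps_prod_nth euler_factor_power_nth_0)

lemma prod_factor_mult_inverse_upto: "(\<Prod>e\<in>{1..d}. factor e) * inverse_upto d = 1"
  unfolding inverse_upto_def by (simp add: prod.distrib [symmetric] factor_mult_inverse_factor)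

lemma inverse_prod_factor: "inverse (\<Prod>e\<in>{1..d}. factor e) = inverse_upto d"
  using prod_factor_mult_inverse_upto[of d] prod_factor_nth_0[of d] by (metis fps_inverse_unique)

lemma inverse_upto_nonneg: "inverse_upto d $ n \<ge> 0"
  unfolding inverse_upto_def by (intro fps_nonneg_prod inverse_factor_nonneg) auto

lemma inverse_upto_l1: "\<exists>B. l1_bound (inverse_upto d) B"
  unfolding inverse_upto_def inverse_factor_def
  by (rule exI, rule l1_bound_prod, rule l1_bound_power, rule inverse_euler_factor(2))
     (use inverse_power_q_bounds in auto)

lemma inverse_upto_le_Suc: "inverse_upto d $ n \<le> inverse_upto (Suc d) $ n"
proof -
  have "inverse_upto d $ n = inverse_upto d $ n * inverse_factor (Suc d) $ (n - n)"
    by (simp add: inverse_factor_nth_0)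
  also have "\<dots> \<le> (\<Sum>i=0..n. inverse_upto d $ i * inverse_factor (Suc d) $ (n - i))"
    by (rule member_le_sum) (auto intro!: mult_nonneg_nonneg inverse_upto_nonneg inverse_factor_nonneg)
  also have "\<dots> = inverse_upto (Suc d) $ n" by (simp add: inverse_upto_def fps_mult_nth)
  finally show ?thesis .
qed

lemma norm_inverse_upto_le: "norm (inverse_upto d $ n) \<le> C"
proof -
  have "inverse_upto d $ n \<le> inverse_upto (max d n) $ n"
    using lift_Suc_mono_le[of "\<lambda>d. inverse_upto d $ n"] inverse_upto_le_Suc by simp
  also have "\<dots> = inverse ((1 - fps_X) * H) $ n"
    unfolding inverse_prod_factor [symmetric]
  proof (rule fps_inverse_nth_cong)
    show "(\<Prod>e\<in>{1..max d n}. factor e) $ i = ((1 - fps_X) * H) $ i" if "i \<le> n" for i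
      using product_nth[of i "max d n"] that by (simp add: factor_def)
    show "((1 - fps_X) * H) $ 0 \<noteq> 0" using product_nth[of 0 0] by simp
  qed (use prod_factor_nth_0[of "max d n"] in simp)
  also have "\<dots> \<le> C" by (rule inverse_le)
  finally show ?thesis using inverse_upto_nonneg by simp
qed

lemma remainder_nth_small:
  assumes "i < d" shows "remainder d $ i = 0"
  using assms unfolding remainder_def factor_def
  by (cases "i = 0")
     (auto simp: euler_factor_power_nth_0 euler_factor_power_nth_small fps_X_power_nth)

lemma remainder_l1:
  assumes "d > 0" shows "l1_bound (remainder d) ((weight d)\<^sup>2 * exp (weight d))"
  using l1_bound_mono[OF l1_bound_euler_factor_power_remainder binomial_remainder_le_exp, of "1 / q ^ d" d "a d"]
    inverse_power_q_bounds[OF assms]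
  by (simp add: remainder_def factor_def weight_def)

lemma cofactor_diff:
  "cofactor d - cofactor (Suc d) = cofactor (Suc d) * remainder (Suc d)
     - fps_const (weight (Suc d)) * (fps_X ^ Suc d * cofactor (Suc d))"
proof -
  have "inverse_upto d = inverse_upto (Suc d) * factor (Suc d)"
    using factor_mult_inverse_factor[of "Suc d"]
    by (simp add: inverse_upto_def mult.assoc mult.commute)
  then have "cofactor d = cofactor (Suc d) * factor (Suc d)" by (simp add: cofactor_def mult.assoc)
  then show ?thesis by (simp add: remainder_def algebra_simps)
qed

lemma cofactor_diagonal: assumes "m > 0" shows "cofactor m $ m = 0"
proof -
  have "cofactor m $ m = ((\<Prod>e\<in>{1..m}. factor e) * inverse_upto m) $ m"
    unfolding cofactor_def
    by (rule fps_mult_nth_cong) (use product_nth[of _ m] in \<open>auto simp: factor_def\<close>)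
  then show ?thesis using assms prod_factor_mult_inverse_upto by simp
qed

lemma sum_weight_cofactor:
  "(\<Sum>d=1..m. weight d * cofactor d $ (m - d))
     = (\<Sum>d=1..m. (cofactor d * remainder d) $ m) - ((1 - fps_X) * H) $ m + (if m = 0 then 1 else 0)"
proof (cases "m = 0")
  case True
  then show ?thesis using product_nth[of 0 0] by simp
next
  case False
  have "((1 - fps_X) * H) $ m = cofactor 0 $ m - cofactor m $ m"
    using cofactor_diagonal False by (simp add: cofactor_def inverse_upto_def)
  also have "\<dots> = (\<Sum>d<m. (cofactor d - cofactor (Suc d)) $ m)"
    using sum_lessThan_telescope'[of "\<lambda>d. cofactor d $ m" m] by simp
  also have "\<dots> = (\<Sum>d<m. (cofactor (Suc d) * remainder (Suc d)) $ m
      - weight (Suc d) * cofactor (Suc d) $ (m - Suc d))"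
  proof (intro sum.cong refl)
    fix d assume "d \<in> {..<m}"
    moreover define k where "k = Suc d"
    ultimately have "\<not> m < k" by simp
    then show "(cofactor d - cofactor (Suc d)) $ m = (cofactor (Suc d) * remainder (Suc d)) $ m
        - weight (Suc d) * cofactor (Suc d) $ (m - Suc d)"
      unfolding cofactor_diff unfolding k_def [symmetric] by (simp add: fps_X_power_mult_nth)
  qed
  also have "\<dots> = (\<Sum>d=1..m. (cofactor d * remainder d) $ m - weight d * cofactor d $ (m - d))"
    by (rule sum.reindex_bij_witness[of _ "\<lambda>d. d - 1" Suc]) auto
  finally show ?thesis using False by (simp add: sum_subtractf)
qed

lemma sum_sum_weight_cofactor:
  "(\<Sum>m\<le>n. \<Sum>d=1..m. weight d * cofactor d $ (m - d))
     = 1 - H $ n + (\<Sum>d=1..n. (H * inverse_upto d * remainder d) $ n)"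
proof -
  have "(\<Sum>m\<le>n. \<Sum>d=1..m. (cofactor d * remainder d) $ m)
      = (\<Sum>m\<le>n. \<Sum>d=1..n. (cofactor d * remainder d) $ m)"
  proof (rule sum.cong[OF refl])
    fix m assume "m \<in> {..n}"
    moreover have "(cofactor d * remainder d) $ m = 0" if "d \<in> {1..n} - {1..m}" for d
      by (rule fps_mult_nth_eq_0, rule remainder_nth_small) (use that in auto)
    ultimately show "(\<Sum>d=1..m. (cofactor d * remainder d) $ m) = (\<Sum>d=1..n. (cofactor d * remainder d) $ m)"
      by (intro sum.mono_neutral_left) auto
  qed
  also have "\<dots> = (\<Sum>d=1..n. \<Sum>m\<le>n. (cofactor d * remainder d) $ m)" by (rule sum.swap)
  also have "\<dots> = (\<Sum>d=1..n. (H * inverse_upto d * remainder d) $ n)"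
    using sum_one_minus_X_mult_nth[of "H * inverse_upto d * remainder d" n for d]
    by (simp add: cofactor_def mult.assoc)
  finally show ?thesis
    using sum_one_minus_X_mult_nth[of H n]
    by (simp only: sum_weight_cofactor sum.distrib sum_subtractf) simp
qed

lemma remainder_term_bound:
  "\<exists>D\<ge>0. \<forall>d>0. \<forall>n. norm ((H * inverse_upto d * remainder d) $ n) \<le> D * (1 / real d ^ 2)"
proof (intro exI conjI allI impI)
  define c' where "c' = max c 1"
  let ?D = "B * C * (c'\<^sup>2 * exp c')"
  have "c' > 0" by (simp add: c'_def)
  have "0 \<le> B" using l1_bound_H by (rule l1_bound_nonneg)
  have "0 \<le> C" using norm_inverse_upto_le[of 0 0] norm_ge_zero order.trans by blast
  show "0 \<le> ?D" using \<open>0 \<le> B\<close> \<open>0 \<le> C\<close> by simp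
  fix d n :: nat assume "d > 0"
  have "norm ((H * inverse_upto d) $ n) \<le> B * C" for n
    by (rule norm_mult_nth_le[OF l1_bound_H norm_inverse_upto_le])
  then have "norm ((remainder d * (H * inverse_upto d)) $ n) \<le> ((weight d)\<^sup>2 * exp (weight d)) * (B * C)"
    by (rule norm_mult_nth_le[OF remainder_l1[OF \<open>d > 0\<close>]])
  also have "\<dots> \<le> ((c' / real d)\<^sup>2 * exp c') * (B * C)"
  proof (intro mult_right_mono mult_mono power_mono)
    show "weight d \<le> c' / real d"
      using weight_le[OF \<open>d > 0\<close>] unfolding weight_def c'_def
      by (meson divide_right_mono max.cobounded1 of_nat_0_le_iff order.trans)
    also have "\<dots> \<le> c'" using \<open>d > 0\<close> \<open>c' > 0\<close> by (simp add: field_simps)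
    finally show "exp (weight d) \<le> exp c'" by simp
  qed (use weight_nonneg \<open>0 \<le> B\<close> \<open>0 \<le> C\<close> in auto)
  finally show "norm ((H * inverse_upto d * remainder d) $ n) \<le> ?D * (1 / real d ^ 2)"
    by (simp add: mult.commute power_divide)
qed

text \<open>Each term tends to \<open>0\<close> with \<open>n\<close> and is \<open>O(1/d\<^sup>2)\<close> uniformly in \<open>n\<close>, so Tannery's theorem applies.\<close>

lemma sum_remainder_tendsto_0: "(\<lambda>n. \<Sum>d=1..n. (H * inverse_upto d * remainder d) $ n) \<longlonglongrightarrow> 0"
proof -
  define f where "f d n = (if 1 \<le> d \<and> d \<le> n then (H * inverse_upto d * remainder d) $ n else 0)" for d n
  obtain D where "0 \<le> D" and
    D: "\<And>d n. d > 0 \<Longrightarrow> norm ((H * inverse_upto d * remainder d) $ n) \<le> D * (1 / real d ^ 2)"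
    using remainder_term_bound by blast
  have "((\<lambda>n. suminf (\<lambda>d. f d n)) \<longlongrightarrow> suminf (\<lambda>d. 0)) sequentially"
  proof (rule tannerys_theorem[where M = "\<lambda>d. D * (1 / real d ^ 2)", THEN conjunct2, THEN conjunct2])
    show "((\<lambda>n. f d n) \<longlongrightarrow> 0) sequentially" for d
    proof (cases "d = 0")
      case False
      obtain S where "l1_bound (inverse_upto d) S" using inverse_upto_l1 by blast
      then have "l1_bound (H * inverse_upto d * remainder d) (B * S * ((weight d)\<^sup>2 * exp (weight d)))"
        using False by (intro l1_bound_mult l1_bound_H remainder_l1) auto
      then have "(\<lambda>n. (H * inverse_upto d * remainder d) $ n) \<longlonglongrightarrow> 0"
        by (rule l1_bound_coeffs_tendsto_0)
      moreover have "eventually (\<lambda>n. f d n = (H * inverse_upto d * remainder d) $ n) sequentially"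
        using eventually_ge_at_top[of d] by eventually_elim (use False in \<open>simp add: f_def\<close>)
      ultimately show ?thesis by (simp add: filterlim_cong)
    qed (simp add: f_def)
    show "\<forall>\<^sub>F (d, n) in at_top \<times>\<^sub>F sequentially. norm (f d n) \<le> D * (1 / real d ^ 2)"
    proof (rule always_eventually, clarify)
      show "norm (f d n) \<le> D * (1 / real d ^ 2)" for d n
        using D[of d n] \<open>0 \<le> D\<close> by (auto simp: f_def)
    qed
    show "summable (\<lambda>d. D * (1 / real d ^ 2))"
      by (intro summable_mult inverse_power_summable[where 'a = real, of 2, unfolded inverse_eq_divide]) simp
  qed simp
  moreover have "suminf (\<lambda>d. f d n) = (\<Sum>d=1..n. (H * inverse_upto d * remainder d) $ n)" for n
    by (subst suminf_finite[of "{1..n}"]) (auto simp: f_def intro!: sum.cong)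
  ultimately show ?thesis by simp
qed

theorem sum_weight_cofactor_tendsto_1:
  "(\<lambda>n. \<Sum>m\<le>n. \<Sum>d=1..m. weight d * cofactor d $ (m - d)) \<longlonglongrightarrow> 1"
proof -
  have "(\<lambda>n. 1 - H $ n + (\<Sum>d=1..n. (H * inverse_upto d * remainder d) $ n)) \<longlonglongrightarrow> 1 - 0 + 0"
    by (intro tendsto_intros sum_remainder_tendsto_0 l1_bound_coeffs_tendsto_0[OF l1_bound_H])
  then show ?thesis by (simp only: sum_sum_weight_cofactor diff_zero add_0_right)
qed

end

section \<open>Distinguishable sums over graded primes\<close>

locale graded_primes =
  fixes P :: "'p set" and deg :: "'p \<Rightarrow> nat" and q :: real
  assumes deg_pos: "p \<in> P \<Longrightarrow> deg p > 0"
    and finite_deg: "finite {p \<in> P. deg p = d}"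
    and q_gt_1: "q > 1"
begin

definition prime_count :: "nat \<Rightarrow> nat" where "prime_count d = card {p \<in> P. deg p = d}"

definition factor :: "nat \<Rightarrow> real fps" where
  "factor d = euler_factor (1 / q ^ d) d ^ prime_count d"

definition sets_above :: "nat \<Rightarrow> nat \<Rightarrow> 'p set set" where
  "sets_above d j = {A. finite A \<and> A \<subseteq> P \<and> (\<forall>p\<in>A. d < deg p) \<and> sum deg A = j}"

lemma finite_deg_le: "finite {p \<in> P. deg p \<le> m}"
proof -
  have "{p \<in> P. deg p \<le> m} = (\<Union>d\<in>{..m}. {p \<in> P. deg p = d})" by auto
  then show ?thesis using finite_deg by simp
qed

lemma finite_deg_between: "finite {p \<in> P. d < deg p \<and> deg p \<le> m}"
  by (rule rev_finite_subset[OF finite_deg_le[of m]]) auto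

lemma sets_above_subset: "sets_above d j \<subseteq> Pow {p \<in> P. d < deg p \<and> deg p \<le> j}"
proof
  fix A assume A: "A \<in> sets_above d j"
  then have "deg p \<le> j" if "p \<in> A" for p
    using that member_le_sum[of p A deg] by (auto simp: sets_above_def)
  with A show "A \<in> Pow {p \<in> P. d < deg p \<and> deg p \<le> j}" by (auto simp: sets_above_def)
qed

lemma finite_sets_above: "finite (sets_above d j)"
  by (rule finite_subset[OF sets_above_subset]) (simp add: finite_deg_between)

lemma prod_factor_eq:
  "(\<Prod>e\<in>{d<..N}. factor e) = (\<Prod>p\<in>{p \<in> P. d < deg p \<and> deg p \<le> N}. euler_factor (1 / q ^ deg p) (deg p))"
proof -
  let ?X = "{p \<in> P. d < deg p \<and> deg p \<le> N}"
  let ?f = "\<lambda>p. euler_factor (1 / q ^ deg p) (deg p)"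
  have "(\<Prod>e\<in>{d<..N}. factor e) = (\<Prod>e\<in>{d<..N}. \<Prod>p\<in>{p \<in> ?X. deg p = e}. ?f p)"
  proof (rule prod.cong[OF refl])
    fix e assume "e \<in> {d<..N}"
    then have "{p \<in> ?X. deg p = e} = {p \<in> P. deg p = e}" by auto
    moreover have "(\<Prod>p\<in>{p \<in> P. deg p = e}. ?f p) = (\<Prod>p\<in>{p \<in> P. deg p = e}. euler_factor (1 / q ^ e) e)"
      by (rule prod.cong) auto
    ultimately show "factor e = (\<Prod>p\<in>{p \<in> ?X. deg p = e}. ?f p)"
      by (simp add: factor_def prime_count_def)
  qed
  also have "\<dots> = prod ?f ?X"
    by (rule prod.group[OF finite_deg_between]) auto
  finally show ?thesis .
qed

lemma prod_neg_monomials: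
  assumes "finite A"
  shows "(\<Prod>p\<in>A. - (fps_const (1 / q ^ deg p) * fps_X ^ deg p))
    = fps_const ((-1) ^ card A / q ^ sum deg A) * fps_X ^ sum deg A"
  using assms
proof (induction A)
  case (insert x A)
  have "fps_const ((-1) ^ card (insert x A) / q ^ sum deg (insert x A))
     = - fps_const (1 / q ^ deg x) * fps_const ((-1) ^ card A / q ^ sum deg A)"
    using insert(1,2) by (simp add: power_add)
  with insert show ?case by (simp add: power_add algebra_simps flip: fps_const_neg)
qed simp

lemma prod_factor_nth:
  assumes "j \<le> N"
  shows "(\<Prod>e\<in>{d<..N}. factor e) $ j = (\<Sum>A\<in>sets_above d j. (-1) ^ card A) / q ^ j"
proof -
  let ?X = "{p \<in> P. d < deg p \<and> deg p \<le> N}"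
  let ?m = "\<lambda>p. fps_const (1 / q ^ deg p) * fps_X ^ deg p"
  have "(\<Prod>e\<in>{d<..N}. factor e) = (\<Prod>p\<in>?X. - ?m p + 1)"
    unfolding prod_factor_eq by (simp add: algebra_simps)
  also have "\<dots> = (\<Sum>A\<in>Pow ?X. \<Prod>p\<in>A. - ?m p)"
    using prod_add[OF finite_deg_between, of "\<lambda>p. - ?m p" "\<lambda>_. 1"] by simp
  finally have "(\<Prod>e\<in>{d<..N}. factor e) $ j = (\<Sum>A\<in>Pow ?X. (\<Prod>p\<in>A. - ?m p) $ j)"
    by (simp add: fps_sum_nth)
  also have "\<dots> = (\<Sum>A\<in>Pow ?X. if sum deg A = j then (-1) ^ card A / q ^ j else 0)"
  proof (rule sum.cong[OF refl])
    fix A assume "A \<in> Pow ?X"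
    then have "finite A" using finite_subset[OF _ finite_deg_between] by blast
    then show "(\<Prod>p\<in>A. - ?m p) $ j = (if sum deg A = j then (-1) ^ card A / q ^ j else 0)"
      by (auto simp: prod_neg_monomials fps_X_power_nth)
  qed
  also have "\<dots> = (\<Sum>A\<in>sets_above d j. (-1) ^ card A / q ^ j)"
  proof (rule sum.mono_neutral_cong_right)
    show "finite (Pow ?X)" using finite_deg_between by simp
    show "sets_above d j \<subseteq> Pow ?X" using sets_above_subset[of d j] assms by fastforce
    show "\<forall>A\<in>Pow ?X - sets_above d j. (if sum deg A = j then (-1) ^ card A / q ^ j else 0) = 0"
      using finite_subset[OF _ finite_deg_between[of d N]] by (auto simp: sets_above_def)
  qed (auto simp: sets_above_def)
  finally show ?thesis by (simp add: sum_divide_distrib)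
qed

lemma prod_factor_tail_nth:
  assumes "\<And>n N. n \<le> N \<Longrightarrow> M $ n = (\<Prod>d\<in>{1..N}. factor d) $ n"
  shows "(M * inverse (\<Prod>e\<in>{1..d}. factor e)) $ j = (\<Sum>A\<in>sets_above d j. (-1) ^ card A) / q ^ j"
proof -
  let ?N = "max d j"
  let ?Q = "\<Prod>e\<in>{1..d}. factor e"
  have "?Q $ 0 = 1"
    by (simp add: factor_def fps_prod_nth' euler_factor_power_nth_0)
  have "(M * inverse ?Q) $ j = ((\<Prod>e\<in>{1..?N}. factor e) * inverse ?Q) $ j"
    by (rule fps_mult_nth_cong) (use assms[of _ ?N] in auto)
  also have "{1..?N} = {d<..?N} \<union> {1..d}" by auto
  also have "prod factor \<dots> = (\<Prod>e\<in>{d<..?N}. factor e) * ?Q"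
    by (rule prod.union_disjoint) auto
  also have "\<dots> * inverse ?Q = (\<Prod>e\<in>{d<..?N}. factor e)"
    using inverse_mult_eq_1'[of ?Q] \<open>?Q $ 0 = 1\<close> by (simp add: mult.assoc)
  finally show ?thesis by (simp add: prod_factor_nth)
qed

definition uniquely_least :: "'p set \<Rightarrow> bool" where
  "uniquely_least B \<longleftrightarrow> (\<exists>!p. p \<in> B \<and> (\<forall>r\<in>B. deg p \<le> deg r))"

lemma sets_aboveD:
  assumes "A \<in> sets_above (deg p) j"
  shows "finite A" "A \<subseteq> P" "p \<notin> A" "\<And>r. r \<in> A \<Longrightarrow> deg p < deg r" "sum deg A = j"
  using assms by (auto simp: sets_above_def)

lemma uniquely_least_insert:
  assumes "\<And>r. r \<in> A \<Longrightarrow> deg p < deg r" shows "uniquely_least (insert p A)"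
  unfolding uniquely_least_def
proof (rule ex1I[of _ p])
  show "p \<in> insert p A \<and> (\<forall>r\<in>insert p A. deg p \<le> deg r)"
    using assms by (auto intro: less_imp_le)
  fix r assume "r \<in> insert p A \<and> (\<forall>s\<in>insert p A. deg r \<le> deg s)"
  then show "r = p" using assms[of r] by (auto simp: not_le [symmetric])
qed

lemma uniquely_leastE:
  assumes "uniquely_least B"
  obtains p where "p \<in> B" "\<And>r. r \<in> B - {p} \<Longrightarrow> deg p < deg r"
proof -
  obtain p where p: "p \<in> B" "\<forall>r\<in>B. deg p \<le> deg r"
    and unique: "\<And>r. r \<in> B \<Longrightarrow> (\<forall>s\<in>B. deg r \<le> deg s) \<Longrightarrow> r = p"
    using assms unfolding uniquely_least_def by blast
  have "deg p < deg r" if "r \<in> B - {p}" for r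
  proof (rule ccontr)
    assume "\<not> deg p < deg r"
    then have "\<forall>s\<in>B. deg r \<le> deg s" using p by (meson linorder_not_less order.trans)
    then show False using unique[of r] that by auto
  qed
  with p(1) show ?thesis by (rule that)
qed

lemma insert_least_inject:
  assumes "A \<in> sets_above (deg p) j" "B \<in> sets_above (deg r) k" "insert p A = insert r B"
  shows "p = r \<and> A = B"
proof -
  have "p = r"
  proof (rule ccontr)
    assume "p \<noteq> r"
    then have "r \<in> A" "p \<in> B" using assms(3) by auto
    then show False
      using sets_aboveD(4)[OF assms(1), of r] sets_aboveD(4)[OF assms(2), of p] by simp
  qed
  then show ?thesis
    using assms(3) sets_aboveD(3)[OF assms(1)] sets_aboveD(3)[OF assms(2)]
    by (metis Diff_insert_absorb)
qed

lemma bij_betw_insert_least: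
  "bij_betw (\<lambda>(p, A). insert p A) (SIGMA p:{p \<in> P. deg p \<le> m}. sets_above (deg p) (m - deg p))
     {B. finite B \<and> B \<subseteq> P \<and> uniquely_least B \<and> sum deg B = m}"
    (is "bij_betw _ ?S ?B")
proof (rule bij_betw_imageI)
  show "inj_on (\<lambda>(p, A). insert p A) ?S"
  proof (rule inj_onI, clarify)
    fix p A r B
    assume "A \<in> sets_above (deg p) (m - deg p)" "B \<in> sets_above (deg r) (m - deg r)" "insert p A = insert r B"
    then show "p = r \<and> A = B" by (rule insert_least_inject)
  qed
  show "(\<lambda>(p, A). insert p A) ` ?S = ?B"
  proof (intro equalityI subsetI)
    fix B assume "B \<in> (\<lambda>(p, A). insert p A) ` ?S"
    then obtain p A where B: "B = insert p A" and p: "p \<in> P" "deg p \<le> m"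
      and A: "A \<in> sets_above (deg p) (m - deg p)" by auto
    then show "B \<in> ?B"
      using uniquely_least_insert[OF sets_aboveD(4)[OF A]] sets_aboveD[OF A] by simp
  next
    fix B assume B: "B \<in> ?B"
    then obtain p where p: "p \<in> B" "\<And>r. r \<in> B - {p} \<Longrightarrow> deg p < deg r"
      using uniquely_leastE by blast
    then have "(p, B - {p}) \<in> ?S"
      using B sum.remove[of B p deg] by (auto simp: sets_above_def)
    then show "B \<in> (\<lambda>(p, A). insert p A) ` ?S"
      using p(1) by (intro image_eqI[of _ _ "(p, B - {p})"]) auto
  qed
qed

lemma sum_uniquely_least:
  "(\<Sum>B | finite B \<and> B \<subseteq> P \<and> uniquely_least B \<and> sum deg B = m. (-1) ^ card B)
     = - (\<Sum>d=1..m. real (prime_count d) * (\<Sum>A\<in>sets_above d (m - d). (-1) ^ card A))"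
    (is "sum _ ?B = - (\<Sum>d=1..m. _ * ?s d)")
proof -
  let ?P = "{p \<in> P. deg p \<le> m}"
  let ?S = "SIGMA p:?P. sets_above (deg p) (m - deg p)"
  have "(\<Sum>B\<in>?B. (-1::real) ^ card B) = (\<Sum>(p, A)\<in>?S. (-1) ^ card (insert p A))"
    using sum.reindex_bij_betw[OF bij_betw_insert_least, of "\<lambda>B. (-1::real) ^ card B"]
    by (simp add: case_prod_unfold)
  also have "\<dots> = (\<Sum>(p, A)\<in>?S. - ((-1) ^ card A))"
    by (rule sum.cong) (auto simp: card_insert_disjoint[OF sets_aboveD(1,3)])
  also have "\<dots> = (\<Sum>p\<in>?P. - ?s (deg p))"
    by (subst sum.Sigma [symmetric]) (use finite_deg_le finite_sets_above in \<open>auto simp: sum_negf\<close>)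
  also have "\<dots> = (\<Sum>d\<in>{1..m}. \<Sum>p\<in>{p \<in> ?P. deg p = d}. - ?s (deg p))"
    by (rule sum.group [symmetric]) (use finite_deg_le deg_pos in \<open>auto simp: Suc_le_eq\<close>)
  also have "\<dots> = (\<Sum>d\<in>{1..m}. - (real (prime_count d) * ?s d))"
  proof (rule sum.cong[OF refl])
    fix d assume "d \<in> {1..m}"
    then have "{p \<in> ?P. deg p = d} = {p \<in> P. deg p = d}" by auto
    then show "(\<Sum>p\<in>{p \<in> ?P. deg p = d}. - ?s (deg p)) = - (real (prime_count d) * ?s d)"
      by (simp add: prime_count_def)
  qed
  finally show ?thesis by (simp add: sum_negf)
qed

definition total_degree :: "'p multiset \<Rightarrow> nat" where "total_degree D = (\<Sum>p\<in>#D. deg p)"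

lemma finite_total_degree_le: "finite {D. set_mset D \<subseteq> P \<and> total_degree D \<le> m}"
proof (rule finite_subset)
  show "{D. set_mset D \<subseteq> P \<and> total_degree D \<le> m}
    \<subseteq> mset ` {xs. set xs \<subseteq> {p \<in> P. deg p \<le> m} \<and> length xs \<le> m}"
  proof
    fix D assume D: "D \<in> {D. set_mset D \<subseteq> P \<and> total_degree D \<le> m}"
    obtain xs where xs: "D = mset xs" by (metis ex_mset)
    have "size D \<le> total_degree D"
      using D unfolding total_degree_def
      by (induction D) (use deg_pos in \<open>auto simp: Suc_le_eq intro!: add_less_le_mono\<close>, fastforce)
    moreover have "deg p \<le> total_degree D" if "p \<in># D" for p
      using that unfolding total_degree_def
      by (metis multi_member_split image_mset_add_mset sum_mset.add_mset le_add1)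
    ultimately show "D \<in> mset ` {xs. set xs \<subseteq> {p \<in> P. deg p \<le> m} \<and> length xs \<le> m}"
      using D xs by (intro image_eqI[of _ _ xs]) fastforce+
  qed
  show "finite (mset ` {xs. set xs \<subseteq> {p \<in> P. deg p \<le> m} \<and> length xs \<le> m})"
    using finite_lists_length_le[OF finite_deg_le] by simp
qed

lemma mset_set_set_mset_if_div_moebius:
  assumes "div_moebius D \<noteq> 0" shows "mset_set (set_mset D) = D"
proof (rule multiset_eqI)
  fix p
  have "count D p \<le> 1" using assms by (auto simp: div_moebius_def split: if_splits)
  then show "count (mset_set (set_mset D)) p = count D p"
    by (auto simp: count_mset_set' le_Suc_eq count_eq_zero_iff)
qed

lemma sum_moebius_uniquely_least:
  "(\<Sum>D | set_mset D \<subseteq> P \<and> uniquely_least (set_mset D) \<and> total_degree D = m. real_of_int (div_moebius D))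
    = (\<Sum>B | finite B \<and> B \<subseteq> P \<and> uniquely_least B \<and> sum deg B = m. (-1) ^ card B)"
    (is "sum _ ?D = sum _ ?B")
proof -
  have "(\<Sum>D\<in>?D. real_of_int (div_moebius D)) = (\<Sum>D\<in>mset_set ` ?B. real_of_int (div_moebius D))"
  proof (rule sum.mono_neutral_right)
    show "finite ?D" by (rule rev_finite_subset[OF finite_total_degree_le[of m]]) auto
    show "mset_set ` ?B \<subseteq> ?D" by (auto simp: total_degree_def sum_unfold_sum_mset)
    show "\<forall>D\<in>?D - mset_set ` ?B. real_of_int (div_moebius D) = 0"
    proof (rule ballI, rule ccontr)
      fix D assume D: "D \<in> ?D - mset_set ` ?B" and "real_of_int (div_moebius D) \<noteq> 0"
      then have squarefree: "mset_set (set_mset D) = D"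
        using mset_set_set_mset_if_div_moebius by simp
      then have "set_mset D \<in> ?B"
        using D arg_cong[OF squarefree, of total_degree]
        by (auto simp: total_degree_def sum_unfold_sum_mset)
      then have "D \<in> mset_set ` ?B"
        using squarefree by (intro image_eqI[of _ _ "set_mset D"]) simp_all
      with D show False by simp
    qed
  qed
  also have "\<dots> = (\<Sum>B\<in>?B. real_of_int (div_moebius (mset_set B)))"
    by (subst sum.reindex) (auto simp: inj_on_def)
  also have "\<dots> = (\<Sum>B\<in>?B. (-1) ^ card B)"
    by (rule sum.cong) (auto simp: div_moebius_def count_mset_set')
  finally show ?thesis .
qed

lemma sum_moebius_norm_uniquely_least:
  assumes product_nth: "\<And>n N. n \<le> N \<Longrightarrow> M $ n = (\<Prod>d\<in>{1..N}. factor d) $ n"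
  shows "(\<Sum>D | set_mset D \<subseteq> P \<and> uniquely_least (set_mset D) \<and> total_degree D = m.
      real_of_int (div_moebius D) / q ^ total_degree D)
    = - (\<Sum>d=1..m. real (prime_count d) / q ^ d * (M * inverse (\<Prod>e\<in>{1..d}. factor e)) $ (m - d))"
    (is "sum _ ?D = - ?t")
proof -
  let ?s = "\<lambda>d. \<Sum>A\<in>sets_above d (m - d). (-1::real) ^ card A"
  have "(\<Sum>D\<in>?D. real_of_int (div_moebius D) / q ^ total_degree D)
      = (\<Sum>D\<in>?D. real_of_int (div_moebius D)) / q ^ m"
    by (simp add: sum_divide_distrib)
  also have "\<dots> = - (\<Sum>d=1..m. real (prime_count d) * ?s d / q ^ m)"
    by (simp add: sum_moebius_uniquely_least sum_uniquely_least sum_divide_distrib)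
  also have "(\<Sum>d=1..m. real (prime_count d) * ?s d / q ^ m) = ?t"
  proof (rule sum.cong[OF refl])
    fix d assume "d \<in> {1..m}"
    then have "q ^ m = q ^ d * q ^ (m - d)" by (simp flip: power_add)
    then show "real (prime_count d) * ?s d / q ^ m
       = real (prime_count d) / q ^ d * (M * inverse (\<Prod>e\<in>{1..d}. factor e)) $ (m - d)"
      by (simp only: prod_factor_tail_nth[OF product_nth]) simp
  qed
  finally show ?thesis .
qed

lemma sum_over_degrees:
  assumes by_degree: "\<And>m. (\<Sum>D | set_mset D \<subseteq> P \<and> uniquely_least (set_mset D) \<and> total_degree D = m. f D) = - t m"
    and "n \<ge> 1"
  shows "(\<Sum>D | set_mset D \<subseteq> P \<and> uniquely_least (set_mset D) \<and> 2 \<le> total_degree D \<and> total_degree D \<le> n. f D)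
    = t 0 + t 1 - (\<Sum>m\<le>n. t m :: real)" (is "sum f ?A = _")
proof -
  have "finite ?A" by (rule rev_finite_subset[OF finite_total_degree_le[of n]]) auto
  then have "sum f ?A = (\<Sum>m\<in>{2..n}. sum f {D \<in> ?A. total_degree D = m})"
    by (intro sum.group [symmetric]) auto
  also have "\<dots> = (\<Sum>m\<in>{2..n}. - t m)"
    unfolding by_degree [symmetric] by (rule sum.cong[OF refl], rule sum.cong) auto
  also have "{..n} = insert 0 (insert 1 {2..n})" using \<open>n \<ge> 1\<close> by auto
  then have "(\<Sum>m\<in>{2..n}. - t m) = t 0 + t 1 - (\<Sum>m\<le>n. t m)" by (simp add: sum_negf)
  finally show ?thesis .
qed

theorem sum_distinguishable_tendsto:
  assumes "\<And>d. d > 0 \<Longrightarrow> real (prime_count d) / q ^ d \<le> c / real d"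
    and "l1_bound H B" and "\<And>n. inverse ((1 - fps_X) * H) $ n \<le> C"
    and product_nth: "\<And>n N. n \<le> N \<Longrightarrow> ((1 - fps_X) * H) $ n = (\<Prod>d\<in>{1..N}. factor d) $ n"
  shows "(\<lambda>n. \<Sum>D | set_mset D \<subseteq> P \<and> uniquely_least (set_mset D) \<and> 2 \<le> total_degree D \<and> total_degree D \<le> n.
           real_of_int (div_moebius D) / q ^ total_degree D) \<longlonglongrightarrow> real (prime_count 1) / q - 1"
    (is "?S \<longlonglongrightarrow> _")
proof -
  interpret E: summable_euler_product prime_count q c B C H
    by unfold_locales (use assms q_gt_1 in \<open>auto simp: factor_def\<close>)
  define t where "t m = (\<Sum>d=1..m. E.weight d * E.cofactor d $ (m - d))" for m
  have factor_eq: "E.factor = factor" by (simp add: fun_eq_iff E.factor_def factor_def)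
  have "(\<Sum>D | set_mset D \<subseteq> P \<and> uniquely_least (set_mset D) \<and> total_degree D = m.
      real_of_int (div_moebius D) / q ^ total_degree D) = - t m" for m
    using sum_moebius_norm_uniquely_least[OF product_nth, of m]
    by (simp only: t_def E.weight_def E.cofactor_def E.inverse_prod_factor [symmetric] factor_eq)
  note sum_eq = sum_over_degrees[OF this]
  have "t 0 = 0" by (simp add: t_def)
  moreover have "{1..Suc 0} = {1}" by simp
  then have "t 1 = real (prime_count 1) / q"
    using E.product_nth[of 0 0]
    by (simp add: t_def E.weight_def E.cofactor_def E.inverse_upto_def E.inverse_factor_nth_0)
  moreover have "(\<lambda>n. t 0 + t 1 - (\<Sum>m\<le>n. t m)) \<longlonglongrightarrow> t 0 + t 1 - 1"
    unfolding t_def by (intro tendsto_intros E.sum_weight_cofactor_tendsto_1)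
  moreover have "eventually (\<lambda>n. t 0 + t 1 - (\<Sum>m\<le>n. t m) = ?S n) sequentially"
    by (rule eventually_sequentiallyI[of 1], rule sum_eq [symmetric])
  ultimately show ?thesis by (auto dest: Lim_transform_eventually)
qed

end

section \<open>Identities in commutative rings\<close>

text \<open>With these rules the simplifier turns a ring expression into a polynomial expression, whose normal
  form \<open>code_simp\<close> computes.\<close>

lemma (in cring) reify:
  "\<zero> = Ipolex l (Const 0)" "\<one> = Ipolex l (Const 1)" "\<guillemotleft>i\<guillemotright> = Ipolex l (Const i)"
  "Ipolex l P \<oplus> Ipolex l Q = Ipolex l (Add P Q)" "Ipolex l P \<ominus> Ipolex l Q = Ipolex l (Sub P Q)"
  "\<ominus> Ipolex l P = Ipolex l (Neg P)" "Ipolex l P \<otimes> Ipolex l Q = Ipolex l (Mul P Q)"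
  "Ipolex l P [^] (n::nat) = Ipolex l (polex.Pow P n)"
  by simp_all

lemma (in ring) eqI_diff: "a \<ominus> b = \<zero> \<Longrightarrow> a \<in> carrier R \<Longrightarrow> b \<in> carrier R \<Longrightarrow> a = b"
  by simp

context cring
begin

lemma diff_add_cancel: "x \<in> carrier R \<Longrightarrow> y \<in> carrier R \<Longrightarrow> x \<ominus> y \<oplus> y = x"
  by (simp add: a_minus_def a_assoc l_neg)

lemma add_diff_cancel: "x \<in> carrier R \<Longrightarrow> y \<in> carrier R \<Longrightarrow> x \<oplus> y \<ominus> y = x"
  by (simp add: a_minus_def a_assoc r_neg)

lemma add_diff_cancel_left: "x \<in> carrier R \<Longrightarrow> y \<in> carrier R \<Longrightarrow> y \<oplus> (x \<ominus> y) = x"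
  by (simp add: a_comm[of y "x \<ominus> y"] diff_add_cancel)

lemma add_diff_cancel_left': "x \<in> carrier R \<Longrightarrow> y \<in> carrier R \<Longrightarrow> y \<oplus> x \<ominus> y = x"
  by (simp add: a_comm[of y x] add_diff_cancel)

lemma diff_diff_cancel: "x \<in> carrier R \<Longrightarrow> y \<in> carrier R \<Longrightarrow> x \<ominus> (x \<ominus> y) = y"
  by (rule eqI_diff, algebra) auto

lemma diff_eq_diff_add_diff:
  assumes "x \<in> carrier R" "y \<in> carrier R" "z \<in> carrier R" shows "x \<ominus> z = (x \<ominus> y) \<oplus> (y \<ominus> z)"
  by (rule eqI_diff, use assms in algebra) (use assms in auto)

lemma diff_mult_add:
  assumes "x \<in> carrier R" "y \<in> carrier R" shows "(x \<ominus> y) \<otimes> (x \<oplus> y) = x \<otimes> x \<ominus> y \<otimes> y"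
  by (rule eqI_diff, use assms in algebra) (use assms in auto)

lemma linear_mult_linear:
  assumes closed: "u \<in> carrier R" "v \<in> carrier R" "u' \<in> carrier R" "v' \<in> carrier R" "y \<in> carrier R"
    and "y \<otimes> y = g"
  shows "(u \<oplus> v \<otimes> y) \<otimes> (u' \<oplus> v' \<otimes> y) = (u \<otimes> u' \<oplus> g \<otimes> (v \<otimes> v')) \<oplus> (u \<otimes> v' \<oplus> v \<otimes> u') \<otimes> y"
  unfolding assms(6) [symmetric] by (rule eqI_diff, use closed in algebra) (use closed in auto)

lemma linear_add_linear:
  assumes "u \<in> carrier R" "v \<in> carrier R" "u' \<in> carrier R" "v' \<in> carrier R" "y \<in> carrier R"
  shows "(u \<oplus> v \<otimes> y) \<oplus> (u' \<oplus> v' \<otimes> y) = (u \<oplus> u') \<oplus> (v \<oplus> v') \<otimes> y"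
    and "(u \<oplus> v \<otimes> y) \<ominus> (u' \<oplus> v' \<otimes> y) = (u \<ominus> u') \<oplus> (v \<ominus> v') \<otimes> y"
  by (rule eqI_diff, use assms in algebra, use assms in auto)+

lemma uminus_linear:
  assumes "u \<in> carrier R" "v \<in> carrier R" "y \<in> carrier R"
  shows "\<ominus> (u \<oplus> v \<otimes> y) = \<ominus> u \<oplus> \<ominus> v \<otimes> y"
  by (rule eqI_diff, use assms in algebra) (use assms in auto)

lemma triple_flip:
  assumes closed: "r \<in> carrier R" "s \<in> carrier R" "t \<in> carrier R" "z \<in> carrier R"
  shows "(r \<ominus> z) \<otimes> (s \<ominus> z) \<otimes> (t \<ominus> z) = \<ominus> \<one> \<otimes> ((z \<ominus> r) \<otimes> (z \<ominus> s) \<otimes> (z \<ominus> t))"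
proof -
  define l where "l = [r, s, t, z]"
  have l_closed: "in_carrier l" using closed by (simp add: l_def in_carrier_def)
  have vars: "r = Ipolex l (Var 0)" "s = Ipolex l (Var 1)" "t = Ipolex l (Var 2)" "z = Ipolex l (Var 3)"
    by (simp_all add: l_def)
  show ?thesis by (simp only: vars reify[where l = l]) (rule norm_eq[OF l_closed], code_simp)
qed

lemma cubic_split:
  assumes closed: "r \<in> carrier R" "s \<in> carrier R" "a \<in> carrier R" "b \<in> carrier R" "T \<in> carrier R"
    and a: "a = \<ominus> (r \<otimes> r \<oplus> r \<otimes> s \<oplus> s \<otimes> s)"
    and b: "b = r \<otimes> s \<otimes> (r \<oplus> s)"
  shows "T [^] (3::nat) \<oplus> a \<otimes> T \<oplus> b = (T \<ominus> r) \<otimes> (T \<ominus> s) \<otimes> (T \<ominus> (\<ominus> (r \<oplus> s)))"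
proof -
  define l where "l = [r, s, T]"
  have l_closed: "in_carrier l" using closed by (simp add: l_def in_carrier_def)
  have vars: "r = Ipolex l (Var 0)" "s = Ipolex l (Var 1)" "T = Ipolex l (Var 2)"
    by (simp_all add: l_def)
  show ?thesis unfolding a b
    by (simp only: vars reify[where l = l]) (rule norm_eq[OF l_closed], code_simp)
qed

lemma cubic_disc_identity:
  assumes closed: "r \<in> carrier R" "s \<in> carrier R" "a \<in> carrier R" "b \<in> carrier R"
    and a: "a = \<ominus> (r \<otimes> r \<oplus> r \<otimes> s \<oplus> s \<otimes> s)"
    and b: "b = r \<otimes> s \<otimes> (r \<oplus> s)"
  shows "\<guillemotleft>4\<guillemotright> \<otimes> a [^] (3::nat) \<oplus> \<guillemotleft>27\<guillemotright> \<otimes> b [^] (2::nat)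
      = \<ominus> (((r \<ominus> s) \<otimes> (\<guillemotleft>2\<guillemotright> \<otimes> r \<oplus> s) \<otimes> (r \<oplus> \<guillemotleft>2\<guillemotright> \<otimes> s)) [^] (2::nat))"
proof -
  define l where "l = [r, s]"
  have l_closed: "in_carrier l" using closed by (simp add: l_def in_carrier_def)
  have vars: "r = Ipolex l (Var 0)" "s = Ipolex l (Var 1)" by (simp_all add: l_def)
  show ?thesis unfolding a b
    by (simp only: vars reify[where l = l]) (rule norm_eq[OF l_closed], code_simp)
qed

lemma cubic_quadratic_resultant:
  assumes closed: "r \<in> carrier R" "s \<in> carrier R" "a \<in> carrier R" "b \<in> carrier R" "u \<in> carrier R"
      "v \<in> carrier R" "w \<in> carrier R" "t \<in> carrier R" "F \<in> carrier R"
    and a: "a = \<ominus> (r \<otimes> r \<oplus> r \<otimes> s \<oplus> s \<otimes> s)"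
    and b: "b = r \<otimes> s \<otimes> (r \<oplus> s)"
    and v: "v = a \<oplus> u \<otimes> u \<ominus> w" and t: "t = \<ominus> (r \<oplus> s)"
    and F: "F = u [^] (3::nat) \<oplus> a \<otimes> u \<oplus> b"
  shows "(r \<otimes> r \<oplus> u \<otimes> r \<oplus> v) \<otimes> (s \<otimes> s \<oplus> u \<otimes> s \<oplus> v) \<otimes> (t \<otimes> t \<oplus> u \<otimes> t \<oplus> v)
     = F \<otimes> F \<ominus> \<guillemotleft>3\<guillemotright> \<otimes> u \<otimes> F \<otimes> w \<oplus> (\<guillemotleft>3\<guillemotright> \<otimes> u \<otimes> u \<oplus> a) \<otimes> w \<otimes> w \<ominus> w \<otimes> w \<otimes> w"
proof -
  define l where "l = [r, s, u, w]"
  have l_closed: "in_carrier l" using closed by (simp add: l_def in_carrier_def)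
  have vars: "r = Ipolex l (Var 0)" "s = Ipolex l (Var 1)" "u = Ipolex l (Var 2)" "w = Ipolex l (Var 3)"
    by (simp_all add: l_def)
  show ?thesis unfolding F v t a b
    by (simp only: vars reify[where l = l]) (rule norm_eq[OF l_closed], code_simp)
qed

lemma resultant_reciprocal:
  assumes closed: "a \<in> carrier R" "b \<in> carrier R" "u \<in> carrier R"
      "w \<in> carrier R" "\<rho> \<in> carrier R" "F \<in> carrier R" "z \<in> carrier R"
    and F: "F = u [^] (3::nat) \<oplus> a \<otimes> u \<oplus> b" and w: "w \<otimes> \<rho> = F" and z: "z = u \<ominus> \<rho>"
  shows "\<rho> \<otimes> (F \<otimes> F \<ominus> \<guillemotleft>3\<guillemotright> \<otimes> u \<otimes> F \<otimes> w \<oplus> (\<guillemotleft>3\<guillemotright> \<otimes> u \<otimes> u \<oplus> a) \<otimes> w \<otimes> w \<ominus> w \<otimes> w \<otimes> w)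
     = w \<otimes> w \<otimes> (\<ominus> (z [^] (3::nat) \<oplus> a \<otimes> z \<oplus> b))"
proof -
  let ?G = "u [^] (3::nat) \<oplus> a \<otimes> u \<oplus> b"
  let ?W = "w \<otimes> \<rho>"
  define l where "l = [a, b, u, w, \<rho>]"
  have l_closed: "in_carrier l" using closed by (simp add: l_def in_carrier_def)
  have vars: "a = Ipolex l (Var 0)" "b = Ipolex l (Var 1)"
      "u = Ipolex l (Var 2)" "w = Ipolex l (Var 3)" "\<rho> = Ipolex l (Var 4)"
    by (simp_all add: l_def)
  have "\<rho> \<otimes> (?W \<otimes> ?W \<ominus> \<guillemotleft>3\<guillemotright> \<otimes> u \<otimes> ?W \<otimes> w \<oplus> (\<guillemotleft>3\<guillemotright> \<otimes> u \<otimes> u \<oplus> a) \<otimes> w \<otimes> w \<ominus> w \<otimes> w \<otimes> w)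
     \<ominus> w \<otimes> w \<otimes> (\<ominus> ((u \<ominus> \<rho>) [^] (3::nat) \<oplus> a \<otimes> (u \<ominus> \<rho>) \<oplus> b)) \<ominus> w \<otimes> w \<otimes> (?G \<ominus> ?W) = \<zero>"
    by (simp only: vars reify[where l = l]) (rule norm_eq[OF l_closed], code_simp)
  moreover have "?G \<ominus> ?W = \<zero>" using F w closed by simp
  ultimately have "\<rho> \<otimes> (?W \<otimes> ?W \<ominus> \<guillemotleft>3\<guillemotright> \<otimes> u \<otimes> ?W \<otimes> w \<oplus> (\<guillemotleft>3\<guillemotright> \<otimes> u \<otimes> u \<oplus> a) \<otimes> w \<otimes> w \<ominus> w \<otimes> w \<otimes> w)
     \<ominus> w \<otimes> w \<otimes> (\<ominus> ((u \<ominus> \<rho>) [^] (3::nat) \<oplus> a \<otimes> (u \<ominus> \<rho>) \<oplus> b)) = \<zero>"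
    using closed by simp
  then show ?thesis unfolding w z by (rule eqI_diff) (use closed in simp_all)
qed

lemma cubic_shift_root:
  assumes closed: "a \<in> carrier R" "b \<in> carrier R" "u \<in> carrier R" "\<rho> \<in> carrier R" "z \<in> carrier R"
    and F: "u [^] (3::nat) \<oplus> a \<otimes> u \<oplus> b = \<zero>" and z: "z = u \<ominus> \<rho>"
  shows "\<ominus> \<rho> \<otimes> (z [^] (3::nat) \<oplus> a \<otimes> z \<oplus> b) = \<rho> \<otimes> \<rho> \<otimes> (\<rho> \<otimes> \<rho> \<oplus> \<ominus> (\<guillemotleft>3\<guillemotright> \<otimes> u) \<otimes> \<rho> \<oplus> (\<guillemotleft>3\<guillemotright> \<otimes> u \<otimes> u \<oplus> a))"
proof -
  define l where "l = [a, b, u, \<rho>]"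
  have l_closed: "in_carrier l" using closed by (simp add: l_def in_carrier_def)
  have vars: "a = Ipolex l (Var 0)" "b = Ipolex l (Var 1)" "u = Ipolex l (Var 2)" "\<rho> = Ipolex l (Var 3)"
    by (simp_all add: l_def)
  have "\<ominus> \<rho> \<otimes> ((u \<ominus> \<rho>) [^] (3::nat) \<oplus> a \<otimes> (u \<ominus> \<rho>) \<oplus> b) \<ominus> \<rho> \<otimes> \<rho> \<otimes> (\<rho> \<otimes> \<rho> \<oplus> \<ominus> (\<guillemotleft>3\<guillemotright> \<otimes> u) \<otimes> \<rho> \<oplus> (\<guillemotleft>3\<guillemotright> \<otimes> u \<otimes> u \<oplus> a))
    \<ominus> \<ominus> \<rho> \<otimes> (u [^] (3::nat) \<oplus> a \<otimes> u \<oplus> b) = \<zero>"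
    by (simp only: vars reify[where l = l]) (rule norm_eq[OF l_closed], code_simp)
  then have "\<ominus> \<rho> \<otimes> ((u \<ominus> \<rho>) [^] (3::nat) \<oplus> a \<otimes> (u \<ominus> \<rho>) \<oplus> b) \<ominus> \<rho> \<otimes> \<rho> \<otimes> (\<rho> \<otimes> \<rho> \<oplus> \<ominus> (\<guillemotleft>3\<guillemotright> \<otimes> u) \<otimes> \<rho> \<oplus> (\<guillemotleft>3\<guillemotright> \<otimes> u \<otimes> u \<oplus> a))
      = \<zero>"
    unfolding F using closed by simp
  then show ?thesis unfolding z by (rule eqI_diff) (use closed in simp_all)
qed

lemma cubic_disc_at_root:
  assumes closed: "a \<in> carrier R" "b \<in> carrier R" "u \<in> carrier R"
    and b: "b = \<ominus> (u [^] (3::nat) \<oplus> a \<otimes> u)"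
  shows "\<guillemotleft>4\<guillemotright> \<otimes> a [^] (3::nat) \<oplus> \<guillemotleft>27\<guillemotright> \<otimes> b [^] (2::nat)
     = (\<guillemotleft>3\<guillemotright> \<otimes> u \<otimes> u \<oplus> \<guillemotleft>4\<guillemotright> \<otimes> a) \<otimes> (\<guillemotleft>3\<guillemotright> \<otimes> u \<otimes> u \<oplus> a) [^] (2::nat)"
proof -
  define l where "l = [a, u]"
  have l_closed: "in_carrier l" using closed by (simp add: l_def in_carrier_def)
  have vars: "a = Ipolex l (Var 0)" "u = Ipolex l (Var 1)" by (simp_all add: l_def)
  show ?thesis unfolding b
    by (simp only: vars reify[where l = l]) (rule norm_eq[OF l_closed], code_simp)
qed

lemma tangent_quadratic_disc:
  assumes closed: "a \<in> carrier R" "u \<in> carrier R"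
  shows "\<ominus> (\<guillemotleft>3\<guillemotright> \<otimes> u) \<otimes> \<ominus> (\<guillemotleft>3\<guillemotright> \<otimes> u) \<ominus> \<guillemotleft>4\<guillemotright> \<otimes> (\<guillemotleft>3\<guillemotright> \<otimes> u \<otimes> u \<oplus> a) = \<ominus> (\<guillemotleft>3\<guillemotright> \<otimes> u \<otimes> u \<oplus> \<guillemotleft>4\<guillemotright> \<otimes> a)"
proof -
  define l where "l = [a, u]"
  have l_closed: "in_carrier l" using closed by (simp add: l_def in_carrier_def)
  have vars: "a = Ipolex l (Var 0)" "u = Ipolex l (Var 1)" by (simp_all add: l_def)
  show ?thesis by (simp only: vars reify[where l = l]) (rule norm_eq[OF l_closed], code_simp)
qed

lemma cubic_disc_double_root:
  assumes "e \<in> carrier R"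
  shows "\<guillemotleft>4\<guillemotright> \<otimes> (e \<otimes> \<ominus> (e \<oplus> e) \<oplus> e \<otimes> (\<ominus> (e \<oplus> e) \<oplus> e)) [^] (3::nat)
    \<oplus> \<guillemotleft>27\<guillemotright> \<otimes> (e \<otimes> (e \<otimes> \<ominus> (e \<oplus> e))) [^] (2::nat) = \<zero>"
proof -
  define l where "l = [e]"
  have l_closed: "in_carrier l" using assms by (simp add: l_def in_carrier_def)
  have vars: "e = Ipolex l (Var 0)" by (simp add: l_def)
  show ?thesis by (simp only: vars reify[where l = l]) (rule norm_eq[OF l_closed], code_simp)
qed

lemma weierstrass_at_infinity:
  assumes closed: "x \<in> carrier R" "z \<in> carrier R" "\<alpha> \<in> carrier R" "\<beta> \<in> carrier R" "y \<in> carrier R"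
    and xz: "x \<otimes> z = \<one>" and y: "y \<otimes> y = x [^] (3::nat) \<oplus> \<alpha> \<otimes> x \<oplus> \<beta>"
  shows "(y \<otimes> (z \<otimes> z)) \<otimes> (y \<otimes> (z \<otimes> z)) = z \<otimes> (\<one> \<oplus> z \<otimes> (z \<otimes> (\<alpha> \<oplus> \<beta> \<otimes> z)))"
proof -
  let ?G = "z \<otimes> ((x \<otimes> z) \<otimes> (x \<otimes> z) \<oplus> x \<otimes> z \<oplus> \<one>) \<oplus> \<alpha> \<otimes> (z \<otimes> (z \<otimes> z))"
  let ?L = "(x [^] (3::nat) \<oplus> \<alpha> \<otimes> x \<oplus> \<beta>) \<otimes> ((z \<otimes> z) \<otimes> (z \<otimes> z))"
  let ?R = "z \<otimes> (\<one> \<oplus> z \<otimes> (z \<otimes> (\<alpha> \<oplus> \<beta> \<otimes> z)))"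
  define l where "l = [x, z, \<alpha>, \<beta>]"
  have l_closed: "in_carrier l" using closed by (simp add: l_def in_carrier_def)
  have vars: "x = Ipolex l (Var 0)" "z = Ipolex l (Var 1)" "\<alpha> = Ipolex l (Var 2)" "\<beta> = Ipolex l (Var 3)"
    by (simp_all add: l_def)
  have "?L \<ominus> ?R \<ominus> (x \<otimes> z \<ominus> \<one>) \<otimes> ?G = \<zero>"
    by (simp only: vars reify[where l = l]) (rule norm_eq[OF l_closed], code_simp)
  then have "?L \<ominus> ?R = (x \<otimes> z \<ominus> \<one>) \<otimes> ?G" using closed by (subst (asm) r_right_minus_eq) auto
  also have "x \<otimes> z \<ominus> \<one> = \<zero>" unfolding xz by (simp add: a_minus_def r_neg)
  finally have "?L = ?R" using closed by (subst r_right_minus_eq[symmetric]) auto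
  moreover have "(y \<otimes> (z \<otimes> z)) \<otimes> (y \<otimes> (z \<otimes> z)) = (y \<otimes> y) \<otimes> ((z \<otimes> z) \<otimes> (z \<otimes> z))"
    using closed by (simp add: m_ac)
  ultimately show ?thesis unfolding y by simp
qed

end

lemma (in abelian_group) diff_eq_diff_of_sum_eq:
  assumes closed: "x \<in> carrier G" "p \<in> carrier G" "x' \<in> carrier G" "p' \<in> carrier G"
    and sums: "x \<oplus> p = x' \<oplus> p'"
  shows "p \<ominus> p' = x' \<ominus> x"
proof -
  have "p \<ominus> p' = \<ominus> x \<oplus> (x \<oplus> p) \<ominus> p'" using closed by (simp add: r_neg1)
  also have "\<dots> = x' \<ominus> x" unfolding sums using closed
    by (simp add: a_minus_def a_assoc r_neg a_comm[of "\<ominus> x" x'])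
  finally show ?thesis .
qed

lemma (in cring) cubic_vieta:
  assumes closed: "a \<in> carrier R" "b \<in> carrier R" "r \<in> carrier R" "s \<in> carrier R"
    and r: "r \<otimes> r \<otimes> r \<oplus> (a \<otimes> r \<oplus> b) = \<zero>" and s: "s \<otimes> s \<oplus> (r \<otimes> s \<oplus> (r \<otimes> r \<oplus> a)) = \<zero>"
  shows "a = \<ominus> (r \<otimes> r \<oplus> r \<otimes> s \<oplus> s \<otimes> s)" "b = r \<otimes> s \<otimes> (r \<oplus> s)"
proof -
  show a: "a = \<ominus> (r \<otimes> r \<oplus> r \<otimes> s \<oplus> s \<otimes> s)"
  proof (rule eqI_diff)
    have "a \<ominus> \<ominus> (r \<otimes> r \<oplus> r \<otimes> s \<oplus> s \<otimes> s) = s \<otimes> s \<oplus> (r \<otimes> s \<oplus> (r \<otimes> r \<oplus> a))"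
      by (rule eqI_diff, use closed in algebra) (use closed in auto)
    then show "a \<ominus> \<ominus> (r \<otimes> r \<oplus> r \<otimes> s \<oplus> s \<otimes> s) = \<zero>" using s by simp
  qed (use closed in auto)
  show "b = r \<otimes> s \<otimes> (r \<oplus> s)"
  proof (rule eqI_diff)
    have "b \<ominus> r \<otimes> s \<otimes> (r \<oplus> s) = r \<otimes> r \<otimes> r \<oplus> (\<ominus> (r \<otimes> r \<oplus> r \<otimes> s \<oplus> s \<otimes> s) \<otimes> r \<oplus> b)"
      by (rule eqI_diff, use closed in algebra) (use closed in auto)
    then show "b \<ominus> r \<otimes> s \<otimes> (r \<oplus> s) = \<zero>" using r unfolding a [symmetric] by simp
  qed (use closed in auto)
qed

lemma (in cring) cubic_roots_distinct:
  assumes closed: "a \<in> carrier R" "b \<in> carrier R" "r \<in> carrier R" "s \<in> carrier R"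
    and a: "a = \<ominus> (r \<otimes> r \<oplus> r \<otimes> s \<oplus> s \<otimes> s)" and b: "b = r \<otimes> s \<otimes> (r \<oplus> s)"
    and disc: "\<guillemotleft>4\<guillemotright> \<otimes> a [^] (3::nat) \<oplus> \<guillemotleft>27\<guillemotright> \<otimes> b [^] (2::nat) \<noteq> \<zero>"
  shows "r \<noteq> s" "r \<noteq> \<ominus> (r \<oplus> s)" "s \<noteq> \<ominus> (r \<oplus> s)"
proof -
  have "(r \<ominus> s) \<otimes> (\<guillemotleft>2\<guillemotright> \<otimes> r \<oplus> s) \<otimes> (r \<oplus> \<guillemotleft>2\<guillemotright> \<otimes> s) \<noteq> \<zero>"
    using cubic_disc_identity[OF closed(3,4,1,2) a b] disc closed by (auto simp: nat_pow_zero)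
  then have "r \<ominus> s \<noteq> \<zero>" "\<guillemotleft>2\<guillemotright> \<otimes> r \<oplus> s \<noteq> \<zero>" "r \<oplus> \<guillemotleft>2\<guillemotright> \<otimes> s \<noteq> \<zero>"
    using closed by (auto simp del: r_right_minus_eq)
  moreover have "\<guillemotleft>2\<guillemotright> \<otimes> r \<oplus> s = r \<ominus> \<ominus> (r \<oplus> s)" "r \<oplus> \<guillemotleft>2\<guillemotright> \<otimes> s = s \<ominus> \<ominus> (r \<oplus> s)"
    unfolding of_int_2 by (rule eqI_diff, use closed in algebra, use closed in auto)+
  ultimately show "r \<noteq> s" "r \<noteq> \<ominus> (r \<oplus> s)" "s \<noteq> \<ominus> (r \<oplus> s)" using closed by auto
qed

section \<open>Polynomials over a field\<close>

lemma card_set_mset_le_size: "card (set_mset M) \<le> size M"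
  by (induction M) (auto simp: card_insert_if le_SucI)

lemma (in ideal) rcos_zero_iff:
  assumes "x \<in> carrier R" shows "I +> x = \<zero>\<^bsub>R Quot I\<^esub> \<longleftrightarrow> x \<in> I"
proof -
  have zero_eq: "\<zero>\<^bsub>R Quot I\<^esub> = I" by (simp add: FactRing_def)
  show ?thesis unfolding zero_eq
    using a_coset_join1[OF _ assms a_subgroup] a_coset_join2[OF assms a_subgroup] by blast
qed

lemma (in ideal) rcosE:
  assumes "z \<in> carrier (R Quot I)" obtains x where "x \<in> carrier R" "z = I +> x"
  using assms by (auto simp: FactRing_simps)

lemma (in cring) maximal_inverse_mod:
  assumes "maximalideal I R" "u \<in> carrier R" "u \<notin> I"
  shows "\<exists>w\<in>carrier R. u \<otimes> w \<ominus> \<one> \<in> I"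
proof -
  interpret I: maximalideal I R by fact
  interpret Q: field "R Quot I" by (rule I.quotient_is_field[OF is_cring])
  interpret H: ring_hom_ring R "R Quot I" "(+>) I" by (rule I.rcos_ring_hom_ring)
  have u: "I +> u \<noteq> \<zero>\<^bsub>R Quot I\<^esub>" using I.rcos_zero_iff assms by simp
  have "inv\<^bsub>R Quot I\<^esub> (I +> u) \<in> carrier (R Quot I)" using u assms by simp
  then obtain w where w: "w \<in> carrier R" "inv\<^bsub>R Quot I\<^esub> (I +> u) = I +> w" by (rule I.rcosE) blast
  have "(I +> u) \<otimes>\<^bsub>R Quot I\<^esub> (I +> w) = \<one>\<^bsub>R Quot I\<^esub>" unfolding w(2) [symmetric] using u assms by simp
  then have "I +> (u \<otimes> w \<ominus> \<one>) = \<zero>\<^bsub>R Quot I\<^esub>" using assms w(1) by (simp add: a_minus_def Q.r_neg)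
  then show ?thesis using I.rcos_zero_iff[of "u \<otimes> w \<ominus> \<one>"] assms(2) w(1) by auto
qed

locale field_polys = field R for R (structure)
begin

sublocale UP: principal_domain "poly_ring R"
  by (rule univ_poly_is_principal[OF carrier_is_subfield])

lemmas poly_zero [simp] = univ_poly_zero[of R "carrier R"]
lemmas poly_one = univ_poly_one[of R "carrier R"]

abbreviation Pmult (infixl ".*" 70) where "u .* v \<equiv> u \<otimes>\<^bsub>poly_ring R\<^esub> v"
abbreviation Padd (infixl ".+" 65) where "u .+ v \<equiv> u \<oplus>\<^bsub>poly_ring R\<^esub> v"
abbreviation Psub (infixl ".-" 65) where "u .- v \<equiv> u \<ominus>\<^bsub>poly_ring R\<^esub> v"
abbreviation Pneg (".~ _" [81] 80) where ".~ u \<equiv> \<ominus>\<^bsub>poly_ring R\<^esub> u"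
abbreviation Ppow (infixr ".^" 75) where "u .^ (n::nat) \<equiv> u [^]\<^bsub>poly_ring R\<^esub> n"
abbreviation "zP \<equiv> \<zero>\<^bsub>poly_ring R\<^esub>"
abbreviation "oP \<equiv> \<one>\<^bsub>poly_ring R\<^esub>"
abbreviation Pdvd (infixl ".|" 50) where "u .| v \<equiv> u divides\<^bsub>poly_ring R\<^esub> v"

abbreviation "kX \<equiv> carrier (poly_ring R)"

lemma poly_carrier_iff: "p \<in> kX \<longleftrightarrow> p = [] \<or> (set p \<subseteq> carrier R \<and> hd p \<noteq> \<zero>)"
  unfolding univ_poly_carrier [symmetric] polynomial_def by simp

lemma poly_set_carrier: "p \<in> kX \<Longrightarrow> set p \<subseteq> carrier R"
  by (auto simp: poly_carrier_iff)

lemma poly_degree_mult: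
  assumes "p \<in> kX" "r \<in> kX" "p \<noteq> []" "r \<noteq> []"
  shows "degree (p .* r) = degree p + degree r"
    and "hd (p .* r) = hd p \<otimes> hd r" and "p .* r \<noteq> []"
proof -
  note polynomials = assms(1,2)[unfolded univ_poly_carrier [symmetric]]
  show "degree (p .* r) = degree p + degree r"
    using poly_mult_degree_eq[OF carrier_is_subring polynomials] assms by (simp add: univ_poly_mult)
  show "hd (p .* r) = hd p \<otimes> hd r"
    using poly_mult_lead_coeff[OF carrier_is_subring polynomials] assms
    by (simp add: univ_poly_mult)
  show "p .* r \<noteq> []"
    using UP.integral[of p r] assms by auto
qed

lemma coeff_add:
  assumes "p \<in> kX" "r \<in> kX"
  shows "coeff (p .+ r) i = coeff p i \<oplus> coeff r i"
  unfolding univ_poly_add using poly_add_coeff[OF assms[THEN poly_set_carrier]] by simp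

lemma coeff_minus:
  assumes "p \<in> kX" "r \<in> kX"
  shows "coeff (p .- r) i = coeff p i \<ominus> coeff r i"
proof -
  have coeff_map_neg: "coeff (map (\<lambda>a. \<ominus> a) r) i = \<ominus> coeff r i" if "set r \<subseteq> carrier R" for r :: "'a list"
    using that by (induction r) auto
  have closed: "set p \<subseteq> carrier R" "set r \<subseteq> carrier R" "set (map (\<lambda>a. \<ominus> a) r) \<subseteq> carrier R"
    using assms[THEN poly_set_carrier] by auto
  show ?thesis
    unfolding a_minus_def univ_poly_a_inv_def'[OF carrier_is_subring assms(2)] univ_poly_add
      poly_add_coeff[OF closed(1,3)] using coeff_map_neg[OF closed(2)] by (simp add: a_minus_def)
qed

lemma length_leI_coeff:
  assumes "p \<in> kX" "\<And>i. i \<ge> d \<Longrightarrow> coeff p i = \<zero>"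
  shows "length p \<le> d"
proof (rule ccontr)
  assume "\<not> length p \<le> d"
  then have "p \<noteq> []" "d \<le> degree p" by auto
  then have "coeff p (degree p) \<noteq> \<zero>"
    using assms(1) lead_coeff_simp[of p] by (auto simp: poly_carrier_iff)
  then show False using assms(2) \<open>d \<le> degree p\<close> by blast
qed

lemma poly_const_hom: "poly_of_const \<in> ring_hom R (poly_ring R)"
  using canonical_embedding_is_hom[OF carrier_is_subring] by simp

sublocale PC: ring_hom_ring R "poly_ring R" poly_of_const
  by (rule ring_hom_ringI2) (auto simp: ring_axioms UP.ring_axioms poly_const_hom)

lemma poly_of_const_eq: "c \<in> carrier R \<Longrightarrow> poly_of_const c = (if c = \<zero> then [] else [c])"
  by (simp add: poly_of_const_def)

lemma poly_two_unit:
  assumes "\<one> \<oplus> \<one> \<noteq> \<zero>" shows "oP .+ oP \<in> Units (poly_ring R)"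
proof -
  have "oP .+ oP = poly_of_const (\<one> \<oplus> \<one>)" by simp
  also have "\<dots> = [\<one> \<oplus> \<one>]" using assms by (simp add: poly_of_const_eq)
  also have "\<dots> \<in> Units (poly_ring R)" using assms
    by (simp add: univ_poly_units[OF carrier_is_subfield])
  finally show ?thesis .
qed

lemma eval_poly_hom: "x \<in> carrier R \<Longrightarrow> ring_hom_ring (poly_ring R) R (\<lambda>p. eval p x)"
  by (rule eval_ring_hom[OF carrier_is_subring])

lemma card_roots_le:
  assumes "p \<in> kX" "p \<noteq> []"
  shows "finite {x \<in> carrier R. eval p x = \<zero>}" "card {x \<in> carrier R. eval p x = \<zero>} \<le> degree p"
proof -
  have roots_eq: "{x \<in> carrier R. eval p x = \<zero>} = set_mset (roots p)"
    using roots_mem_iff_is_root[OF assms(1)] assms(2) by (auto simp: is_root_def)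
  then show "finite {x \<in> carrier R. eval p x = \<zero>}" by simp
  have "card (set_mset (roots p)) \<le> size (roots p)" by (rule card_set_mset_le_size)
  also have "\<dots> \<le> degree p" using size_roots_le_degree[OF assms(1)] .
  finally show "card {x \<in> carrier R. eval p x = \<zero>} \<le> degree p" by (simp only: roots_eq)
qed

lemma poly_eqI_eval:
  assumes p: "p \<in> kX" "r \<in> kX" and "length (p .- r) \<le> card Xs" "finite Xs" "Xs \<subseteq> carrier R"
    and eval_eq: "\<And>x. x \<in> Xs \<Longrightarrow> eval p x = eval r x"
  shows "p = r"
proof (rule ccontr)
  assume "p \<noteq> r"
  then have nonzero: "p .- r \<noteq> []" using p UP.r_right_minus_eq[of p r] by simp
  have closed: "p .- r \<in> kX" using p by simp
  have "eval (p .- r) x = \<zero>" if "x \<in> Xs" for x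
  proof -
    interpret E: ring_hom_ring "poly_ring R" R "\<lambda>p. eval p x"
      by (rule eval_poly_hom) (use that assms(5) in auto)
    show ?thesis using p eval_eq[OF that] E.hom_closed[of r] by (simp add: a_minus_def r_neg)
  qed
  then have "Xs \<subseteq> {x \<in> carrier R. eval (p .- r) x = \<zero>}" using assms(5) by auto
  then have "card Xs \<le> degree (p .- r)"
    using card_roots_le[OF closed nonzero] card_mono le_trans by blast
  then show False using assms(3) nonzero by (cases "p .- r") auto
qed

definition monics :: "'a list set" where
  "monics = {p \<in> kX. p \<noteq> [] \<and> hd p = \<one>}"

definition monics_deg :: "nat \<Rightarrow> 'a list set" where "monics_deg n = {p \<in> monics. degree p = n}"

definition monic_irreds :: "'a list set" where
  "monic_irreds = {p \<in> monics. pirreducible (carrier R) p}"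

definition polys_below :: "nat \<Rightarrow> 'a list set" where "polys_below d = {p \<in> kX. length p \<le> d}"

lemma monicsD: "p \<in> monics \<Longrightarrow> p \<in> kX" "p \<in> monics \<Longrightarrow> p \<noteq> []" "p \<in> monics \<Longrightarrow> hd p = \<one>"
  by (auto simp: monics_def)

lemma monics_degD:
  assumes "p \<in> monics_deg n"
  shows "p \<in> monics" "p \<in> kX" "p \<noteq> []" "hd p = \<one>" "degree p = n"
  using assms by (auto simp: monics_deg_def monics_def)

lemma monic_mult: "p \<in> monics \<Longrightarrow> r \<in> monics \<Longrightarrow> p .* r \<in> monics"
  by (auto simp: monics_def poly_degree_mult)

lemma monic_degree_mult: "p \<in> monics \<Longrightarrow> r \<in> monics \<Longrightarrow> degree (p .* r) = degree p + degree r"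
  using poly_degree_mult by (auto simp: monics_def)

lemma monic_cofactor:
  assumes "p \<in> monics" "r \<in> kX" "p .* r \<in> monics"
  shows "r \<in> monics"
proof -
  have "r \<noteq> []" using assms UP.r_null[of p] by (auto simp: monics_def)
  moreover have "hd r \<in> carrier R" using assms(2) calculation by (auto simp: poly_carrier_iff)
  ultimately show ?thesis using assms poly_degree_mult(2)[of p r] by (auto simp: monics_def)
qed

lemma monic_divides_cofactor:
  assumes "p \<in> monics" "g \<in> monics" "p .| g"
  obtains h where "h \<in> monics" "g = p .* h"
  using assms monic_cofactor unfolding factor_def by blast

lemma one_in_monics: "[\<one>] \<in> monics"
  by (auto simp: monics_def poly_carrier_iff)

lemma monics_deg_eq: "monics_deg n = (\<lambda>cs. \<one> # cs) ` {cs. set cs \<subseteq> carrier R \<and> length cs = n}"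
proof (intro equalityI subsetI)
  fix p assume "p \<in> monics_deg n"
  then show "p \<in> (\<lambda>cs. \<one> # cs) ` {cs. set cs \<subseteq> carrier R \<and> length cs = n}"
    by (cases p) (auto simp: monics_deg_def monics_def poly_carrier_iff)
qed (auto simp: monics_deg_def monics_def poly_carrier_iff)

lemma monics_deg_0: "monics_deg 0 = {[\<one>]}" by (auto simp: monics_deg_eq)

lemma monics_deg_1E:
  assumes "p \<in> monics_deg 1" obtains e where "e \<in> carrier R" "p = [\<one>, e]"
  using assms unfolding monics_deg_eq by (auto simp: length_Suc_conv)

lemma linear_in_monics_deg: "c \<in> carrier R \<Longrightarrow> [\<one>, c] \<in> monics_deg 1"
  by (auto simp: monics_deg_def monics_def poly_carrier_iff)

lemma monics_deg_mult:
  "p \<in> monics_deg m \<Longrightarrow> r \<in> monics_deg n \<Longrightarrow> p .* r \<in> monics_deg (m + n)"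
  using monic_mult monic_degree_mult by (auto simp: monics_deg_def)

lemma monics_deg_pow: "p \<in> monics_deg d \<Longrightarrow> p .^ (n::nat) \<in> monics_deg (n * d)"
proof (induction n)
  case 0
  then show ?case using one_in_monics by (simp add: monics_deg_def poly_one)
next
  case (Suc n)
  then show ?case using monics_deg_mult[of "p .^ n" "n * d" p d] by (simp add: add.commute)
qed

lemma length_diff_monics_deg:
  assumes "p \<in> monics_deg d" "r \<in> monics_deg d" shows "length (p .- r) \<le> d"
proof -
  note p = monics_degD[OF assms(1)] and r = monics_degD[OF assms(2)]
  show ?thesis
  proof (rule length_leI_coeff)
    show "p .- r \<in> kX" using p r by simp
    fix i assume "i \<ge> d"
    then consider "i = d" | "i > degree p" "i > degree r" using p r by fastforce
    then have "coeff p i = coeff r i"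
    proof cases
      case 1
      then show ?thesis using lead_coeff_simp[OF p(3)] lead_coeff_simp[OF r(3)] p r by simp
    next
      case 2
      then show ?thesis using coeff_degree[of p i] coeff_degree[of r i] by simp
    qed
    moreover have "coeff p i \<in> carrier R" using coeff_in_carrier[OF poly_set_carrier[OF p(2)]] .
    ultimately show "coeff (p .- r) i = \<zero>" using coeff_minus[OF p(2) r(2)] by simp
  qed
qed

lemma monics_deg_add:
  assumes "g \<in> monics_deg n" and p: "p \<in> kX" "length p \<le> n"
  shows "g .+ p \<in> monics_deg n"
proof -
  note g = monics_degD[OF assms(1)]
  let ?s = "g .+ p"
  have closed: "?s \<in> kX" using g p by simp
  have lead: "coeff ?s n = \<one>"
    using lead_coeff_simp[OF g(3)] g coeff_length[OF p(2)] by (simp add: coeff_add[OF g(2) p(1)])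
  then have "?s \<noteq> []" by (metis coeff.simps(1) one_not_zero)
  have "length ?s \<le> Suc n"
  proof (rule length_leI_coeff[OF closed])
    fix i assume "i \<ge> Suc n"
    then show "coeff ?s i = \<zero>"
      using coeff_degree[of g i] coeff_length[of p i] g p by (simp add: coeff_add[OF g(2) p(1)])
  qed
  moreover have "length ?s > n" using coeff_length[of ?s n] lead by fastforce
  ultimately have "degree ?s = n" by simp
  then show ?thesis
    using closed lead \<open>?s \<noteq> []\<close> lead_coeff_simp[of ?s] by (simp add: monics_deg_def monics_def)
qed

lemma polys_below_carrier: "p \<in> polys_below d \<Longrightarrow> p \<in> kX"
  by (simp add: polys_below_def)

lemma polys_below_minus:
  assumes "p \<in> polys_below d" "r \<in> polys_below d" shows "p .- r \<in> polys_below d"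
proof -
  have below: "p \<in> kX" "r \<in> kX" "length p \<le> d" "length r \<le> d"
    using assms by (auto simp: polys_below_def)
  have "length (p .- r) \<le> d"
    by (rule length_leI_coeff) (use below in \<open>auto simp: coeff_minus coeff_length\<close>)
  then show ?thesis using below by (simp add: polys_below_def)
qed

lemma polys_below_zero:
  assumes D: "D \<in> monics_deg d" and p: "p \<in> polys_below d" "D .| p" shows "p = []"
proof (rule ccontr)
  assume nonzero: "p \<noteq> []"
  have D_monic: "D \<in> kX" "D \<noteq> []" "degree D = d" using D by (auto simp: monics_deg_def monics_def)
  obtain h where h: "h \<in> kX" "p = D .* h" using p(2) by (auto simp: factor_def)
  have "h \<noteq> []" using nonzero h D_monic UP.r_null[of D] by auto
  then have "degree p = d + degree h"
    using poly_degree_mult(1)[OF D_monic(1) h(1) D_monic(2)] D_monic h by simp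
  moreover have "length p \<le> d" "length p > 0" using p(1) nonzero by (auto simp: polys_below_def)
  ultimately show False by linarith
qed

lemma polys_below_unique:
  assumes D: "D \<in> monics_deg d" and p: "p \<in> polys_below d" "r \<in> polys_below d" "D .| (p .- r)"
  shows "p = r"
  using polys_below_zero[OF D polys_below_minus[OF p(1,2)] p(3)] UP.r_right_minus_eq[OF p(1,2)[THEN polys_below_carrier]] by simp

lemma polys_below_exists:
  assumes "D \<in> monics_deg d" and p: "p \<in> kX"
  obtains r where "r \<in> polys_below d" "D .| (p .- r)"
proof
  note D = monics_degD[OF assms(1)]
  note closed = long_division_closed[OF carrier_is_subfield p D(2)]
  show "p pmod D \<in> polys_below d"
    using pmod_degree[OF carrier_is_subfield p D(2,3)] closed D by (auto simp: polys_below_def)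
  have "p = D .* (p pdiv D) .+ (p pmod D)"
    by (rule pdiv_pmod[OF carrier_is_subfield p D(2)])
  then have "p .- (p pmod D) = D .* (p pdiv D)"
    using UP.add_diff_cancel[of "D .* (p pdiv D)" "p pmod D"] closed D(2) by simp
  then show "D .| (p .- (p pmod D))" using closed(1) by (auto simp: factor_def)
qed

lemma monic_irredD:
  assumes "p \<in> monic_irreds"
  shows "p \<in> monics" "p \<in> kX" "degree p > 0" "Divisibility.prime (poly_ring R) p" "p \<noteq> []"
    and "p \<notin> Units (poly_ring R)"
proof -
  have irred: "p \<in> monics" "pirreducible (carrier R) p" using assms by (auto simp: monic_irreds_def)
  then show "p \<in> monics" "p \<in> kX" "p \<noteq> []" by (auto simp: monics_def)
  then show "degree p > 0" using pirreducible_degree[OF carrier_is_subfield _ irred(2)] by simp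
  show "Divisibility.prime (poly_ring R) p"
    using pprime_iff_pirreducible[OF carrier_is_subfield] irred monicsD(1)
    by (auto simp: ring_prime_def)
  show "p \<notin> Units (poly_ring R)"
    using pirreducibleE(2)[OF carrier_is_subring _ irred(2)] irred monicsD(1) by blast
qed

lemma monic_irred_prime:
  assumes "p \<in> monic_irreds" "u \<in> kX" "v \<in> kX"
    and "p .| (u .* v)"
  shows "p .| u \<or> p .| v"
  using monic_irredD(4)[OF assms(1)] assms(2-4) by (auto elim!: primeE)

lemma monic_irred_divides_eq:
  assumes "p \<in> monic_irreds" "r \<in> monic_irreds" "p .| r" shows "p = r"
proof -
  obtain h where h: "h \<in> monics" "r = p .* h"
    using monic_divides_cofactor assms monic_irredD by metis
  have "h \<in> Units (poly_ring R)"
    using pirreducibleE(3)[OF carrier_is_subring, of r p h] monic_irredD[OF assms(1)] monic_irredD[OF assms(2)]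
      assms(2) h monicsD(1)[OF h(1)]
    by (simp add: monic_irreds_def)
  then obtain k where "h = [k]" unfolding univ_poly_carrier_units by blast
  then have "h = [\<one>]" using monicsD(3)[OF h(1)] by simp
  then show ?thesis using h monic_irredD[OF assms(1)] UP.r_one[of p] by (simp add: poly_one)
qed

lemma linear_monic_irred: assumes "c \<in> carrier R" shows "[\<one>, c] \<in> monic_irreds"
  using monics_degD[OF linear_in_monics_deg[OF assms]]
    degree_one_imp_pirreducible[OF carrier_is_subfield, of "[\<one>, c]"] by (simp add: monic_irreds_def)

lemma pirreducible_scale:
  assumes c: "c \<in> Units (poly_ring R)" and u: "u \<in> kX" "pirreducible (carrier R) u"
  shows "pirreducible (carrier R) (c .* u)"
proof (rule pirreducibleI[OF carrier_is_subring])
  note irred = pirreducibleE[OF carrier_is_subring u]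
  have c_closed: "c \<in> kX" "inv\<^bsub>poly_ring R\<^esub> c \<in> kX" using c by auto
  have u_eq: "u = inv\<^bsub>poly_ring R\<^esub> c .* (c .* u)"
    using c c_closed u by (simp add: UP.m_assoc [symmetric])
  show "c .* u \<in> kX" using c_closed u by simp
  show "c .* u \<noteq> []" using u_eq irred(1) UP.r_null[OF c_closed(2)] by auto
  show "c .* u \<notin> Units (poly_ring R)"
    using u_eq irred(2) c UP.Units_m_closed UP.Units_inv_Units by metis
  fix v w assume vw: "v \<in> kX" "w \<in> kX" "c .* u = v .* w"
  then have "u = (inv\<^bsub>poly_ring R\<^esub> c .* v) .* w" using u_eq c_closed by (simp add: UP.m_assoc)
  then have "inv\<^bsub>poly_ring R\<^esub> c .* v \<in> Units (poly_ring R) \<or> w \<in> Units (poly_ring R)"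
    using irred(3)[of "inv\<^bsub>poly_ring R\<^esub> c .* v" w] vw c_closed by simp
  moreover have "v = c .* (inv\<^bsub>poly_ring R\<^esub> c .* v)"
    using c c_closed vw by (simp add: UP.m_assoc [symmetric])
  ultimately show "v \<in> Units (poly_ring R) \<or> w \<in> Units (poly_ring R)"
    using c UP.Units_m_closed by metis
qed

lemma exists_monic_irred_divisor:
  assumes u: "u \<in> kX" "degree u > 0"
  obtains P where "P \<in> monic_irreds" "P .| u"
proof -
  have nonzero: "u \<in> kX - {zP}" using u by auto
  have nonunit: "u \<notin> Units (poly_ring R)"
    using univ_poly_units'[OF carrier_is_subfield] u(2) by auto
  obtain v where v: "v \<in> kX" "pirreducible (carrier R) v" "v .| u"
    by (rule UP.exists_irreducible_divisor[OF nonzero nonunit])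
  have hd_v: "hd v \<in> carrier R" "hd v \<noteq> \<zero>" "v \<noteq> []"
    using pirreducibleE(1)[OF carrier_is_subring v(1,2)] v(1) by (auto simp: poly_carrier_iff)
  define c where "c = [inv (hd v)]"
  have c: "c \<in> kX" "c \<in> Units (poly_ring R)"
    using hd_v nonzero_imp_inverse_nonzero
    by (auto simp: c_def poly_carrier_iff univ_poly_units[OF carrier_is_subfield])
  have "hd (c .* v) = \<one>" "c .* v \<noteq> []"
    using poly_degree_mult(2,3)[OF c(1) v(1) _ hd_v(3)] hd_v by (auto simp: c_def)
  then have "c .* v \<in> monic_irreds"
    using pirreducible_scale[OF c(2) v(1,2)] c v by (simp add: monic_irreds_def monics_def)
  moreover have "(c .* v) .* inv\<^bsub>poly_ring R\<^esub> c = v"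
    using c v by (simp add: UP.m_comm[of c v] UP.m_assoc)
  then have "c .* v .| v" using c by (auto intro: dividesI[of "inv\<^bsub>poly_ring R\<^esub> c"])
  then have "c .* v .| u" using v(3) c(1) v(1) UP.divides_trans by (meson UP.m_closed)
  ultimately show ?thesis by (rule that)
qed

lemma exists_monic_irred_factor:
  assumes u: "u \<in> kX" "degree u > 0"
  obtains P w where "P \<in> monic_irreds" "w \<in> kX" "w \<noteq> []" "u = P .* w" "length w < length u"
proof -
  obtain P where P: "P \<in> monic_irreds" "P .| u" using exists_monic_irred_divisor[OF u] .
  note PD = monic_irredD[OF P(1)]
  obtain w where w: "w \<in> kX" "u = P .* w" using P(2) by (auto simp: factor_def)
  have "u \<noteq> []" using u by auto
  then have "w \<noteq> []" using w UP.r_null[OF PD(2)] by auto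
  moreover from this have "length w < length u"
    using poly_degree_mult(1)[OF PD(2) w(1) PD(5)] w(2) PD(3) \<open>u \<noteq> []\<close> by (cases u; cases w) auto
  ultimately show ?thesis using that P(1) w by blast
qed

lemma cgenideal_monic_irred:
  assumes "P \<in> monic_irreds"
  shows "maximalideal (PIdl\<^bsub>poly_ring R\<^esub> P) (poly_ring R)"
    and "x \<in> kX \<Longrightarrow> x \<in> PIdl\<^bsub>poly_ring R\<^esub> P \<longleftrightarrow> P .| x"
proof -
  note P = monic_irredD[OF assms]
  show "maximalideal (PIdl\<^bsub>poly_ring R\<^esub> P) (poly_ring R)"
    using UP.irreducible_imp_maximalideal[OF P(2)] assms by (auto simp: monic_irreds_def)
  show "x \<in> kX \<Longrightarrow> x \<in> PIdl\<^bsub>poly_ring R\<^esub> P \<longleftrightarrow> P .| x"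
    using P(2) UP.m_comm by (auto simp: cgenideal_def factor_def)
qed

lemma monic_irred_inverse_mod:
  assumes P: "P \<in> monic_irreds" and u: "u \<in> kX" "\<not> P .| u"
  shows "\<exists>w\<in>kX. P .| (u .* w .- oP)"
proof -
  obtain w where w: "w \<in> kX" "u .* w .- oP \<in> PIdl\<^bsub>poly_ring R\<^esub> P"
    using UP.maximal_inverse_mod[OF cgenideal_monic_irred(1)[OF P] u(1)] u cgenideal_monic_irred(2)[OF P u(1)]
    by auto
  then show ?thesis using cgenideal_monic_irred(2)[OF P, of "u .* w .- oP"] u by auto
qed

lemma odd_degree_aniso:
  assumes f: "f \<in> kX" "f \<noteq> []" "odd (degree f)"
    and u: "u \<in> kX" and v: "v \<in> kX"
    and e: "u .* u = f .* (v .* v)"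
  shows "u = [] \<and> v = []"
proof (cases "v = []")
  case True
  then have "v .* v = []" using UP.r_null[OF v] by simp
  then have "u .* u = []" using e UP.r_null[OF f(1)] by simp
  then show ?thesis using True UP.integral[of u u] u by simp
next
  case False
  note degree_vv = poly_degree_mult[OF v v False False]
  have vv_closed: "v .* v \<in> kX" using v by simp
  note degree_fvv = poly_degree_mult[OF f(1) vv_closed f(2) degree_vv(3)]
  have "u \<noteq> []" using e degree_fvv(3) UP.r_null[OF u] by auto
  then have "degree u + degree u = degree f + (degree v + degree v)"
    using poly_degree_mult(1)[OF u u] degree_fvv(1) degree_vv(1) e by simp
  moreover have "even (degree u + degree u)" "odd (degree f + (degree v + degree v))"
    using f(3) by auto
  ultimately show ?thesis by metis
qed

lemma mult_linear_linear: "e \<in> carrier R \<Longrightarrow> g \<in> carrier R \<Longrightarrow> [\<one>, e] .* [\<one>, g] = [\<one>, g \<oplus> e, e \<otimes> g]"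
  by (simp add: univ_poly_mult)

lemma mult_linear_quadratic:
  "e \<in> carrier R \<Longrightarrow> s \<in> carrier R \<Longrightarrow> t \<in> carrier R \<Longrightarrow>
   [\<one>, e] .* [\<one>, s, t] = [\<one>, s \<oplus> e, t \<oplus> e \<otimes> s, e \<otimes> t]"
  by (simp add: univ_poly_mult)

lemma monic_root_factor:
  assumes p: "p \<in> monics" "eval p x = \<zero>" and x: "x \<in> carrier R"
  obtains h where "h \<in> monics" "degree p = Suc (degree h)"
    "\<And>y. y \<in> carrier R \<Longrightarrow> eval p y = (y \<ominus> x) \<otimes> eval h y"
proof -
  have linear: "[\<one>, \<ominus> x] \<in> monics" using x by (auto simp: monics_def poly_carrier_iff)
  have "is_root p x" using p x monicsD by (auto simp: is_root_def)
  then have "[\<one>, \<ominus> x] .| p"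
    using is_root_imp_pdivides[of p x] p(1) monicsD(1) by (auto simp: pdivides_def)
  then obtain h where h: "h \<in> monics" "p = [\<one>, \<ominus> x] .* h"
    using monic_divides_cofactor[OF linear p(1)] by blast
  have "eval p y = (y \<ominus> x) \<otimes> eval h y" if y: "y \<in> carrier R" for y
  proof -
    have "eval p y = eval [\<one>, \<ominus> x] y \<otimes> eval h y"
      unfolding h(2)
      using ring_hom_mult[OF ring_hom_ring.homh[OF eval_poly_hom[OF y]] monicsD(1)[OF linear] monicsD(1)[OF h(1)]] .
    then show ?thesis using y x by (simp add: a_minus_def)
  qed
  moreover have "degree p = Suc (degree h)" using monic_degree_mult[OF linear h(1)] by (simp add: h(2))
  ultimately show thesis using that h(1) by blast
qed

lemma eval_eq_prod_roots:
  assumes "p \<in> monics" "degree p = card Xs" "finite Xs" "Xs \<subseteq> carrier R" "\<And>x. x \<in> Xs \<Longrightarrow> eval p x = \<zero>"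
    and T: "T \<in> carrier R"
  shows "eval p T = (\<Otimes>x\<in>Xs. T \<ominus> x)"
  using assms(3,1,2,4,5)
proof (induction Xs arbitrary: p rule: finite_induct)
  case empty
  then have "p \<in> monics_deg 0" by (simp add: monics_deg_def)
  then show ?case by (simp add: monics_deg_0)
next
  case (insert x Xs)
  have x: "x \<in> carrier R" "Xs \<subseteq> carrier R" using insert by auto
  obtain h where h: "h \<in> monics" "degree p = Suc (degree h)"
    and eval_eq: "\<And>y. y \<in> carrier R \<Longrightarrow> eval p y = (y \<ominus> x) \<otimes> eval h y"
    using monic_root_factor[OF insert.prems(1) _ x(1)] insert.prems(4)[of x] by blast
  have "eval h T = (\<Otimes>x\<in>Xs. T \<ominus> x)"
  proof (rule insert.IH[OF h(1) _ x(2)])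
    show "degree h = card Xs" using insert h(2) by simp
    fix y assume "y \<in> Xs"
    then have y: "y \<in> carrier R" "y \<noteq> x" "y \<in> Xs" using x insert by auto
    have "(y \<ominus> x) \<otimes> eval h y = \<zero>" using eval_eq[OF y(1)] insert.prems(4)[of y] y by simp
    moreover have "y \<ominus> x \<noteq> \<zero>" using y x by simp
    ultimately show "eval h y = \<zero>"
      using integral[of "y \<ominus> x" "eval h y"] y x eval_in_carrier[OF poly_set_carrier[OF monicsD(1)[OF h(1)]] y(1)]
      by auto
  qed
  moreover have "(\<Otimes>y\<in>insert x Xs. T \<ominus> y) = (T \<ominus> x) \<otimes> (\<Otimes>y\<in>Xs. T \<ominus> y)"
    by (rule finprod_insert) (use insert T x in auto)
  ultimately show ?case using eval_eq[OF T] by simp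
qed

end

section \<open>Finite fields\<close>

lemma (in domain) finite_domain_is_field:
  assumes "finite (carrier R)" shows "field R"
proof (rule cring_fieldI)
  show "Units R = carrier R - {\<zero>}"
  proof (intro equalityI subsetI)
    fix x assume "x \<in> Units R"
    then show "x \<in> carrier R - {\<zero>}" using Units_r_inv_ex[of x] Units_closed[of x] by auto
  next
    fix x assume x: "x \<in> carrier R - {\<zero>}"
    have "inj_on (\<lambda>y. x \<otimes> y) (carrier R)" using x by (auto simp: inj_on_def m_lcancel)
    moreover have "(\<lambda>y. x \<otimes> y) ` carrier R \<subseteq> carrier R" using x by auto
    ultimately have "(\<lambda>y. x \<otimes> y) ` carrier R = carrier R"
      using assms by (simp add: card_image card_subset_eq)
    then obtain y where "y \<in> carrier R" "x \<otimes> y = \<one>" using one_closed by (metis imageE)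
    then show "x \<in> Units R" using x by (auto simp: Units_def m_comm intro!: bexI[of _ y])
  qed
qed

locale finite_field = field_polys R for R (structure) +
  assumes finite_carrier: "finite (carrier R)"
begin

lemma order_gt_1: "order R > 1"
  unfolding order_def using card_mono[of "carrier R" "{\<zero>, \<one>}"] finite_carrier by simp

lemma nonzero_pow_order:
  assumes "x \<in> carrier R" "x \<noteq> \<zero>"
  shows "x [^] (order R - 1) = \<one>"
proof -
  interpret G: group "Multiplicative_Group.mult_of R" by (rule field_mult_group)
  have "x [^]\<^bsub>Multiplicative_Group.mult_of R\<^esub> order (Multiplicative_Group.mult_of R) = \<one>"
    using G.pow_order_eq_1[of x] assms
    by (simp add: Multiplicative_Group.one_mult_of Multiplicative_Group.carrier_mult_of)
  then show ?thesis
    by (simp only: Multiplicative_Group.nat_pow_mult_of order_mult_of[OF finite_carrier])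
qed

lemma pow_order:
  assumes "x \<in> carrier R" shows "x [^] order R = x"
proof (cases "x = \<zero>")
  case True
  then show ?thesis using order_gt_1 by (simp add: nat_pow_zero)
next
  case False
  have "x [^] Suc (order R - 1) = x" using nonzero_pow_order[OF assms False] assms by simp
  then show ?thesis using order_gt_1 by simp
qed

lemma finite_monics_deg: "finite (monics_deg n)"
  by (simp add: monics_deg_eq finite_lists_length_eq finite_carrier)

lemma card_monics_deg: "card (monics_deg n) = order R ^ n"
  by (simp add: monics_deg_eq card_image inj_on_def card_lists_length_eq order_def finite_carrier)

lemma card_polys_below: "finite (polys_below d)" "card (polys_below d) = order R ^ d"
proof (induction d)
  case 0
  have "polys_below 0 = {[]}" by (auto simp: polys_below_def poly_carrier_iff)
  then show "finite (polys_below 0)" "card (polys_below 0) = order R ^ 0" by simp_all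
next
  case (Suc d)
  let ?N = "(\<lambda>(c, cs). c # cs) ` ((carrier R - {\<zero>}) \<times> {cs. set cs \<subseteq> carrier R \<and> length cs = d})"
  have below_Suc: "polys_below (Suc d) = polys_below d \<union> ?N"
  proof (intro equalityI subsetI)
    fix p assume "p \<in> polys_below (Suc d)"
    then show "p \<in> polys_below d \<union> ?N"
      by (cases p; cases "length p \<le> d") (auto simp: polys_below_def poly_carrier_iff)
  qed (auto simp: polys_below_def poly_carrier_iff)
  have "finite ?N" using finite_carrier by (auto simp: finite_lists_length_eq)
  then show "finite (polys_below (Suc d))" using below_Suc Suc by simp
  have "polys_below d \<inter> ?N = {}" by (auto simp: polys_below_def)
  with Suc(1) \<open>finite ?N\<close> have "card (polys_below (Suc d)) = card (polys_below d) + card ?N"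
    unfolding below_Suc by (rule card_Un_disjoint)
  moreover have "card ?N = (order R - 1) * order R ^ d"
    using finite_carrier
    by (subst card_image) (auto simp: inj_on_def card_cartesian_product card_lists_length_eq order_def)
  moreover have "order R ^ d + (order R - 1) * order R ^ d = order R ^ Suc d"
    using order_gt_1 by (cases "order R") auto
  ultimately show "card (polys_below (Suc d)) = order R ^ Suc d" by (simp only: Suc(2))
qed

text \<open>Two monic polynomials of degree \<open>q\<close> that agree on the whole field are equal.\<close>

lemma var_plus_one_pow_order: "[\<one>, \<one>] .^ order R = [\<one>, \<zero>] .^ order R .+ [\<one>]"
proof (rule poly_eqI_eval)
  let ?q = "order R"
  have one: "[\<one>] \<in> kX" "length [\<one>] \<le> ?q" using order_gt_1 by (auto simp: poly_carrier_iff)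
  have linear: "[\<one>, \<one>] \<in> monics_deg 1" "[\<one>, \<zero>] \<in> monics_deg 1" by (rule linear_in_monics_deg; simp)+
  then have power: "[\<one>, c] .^ ?q \<in> monics_deg ?q" if "[\<one>, c] \<in> monics_deg 1" for c
    using monics_deg_pow[OF that, of ?q] by simp
  have monic: "[\<one>, \<one>] .^ ?q \<in> monics_deg ?q" "[\<one>, \<zero>] .^ ?q .+ [\<one>] \<in> monics_deg ?q"
    using power linear monics_deg_add[OF power one] by auto
  then show "[\<one>, \<one>] .^ ?q \<in> kX" "[\<one>, \<zero>] .^ ?q .+ [\<one>] \<in> kX"
    by (auto dest: monics_degD(2))
  show "length ([\<one>, \<one>] .^ ?q .- ([\<one>, \<zero>] .^ ?q .+ [\<one>])) \<le> card (carrier R)"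
    using length_diff_monics_deg[OF monic] by (simp add: order_def)
  fix x assume x: "x \<in> carrier R"
  interpret E: ring_hom_ring "poly_ring R" R "\<lambda>p. eval p x" by (rule eval_poly_hom[OF x])
  have "[\<one>, \<one>] \<in> kX" "[\<one>, \<zero>] \<in> kX" by (auto simp: poly_carrier_iff)
  then show "eval ([\<one>, \<one>] .^ ?q) x = eval ([\<one>, \<zero>] .^ ?q .+ [\<one>]) x"
    using E.hom_nat_pow[of "[\<one>, \<one>]" ?q] E.hom_nat_pow[of "[\<one>, \<zero>]" ?q] x one(1)
      pow_order[of x] pow_order[of "x \<oplus> \<one>"] by simp
qed (simp_all add: finite_carrier)

lemma bij_betw_monic_division:
  assumes D: "D \<in> monics_deg d" and "d \<le> n"
  shows "bij_betw (\<lambda>(h, p). D .* h .+ p) (monics_deg (n - d) \<times> polys_below d) (monics_deg n)"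
proof (rule bij_betw_imageI)
  let ?f = "\<lambda>(h, p). D .* h .+ p" and ?X = "monics_deg (n - d) \<times> polys_below d"
  show inj: "inj_on ?f ?X"
  proof (rule inj_onI, clarify)
    fix h p h' p' assume h: "h \<in> monics_deg (n - d)" "h' \<in> monics_deg (n - d)"
      and p: "p \<in> polys_below d" "p' \<in> polys_below d" and sums: "D .* h .+ p = D .* h' .+ p'"
    note closed = monics_degD(2)[OF D] h[THEN monics_degD(2)] p[THEN polys_below_carrier]
    have "p .- p' = D .* h' .- D .* h" using closed sums by (intro UP.diff_eq_diff_of_sum_eq) auto
    also have "\<dots> = D .* (h' .- h)" by (rule UP.eqI_diff, use closed in algebra) (use closed in auto)
    finally have "D .| (p .- p')" using closed by (auto simp: factor_def)
    then have p_eq: "p = p'" by (rule polys_below_unique[OF D p])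
    have "D .* h = D .* h'"
      by (rule UP.add.r_cancel[OF sums[unfolded p_eq]]) (use closed in auto)
    then show "h = h' \<and> p = p'"
      using p_eq closed monics_degD(3)[OF D] UP.m_lcancel[of D h h'] by simp
  qed
  have "D .* h .+ p \<in> monics_deg n" if "h \<in> monics_deg (n - d)" "p \<in> polys_below d" for h p
    using monics_deg_mult[OF D that(1)] that(2) \<open>d \<le> n\<close>
    by (intro monics_deg_add) (auto simp: polys_below_def)
  then have "?f ` ?X \<subseteq> monics_deg n" by auto
  moreover have "card (?f ` ?X) = card (monics_deg n)"
    using \<open>d \<le> n\<close>
    by (simp add: card_image[OF inj] card_cartesian_product card_monics_deg card_polys_below flip: power_add)
  ultimately show "?f ` ?X = monics_deg n" using finite_monics_deg by (intro card_subset_eq)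
qed

lemma bij_betw_const_mult_polys_below:
  assumes c: "c \<in> carrier R" "c \<noteq> \<zero>"
  shows "bij_betw (\<lambda>p. [c] .* p) (polys_below d) (polys_below d)"
proof -
  have const: "[c] \<in> kX" "[c] \<noteq> []" using c by (auto simp: poly_carrier_iff)
  have inj: "inj_on (\<lambda>p. [c] .* p) (polys_below d)"
    using const by (auto simp: inj_on_def polys_below_def UP.m_lcancel)
  have "[c] .* p \<in> polys_below d" if p: "p \<in> polys_below d" for p
  proof (cases "p = []")
    case True
    then show ?thesis using p UP.r_null[OF const(1)] by simp
  next
    case False
    then have "degree ([c] .* p) = degree p" "p \<in> kX" "length p \<le> d"
      using poly_degree_mult(1)[OF const(1) _ const(2) False] p by (auto simp: polys_below_def)
    then show ?thesis using const False by (cases p) (auto simp: polys_below_def)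
  qed
  then have "(\<lambda>p. [c] .* p) ` polys_below d = polys_below d"
    by (intro endo_inj_surj[OF card_polys_below(1) _ inj]) auto
  then show ?thesis using inj by (simp add: bij_betw_def)
qed

end

section \<open>Euler products over monic polynomials\<close>

context field_polys
begin

definition monics_over :: "'a list set \<Rightarrow> nat \<Rightarrow> 'a list set" where
  "monics_over Y n = {g \<in> monics_deg n. \<forall>P\<in>monic_irreds. P .| g \<longrightarrow> P \<in> Y}"

definition zeta_fps :: "('a list \<Rightarrow> real) \<Rightarrow> 'a list set \<Rightarrow> real fps" where
  "zeta_fps w Y = Abs_fps (\<lambda>n. \<Sum>g\<in>monics_over Y n. w g)"

lemma monics_over_empty: "monics_over {} n = (if n = 0 then {[\<one>]} else {})"
proof (cases "n = 0")
  case True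
  have "\<not> P .| [\<one>]" if "P \<in> monic_irreds" for P
    using that monic_irredD UP.divides_one[of P] by (auto simp: poly_one)
  then show ?thesis using True by (auto simp: monics_over_def monics_deg_0)
next
  case False
  have "\<exists>P\<in>monic_irreds. P .| g" if "g \<in> monics_deg n" for g
  proof -
    have "g \<in> kX" "degree g > 0" using monics_degD[OF that] False by auto
    then show ?thesis using exists_monic_irred_divisor by blast
  qed
  then show ?thesis using False by (auto simp: monics_over_def)
qed

lemma monics_over_insert_disjoint:
  assumes "P \<in> monic_irreds" "P \<notin> Y"
  shows "monics_over Y n \<inter> (\<lambda>h. P .* h) ` monics_over Z m = {}"
proof -
  have False if "h \<in> monics" "P .* h \<in> monics_over Y n" for h
  proof -
    have "P .| (P .* h)" using monicsD(1)[OF that(1)] by (auto simp: factor_def)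
    then show False using that(2) assms by (auto simp: monics_over_def)
  qed
  then show ?thesis by (auto simp: monics_over_def monics_deg_def)
qed

lemma monics_over_cofactor:
  assumes P: "P \<in> monic_irreds" and g: "g \<in> monics_over Y n" "P .| g"
  obtains h where "degree P \<le> n" "h \<in> monics_over Y (n - degree P)" "g = P .* h"
proof -
  have g_monic: "g \<in> monics" "degree g = n" using g(1)
    by (auto simp: monics_over_def monics_deg_def)
  obtain h where h: "h \<in> monics" "g = P .* h"
    using monic_divides_cofactor[OF monic_irredD(1)[OF P] g_monic(1) g(2)] .
  have "n = degree P + degree h"
    using monic_degree_mult[OF monic_irredD(1)[OF P] h(1)] g_monic h by simp
  moreover have "Q \<in> Y" if Q: "Q \<in> monic_irreds" "Q .| h" for Q
  proof -
    have "Q .| g"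
      unfolding h(2) using Q(2) monic_irredD(2)[OF P] monicsD(1)[OF h(1)] monic_irredD(2)[OF Q(1)]
      by (intro UP.divides_prod_l) auto
    then show ?thesis using g(1) Q by (auto simp: monics_over_def)
  qed
  ultimately show ?thesis using that h by (auto simp: monics_over_def monics_deg_def)
qed

lemma monics_over_mult:
  assumes P: "P \<in> monic_irreds" and h: "h \<in> monics_over (insert P Y) m"
  shows "P .* h \<in> monics_over (insert P Y) (degree P + m)"
proof -
  have h_monic: "h \<in> monics" "degree h = m" using h by (auto simp: monics_over_def monics_deg_def)
  have "P .* h \<in> monics_deg (degree P + m)"
    using monics_deg_mult[of P "degree P" h m] monic_irredD(1)[OF P] h_monic
    by (simp add: monics_deg_def)
  moreover have "Q \<in> insert P Y" if Q: "Q \<in> monic_irreds" "Q .| (P .* h)" for Q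
    using monic_irred_prime[OF Q(1) monic_irredD(2)[OF P] monicsD(1)[OF h_monic(1)] Q(2)]
      monic_irred_divides_eq[OF Q(1) P] Q(1) h by (auto simp: monics_over_def)
  ultimately show ?thesis by (auto simp: monics_over_def)
qed

lemma monics_over_insert:
  assumes P: "P \<in> monic_irreds"
  shows "monics_over (insert P Y) n = monics_over Y n \<union>
     (if n < degree P then {} else (\<lambda>h. P .* h) ` monics_over (insert P Y) (n - degree P))"
    (is "?A = ?B \<union> ?C")
proof (intro equalityI subsetI)
  fix g assume g: "g \<in> ?A"
  show "g \<in> ?B \<union> ?C"
  proof (cases "P .| g")
    case True
    obtain h where "degree P \<le> n" "h \<in> monics_over (insert P Y) (n - degree P)" "g = P .* h"
      using monics_over_cofactor[OF P g True] .
    then show ?thesis by auto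
  qed (use g in \<open>auto simp: monics_over_def\<close>)
next
  fix g assume "g \<in> ?B \<union> ?C"
  then consider "g \<in> ?B" | h where "n \<ge> degree P" "h \<in> monics_over (insert P Y) (n - degree P)" "g = P .* h"
    by (auto split: if_splits)
  then show "g \<in> ?A"
  proof cases
    case 1
    then show ?thesis by (auto simp: monics_over_def)
  next
    case 2
    then show ?thesis using monics_over_mult[OF P 2(2)] by simp
  qed
qed

definition monic_irreds_le :: "nat \<Rightarrow> 'a list set" where
  "monic_irreds_le N = {P \<in> monic_irreds. degree P \<le> N}"

lemma monics_over_monic_irreds_le: assumes "n \<le> N"
  shows "monics_over (monic_irreds_le N) n = monics_deg n"
proof -
  have "degree P \<le> n" if "P \<in> monic_irreds" "g \<in> monics_deg n" "P .| g" for P g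
    using monic_divides_cofactor[OF monic_irredD(1)[OF that(1)] _ that(3)]
      monic_degree_mult[OF monic_irredD(1)[OF that(1)]] monics_degD(1,5)[OF that(2)]
        by (metis le_add1)
  then show ?thesis using assms by (force simp: monics_over_def monic_irreds_le_def)
qed

end

context finite_field
begin

lemma finite_monics_over: "finite (monics_over Y n)"
  using finite_monics_deg[of n] by (auto simp: monics_over_def)

lemma finite_monic_irreds_le: "finite (monic_irreds_le N)"
proof (rule finite_subset)
  show "monic_irreds_le N \<subseteq> (\<Union>n\<le>N. monics_deg n)"
    by (auto simp: monic_irreds_le_def monics_deg_def monic_irreds_def)
qed (auto simp: finite_monics_deg)

lemma sum_monics_over_insert:
  assumes P: "P \<in> monic_irreds" "P \<notin> Y"
    and w_mult: "\<And>p r. p \<in> monics \<Longrightarrow> r \<in> monics \<Longrightarrow> w (p .* r) = w p * (w r :: real)"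
  shows "sum w (monics_over (insert P Y) n) = sum w (monics_over Y n) +
    (if n < degree P then 0 else w P * sum w (monics_over (insert P Y) (n - degree P)))"
proof (cases "n < degree P")
  case True
  then show ?thesis using monics_over_insert[OF P(1), of Y n] by simp
next
  case False
  let ?G = "monics_over (insert P Y) (n - degree P)"
  have inj: "inj_on (\<lambda>h. P .* h) ?G"
    using monic_irredD[OF P(1)]
    by (auto simp: inj_on_def monics_over_def monics_deg_def monics_def UP.m_lcancel)
  have "sum w (monics_over (insert P Y) n) = sum w (monics_over Y n \<union> (\<lambda>h. P .* h) ` ?G)"
    by (subst monics_over_insert[OF P(1), of Y n]) (use False in simp)
  also have "\<dots> = sum w (monics_over Y n) + sum w ((\<lambda>h. P .* h) ` ?G)"
    by (rule sum.union_disjoint) (use finite_monics_over monics_over_insert_disjoint[OF P] in auto)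
  also have "sum w ((\<lambda>h. P .* h) ` ?G) = (\<Sum>h\<in>?G. w (P .* h))"
    using sum.reindex[OF inj, of w] by simp
  also have "\<dots> = (\<Sum>h\<in>?G. w P * w h)"
    by (rule sum.cong) (use w_mult[OF monic_irredD(1)[OF P(1)]] in \<open>auto simp: monics_over_def monics_deg_def\<close>)
  finally show ?thesis using False by (simp add: sum_distrib_left)
qed

lemma zeta_fps_euler:
  assumes w_one: "w [\<one>] = 1"
    and w_mult: "\<And>p r. p \<in> monics \<Longrightarrow> r \<in> monics \<Longrightarrow> w (p .* r) = w p * w r"
    and "finite Y" "Y \<subseteq> monic_irreds"
  shows "zeta_fps w Y * (\<Prod>P\<in>Y. euler_factor (w P) (degree P)) = 1"
  using assms(3,4)
proof (induction Y rule: finite_induct)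
  case empty
  show ?case by (rule fps_ext) (auto simp: zeta_fps_def monics_over_empty w_one)
next
  case (insert P Y)
  let ?Z = "zeta_fps w (insert P Y)"
  have "?Z * euler_factor (w P) (degree P) = ?Z - fps_const (w P) * (fps_X ^ degree P * ?Z)"
    by (simp add: algebra_simps)
  also have "\<dots> = zeta_fps w Y"
  proof (rule fps_ext)
    show "(?Z - fps_const (w P) * (fps_X ^ degree P * ?Z)) $ n = zeta_fps w Y $ n" for n
      using sum_monics_over_insert[of P Y w n] insert w_mult
      by (simp add: fps_X_power_mult_nth zeta_fps_def)
  qed
  finally show ?case using insert by (simp add: mult.assoc [symmetric])
qed

end

section \<open>Quadratic characters of finite fields\<close>

text \<open>For \<open>n = (q - 1) div 2\<close> this is the quadratic character of the field with \<open>q\<close> elements,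
  but \<open>x\<close> may lie in a larger field.\<close>

definition power_char :: "('a, 'm) ring_scheme \<Rightarrow> nat \<Rightarrow> 'a \<Rightarrow> real" where
  "power_char R n x = (if x = \<zero>\<^bsub>R\<^esub> then 0 else if x [^]\<^bsub>R\<^esub> n = \<one>\<^bsub>R\<^esub> then 1 else -1)"

lemma (in domain) pow_pm_one:
  assumes "x \<in> carrier R" "x [^] (2 * n :: nat) = \<one>"
  shows "x [^] n = \<one> \<or> x [^] n = \<ominus> \<one>"
proof -
  have "(x [^] n) \<otimes> (x [^] n) = \<one> \<otimes> \<one>"
    using assms by (simp add: nat_pow_mult mult_2)
  then show ?thesis using assms by (subst (asm) square_eq_iff) auto
qed

lemma (in domain) power_char_mult:
  assumes "x \<in> carrier R" "y \<in> carrier R"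
    and "x \<noteq> \<zero> \<Longrightarrow> x [^] (2 * n) = \<one>" "y \<noteq> \<zero> \<Longrightarrow> y [^] (2 * n) = \<one>"
  shows "power_char R n (x \<otimes> y) = power_char R n x * power_char R n y"
proof (cases "x = \<zero> \<or> y = \<zero>")
  case True
  then show ?thesis using assms by (auto simp: power_char_def)
next
  case False
  then have xy: "x \<otimes> y \<noteq> \<zero>" using assms integral by blast
  have p: "(x \<otimes> y) [^] n = x [^] n \<otimes> y [^] n" using assms by (simp add: nat_pow_distrib)
  have "x [^] n = \<one> \<or> x [^] n = \<ominus> \<one>" "y [^] n = \<one> \<or> y [^] n = \<ominus> \<one>"
    using False assms pow_pm_one by auto
  moreover have "\<ominus> \<one> \<otimes> \<ominus> \<one> = \<one>" by (simp add: l_minus r_minus)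
  ultimately show ?thesis using False xy
    by (cases "\<ominus> \<one> = \<one>") (auto simp: power_char_def p)
qed

lemma (in domain) power_char_square:
  assumes "x \<in> carrier R" "x \<noteq> \<zero>" "x [^] (2 * n) = \<one>"
  shows "power_char R n (x \<otimes> x) = 1"
  using power_char_mult[OF assms(1,1), of n] assms by (auto simp: power_char_def)

locale odd_finite_field = finite_field R for R (structure) +
  assumes two_nonzero: "\<one> \<oplus> \<one> \<noteq> \<zero>"
begin

definition half_order :: nat where "half_order = (order R - 1) div 2"

lemma double_nonzero: assumes "x \<in> carrier R" "x \<noteq> \<zero>" shows "x \<oplus> x \<noteq> \<zero>"
proof -
  have "x \<oplus> x = (\<one> \<oplus> \<one>) \<otimes> x" using assms by (simp add: l_distr)
  then show ?thesis using assms two_nonzero integral[of "\<one> \<oplus> \<one>" x] by auto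
qed

lemma neg_neq: "x \<in> carrier R \<Longrightarrow> x \<noteq> \<zero> \<Longrightarrow> \<ominus> x \<noteq> x"
  using double_nonzero by (metis r_neg)

lemma order_eq: "order R = 2 * half_order + 1" and half_order_pos: "half_order > 0"
proof -
  interpret G: group "Multiplicative_Group.mult_of R" by (rule field_mult_group)
  have "(\<ominus> \<one>) [^] (2::nat) = \<one>" by (simp add: power2_eq_square l_minus r_minus)
  then have "G.ord (\<ominus> \<one>) dvd 2"
    using G.pow_eq_id[of "\<ominus> \<one>" 2] by (simp add: Multiplicative_Group.mult_of_simps)
  moreover have "G.ord (\<ominus> \<one>) \<noteq> 1"
    using G.ord_eq_1[of "\<ominus> \<one>"] neg_neq[of \<one>] by (simp add: Multiplicative_Group.mult_of_simps)
  ultimately have "G.ord (\<ominus> \<one>) = 2" using prime_nat_iff two_is_prime_nat by blast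
  then have "2 dvd order R - 1"
    using G.ord_dvd_group_order[of "\<ominus> \<one>"] finite_carrier
    by (simp add: Multiplicative_Group.mult_of_simps order_mult_of)
  then show "order R = 2 * half_order + 1" "half_order > 0"
    using order_gt_1 by (auto simp: half_order_def elim: oddE)
qed

lemma pow_twice_half_order: "x \<in> carrier R \<Longrightarrow> x \<noteq> \<zero> \<Longrightarrow> x [^] (2 * half_order) = \<one>"
  using nonzero_pow_order order_eq by simp

lemma generator_pow_half_order:
  assumes g: "g \<in> carrier R" "g \<noteq> \<zero>" and generator: "carrier R - {\<zero>} = {g [^] i | i::nat. i \<in> UNIV}"
  shows "g [^] half_order \<noteq> \<one>"
proof
  assume one: "g [^] half_order = \<one>"
  have "carrier R - {\<zero>} \<subseteq> (\<lambda>i. g [^] i) ` {..<half_order}"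
  proof
    fix z assume "z \<in> carrier R - {\<zero>}"
    then obtain l :: nat where l: "z = g [^] l" using generator by blast
    have "g [^] l = g [^] (half_order * (l div half_order) + l mod half_order)" by simp
    also have "\<dots> = (g [^] half_order) [^] (l div half_order) \<otimes> g [^] (l mod half_order)"
      using g by (simp only: nat_pow_pow nat_pow_mult)
    also have "\<dots> = g [^] (l mod half_order)" using one g by simp
    finally show "z \<in> (\<lambda>i. g [^] i) ` {..<half_order}" using l half_order_pos by auto
  qed
  then have "card (carrier R - {\<zero>}) \<le> card {..<half_order}" using surj_card_le by blast
  moreover have "card (carrier R - {\<zero>}) = 2 * half_order"
    using order_eq finite_carrier by (simp add: order_def)
  ultimately show False using half_order_pos by simp
qed

lemma euler_criterion:
  assumes "x \<in> carrier R" "x \<noteq> \<zero>"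
  shows "(\<exists>y\<in>carrier R. y \<otimes> y = x) \<longleftrightarrow> x [^] half_order = \<one>"
proof
  assume "\<exists>y\<in>carrier R. y \<otimes> y = x"
  then obtain y where y: "y \<in> carrier R" "y \<otimes> y = x" by blast
  then have "y \<noteq> \<zero>" using assms by auto
  then show "x [^] half_order = \<one>" using pow_twice_half_order[of y] y
    by (metis nat_pow_distrib nat_pow_mult mult_2)
next
  assume one: "x [^] half_order = \<one>"
  obtain g where g: "g \<in> carrier R" "g \<noteq> \<zero>" and generator: "carrier R - {\<zero>} = {g [^] i | i::nat. i \<in> UNIV}"
    using finite_field_mult_group_has_gen[OF finite_carrier]
    by (auto simp: Multiplicative_Group.carrier_mult_of)
  obtain i :: nat where i: "x = g [^] i" using generator assms by blast
  show "\<exists>y\<in>carrier R. y \<otimes> y = x"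
  proof (cases "even i")
    case True
    then obtain j where "i = j + j" by (metis evenE mult_2)
    then have "g [^] j \<otimes> g [^] j = x" using i g by (simp add: nat_pow_mult)
    then show ?thesis using g by blast
  next
    case False
    then obtain j where j: "i = 2 * j + 1" by (metis oddE)
    have "x [^] half_order = g [^] (i * half_order)" using i g by (simp only: nat_pow_pow)
    also have "i * half_order = 2 * half_order * j + half_order" by (simp add: j algebra_simps)
    also have "g [^] \<dots> = (g [^] (2 * half_order)) [^] j \<otimes> g [^] half_order"
      using g by (simp add: nat_pow_pow nat_pow_mult)
    finally show ?thesis
      using one pow_twice_half_order[OF g] g generator_pow_half_order[OF g generator] by simp
  qed
qed

abbreviation qchar :: "'a \<Rightarrow> real" where "qchar \<equiv> power_char R half_order"

lemma qchar_zero: "qchar \<zero> = 0" by (simp add: power_char_def)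

lemma qchar_mult: "x \<in> carrier R \<Longrightarrow> y \<in> carrier R \<Longrightarrow> qchar (x \<otimes> y) = qchar x * qchar y"
  by (rule power_char_mult) (auto intro: pow_twice_half_order)

lemma qchar_square: "x \<in> carrier R \<Longrightarrow> x \<noteq> \<zero> \<Longrightarrow> qchar (x \<otimes> x) = 1"
  by (rule power_char_square) (auto intro: pow_twice_half_order)

lemma card_sqrt:
  assumes "x \<in> carrier R" shows "real (card {y \<in> carrier R. y \<otimes> y = x}) = 1 + qchar x"
proof -
  consider "x = \<zero>" | y where "x \<noteq> \<zero>" "y \<in> carrier R" "y \<otimes> y = x"
    | "x \<noteq> \<zero>" "{y \<in> carrier R. y \<otimes> y = x} = {}" by blast
  then show ?thesis
  proof cases
    case 1
    then have "{y \<in> carrier R. y \<otimes> y = x} = {\<zero>}" using integral by auto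
    then show ?thesis using 1 by (simp add: power_char_def)
  next
    case (2 y)
    then have "{z \<in> carrier R. z \<otimes> z = x} = {y, \<ominus> y}"
      using square_eq_iff[of _ y] by (auto simp: l_minus r_minus)
    moreover have "y \<noteq> \<zero>" using 2 by auto
    then have "\<ominus> y \<noteq> y" using neg_neq 2(2) by blast
    ultimately show ?thesis using 2 assms euler_criterion by (auto simp: power_char_def)
  next
    case 3
    then have "x [^] half_order \<noteq> \<one>" using assms euler_criterion by blast
    then show ?thesis unfolding 3(2) using 3(1) by (simp add: power_char_def)
  qed
qed

lemma sum_qchar: "(\<Sum>x\<in>carrier R. qchar x) = 0"
proof -
  have "(\<Sum>x\<in>carrier R. real (card {y \<in> carrier R. y \<otimes> y = x})) = real (card (carrier R))"
  proof -
    have "(\<Sum>x\<in>carrier R. card {y \<in> carrier R. y \<otimes> y = x}) = card (\<Union>x\<in>carrier R. {y \<in> carrier R. y \<otimes> y = x})"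
      using finite_carrier by (intro card_UN_disjoint [symmetric]) auto
    also have "(\<Union>x\<in>carrier R. {y \<in> carrier R. y \<otimes> y = x}) = carrier R" by auto
    finally show ?thesis by (simp flip: of_nat_sum)
  qed
  then show ?thesis by (simp add: card_sqrt sum.distrib)
qed

lemma exists_nonresidue: "\<exists>c\<in>carrier R. qchar c = -1"
proof (rule ccontr)
  assume "\<not> ?thesis"
  then have "qchar x \<ge> 0" if "x \<in> carrier R" for x using that
    by (auto simp: power_char_def split: if_splits)
  moreover have "qchar \<one> = 1" by (simp add: power_char_def)
  ultimately have "(\<Sum>x\<in>carrier R. qchar x) > 0"
    using finite_carrier by (intro sum_pos2[of _ \<one>]) auto
  then show False by (simp add: sum_qchar)
qed

lemma card_linear_solutions:
  assumes "c \<in> carrier R" "d \<in> carrier R" "c = \<zero> \<Longrightarrow> d \<noteq> \<zero>"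
  shows "card {r \<in> carrier R. r \<otimes> c = d} = (if c = \<zero> then 0 else 1)"
proof (cases "c = \<zero>")
  case True
  then have no_solution: "{r \<in> carrier R. r \<otimes> c = d} = {}" using assms by auto
  show ?thesis unfolding no_solution using True by simp
next
  case False
  have "{r \<in> carrier R. r \<otimes> c = d} = {d \<otimes> inv c}"
  proof (intro equalityI subsetI)
    fix r assume "r \<in> {r \<in> carrier R. r \<otimes> c = d}"
    then show "r \<in> {d \<otimes> inv c}" using assms False by (auto simp: m_assoc)
  qed (use assms False in \<open>auto simp: m_assoc\<close>)
  then show ?thesis using False by simp
qed

text \<open>Writing \<open>z = r + t\<close>, the equation \<open>z\<^sup>2 = r\<^sup>2 + \<beta>r + \<gamma>\<close> becomes linear in \<open>r\<close>.\<close>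

lemma card_sqrt_quadratic:
  assumes "r \<in> carrier R" and "\<beta> \<in> carrier R" "\<gamma> \<in> carrier R"
  shows "card {z \<in> carrier R. z \<otimes> z = r \<otimes> r \<oplus> \<beta> \<otimes> r \<oplus> \<gamma>}
    = card {t \<in> carrier R. r \<otimes> (t \<oplus> t \<ominus> \<beta>) = \<gamma> \<ominus> t \<otimes> t}"
proof -
  let ?Q = "r \<otimes> r \<oplus> \<beta> \<otimes> r \<oplus> \<gamma>"
  have "bij_betw (\<lambda>t. r \<oplus> t) (carrier R) (carrier R)"
    by (rule bij_betw_byWitness[where f' = "\<lambda>z. z \<ominus> r"])
       (use assms(1) in \<open>auto simp: add_diff_cancel_left add_diff_cancel_left'\<close>)
  then have "bij_betw (\<lambda>t. r \<oplus> t) {t \<in> carrier R. r \<otimes> (t \<oplus> t \<ominus> \<beta>) = \<gamma> \<ominus> t \<otimes> t} {z \<in> carrier R. z \<otimes> z = ?Q}"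
  proof (rule bij_betw_Collect)
    fix t assume t: "t \<in> carrier R"
    have "(r \<oplus> t) \<otimes> (r \<oplus> t) \<ominus> ?Q = r \<otimes> (t \<oplus> t \<ominus> \<beta>) \<ominus> (\<gamma> \<ominus> t \<otimes> t)"
      by (rule eqI_diff, use assms t in algebra) (use assms t in auto)
    then show "(r \<oplus> t) \<otimes> (r \<oplus> t) = ?Q \<longleftrightarrow> r \<otimes> (t \<oplus> t \<ominus> \<beta>) = \<gamma> \<ominus> t \<otimes> t"
      using r_right_minus_eq[of "(r \<oplus> t) \<otimes> (r \<oplus> t)" ?Q] assms t
        r_right_minus_eq[of "r \<otimes> (t \<oplus> t \<ominus> \<beta>)" "\<gamma> \<ominus> t \<otimes> t"] by simp
  qed
  then show ?thesis by (simp add: bij_betw_same_card)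
qed

lemma halving: assumes "\<beta> \<in> carrier R" obtains h where "h \<in> carrier R" "\<beta> = h \<oplus> h"
proof
  have "inv (\<one> \<oplus> \<one>) \<oplus> inv (\<one> \<oplus> \<one>) = (\<one> \<oplus> \<one>) \<otimes> inv (\<one> \<oplus> \<one>)"
    using two_nonzero by (simp add: l_distr del: r_inv)
  then show "\<beta> = \<beta> \<otimes> inv (\<one> \<oplus> \<one>) \<oplus> \<beta> \<otimes> inv (\<one> \<oplus> \<one>)"
    using assms two_nonzero by (simp add: r_distr [symmetric])
qed (use assms two_nonzero in simp)

lemma double_eq_iff: "t \<in> carrier R \<Longrightarrow> h \<in> carrier R \<Longrightarrow> t \<oplus> t = h \<oplus> h \<longleftrightarrow> t = h"
proof
  assume t_h: "t \<in> carrier R" "h \<in> carrier R" "t \<oplus> t = h \<oplus> h"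
  have "(t \<ominus> h) \<oplus> (t \<ominus> h) = (t \<oplus> t) \<ominus> (h \<oplus> h)"
    by (rule eqI_diff, use t_h(1,2) in algebra) (use t_h(1,2) in auto)
  then have "t \<ominus> h = \<zero>" using t_h double_nonzero[of "t \<ominus> h"] by auto
  then show "t = h" using t_h by simp
qed simp

lemma sum_qchar_quadratic:
  assumes coeffs: "\<beta> \<in> carrier R" "\<gamma> \<in> carrier R" and disc: "\<beta> \<otimes> \<beta> \<noteq> \<guillemotleft>4\<guillemotright> \<otimes> \<gamma>"
  shows "(\<Sum>r\<in>carrier R. qchar (r \<otimes> r \<oplus> \<beta> \<otimes> r \<oplus> \<gamma>)) = -1"
proof -
  let ?Q = "\<lambda>r. r \<otimes> r \<oplus> \<beta> \<otimes> r \<oplus> \<gamma>"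
  obtain h where h: "h \<in> carrier R" "\<beta> = h \<oplus> h" using halving[OF coeffs(1)] .
  have "\<guillemotleft>4\<guillemotright> = (\<one> \<oplus> \<one>) \<otimes> (\<one> \<oplus> \<one>)" using of_int_mult[of 2 2] by (simp add: of_int_2)
  then have "\<beta> \<otimes> \<beta> = \<guillemotleft>4\<guillemotright> \<otimes> (h \<otimes> h)" unfolding h(2)
    by (simp only:) (rule eqI_diff, use h in algebra, use h in auto)
  then have "\<gamma> \<noteq> h \<otimes> h" using disc by auto
  have count: "card {r \<in> carrier R. r \<otimes> (t \<oplus> t \<ominus> \<beta>) = \<gamma> \<ominus> t \<otimes> t} = (if t = h then 0 else 1)"
    if t: "t \<in> carrier R" for t
  proof -
    have "t \<oplus> t \<ominus> \<beta> = \<zero> \<longleftrightarrow> t = h" using t h double_eq_iff[OF t h(1)] by simp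
    then show ?thesis
      using card_linear_solutions[of "t \<oplus> t \<ominus> \<beta>" "\<gamma> \<ominus> t \<otimes> t"] t h(1) coeffs \<open>\<gamma> \<noteq> h \<otimes> h\<close> by auto
  qed
  have "(\<Sum>r\<in>carrier R. card {z \<in> carrier R. z \<otimes> z = ?Q r})
      = (\<Sum>r\<in>carrier R. card {t \<in> carrier R. r \<otimes> (t \<oplus> t \<ominus> \<beta>) = \<gamma> \<ominus> t \<otimes> t})"
    using coeffs by (intro sum.cong refl card_sqrt_quadratic) auto
  also have "\<dots> = (\<Sum>t\<in>carrier R. if t = h then 0 else 1)"
    using count by (intro sum_multicount_gen finite_carrier) blast
  also have "\<dots> = (\<Sum>t\<in>carrier R - {h}. 1)"
    by (rule sum.mono_neutral_cong_right) (use finite_carrier in auto)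
  also have "\<dots> = order R - 1" using h(1) finite_carrier by (simp add: order_def)
  finally have "(\<Sum>r\<in>carrier R. real (card {z \<in> carrier R. z \<otimes> z = ?Q r})) = real (order R) - 1"
    using order_gt_1 by (simp flip: of_nat_sum)
  moreover have "(\<Sum>r\<in>carrier R. real (card {z \<in> carrier R. z \<otimes> z = ?Q r})) = (\<Sum>r\<in>carrier R. 1 + qchar (?Q r))"
    by (intro sum.cong refl card_sqrt) (use coeffs in auto)
  ultimately show ?thesis by (simp add: sum.distrib order_def)
qed

end

section \<open>A character sum attached to the cubic\<close>

context odd_finite_field
begin

lemma qchar_times_self: "x \<in> carrier R \<Longrightarrow> x \<noteq> \<zero> \<Longrightarrow> qchar x * qchar x = 1"
  using qchar_square qchar_mult by metis

lemma sum_qchar_square_mult: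
  assumes f: "f \<in> carrier R \<rightarrow> carrier R"
  shows "(\<Sum>x\<in>carrier R. qchar (x \<otimes> x \<otimes> f x)) = (\<Sum>x\<in>carrier R. qchar (f x)) - qchar (f \<zero>)"
proof -
  have "(\<Sum>x\<in>carrier R - {\<zero>}. qchar (x \<otimes> x \<otimes> f x)) = (\<Sum>x\<in>carrier R - {\<zero>}. qchar (f x))"
    by (rule sum.cong) (use f in \<open>auto simp: qchar_mult qchar_times_self Pi_iff\<close>)
  then show ?thesis
    using sum.remove[OF finite_carrier zero_closed, of "\<lambda>x. qchar (x \<otimes> x \<otimes> f x)"] f
      sum.remove[OF finite_carrier zero_closed, of "\<lambda>x. qchar (f x)"]
        by (simp add: qchar_zero Pi_iff)
qed

end

lemma (in cring) sum_carrier_diff: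
  assumes "c \<in> carrier R"
  shows "(\<Sum>x\<in>carrier R. g (x \<ominus> c)) = (\<Sum>x\<in>carrier R. g x)" "(\<Sum>x\<in>carrier R. g (c \<ominus> x)) = (\<Sum>x\<in>carrier R. g x)"
proof -
  show "(\<Sum>x\<in>carrier R. g (x \<ominus> c)) = (\<Sum>x\<in>carrier R. g x)"
    by (rule sum.reindex_bij_witness[of _ "\<lambda>x. x \<oplus> c" "\<lambda>x. x \<ominus> c"])
       (use assms in \<open>auto simp: add_diff_cancel diff_add_cancel\<close>)
  show "(\<Sum>x\<in>carrier R. g (c \<ominus> x)) = (\<Sum>x\<in>carrier R. g x)"
    by (rule sum.reindex_bij_witness[of _ "\<lambda>x. c \<ominus> x" "\<lambda>x. c \<ominus> x"])
       (use assms in \<open>auto simp: diff_diff_cancel\<close>)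
qed

lemma (in field) div_div_cancel:
  assumes "x \<in> carrier R" "x \<noteq> \<zero>" "y \<in> carrier R" "y \<noteq> \<zero>"
  shows "x \<otimes> inv y \<noteq> \<zero>" "x \<otimes> inv (x \<otimes> inv y) = y"
proof -
  have inv_y: "inv y \<in> carrier R" "inv y \<noteq> \<zero>" "y \<otimes> inv y = \<one>"
    using assms nonzero_imp_inverse_nonzero by auto
  show nonzero: "x \<otimes> inv y \<noteq> \<zero>" using assms inv_y integral by blast
  have "y \<otimes> (x \<otimes> inv y) = x" using assms inv_y m_lcomm[of y x "inv y"] by simp
  then have "x \<otimes> inv (x \<otimes> inv y) = y \<otimes> (x \<otimes> inv y) \<otimes> inv (x \<otimes> inv y)" by simp
  also have "\<dots> = y" using assms(1,3) inv_y(1) nonzero by (simp add: m_assoc)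
  finally show "x \<otimes> inv (x \<otimes> inv y) = y" .
qed

locale curve_field = odd_finite_field R for R (structure) +
  fixes a b :: 'a
  assumes ab [simp]: "a \<in> carrier R" "b \<in> carrier R"
    and disc: "\<guillemotleft>4\<guillemotright> \<otimes> a [^] (3::nat) \<oplus> \<guillemotleft>27\<guillemotright> \<otimes> b [^] (2::nat) \<noteq> \<zero>"
begin

definition cubic :: "'a \<Rightarrow> 'a" where "cubic x = x [^] (3::nat) \<oplus> a \<otimes> x \<oplus> b"

lemma cubic_closed [simp]: "x \<in> carrier R \<Longrightarrow> cubic x \<in> carrier R"
  by (simp add: cubic_def)

text \<open>Up to sign, \<open>resultant2 u w\<close> is the resultant of the cubic with the polynomial
  \<open>X\<^sup>2 + uX + (a + u\<^sup>2 - w)\<close>.\<close>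

definition resultant2 :: "'a \<Rightarrow> 'a \<Rightarrow> 'a" where
  "resultant2 u w = cubic u \<otimes> cubic u \<ominus> \<guillemotleft>3\<guillemotright> \<otimes> u \<otimes> cubic u \<otimes> w \<oplus> (\<guillemotleft>3\<guillemotright> \<otimes> u \<otimes> u \<oplus> a) \<otimes> w \<otimes> w \<ominus> w \<otimes> w \<otimes> w"

lemma resultant2_closed: "u \<in> carrier R \<Longrightarrow> w \<in> carrier R \<Longrightarrow> resultant2 u w \<in> carrier R"
  by (simp add: resultant2_def)

text \<open>Substituting \<open>w = cubic u / \<rho>\<close> turns the resultant \<open>resultant2 u w\<close> into \<open>- \<rho> * cubic (u - \<rho>)\<close> up to squares.
  The resulting formula persists when \<open>cubic u = 0\<close>.\<close>

lemma qchar_resultant2_reciprocal: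
  assumes u: "u \<in> carrier R" "cubic u \<noteq> \<zero>" and w: "w \<in> carrier R" "w \<noteq> \<zero>"
    and \<rho>: "\<rho> = cubic u \<otimes> inv w"
  shows "qchar (\<ominus> \<rho> \<otimes> cubic (u \<ominus> \<rho>)) = qchar (resultant2 u w)"
proof -
  have inv_w: "inv w \<in> carrier R" "w \<otimes> inv w = \<one>" using w by auto
  have \<rho>_closed: "\<rho> \<in> carrier R" and \<rho>_nonzero: "\<rho> \<noteq> \<zero>"
    using u w inv_w div_div_cancel(1) by (auto simp: \<rho>)
  have "w \<otimes> \<rho> = cubic u" unfolding \<rho> using u w inv_w m_lcomm[of w "cubic u" "inv w"] by simp
  then have "\<rho> \<otimes> resultant2 u w = w \<otimes> w \<otimes> (\<ominus> cubic (u \<ominus> \<rho>))"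
    unfolding resultant2_def cubic_def[of "u \<ominus> \<rho>"]
    by (intro resultant_reciprocal) (use u w \<rho>_closed in \<open>simp_all add: cubic_def\<close>)
  then have "qchar \<rho> * qchar (resultant2 u w) = qchar (w \<otimes> w) * qchar (\<ominus> cubic (u \<ominus> \<rho>))"
    using resultant2_closed \<rho>_closed u w
    by (metis qchar_mult m_closed a_inv_closed cubic_closed minus_closed)
  then have "qchar \<rho> * qchar \<rho> * qchar (resultant2 u w) = qchar \<rho> * qchar (\<ominus> cubic (u \<ominus> \<rho>))"
    using qchar_square[OF w] by simp
  then have "qchar (resultant2 u w) = qchar (\<rho> \<otimes> \<ominus> cubic (u \<ominus> \<rho>))"
    using qchar_times_self[OF \<rho>_closed \<rho>_nonzero] qchar_mult \<rho>_closed u by simp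
  also have "\<rho> \<otimes> \<ominus> cubic (u \<ominus> \<rho>) = \<ominus> \<rho> \<otimes> cubic (u \<ominus> \<rho>)"
    using \<rho>_closed u by (simp add: l_minus r_minus)
  finally show ?thesis ..
qed

lemma sum_qchar_resultant2_nonroot:
  assumes u: "u \<in> carrier R" "cubic u \<noteq> \<zero>"
  shows "(\<Sum>w\<in>carrier R. qchar (resultant2 u w)) = 1 + (\<Sum>\<rho>\<in>carrier R. qchar (\<ominus> \<rho> \<otimes> cubic (u \<ominus> \<rho>)))"
proof -
  have "(\<Sum>w\<in>carrier R - {\<zero>}. qchar (resultant2 u w)) = (\<Sum>\<rho>\<in>carrier R - {\<zero>}. qchar (\<ominus> \<rho> \<otimes> cubic (u \<ominus> \<rho>)))"
    by (rule sum.reindex_bij_witness[of _ "\<lambda>\<rho>. cubic u \<otimes> inv \<rho>" "\<lambda>w. cubic u \<otimes> inv w"])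
       (use u div_div_cancel qchar_resultant2_reciprocal in auto)
  moreover have "resultant2 u \<zero> = cubic u \<otimes> cubic u" "\<ominus> \<zero> \<otimes> cubic (u \<ominus> \<zero>) = \<zero>"
    using u by (simp_all add: resultant2_def)
  ultimately show ?thesis
    using qchar_square[OF cubic_closed[OF u(1)] u(2)]
      sum.remove[OF finite_carrier zero_closed, of "\<lambda>w. qchar (resultant2 u w)"]
      sum.remove[OF finite_carrier zero_closed, of "\<lambda>\<rho>. qchar (\<ominus> \<rho> \<otimes> cubic (u \<ominus> \<rho>))"]
    by (simp add: qchar_zero)
qed

lemma tangent_disc_nonzero:
  assumes u: "u \<in> carrier R" "cubic u = \<zero>" shows "\<guillemotleft>3\<guillemotright> \<otimes> u \<otimes> u \<oplus> \<guillemotleft>4\<guillemotright> \<otimes> a \<noteq> \<zero>"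
proof -
  have "b = \<ominus> (u [^] (3::nat) \<oplus> a \<otimes> u)"
    using u minus_equality[of b "u [^] (3::nat) \<oplus> a \<otimes> u"] by (simp add: cubic_def a_comm)
  then show ?thesis using cubic_disc_at_root[of a b u] disc u by auto
qed

lemma sum_qchar_resultant2_root:
  assumes u: "u \<in> carrier R" "cubic u = \<zero>"
  shows "(\<Sum>w\<in>carrier R. qchar (resultant2 u w)) = 1 + (\<Sum>\<rho>\<in>carrier R. qchar (\<ominus> \<rho> \<otimes> cubic (u \<ominus> \<rho>)))"
proof -
  define slope where "slope = \<guillemotleft>3\<guillemotright> \<otimes> u \<otimes> u \<oplus> a"
  have slope: "slope \<in> carrier R" using u by (simp add: slope_def)
  have "resultant2 u w = w \<otimes> w \<otimes> (slope \<ominus> w)" if w: "w \<in> carrier R" for w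
  proof -
    have "resultant2 u w = slope \<otimes> w \<otimes> w \<ominus> w \<otimes> w \<otimes> w"
      using u w by (simp add: resultant2_def slope_def)
    also have "\<dots> = w \<otimes> w \<otimes> (slope \<ominus> w)"
      by (rule eqI_diff, use slope w in algebra) (use slope w in auto)
    finally show ?thesis .
  qed
  then have "(\<Sum>w\<in>carrier R. qchar (resultant2 u w)) = (\<Sum>w\<in>carrier R. qchar (w \<otimes> w \<otimes> (slope \<ominus> w)))"
    by simp
  also have "\<dots> = - qchar slope"
    using sum_qchar_square_mult[of "\<lambda>w. slope \<ominus> w"] slope sum_carrier_diff(2)[OF slope, of qchar]
    by (simp add: sum_qchar)
  finally have left: "(\<Sum>w\<in>carrier R. qchar (resultant2 u w)) = - qchar slope" .
  let ?quad = "\<lambda>r. r \<otimes> r \<oplus> \<ominus> (\<guillemotleft>3\<guillemotright> \<otimes> u) \<otimes> r \<oplus> slope"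
  have "\<ominus> (\<guillemotleft>3\<guillemotright> \<otimes> u) \<otimes> \<ominus> (\<guillemotleft>3\<guillemotright> \<otimes> u) \<ominus> \<guillemotleft>4\<guillemotright> \<otimes> slope \<noteq> \<zero>"
    unfolding slope_def tangent_quadratic_disc[OF ab(1) u(1)]
    using tangent_disc_nonzero[OF u] u(1) by simp
  then have sum_quad: "(\<Sum>r\<in>carrier R. qchar (?quad r)) = -1"
    using u slope by (intro sum_qchar_quadratic) auto
  have "\<ominus> r \<otimes> cubic (u \<ominus> r) = r \<otimes> r \<otimes> ?quad r" if "r \<in> carrier R" for r
    unfolding cubic_def slope_def using u that by (intro cubic_shift_root) (auto simp: cubic_def)
  then have "(\<Sum>\<rho>\<in>carrier R. qchar (\<ominus> \<rho> \<otimes> cubic (u \<ominus> \<rho>))) = (\<Sum>r\<in>carrier R. qchar (r \<otimes> r \<otimes> ?quad r))"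
    by simp
  also have "\<dots> = -1 - qchar slope" using sum_qchar_square_mult[of ?quad] u slope sum_quad by simp
  finally show ?thesis using left by simp
qed

lemma sum_qchar_resultant2: "(\<Sum>u\<in>carrier R. \<Sum>w\<in>carrier R. qchar (resultant2 u w)) = real (order R)"
proof -
  have "(\<Sum>u\<in>carrier R. \<Sum>\<rho>\<in>carrier R. qchar (\<ominus> \<rho> \<otimes> cubic (u \<ominus> \<rho>)))
     = (\<Sum>\<rho>\<in>carrier R. \<Sum>u\<in>carrier R. qchar (\<ominus> \<rho>) * qchar (cubic (u \<ominus> \<rho>)))"
    by (subst sum.swap) (intro sum.cong refl qchar_mult, auto)
  also have "\<dots> = (\<Sum>\<rho>\<in>carrier R. qchar (\<ominus> \<rho>) * (\<Sum>u\<in>carrier R. qchar (cubic u)))"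
    by (rule sum.cong) (simp_all add: sum_distrib_left [symmetric] sum_carrier_diff(1)[of _ "\<lambda>u. qchar (cubic u)"])
  also have "\<dots> = (\<Sum>\<rho>\<in>carrier R. qchar (\<ominus> \<rho>)) * (\<Sum>u\<in>carrier R. qchar (cubic u))"
    by (simp add: sum_distrib_right)
  also have "(\<Sum>\<rho>\<in>carrier R. qchar (\<ominus> \<rho>)) = (\<Sum>\<rho>\<in>carrier R. qchar \<rho>)"
    by (rule sum.reindex_bij_witness[of _ "\<lambda>u. \<ominus> u" "\<lambda>u. \<ominus> u"]) auto
  finally have "(\<Sum>u\<in>carrier R. \<Sum>\<rho>\<in>carrier R. qchar (\<ominus> \<rho> \<otimes> cubic (u \<ominus> \<rho>))) = 0"
    by (simp add: sum_qchar)
  moreover have "(\<Sum>w\<in>carrier R. qchar (resultant2 u w)) = 1 + (\<Sum>\<rho>\<in>carrier R. qchar (\<ominus> \<rho> \<otimes> cubic (u \<ominus> \<rho>)))"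
    if "u \<in> carrier R" for u
    using sum_qchar_resultant2_nonroot sum_qchar_resultant2_root that by blast
  ultimately show ?thesis by (simp add: sum.distrib order_def)
qed

end

section \<open>Extensions of finite fields\<close>

lemma (in ring_hom_ring) hom_of_natural: "h \<guillemotleft>n\<guillemotright>\<^sub>\<nat>\<^bsub>R\<^esub> = \<guillemotleft>n\<guillemotright>\<^sub>\<nat>\<^bsub>S\<^esub>"
  by (induction n) auto

lemma (in ring_hom_ring) hom_of_integer: "h \<guillemotleft>i\<guillemotright>\<^bsub>R\<^esub> = \<guillemotleft>i\<guillemotright>\<^bsub>S\<^esub>"
  by (simp add: of_integer_def hom_of_natural)

locale poly_eval_hom = field_polys R + L: field_polys L
  for R (structure) and L (structure) +
  fixes \<sigma> :: "'a \<Rightarrow> 'c"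
  assumes \<sigma>_hom: "\<sigma> \<in> ring_hom R L"
begin

sublocale S: ring_hom_ring R L \<sigma>
  by (rule ring_hom_ringI2) (auto simp: ring_axioms L.ring_axioms \<sigma>_hom)

abbreviation Lmult (infixl ":*" 70) where "u :* v \<equiv> u \<otimes>\<^bsub>L\<^esub> v"
abbreviation Ladd (infixl ":+" 65) where "u :+ v \<equiv> u \<oplus>\<^bsub>L\<^esub> v"
abbreviation Lsub (infixl ":-" 65) where "u :- v \<equiv> u \<ominus>\<^bsub>L\<^esub> v"
abbreviation Lneg (":~ _" [81] 80) where ":~ u \<equiv> \<ominus>\<^bsub>L\<^esub> u"
abbreviation Lpow (infixr ":^" 75) where "u :^ (n::nat) \<equiv> u [^]\<^bsub>L\<^esub> n"
abbreviation "zL \<equiv> \<zero>\<^bsub>L\<^esub>"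
abbreviation "oL \<equiv> \<one>\<^bsub>L\<^esub>"

lemma inj_on_\<sigma>: "inj_on \<sigma> (carrier R)"
proof (rule S.non_trivial_field_hom_imp_inj[OF field_axioms])
  have "\<sigma> \<one> \<noteq> zL" by simp
  then show "\<sigma> ` carrier R \<noteq> {zL}" using one_closed by blast
qed

lemma \<sigma>_nonzero: "x \<in> carrier R \<Longrightarrow> x \<noteq> \<zero> \<Longrightarrow> \<sigma> x \<noteq> zL"
  using inj_onD[OF inj_on_\<sigma>, of x \<zero>] S.hom_zero by auto

lemma power_char_\<sigma>: assumes "x \<in> carrier R" shows "power_char L n (\<sigma> x) = power_char R n x"
proof -
  have "\<sigma> x = zL \<longleftrightarrow> x = \<zero>" using assms \<sigma>_nonzero by auto
  moreover have "\<sigma> x :^ n = oL \<longleftrightarrow> x [^] n = \<one>"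
    using assms inj_onD[OF inj_on_\<sigma>, of "x [^] n" \<one>] by (auto simp flip: S.hom_nat_pow)
  ultimately show ?thesis by (simp add: power_char_def)
qed

definition ev :: "'c \<Rightarrow> 'a list \<Rightarrow> 'c" where "ev \<theta> p = L.eval (map \<sigma> p) \<theta>"

lemma map_\<sigma>_carrier: "set p \<subseteq> carrier R \<Longrightarrow> set (map \<sigma> p) \<subseteq> carrier L"
  by auto

lemma ev_closed: "\<theta> \<in> carrier L \<Longrightarrow> set p \<subseteq> carrier R \<Longrightarrow> ev \<theta> p \<in> carrier L"
  unfolding ev_def by (intro L.eval_in_carrier map_\<sigma>_carrier)

lemma ev_poly_closed: "\<theta> \<in> carrier L \<Longrightarrow> p \<in> kX \<Longrightarrow> ev \<theta> p \<in> carrier L"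
  using ev_closed poly_set_carrier by blast

lemma ev_hom:
  assumes \<theta>: "\<theta> \<in> carrier L" shows "ring_hom_ring (poly_ring R) L (ev \<theta>)"
proof (rule ring_hom_ringI2[OF UP.ring_axioms L.ring_axioms], rule ring_hom_memI)
  fix p r assume closed: "p \<in> kX" "r \<in> kX"
  note coeffs = closed[THEN poly_set_carrier]
  note mapped = coeffs[THEN map_\<sigma>_carrier]
  show "ev \<theta> p \<in> carrier L" using ev_closed[OF \<theta> coeffs(1)] .
  have "set (poly_mult p r) \<subseteq> carrier R" "set (poly_add p r) \<subseteq> carrier R"
    using poly_mult_in_carrier poly_add_in_carrier coeffs
    by (auto simp del: poly_add.simps poly_mult.simps)
  note results = this[THEN map_\<sigma>_carrier]
  show "ev \<theta> (p .* r) = ev \<theta> p :* ev \<theta> r"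
    unfolding ev_def univ_poly_mult
    using L.eval_normalize[OF results(1) \<theta>] S.poly_mult_hom'[OF coeffs] L.eval_poly_mult[OF mapped \<theta>] by simp
  show "ev \<theta> (p .+ r) = ev \<theta> p :+ ev \<theta> r"
    unfolding ev_def univ_poly_add
    using L.eval_normalize[OF results(2) \<theta>] S.poly_add_hom'[OF coeffs] L.eval_poly_add[OF mapped \<theta>] by simp
next
  show "ev \<theta> oP = oL" using \<theta> by (simp add: ev_def poly_one)
qed

lemma ev_mult: "\<theta> \<in> carrier L \<Longrightarrow> p \<in> kX \<Longrightarrow> r \<in> kX \<Longrightarrow> ev \<theta> (p .* r) = ev \<theta> p :* ev \<theta> r"
  using ring_hom_mult[OF ring_hom_ring.homh[OF ev_hom]] .

lemma ev_zero_iff: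
  assumes P: "P \<in> monic_irreds" and \<theta>: "\<theta> \<in> carrier L" "ev \<theta> P = zL" and p: "p \<in> kX"
  shows "ev \<theta> p = zL \<longleftrightarrow> P .| p"
proof -
  interpret E: ring_hom_ring "poly_ring R" L "ev \<theta>" by (rule ev_hom[OF \<theta>(1)])
  let ?K = "a_kernel (poly_ring R) L (ev \<theta>)"
  have kernel_iff: "x \<in> ?K \<longleftrightarrow> x \<in> kX \<and> ev \<theta> x = zL" for x
    unfolding a_kernel_def' by blast
  have "PIdl\<^bsub>poly_ring R\<^esub> P \<subseteq> ?K"
  proof
    fix x assume "x \<in> PIdl\<^bsub>poly_ring R\<^esub> P"
    then obtain y where "y \<in> kX" "x = y .* P" by (auto simp: cgenideal_def)
    then show "x \<in> ?K" using monic_irredD(2)[OF P] \<theta>(2) unfolding kernel_iff by simp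
  qed
  then have "?K = PIdl\<^bsub>poly_ring R\<^esub> P \<or> ?K = kX"
    using kernel_iff
    by (intro maximalideal.I_maximal[OF cgenideal_monic_irred(1)[OF P] E.kernel_is_ideal]) auto
  moreover have "oP \<notin> ?K" unfolding kernel_iff by simp
  ultimately have "?K = PIdl\<^bsub>poly_ring R\<^esub> P" using UP.one_closed by blast
  then show ?thesis using cgenideal_monic_irred(2)[OF P p] kernel_iff[of p] p by simp
qed

end

locale finite_field_extension = finite_field R + poly_eval_hom R L \<sigma>
  for R (structure) and L (structure) and \<sigma>
begin

abbreviation q :: nat where "q \<equiv> order R"

lemma \<sigma>_pow_q: "c \<in> carrier R \<Longrightarrow> \<sigma> c :^ q = \<sigma> c"
  using S.hom_nat_pow[of c q] pow_order[of c] by simp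

lemma frob_add_one:
  assumes \<theta>: "\<theta> \<in> carrier L" shows "(\<theta> :+ oL) :^ q = \<theta> :^ q :+ oL"
proof -
  interpret E: ring_hom_ring "poly_ring R" L "ev \<theta>" by (rule ev_hom[OF \<theta>])
  have closed: "[\<one>, \<one>] \<in> kX" "[\<one>, \<zero>] \<in> kX" "[\<one>] \<in> kX" by (auto simp: poly_carrier_iff)
  have ev_linear: "ev \<theta> [\<one>, \<one>] = \<theta> :+ oL" "ev \<theta> [\<one>, \<zero>] = \<theta>" "ev \<theta> [\<one>] = oL"
    using \<theta> by (auto simp: ev_def)
  have "ev \<theta> ([\<one>, \<one>] .^ q) = ev \<theta> ([\<one>, \<zero>] .^ q .+ [\<one>])" using var_plus_one_pow_order by simp
  then show ?thesis using closed ev_linear by (simp add: E.hom_nat_pow)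
qed

lemma frob_add:
  assumes u: "u \<in> carrier L" and v: "v \<in> carrier L"
  shows "(u :+ v) :^ q = u :^ q :+ v :^ q"
proof (cases "v = zL")
  case True
  then show ?thesis using u order_gt_1 by (simp add: L.nat_pow_zero)
next
  case False
  define t where "t = u :* inv\<^bsub>L\<^esub> v"
  have "inv\<^bsub>L\<^esub> v \<in> carrier L" "inv\<^bsub>L\<^esub> v :* v = oL" using v False by auto
  then have t: "t \<in> carrier L" "t :* v = u" using u v by (auto simp: t_def L.m_assoc)
  have "u :+ v = (t :+ oL) :* v" using t v by (simp add: L.l_distr)
  then have "(u :+ v) :^ q = (t :^ q :+ oL) :* v :^ q"
    using t v frob_add_one[OF t(1)] by (simp add: L.nat_pow_distrib)
  also have "\<dots> = (t :* v) :^ q :+ v :^ q"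
    using t(1) v by (simp add: L.nat_pow_distrib L.l_distr)
  finally show ?thesis by (simp add: t)
qed

lemma frob_inj:
  assumes u: "u \<in> carrier L" and v: "v \<in> carrier L" and frob_eq: "u :^ q = v :^ q"
  shows "u = v"
proof -
  have "v :^ q = (u :- v :+ v) :^ q" using u v frob_eq by (simp add: L.diff_add_cancel)
  also have "\<dots> = (u :- v) :^ q :+ v :^ q" by (rule frob_add) (use u v in auto)
  finally have "(u :- v) :^ q = zL" using u v by (simp add: L.add.r_cancel_one')
  then show ?thesis using u v by (simp add: L.nat_pow_eq_0_iff)
qed

lemma frob_ev:
  assumes \<theta>: "\<theta> \<in> carrier L" and "set p \<subseteq> carrier R"
  shows "ev \<theta> p :^ q = ev (\<theta> :^ q) p"
  using assms(2)
proof (induction p)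
  case Nil
  then show ?case using order_gt_1 by (simp add: ev_def L.nat_pow_zero)
next
  case (Cons c p)
  then have cp: "c \<in> carrier R" "set p \<subseteq> carrier R" by auto
  have ev_Cons: "ev \<eta> (c # p) = \<sigma> c :* \<eta> :^ length p :+ ev \<eta> p" for \<eta> by (simp add: ev_def)
  have "ev \<theta> (c # p) :^ q = (\<sigma> c :* \<theta> :^ length p) :^ q :+ ev \<theta> p :^ q"
    unfolding ev_Cons by (rule frob_add) (use \<theta> cp ev_closed[OF \<theta> cp(2)] in auto)
  also have "(\<sigma> c :* \<theta> :^ length p) :^ q = \<sigma> c :* (\<theta> :^ q) :^ length p"
    using \<theta> cp \<sigma>_pow_q[OF cp(1)] by (simp add: L.nat_pow_distrib L.nat_pow_pow mult.commute)
  finally show ?case using Cons.IH[OF cp(2)] unfolding ev_Cons by simp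
qed

lemma pow_q_Suc: "u \<in> carrier L \<Longrightarrow> u :^ (q ^ Suc i) = (u :^ (q ^ i)) :^ q"
  by (simp add: L.nat_pow_pow mult.commute)

lemma frob_ev_pow:
  assumes "\<theta> \<in> carrier L" "set p \<subseteq> carrier R"
  shows "ev \<theta> p :^ (q ^ i) = ev (\<theta> :^ (q ^ i)) p"
proof (induction i)
  case 0
  then show ?case using ev_closed[OF assms] assms by simp
next
  case (Suc i)
  then show ?case using ev_closed[OF assms] assms frob_ev[of "\<theta> :^ (q ^ i)" p]
    by (simp only: pow_q_Suc L.nat_pow_closed)
qed

lemma frob_pow_inj:
  assumes "u \<in> carrier L" "v \<in> carrier L" "u :^ (q ^ i) = v :^ (q ^ i)" shows "u = v"
  using assms(3)
proof (induction i)
  case 0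
  then show ?case using assms by simp
next
  case (Suc i)
  then show ?case using frob_inj[of "u :^ (q ^ i)" "v :^ (q ^ i)"] assms
    by (simp only: pow_q_Suc L.nat_pow_closed)
qed

lemma card_frob_fixed:
  assumes "i > 0"
  shows "finite {u \<in> carrier L. u :^ (q ^ i) = u}" "card {u \<in> carrier L. u :^ (q ^ i) = u} \<le> q ^ i"
proof -
  let ?n = "q ^ i" and ?X = "[oL, zL]"
  define p where "p = ?X [^]\<^bsub>poly_ring L\<^esub> ?n"
  have X: "?X \<in> L.monics_deg 1" "[:~ oL, zL] \<in> carrier (poly_ring L)"
    by (auto simp: L.monics_deg_def L.monics_def L.poly_carrier_iff)
  have p: "p \<in> L.monics_deg ?n" using L.monics_deg_pow[OF X(1), of ?n] by (simp add: p_def)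
  have "?n > 1" using order_gt_1 assms by (rule one_less_power)
  then have monic: "p \<oplus>\<^bsub>poly_ring L\<^esub> [:~ oL, zL] \<in> L.monics_deg ?n"
    using X by (intro L.monics_deg_add[OF p]) auto
  have "L.eval (p \<oplus>\<^bsub>poly_ring L\<^esub> [:~ oL, zL]) u = u :^ ?n :- u" if u: "u \<in> carrier L" for u
  proof -
    interpret E: ring_hom_ring "poly_ring L" L "\<lambda>p. L.eval p u" by (rule L.eval_poly_hom[OF u])
    have "L.eval p u = u :^ ?n"
      unfolding p_def using E.hom_nat_pow[of ?X ?n] X(1) u by (simp add: L.monics_degD(2))
    then show ?thesis using p X u by (simp add: L.monics_degD(2) a_minus_def L.l_minus)
  qed
  then have "{u \<in> carrier L. u :^ ?n = u} = {u \<in> carrier L. L.eval (p \<oplus>\<^bsub>poly_ring L\<^esub> [:~ oL, zL]) u = zL}"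
    by auto
  then show "finite {u \<in> carrier L. u :^ ?n = u}" "card {u \<in> carrier L. u :^ ?n = u} \<le> ?n"
    using L.card_roots_le[OF L.monics_degD(2,3)[OF monic]] L.monics_degD(5)[OF monic] by simp_all
qed

abbreviation adjoin :: "'c \<Rightarrow> ('c, 'd) ring_scheme" where "adjoin \<theta> \<equiv> L\<lparr>carrier := ev \<theta> ` kX\<rparr>"

context
  fixes P \<theta>
  assumes P: "P \<in> monic_irreds" and \<theta>: "\<theta> \<in> carrier L" "ev \<theta> P = zL"
begin

lemma ev_eq_iff:
  assumes "p \<in> kX" "r \<in> kX" shows "ev \<theta> p = ev \<theta> r \<longleftrightarrow> P .| (p .- r)"
proof -
  interpret E: ring_hom_ring "poly_ring R" L "ev \<theta>" by (rule ev_hom[OF \<theta>(1)])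
  have "ev \<theta> (p .- r) = ev \<theta> p :- ev \<theta> r" using assms by (simp add: a_minus_def)
  then show ?thesis using ev_zero_iff[OF P \<theta>, of "p .- r"] assms by (simp add: E.hom_closed)
qed

lemma bij_betw_ev_polys_below: "bij_betw (ev \<theta>) (polys_below (degree P)) (carrier (adjoin \<theta>))"
proof (rule bij_betw_imageI)
  have P_deg: "P \<in> monics_deg (degree P)" using monic_irredD(1)[OF P] by (simp add: monics_deg_def)
  show "inj_on (ev \<theta>) (polys_below (degree P))"
    by (rule inj_onI) (simp add: ev_eq_iff polys_below_carrier polys_below_unique[OF P_deg])
  have "ev \<theta> p \<in> ev \<theta> ` polys_below (degree P)" if p: "p \<in> kX" for p
  proof -
    obtain r where "r \<in> polys_below (degree P)" "P .| (p .- r)"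
      using polys_below_exists[OF P_deg p] .
    then show ?thesis using ev_eq_iff[OF p] polys_below_carrier by blast
  qed
  then show "ev \<theta> ` polys_below (degree P) = carrier (adjoin \<theta>)" using polys_below_carrier by auto
qed

lemma finite_field_adjoin: "finite_field (adjoin \<theta>)" and order_adjoin: "order (adjoin \<theta>) = q ^ degree P"
proof -
  interpret E: ring_hom_ring "poly_ring R" L "ev \<theta>" by (rule ev_hom[OF \<theta>(1)])
  have finite: "finite (carrier (adjoin \<theta>))"
    using bij_betw_finite[OF bij_betw_ev_polys_below] card_polys_below by blast
  interpret K: domain "adjoin \<theta>"
    using L.subring_is_domain[OF E.img_is_subring[OF UP.carrier_is_subring]] .
  show "finite_field (adjoin \<theta>)"
    using K.finite_domain_is_field finite
    by (simp add: finite_field_def field_polys_def finite_field_axioms_def)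
  show "order (adjoin \<theta>) = q ^ degree P"
    using bij_betw_same_card[OF bij_betw_ev_polys_below] by (simp only: card_polys_below order_def)
qed

lemma frob_root: "ev (\<theta> :^ (q ^ i)) P = zL"
  using frob_ev_pow[OF \<theta>(1) poly_set_carrier[OF monic_irredD(2)[OF P]], of i] \<theta>(2) order_gt_1
  by (simp add: L.nat_pow_zero)

lemma frob_degree: "\<theta> :^ (q ^ degree P) = \<theta>"
proof -
  interpret K: finite_field "adjoin \<theta>" by (rule finite_field_adjoin)
  have "ev \<theta> [\<one>, \<zero>] = \<theta>" using \<theta> by (simp add: ev_def)
  then have "\<theta> \<in> carrier (adjoin \<theta>)"
    using image_eqI[of \<theta> "ev \<theta>" "[\<one>, \<zero>]" kX] by (simp add: poly_carrier_iff)
  then have "\<theta> [^]\<^bsub>adjoin \<theta>\<^esub> order (adjoin \<theta>) = \<theta>" by (rule K.pow_order)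
  then show ?thesis using order_adjoin by (simp add: nat_pow_def)
qed

lemma inj_on_frob_orbit: "inj_on (\<lambda>i. \<theta> :^ (q ^ i)) {..<degree P}"
proof (rule linorder_inj_onI', rule notI)
  fix i j assume ij: "j \<in> {..<degree P}" "i < j" and orbit_eq: "\<theta> :^ (q ^ i) = \<theta> :^ (q ^ j)"
  let ?U = "{u \<in> carrier L. u :^ (q ^ (j - i)) = u}"
  have "(\<theta> :^ (q ^ (j - i))) :^ (q ^ i) = \<theta> :^ (q ^ i)"
    using ij orbit_eq \<theta> by (simp add: L.nat_pow_pow flip: power_add)
  then have fixed: "\<theta> :^ (q ^ (j - i)) = \<theta>"
    using frob_pow_inj[of "\<theta> :^ (q ^ (j - i))" \<theta> i] \<theta> by simp
  have "ev \<theta> p \<in> ?U" if "p \<in> kX" for p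
    using frob_ev_pow[OF \<theta>(1) poly_set_carrier[OF that], of "j - i"] ev_poly_closed[OF \<theta>(1) that] fixed by simp
  then have "card (carrier (adjoin \<theta>)) \<le> card ?U"
    using card_frob_fixed(1)[of "j - i"] ij by (intro card_mono) auto
  then have "q ^ degree P \<le> q ^ (j - i)"
    using card_frob_fixed(2)[of "j - i"] ij order_adjoin by (simp add: order_def)
  then show False using ij order_gt_1 power_le_imp_le_exp[of q "degree P" "j - i"] by simp
qed

lemma ev_eq_prod_frob_orbit:
  assumes T: "T \<in> carrier L"
  shows "ev T P = (\<Otimes>\<^bsub>L\<^esub>i\<in>{..<degree P}. T :- \<theta> :^ (q ^ i))"
proof -
  let ?orbit = "\<lambda>i. \<theta> :^ (q ^ i)"
  have monic: "map \<sigma> P \<in> L.monics"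
    using monicsD[OF monic_irredD(1)[OF P]] poly_set_carrier[OF monic_irredD(2)[OF P]]
    by (auto simp: L.monics_def L.poly_carrier_iff hd_map)
  have "L.eval (map \<sigma> P) T = (\<Otimes>\<^bsub>L\<^esub>x\<in>?orbit ` {..<degree P}. T :- x)"
    by (rule L.eval_eq_prod_roots[OF monic _ _ _ _ T])
       (use card_image[OF inj_on_frob_orbit] frob_root \<theta> in \<open>auto simp: ev_def\<close>)
  also have "\<dots> = (\<Otimes>\<^bsub>L\<^esub>i\<in>{..<degree P}. T :- ?orbit i)"
    by (rule L.finprod_reindex[OF _ inj_on_frob_orbit]) (use \<theta> T in auto)
  finally show ?thesis by (simp add: ev_def)
qed

end

end

locale finite_field_closure = finite_field_extension R L \<sigma>
  for R (structure) and L (structure) and \<sigma> +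
  assumes alg_closed: "p \<in> carrier (poly_ring L) \<Longrightarrow> degree p > 0 \<Longrightarrow> \<exists>x\<in>carrier L. ring.eval L p x = \<zero>\<^bsub>L\<^esub>"
begin

lemma monic_irred_root:
  assumes "P \<in> monic_irreds" obtains \<theta> where "\<theta> \<in> carrier L" "ev \<theta> P = zL"
proof -
  note P = monic_irredD[OF assms]
  have "map \<sigma> P \<in> L.monics"
    using monicsD[OF P(1)] poly_set_carrier[OF P(2)]
    by (auto simp: L.monics_def L.poly_carrier_iff hd_map)
  then have "\<exists>x\<in>carrier L. L.eval (map \<sigma> P) x = zL"
    using alg_closed[of "map \<sigma> P"] P(3) L.monicsD(1) by simp
  then show ?thesis using that by (auto simp: ev_def)
qed

definition zeros :: "'a list \<Rightarrow> 'c set" where "zeros P = {x \<in> carrier L. ev x P = zL}"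

lemma zeros_subset_frob_fixed: "P \<in> monic_irreds \<Longrightarrow> zeros P \<subseteq> {u \<in> carrier L. u :^ (q ^ degree P) = u}"
  using frob_degree by (auto simp: zeros_def)

lemma finite_zeros: "P \<in> monic_irreds \<Longrightarrow> finite (zeros P)"
  using zeros_subset_frob_fixed card_frob_fixed(1)[OF monic_irredD(3)] by (rule finite_subset)

lemma degree_le_card_zeros:
  assumes P: "P \<in> monic_irreds" shows "degree P \<le> card (zeros P)"
proof -
  obtain \<theta> where \<theta>: "\<theta> \<in> carrier L" "ev \<theta> P = zL" using monic_irred_root[OF P] .
  have "card ((\<lambda>i. \<theta> :^ (q ^ i)) ` {..<degree P}) \<le> card (zeros P)"
    by (rule card_mono[OF finite_zeros[OF P]]) (use frob_root[OF P \<theta>] \<theta> in \<open>auto simp: zeros_def\<close>)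
  then show ?thesis using card_image[OF inj_on_frob_orbit[OF P \<theta>]] by simp
qed

lemma disjoint_zeros:
  assumes "P \<in> monic_irreds" "Q \<in> monic_irreds" "P \<noteq> Q" shows "zeros P \<inter> zeros Q = {}"
proof (rule equals0I)
  fix x assume "x \<in> zeros P \<inter> zeros Q"
  then have "P .| Q" using ev_zero_iff[OF assms(1) _ _ monic_irredD(2)[OF assms(2)], of x]
    by (simp add: zeros_def)
  then show False using monic_irred_divides_eq[OF assms(1,2)] assms(3) by simp
qed

lemma card_monic_irreds_degree:
  assumes "n > 0" shows "card {P \<in> monic_irreds. degree P = n} * n \<le> q ^ n"
proof -
  let ?I = "{P \<in> monic_irreds. degree P = n}" and ?U = "{u \<in> carrier L. u :^ (q ^ n) = u}"
  have finite_I: "finite ?I"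
    by (rule finite_subset[OF _ finite_monics_deg[of n]]) (auto simp: monics_deg_def monic_irreds_def)
  have "card ?I * n = (\<Sum>P\<in>?I. n)" by simp
  also have "\<dots> \<le> (\<Sum>P\<in>?I. card (zeros P))" by (rule sum_mono) (use degree_le_card_zeros in auto)
  also have "\<dots> = card (\<Union>P\<in>?I. zeros P)"
    by (rule card_UN_disjoint [symmetric]) (use finite_I finite_zeros disjoint_zeros in auto)
  also have "\<dots> \<le> card ?U"
    by (rule card_mono[OF card_frob_fixed(1)[OF assms]]) (use zeros_subset_frob_fixed in blast)
  also have "\<dots> \<le> q ^ n" by (rule card_frob_fixed(2)[OF assms])
  finally show ?thesis .
qed

end

context finite_field
begin

lemma finite_field_closure_alg_closure: "finite_field_closure R alg_closure indexed_const"
proof -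
  interpret C: algebraic_closure alg_closure "indexed_const ` carrier R" by (rule alg_closureE(1))
  have "\<exists>x\<in>carrier alg_closure. C.eval p x = \<zero>\<^bsub>alg_closure\<^esub>"
    if p: "p \<in> carrier (poly_ring alg_closure)" "degree p > 0" for p
  proof -
    have "size (C.roots p) > 0" using C.roots_over_carrier[OF p(1)] p(2)
      by (simp add: C.splitted_def)
    then obtain x where "x \<in># C.roots p" by (metis nonempty_has_size multiset_nonemptyE)
    then show ?thesis using C.roots_mem_iff_is_root[OF p(1)] by (auto simp: C.is_root_def)
  qed
  then show ?thesis
    by (intro finite_field_closure.intro finite_field_extension.intro finite_field_axioms poly_eval_hom.intro
        poly_eval_hom_axioms.intro field_polys_axioms finite_field_closure_axioms.intro field_polys.intro
        C.field_axioms alg_closureE(2))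
qed

lemma card_monic_irreds_degree: "n > 0 \<Longrightarrow> card {P \<in> monic_irreds. degree P = n} * n \<le> order R ^ n"
  by (rule finite_field_closure.card_monic_irreds_degree[OF finite_field_closure_alg_closure])

end

section \<open>The quadratic character of the curve\<close>

lemma (in comm_monoid) finprod_pow_sum:
  assumes "x \<in> carrier G" "finite I" shows "(\<Otimes>i\<in>I. x [^] (f i :: nat)) = x [^] (\<Sum>i\<in>I. f i)"
  using assms(2)
proof (induction I rule: finite_induct)
  case (insert i I)
  then show ?case using assms(1) by (subst finprod_insert) (auto simp: nat_pow_mult)
qed simp

lemma geometric_sum_nat: "(\<Sum>i<d. (m + 1) ^ i) * m + 1 = (m + 1 :: nat) ^ d"
  by (induction d) (auto simp: algebra_simps)

context curve_field
begin

abbreviation "cubic_poly \<equiv> [\<one>, \<zero>, a, b]"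

lemma cubic_poly_monic: "cubic_poly \<in> monics_deg 3" and cubic_poly_carrier [simp]: "cubic_poly \<in> kX"
  by (simp_all add: monics_deg_def monics_def poly_carrier_iff)

definition cubic_sqrts :: "'a list \<Rightarrow> 'a list set" where
  "cubic_sqrts P = {s \<in> polys_below (degree P). P .| (s .* s .- cubic_poly)}"

lemma finite_cubic_sqrts: "finite (cubic_sqrts P)"
  using card_polys_below(1)[of "degree P"] by (auto simp: cubic_sqrts_def)

end

locale curve_character = curve_field R a b for R (structure) and a b +
  fixes \<chi> :: "'a list \<Rightarrow> real"
  assumes char_one: "\<chi> [\<one>] = 1"
    and char_mult: "g \<in> monics \<Longrightarrow> h \<in> monics \<Longrightarrow> \<chi> (g .* h) = \<chi> g * \<chi> h"
    and char_range: "\<chi> g \<in> {-1, 0, 1}"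
    and card_cubic_sqrts: "P \<in> monic_irreds \<Longrightarrow> real (card (cubic_sqrts P)) = 1 + \<chi> P"
    and sum_char_1: "(\<Sum>g\<in>monics_deg 1. \<chi> g) = (\<Sum>x\<in>carrier R. qchar (cubic x))"
    and sum_char_2: "(\<Sum>g\<in>monics_deg 2. \<chi> g) = real (order R)"
    and sum_char_ge_3: "n \<ge> 3 \<Longrightarrow> (\<Sum>g\<in>monics_deg n. \<chi> g) = 0"

locale curve_closure = curve_field R a b + finite_field_closure R L \<sigma>
  for R (structure) and a b and L (structure) and \<sigma>

locale curve_split = curve_closure R a b L \<sigma>
  for R (structure) and a b and L (structure) and \<sigma> +
  fixes r s t
  assumes rst [simp]: "r \<in> carrier L" "s \<in> carrier L" "t \<in> carrier L"
    and distinct: "r \<noteq> s" "r \<noteq> t" "s \<noteq> t"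
    and a_eq: "\<sigma> a = \<ominus>\<^bsub>L\<^esub> (r \<otimes>\<^bsub>L\<^esub> r \<oplus>\<^bsub>L\<^esub> r \<otimes>\<^bsub>L\<^esub> s \<oplus>\<^bsub>L\<^esub> s \<otimes>\<^bsub>L\<^esub> s)"
    and b_eq: "\<sigma> b = r \<otimes>\<^bsub>L\<^esub> s \<otimes>\<^bsub>L\<^esub> (r \<oplus>\<^bsub>L\<^esub> s)"
    and t_eq: "t = \<ominus>\<^bsub>L\<^esub> (r \<oplus>\<^bsub>L\<^esub> s)"
begin

definition cubic_L where "cubic_L T = T :^ (3::nat) :+ \<sigma> a :* T :+ \<sigma> b"

lemma cubic_L_closed: "T \<in> carrier L \<Longrightarrow> cubic_L T \<in> carrier L" by (simp add: cubic_L_def)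

lemma cubic_L_split: "T \<in> carrier L \<Longrightarrow> cubic_L T = (T :- r) :* (T :- s) :* (T :- t)"
  unfolding cubic_L_def t_eq by (rule L.cubic_split[OF _ _ _ _ _ a_eq b_eq]) auto

lemma cubic_L_flip: "T \<in> carrier L \<Longrightarrow> (r :- T) :* (s :- T) :* (t :- T) = :~ oL :* cubic_L T"
  unfolding cubic_L_split by (rule L.triple_flip[OF rst])

lemma ev_cubic_poly: "T \<in> carrier L \<Longrightarrow> ev T cubic_poly = cubic_L T"
  by (simp add: ev_def cubic_L_def L.a_assoc numeral_3_eq_3)

lemma cubic_L_\<sigma>: "x \<in> carrier R \<Longrightarrow> cubic_L (\<sigma> x) = \<sigma> (cubic x)"
  by (simp add: cubic_L_def cubic_def S.hom_nat_pow)

lemma cubic_L_roots: "cubic_L r = zL" "cubic_L s = zL" "cubic_L t = zL"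
  by (simp_all add: cubic_L_split a_minus_def L.r_neg)

lemma cubic_L_zero: "T \<in> carrier L \<Longrightarrow> cubic_L T = zL \<Longrightarrow> T \<in> {r, s, t}"
  by (auto simp: cubic_L_split L.integral_iff)

lemma cubic_L_frob:
  assumes "T \<in> carrier L" shows "cubic_L T :^ (q ^ i) = cubic_L (T :^ (q ^ i))"
  using frob_ev_pow[OF assms poly_set_carrier[OF cubic_poly_carrier], of i] assms
  by (simp only: ev_cubic_poly L.nat_pow_closed)

text \<open>The sign turns \<open>g(r) g(s) g(t)\<close> into the product of the values of the cubic at the zeros of \<open>g\<close>.\<close>

definition cubic_resultant :: "'a list \<Rightarrow> 'c" where
  "cubic_resultant g = (:~ oL) :^ degree g :* (ev r g :* ev s g :* ev t g)"

definition cubic_char :: "'a list \<Rightarrow> real" where "cubic_char g = power_char L half_order (cubic_resultant g)"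

lemma cubic_char_range: "cubic_char g \<in> {-1, 0, 1}" by (simp add: cubic_char_def power_char_def)

lemma cubic_resultant_closed: "g \<in> kX \<Longrightarrow> cubic_resultant g \<in> carrier L"
  by (simp add: cubic_resultant_def ev_poly_closed)

lemma frob_permutes_roots: "(\<lambda>x. x :^ q) ` {r, s, t} = {r, s, t}"
proof (rule endo_inj_surj)
  have "x :^ q \<in> {r, s, t}" if "x \<in> carrier L" "cubic_L x = zL" for x
    using cubic_L_frob[OF that(1), of 1] that order_gt_1
    by (intro cubic_L_zero) (simp_all add: L.nat_pow_zero)
  then show "(\<lambda>x. x :^ q) ` {r, s, t} \<subseteq> {r, s, t}" using cubic_L_roots by auto
qed (auto intro!: inj_onI intro: frob_inj)

lemma minus_one_pow_frob: "((:~ oL) :^ (n::nat)) :^ q = (:~ oL) :^ n"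
proof -
  have "(:~ oL) :^ q = :~ oL" using \<sigma>_pow_q[of "\<ominus> \<one>"] by simp
  then have "((:~ oL) :^ q) :^ n = (:~ oL) :^ n" by simp
  then show ?thesis by (simp add: L.nat_pow_pow mult.commute)
qed

lemma cubic_resultant_frob:
  assumes g: "g \<in> kX" shows "cubic_resultant g :^ q = cubic_resultant g"
proof -
  let ?G = "\<lambda>x. ev x g"
  have closed: "ev x g \<in> carrier L" if "x \<in> carrier L" for x using ev_poly_closed[OF that g] .
  have three: "finprod L H {r, s, t} = H r :* (H s :* H t)" if "H \<in> carrier L \<rightarrow> carrier L" for H
    using that distinct rst by (subst L.finprod_insert; simp add: Pi_iff)+
  have "finprod L (\<lambda>x. ?G (x :^ q)) {r, s, t} = finprod L ?G ((\<lambda>x. x :^ q) ` {r, s, t})"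
    by (rule L.finprod_reindex [symmetric]) (auto intro!: inj_onI intro: frob_inj closed)
  also have "\<dots> = finprod L ?G {r, s, t}" by (simp only: frob_permutes_roots)
  finally have permuted: "ev (r :^ q) g :* (ev (s :^ q) g :* ev (t :^ q) g) = ev r g :* (ev s g :* ev t g)"
    using three[of ?G] three[of "\<lambda>x. ?G (x :^ q)"] closed by (simp add: Pi_iff)
  have "cubic_resultant g :^ q = (:~ oL) :^ degree g :* (ev r g :^ q :* (ev s g :^ q :* ev t g :^ q))"
    unfolding cubic_resultant_def using closed minus_one_pow_frob[of "degree g"]
    by (simp add: L.nat_pow_distrib L.m_assoc)
  also have "\<dots> = cubic_resultant g"
    unfolding cubic_resultant_def using closed permuted
    by (simp add: frob_ev poly_set_carrier[OF g] L.m_assoc)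
  finally show ?thesis .
qed

lemma cubic_resultant_pow:
  assumes g: "g \<in> kX" "cubic_resultant g \<noteq> zL" shows "cubic_resultant g :^ (2 * half_order) = oL"
proof -
  have "cubic_resultant g :^ (2 * half_order) :* cubic_resultant g = oL :* cubic_resultant g"
    using cubic_resultant_frob[OF g(1)] cubic_resultant_closed[OF g(1)] by (simp add: order_eq)
  then show ?thesis using cubic_resultant_closed[OF g(1)] g(2) by (subst (asm) L.m_rcancel) auto
qed

lemma cubic_resultant_mult:
  assumes "g \<in> monics" "h \<in> monics"
  shows "cubic_resultant (g .* h) = cubic_resultant g :* cubic_resultant h"
proof -
  note gh = assms[THEN monicsD(1)]
  have closed: "ev x g \<in> carrier L" "ev x h \<in> carrier L" if "x \<in> carrier L" for x
    using ev_poly_closed that gh by auto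
  define m1 where "m1 = :~ oL"
  have m1: "m1 \<in> carrier L" by (simp add: m1_def)
  have "cubic_resultant (g .* h) = (m1 :^ degree g :* m1 :^ degree h) :*
     ((ev r g :* ev r h) :* (ev s g :* ev s h) :* (ev t g :* ev t h))"
    unfolding cubic_resultant_def monic_degree_mult[OF assms] m1_def [symmetric]
    using m1 gh by (simp add: ev_mult L.nat_pow_mult)
  also have "\<dots> = cubic_resultant g :* cubic_resultant h"
    unfolding cubic_resultant_def m1_def [symmetric] using closed m1 by (simp add: L.m_ac)
  finally show ?thesis .
qed

lemma cubic_char_mult: "g \<in> monics \<Longrightarrow> h \<in> monics \<Longrightarrow> cubic_char (g .* h) = cubic_char g * cubic_char h"
  unfolding cubic_char_def cubic_resultant_mult
  by (rule L.power_char_mult) (use monicsD(1) cubic_resultant_closed cubic_resultant_pow in auto)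

lemma cubic_char_one: "cubic_char [\<one>] = 1"
  by (simp add: cubic_char_def cubic_resultant_def ev_def power_char_def)

lemma cubic_char_scale_remainder:
  assumes h: "h \<in> kX" and p: "p \<in> kX" and c: "c \<in> carrier R" "c \<noteq> \<zero>"
    and deg: "degree (cubic_poly .* h .+ [c] .* p) = degree (cubic_poly .* h .+ p)"
  shows "cubic_char (cubic_poly .* h .+ [c] .* p) = qchar c * cubic_char (cubic_poly .* h .+ p)"
proof -
  let ?g = "cubic_poly .* h .+ p" and ?g' = "cubic_poly .* h .+ [c] .* p"
  have const: "[c] \<in> kX" using c by (auto simp: poly_carrier_iff)
  have g: "?g \<in> kX" using h p by simp
  have ev_g': "ev x ?g' = \<sigma> c :* ev x ?g" if "x \<in> carrier L" "cubic_L x = zL" for x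
  proof -
    interpret E: ring_hom_ring "poly_ring R" L "ev x" by (rule ev_hom[OF that(1)])
    have "ev x cubic_poly = zL" "ev x [c] = \<sigma> c" using that ev_cubic_poly c by (auto simp: ev_def)
    then show ?thesis using h p const c by simp
  qed
  note roots = ev_g'[OF rst(1) cubic_L_roots(1)] ev_g'[OF rst(2) cubic_L_roots(2)] ev_g'[OF rst(3) cubic_L_roots(3)]
  have closed: "\<sigma> c \<in> carrier L" "(:~ oL) :^ degree ?g \<in> carrier L" "ev x ?g \<in> carrier L"
    if "x \<in> carrier L" for x
    using c ev_poly_closed[OF that g] by simp_all
  have "cubic_resultant ?g' = \<sigma> (c \<otimes> (c \<otimes> c)) :* cubic_resultant ?g"
    unfolding cubic_resultant_def deg roots using closed c by (simp add: L.m_ac)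
  then have "cubic_char ?g' = power_char L half_order (\<sigma> (c \<otimes> (c \<otimes> c))) * cubic_char ?g"
    unfolding cubic_char_def
    using cubic_resultant_closed[OF g] cubic_resultant_pow[OF g] c pow_twice_half_order[of "c \<otimes> (c \<otimes> c)"]
    by (simp only:, intro L.power_char_mult) (auto simp: integral_iff simp flip: S.hom_nat_pow S.hom_mult)
  also have "power_char L half_order (\<sigma> (c \<otimes> (c \<otimes> c))) = qchar c"
    using c qchar_mult qchar_times_self[OF c] by (simp add: power_char_\<sigma> del: S.hom_mult)
  finally show ?thesis .
qed

lemma sum_cubic_char_ge_3:
  assumes "n \<ge> 3" shows "(\<Sum>g\<in>monics_deg n. cubic_char g) = 0"
proof -
  obtain c where c: "c \<in> carrier R" "qchar c = -1" "c \<noteq> \<zero>"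
    using exists_nonresidue qchar_zero by force
  note division = bij_betw_monic_division[OF cubic_poly_monic assms]
  note scaling = bij_betw_const_mult_polys_below[OF c(1,3), of 3]
  have "(\<Sum>p\<in>polys_below 3. cubic_char (cubic_poly .* h .+ p)) = 0" if h: "h \<in> monics_deg (n - 3)" for h
  proof -
    have deg: "degree (cubic_poly .* h .+ p) = n" if "p \<in> polys_below 3" for p
      using bij_betwE[OF division] h that monics_degD(5) by fastforce
    have "(\<Sum>p\<in>polys_below 3. cubic_char (cubic_poly .* h .+ p))
        = (\<Sum>p\<in>polys_below 3. cubic_char (cubic_poly .* h .+ [c] .* p))"
      using sum.reindex_bij_betw[OF scaling, of "\<lambda>p. cubic_char (cubic_poly .* h .+ p)"] by simp
    also have "\<dots> = (\<Sum>p\<in>polys_below 3. - cubic_char (cubic_poly .* h .+ p))"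
    proof (rule sum.cong[OF refl])
      fix p assume p: "p \<in> polys_below 3"
      then have "[c] .* p \<in> polys_below 3" using bij_betwE[OF scaling] by blast
      then show "cubic_char (cubic_poly .* h .+ [c] .* p) = - cubic_char (cubic_poly .* h .+ p)"
        using cubic_char_scale_remainder[OF monics_degD(2)[OF h] polys_below_carrier[OF p] c(1,3)] p c(2) deg by simp
    qed
    finally show ?thesis by (simp add: sum_negf)
  qed
  then have "(\<Sum>h\<in>monics_deg (n - 3). \<Sum>p\<in>polys_below 3. cubic_char (cubic_poly .* h .+ p)) = 0"
    by simp
  then show ?thesis
    using sum.reindex_bij_betw[OF division, of cubic_char]
    by (simp add: sum.cartesian_product case_prod_unfold)
qed

lemma cubic_char_linear:
  assumes x: "x \<in> carrier R" shows "cubic_char [\<one>, \<ominus> x] = qchar (cubic x)"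
proof -
  have "cubic_resultant [\<one>, \<ominus> x] = :~ oL :* ((r :- \<sigma> x) :* (s :- \<sigma> x) :* (t :- \<sigma> x))"
    using x by (simp add: cubic_resultant_def ev_def a_minus_def)
  also have "\<dots> = cubic_L (\<sigma> x)" using x cubic_L_closed[of "\<sigma> x"]
    by (simp add: cubic_L_flip L.l_minus L.r_minus)
  finally show ?thesis using x by (simp add: cubic_char_def cubic_L_\<sigma> power_char_\<sigma>)
qed

lemma sum_cubic_char_1: "(\<Sum>g\<in>monics_deg 1. cubic_char g) = (\<Sum>x\<in>carrier R. qchar (cubic x))"
proof (rule sum.reindex_bij_witness[of _ "\<lambda>x. [\<one>, \<ominus> x]" "\<lambda>g. \<ominus> (g ! 1)"])
  fix g assume "g \<in> monics_deg 1"
  then obtain e where e: "e \<in> carrier R" "g = [\<one>, e]" by (rule monics_deg_1E)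
  then show "[\<one>, \<ominus> (\<ominus> (g ! 1))] = g" "\<ominus> (g ! 1) \<in> carrier R" "qchar (cubic (\<ominus> (g ! 1))) = cubic_char g"
    using cubic_char_linear[of "\<ominus> e"] by simp_all
qed (auto intro: linear_in_monics_deg simp del: One_nat_def)

lemma cubic_char_quadratic:
  assumes uw: "u \<in> carrier R" "w \<in> carrier R"
  shows "cubic_char [\<one>, u, a \<oplus> u \<otimes> u \<ominus> w] = qchar (resultant2 u w)"
proof -
  let ?v = "a \<oplus> u \<otimes> u \<ominus> w"
  have "ev x [\<one>, u, ?v] = x :* x :+ \<sigma> u :* x :+ \<sigma> ?v" if "x \<in> carrier L" for x
    using that uw by (simp add: ev_def L.power2_eq_square numeral_2_eq_2 [symmetric] L.a_assoc)
  moreover have "(:~ oL) :^ degree [\<one>, u, ?v] = oL" by (simp add: L.l_minus L.r_minus)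
  ultimately have "cubic_resultant [\<one>, u, ?v] = (r :* r :+ \<sigma> u :* r :+ \<sigma> ?v) :* (s :* s :+ \<sigma> u :* s :+ \<sigma> ?v)
      :* (t :* t :+ \<sigma> u :* t :+ \<sigma> ?v)"
    using uw unfolding cubic_resultant_def by simp
  also have "\<dots> = \<sigma> (cubic u) :* \<sigma> (cubic u) :- \<guillemotleft>3\<guillemotright>\<^bsub>L\<^esub> :* \<sigma> u :* \<sigma> (cubic u) :* \<sigma> w
      :+ (\<guillemotleft>3\<guillemotright>\<^bsub>L\<^esub> :* \<sigma> u :* \<sigma> u :+ \<sigma> a) :* \<sigma> w :* \<sigma> w :- \<sigma> w :* \<sigma> w :* \<sigma> w"
    by (rule L.cubic_quadratic_resultant[OF _ _ _ _ _ _ _ _ _ a_eq b_eq _ t_eq])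
       (use uw cubic_L_\<sigma>[OF uw(1)] in \<open>auto simp: cubic_L_def a_minus_def\<close>)
  also have "\<dots> = \<sigma> (resultant2 u w)" using uw
    by (simp add: resultant2_def a_minus_def S.hom_of_integer)
  finally show ?thesis using uw by (simp add: cubic_char_def power_char_\<sigma> resultant2_closed)
qed

lemma sum_cubic_char_2: "(\<Sum>g\<in>monics_deg 2. cubic_char g) = real q"
proof -
  have "(\<Sum>g\<in>monics_deg 2. cubic_char g) = (\<Sum>(u, w)\<in>carrier R \<times> carrier R. qchar (resultant2 u w))"
  proof (rule sum.reindex_bij_witness[of _ "\<lambda>(u, w). [\<one>, u, a \<oplus> u \<otimes> u \<ominus> w]" "\<lambda>g. (g ! 1, a \<oplus> g ! 1 \<otimes> g ! 1 \<ominus> g ! 2)"])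
    fix g assume "g \<in> monics_deg 2"
    then obtain u v where "g = [\<one>, u, v]" "u \<in> carrier R" "v \<in> carrier R"
      by (auto simp: monics_deg_eq numeral_2_eq_2 length_Suc_conv)
    then show "(case (g ! 1, a \<oplus> g ! 1 \<otimes> g ! 1 \<ominus> g ! 2) of (u, w) \<Rightarrow> [\<one>, u, a \<oplus> u \<otimes> u \<ominus> w]) = g"
      "(g ! 1, a \<oplus> g ! 1 \<otimes> g ! 1 \<ominus> g ! 2) \<in> carrier R \<times> carrier R"
      "(case (g ! 1, a \<oplus> g ! 1 \<otimes> g ! 1 \<ominus> g ! 2) of (u, w) \<Rightarrow> qchar (resultant2 u w)) = cubic_char g"
      using cubic_char_quadratic[of u "a \<oplus> u \<otimes> u \<ominus> v"] by (simp_all add: diff_diff_cancel)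
  qed (auto simp: monics_deg_eq diff_diff_cancel)
  then show ?thesis using sum_qchar_resultant2 by (simp add: sum.cartesian_product)
qed

lemma cubic_resultant_irreducible:
  assumes P: "P \<in> monic_irreds" and \<theta>: "\<theta> \<in> carrier L" "ev \<theta> P = zL"
  shows "cubic_resultant P = cubic_L \<theta> :^ (\<Sum>i<degree P. q ^ i)"
proof -
  let ?d = "degree P"
  define orbit where "orbit = (\<lambda>i::nat. \<theta> :^ (q ^ i))"
  have orbit: "orbit i \<in> carrier L" for i using \<theta> by (simp add: orbit_def)
  define m1 where "m1 = :~ oL"
  have m1: "m1 \<in> carrier L" "m1 :* m1 = oL" by (auto simp: m1_def L.l_minus L.r_minus)
  define N where "N = (\<Otimes>\<^bsub>L\<^esub>i\<in>{..<?d}. cubic_L (orbit i))"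
  have N: "N \<in> carrier L" unfolding N_def
    using orbit cubic_L_closed by (intro L.finprod_closed) auto
  have "ev T P = (\<Otimes>\<^bsub>L\<^esub>i\<in>{..<?d}. T :- orbit i)" if "T \<in> carrier L" for T
    unfolding orbit_def by (rule ev_eq_prod_frob_orbit[OF P \<theta> that])
  then have "ev r P :* ev s P :* ev t P = (\<Otimes>\<^bsub>L\<^esub>i\<in>{..<?d}. (r :- orbit i) :* (s :- orbit i) :* (t :- orbit i))"
    using orbit by (simp add: L.finprod_multf Pi_iff)
  also have "\<dots> = (\<Otimes>\<^bsub>L\<^esub>i\<in>{..<?d}. m1 :* cubic_L (orbit i))"
    by (rule L.finprod_cong') (use orbit m1 cubic_L_closed in \<open>auto simp: cubic_L_flip m1_def\<close>)
  also have "\<dots> = m1 :^ ?d :* N"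
    unfolding N_def using m1 orbit cubic_L_closed
    by (subst L.finprod_multf) (auto simp: L.finprod_const)
  finally have "cubic_resultant P = m1 :^ ?d :* (m1 :^ ?d :* N)"
    unfolding cubic_resultant_def m1_def by simp
  also have "\<dots> = (m1 :* m1) :^ ?d :* N" using m1(1) N
    by (subst L.nat_pow_distrib) (auto simp: L.m_assoc)
  also have "\<dots> = N" using m1 N by simp
  also have "\<dots> = (\<Otimes>\<^bsub>L\<^esub>i\<in>{..<?d}. cubic_L \<theta> :^ (q ^ i))"
    unfolding N_def orbit_def by (rule L.finprod_cong') (use \<theta> cubic_L_frob cubic_L_closed in auto)
  also have "\<dots> = cubic_L \<theta> :^ (\<Sum>i<?d. q ^ i)"
    using \<theta> cubic_L_closed by (intro L.finprod_pow_sum) auto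
  finally show ?thesis .
qed

lemma odd_finite_field_adjoin:
  assumes "P \<in> monic_irreds" "\<theta> \<in> carrier L" "ev \<theta> P = zL" shows "odd_finite_field (adjoin \<theta>)"
  using finite_field_adjoin[OF assms] \<sigma>_nonzero[of "\<one> \<oplus> \<one>"] two_nonzero
  by (simp add: odd_finite_field_def odd_finite_field_axioms_def)

lemma power_char_adjoin:
  assumes P: "P \<in> monic_irreds" and \<theta>: "\<theta> \<in> carrier L" "ev \<theta> P = zL"
  shows "power_char (adjoin \<theta>) (odd_finite_field.half_order (adjoin \<theta>)) (cubic_L \<theta>) = cubic_char P"
proof -
  interpret K: odd_finite_field "adjoin \<theta>" by (rule odd_finite_field_adjoin[OF P \<theta>])
  let ?u = "cubic_L \<theta>"
  define N where "N = (\<Sum>i<degree P. q ^ i)"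
  have u: "?u \<in> carrier L" using cubic_L_closed \<theta> by simp
  have "N * (2 * half_order) + 1 = 2 * K.half_order + 1"
    using geometric_sum_nat[of "2 * half_order" "degree P"] order_eq K.order_eq order_adjoin[OF P \<theta>]
    by (simp add: N_def)
  then have half_order_K: "N * half_order = K.half_order" by simp
  have "q ^ 0 \<le> N" unfolding N_def by (rule member_le_sum) (use monic_irredD(3)[OF P] in auto)
  then have "?u :^ N = zL \<longleftrightarrow> ?u = zL" using u by (auto simp: L.nat_pow_zero L.nat_pow_eq_0_iff)
  moreover have "?u [^]\<^bsub>adjoin \<theta>\<^esub> K.half_order = (?u :^ N) :^ half_order"
    using u by (simp add: L.nat_pow_pow half_order_K) (simp add: nat_pow_def)
  ultimately show ?thesis
    unfolding cubic_char_def cubic_resultant_irreducible[OF P \<theta>] N_def [symmetric]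
    by (simp add: power_char_def)
qed

lemma card_cubic_sqrts:
  assumes P: "P \<in> monic_irreds"
  shows "real (card (cubic_sqrts P)) = 1 + cubic_char P"
proof -
  obtain \<theta> where \<theta>: "\<theta> \<in> carrier L" "ev \<theta> P = zL" using monic_irred_root[OF P] .
  interpret E: ring_hom_ring "poly_ring R" L "ev \<theta>" by (rule ev_hom[OF \<theta>(1)])
  interpret K: odd_finite_field "adjoin \<theta>" by (rule odd_finite_field_adjoin[OF P \<theta>])
  let ?u = "cubic_L \<theta>"
  have u: "?u \<in> carrier (adjoin \<theta>)"
    unfolding ev_cubic_poly[OF \<theta>(1), symmetric] using cubic_poly_carrier by simp
  have "bij_betw (ev \<theta>) (cubic_sqrts P) {y \<in> carrier (adjoin \<theta>). y \<otimes>\<^bsub>adjoin \<theta>\<^esub> y = ?u}"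
    unfolding cubic_sqrts_def
  proof (rule bij_betw_Collect[OF bij_betw_ev_polys_below[OF P \<theta>]])
    fix p assume "p \<in> polys_below (degree P)"
    then have p: "p \<in> kX" by (rule polys_below_carrier)
    have "P .| (p .* p .- cubic_poly) \<longleftrightarrow> ev \<theta> (p .* p) = ev \<theta> cubic_poly"
      using ev_eq_iff[OF P \<theta>, of "p .* p" cubic_poly] p by simp
    then show "ev \<theta> p \<otimes>\<^bsub>adjoin \<theta>\<^esub> ev \<theta> p = ?u \<longleftrightarrow> P .| (p .* p .- cubic_poly)"
      unfolding ev_cubic_poly[OF \<theta>(1)] using p by simp
  qed
  then have "real (card (cubic_sqrts P)) = real (card {y \<in> carrier (adjoin \<theta>). y \<otimes>\<^bsub>adjoin \<theta>\<^esub> y = ?u})"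
    by (simp only: bij_betw_same_card)
  also have "\<dots> = 1 + cubic_char P" by (simp only: K.card_sqrt[OF u] power_char_adjoin[OF P \<theta>])
  finally show ?thesis .
qed

lemma curve_character_cubic_char: "curve_character R a b cubic_char"
  by (intro curve_character.intro curve_field_axioms curve_character_axioms.intro)
     (fact cubic_char_one cubic_char_mult cubic_char_range card_cubic_sqrts sum_cubic_char_1 sum_cubic_char_2
       sum_cubic_char_ge_3)+

end

lemma (in curve_closure) exists_curve_split: "\<exists>r s t. curve_split R a b L \<sigma> r s t"
proof -
  define A B where "A = \<sigma> a" and "B = \<sigma> b"
  have AB: "A \<in> carrier L" "B \<in> carrier L" by (auto simp: A_def B_def)
  have "[oL, zL, A, B] \<in> carrier (poly_ring L)" using AB by (auto simp: L.poly_carrier_iff)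
  then obtain r where r: "r \<in> carrier L" "L.eval [oL, zL, A, B] r = zL"
    using alg_closed[of "[oL, zL, A, B]"] by auto
  have "[oL, r, r :* r :+ A] \<in> carrier (poly_ring L)" using r AB by (auto simp: L.poly_carrier_iff)
  then obtain s where s: "s \<in> carrier L" "L.eval [oL, r, r :* r :+ A] s = zL"
    using alg_closed[of "[oL, r, r :* r :+ A]"] by auto
  have vieta: "A = :~ (r :* r :+ r :* s :+ s :* s)" "B = r :* s :* (r :+ s)"
    by (rule L.cubic_vieta[OF AB r(1) s(1)]; use r s AB in simp)+
  have "\<sigma> (\<guillemotleft>4\<guillemotright> \<otimes> a [^] (3::nat) \<oplus> \<guillemotleft>27\<guillemotright> \<otimes> b [^] (2::nat)) \<noteq> zL"
    by (rule \<sigma>_nonzero) (use disc in auto)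
  then have "\<guillemotleft>4\<guillemotright>\<^bsub>L\<^esub> :* A :^ (3::nat) :+ \<guillemotleft>27\<guillemotright>\<^bsub>L\<^esub> :* B :^ (2::nat) \<noteq> zL"
    by (simp add: S.hom_of_integer S.hom_nat_pow A_def B_def)
  note distinct = L.cubic_roots_distinct[OF AB r(1) s(1) vieta this]
  have "curve_split R a b L \<sigma> r s (:~ (r :+ s))"
    using r(1) s(1) vieta distinct
    by (intro curve_split.intro curve_closure_axioms curve_split_axioms.intro) (auto simp: A_def B_def)
  then show ?thesis by blast
qed

theorem (in curve_field) exists_curve_character: obtains \<chi> where "curve_character R a b \<chi>"
proof -
  interpret curve_closure R a b alg_closure indexed_const
    by (intro curve_closure.intro curve_field_axioms finite_field_closure_alg_closure)
  obtain r s t where "curve_split R a b alg_closure indexed_const r s t"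
    using exists_curve_split by blast
  then show thesis by (rule that[OF curve_split.curve_character_cubic_char])
qed

section \<open>Valuation rings and places\<close>

context field
begin

definition nonunits :: "'a set \<Rightarrow> 'a set" where
  "nonunits V = {z \<in> V. z = \<zero> \<or> inv z \<notin> V}"

lemma valuation_ringD:
  assumes "valuation_ring R C V"
  shows "subring V R" "C \<subseteq> V" "V \<subseteq> carrier R" "V \<noteq> carrier R"
    and "\<And>z. z \<in> carrier R \<Longrightarrow> z \<noteq> \<zero> \<Longrightarrow> z \<in> V \<or> inv z \<in> V"
  using assms unfolding valuation_ring_def by auto

lemma nonunits_mult:
  assumes V: "valuation_ring R C V" and v: "v \<in> V" and z: "z \<in> nonunits V"
  shows "v \<otimes> z \<in> nonunits V"
proof (cases "v \<otimes> z = \<zero>")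
  case True
  then show ?thesis using subringE(2)[OF valuation_ringD(1)[OF V]] by (simp add: nonunits_def)
next
  case False
  note mult = subringE(6)[OF valuation_ringD(1)[OF V]]
  have z_in_V: "z \<in> V" using z by (simp add: nonunits_def)
  then have closed: "v \<in> carrier R" "z \<in> carrier R" using v valuation_ringD(3)[OF V] by auto
  then have nonzero: "v \<noteq> \<zero>" "z \<noteq> \<zero>" using False by auto
  then have "inv z = v \<otimes> inv (v \<otimes> z)" using closed
    by (simp add: nonzero_inverse_mult_distrib m_lcomm[of v])
  moreover have "inv z \<notin> V" using z nonzero by (simp add: nonunits_def)
  ultimately have "inv (v \<otimes> z) \<notin> V" using mult[OF v] by auto
  then show ?thesis using mult[OF v z_in_V] by (simp add: nonunits_def)
qed

lemma nonunits_add: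
  assumes V: "valuation_ring R C V" and z: "z \<in> nonunits V" and w: "w \<in> nonunits V"
  shows "z \<oplus> w \<in> nonunits V"
proof -
  note VD = valuation_ringD[OF V]
  have quotient: "z \<oplus> w \<in> nonunits V"
    if zw: "z \<in> nonunits V" "w \<in> nonunits V" "w \<noteq> \<zero>" "z \<otimes> inv w \<in> V" for z w
  proof -
    have closed: "z \<in> carrier R" "w \<in> carrier R" using zw VD(3) by (auto simp: nonunits_def)
    have "z \<otimes> inv w \<oplus> \<one> \<in> V" using zw(4) subringE(3,7)[OF VD(1)] by auto
    then have "(z \<otimes> inv w \<oplus> \<one>) \<otimes> w \<in> nonunits V" using nonunits_mult[OF V] zw(2) by blast
    also have "(z \<otimes> inv w \<oplus> \<one>) \<otimes> w = z \<oplus> w" using closed zw(3) by (simp add: l_distr m_assoc)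
    finally show ?thesis .
  qed
  have closed: "z \<in> carrier R" "w \<in> carrier R" using z w VD(3) by (auto simp: nonunits_def)
  show ?thesis
  proof (cases "z = \<zero> \<or> w = \<zero>")
    case True
    then show ?thesis using z w closed by auto
  next
    case False
    then have "inv (z \<otimes> inv w) = w \<otimes> inv z" "z \<otimes> inv w \<noteq> \<zero>"
      using closed nonzero_imp_inverse_nonzero integral[of z "inv w"]
      by (auto simp: nonzero_inverse_mult_distrib nonzero_inverse_inverse_eq m_comm)
    then have "z \<otimes> inv w \<in> V \<or> w \<otimes> inv z \<in> V" using VD(5)[of "z \<otimes> inv w"] False closed by auto
    then show ?thesis using quotient[OF z w] quotient[OF w z] False closed by (auto simp: a_comm)
  qed
qed

lemma subring_minus:
  assumes "subring V R" "z \<in> V" "x \<in> V"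
  shows "\<ominus>\<^bsub>R\<lparr>carrier := V\<rparr>\<^esub> x = \<ominus> x" "z \<ominus>\<^bsub>R\<lparr>carrier := V\<rparr>\<^esub> x = z \<ominus> x"
proof -
  interpret V: ring "R\<lparr>carrier := V\<rparr>" using subring_is_ring[OF assms(1)] .
  show "\<ominus>\<^bsub>R\<lparr>carrier := V\<rparr>\<^esub> x = \<ominus> x"
    using assms subringE(1,5)[OF assms(1)] by (intro V.minus_equality) (auto simp: l_neg)
  then show "z \<ominus>\<^bsub>R\<lparr>carrier := V\<rparr>\<^esub> x = z \<ominus> x" by (simp add: a_minus_def)
qed

lemma one_not_nonunit: "valuation_ring R C V \<Longrightarrow> \<one> \<notin> nonunits V"
  using subringE(3)[OF valuation_ringD(1)] by (auto simp: nonunits_def)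

lemma nonunits_ideal:
  assumes V: "valuation_ring R C V" shows "ideal (nonunits V) (R\<lparr>carrier := V\<rparr>)"
proof -
  note sub = valuation_ringD(1)[OF V]
  have ring: "ring (R\<lparr>carrier := V\<rparr>)" using subring_is_ring[OF sub] .
  interpret V: ring "R\<lparr>carrier := V\<rparr>" by (rule ring)
  have closed: "z \<in> V" "z \<in> carrier R" if "z \<in> nonunits V" for z
    using that valuation_ringD(3)[OF V] by (auto simp: nonunits_def)
  have neg: "\<ominus> z \<in> nonunits V" if "z \<in> nonunits V" for z
    using nonunits_mult[OF V _ that, of "\<ominus> \<one>"] closed[OF that] subringE(3,5)[OF sub]
    by (auto simp: l_minus)
  show ?thesis
  proof (rule idealI[OF ring])
    show "subgroup (nonunits V) (add_monoid (R\<lparr>carrier := V\<rparr>))"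
    proof (rule V.add.subgroupI)
      show "nonunits V \<subseteq> carrier (R\<lparr>carrier := V\<rparr>)" using closed by auto
      show "nonunits V \<noteq> {}" using subringE(2)[OF sub] by (auto simp: nonunits_def)
      show "\<ominus>\<^bsub>R\<lparr>carrier := V\<rparr>\<^esub> z \<in> nonunits V" if "z \<in> nonunits V" for z
        using neg[OF that] subring_minus(1)[OF sub _ closed(1)[OF that]] closed(1)[OF that] by simp
      show "z \<oplus>\<^bsub>R\<lparr>carrier := V\<rparr>\<^esub> w \<in> nonunits V" if "z \<in> nonunits V" "w \<in> nonunits V" for z w
        using nonunits_add[OF V that] by simp
    qed
    fix z x assume zx: "z \<in> nonunits V" "x \<in> carrier (R\<lparr>carrier := V\<rparr>)"
    then show "x \<otimes>\<^bsub>R\<lparr>carrier := V\<rparr>\<^esub> z \<in> nonunits V" using nonunits_mult[OF V] by simp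
    moreover have "x \<in> carrier R" using zx valuation_ringD(3)[OF V] by auto
    ultimately show "z \<otimes>\<^bsub>R\<lparr>carrier := V\<rparr>\<^esub> x \<in> nonunits V" using m_comm closed(2)[OF zx(1)] by simp
  qed
qed

lemma proper_ideal_subset_nonunits:
  assumes V: "valuation_ring R C V" and J: "ideal J (R\<lparr>carrier := V\<rparr>)" "J \<noteq> V"
  shows "J \<subseteq> nonunits V"
proof
  interpret J: ideal J "R\<lparr>carrier := V\<rparr>" by (rule J(1))
  fix z assume z: "z \<in> J"
  then have z_in_V: "z \<in> V" "z \<in> carrier R" using J.a_subset valuation_ringD(3)[OF V] by auto
  have "inv z \<notin> V" if "z \<noteq> \<zero>"
  proof
    assume "inv z \<in> V"
    then have "inv z \<otimes> z \<in> J" using J.I_l_closed[of z "inv z"] z by simp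
    then have "\<one> \<in> J" using that z_in_V by simp
    then show False using J.one_imp_carrier J(2) by simp
  qed
  then show "z \<in> nonunits V" using z_in_V by (auto simp: nonunits_def)
qed

lemma maximalideal_iff_nonunits:
  assumes V: "valuation_ring R C V"
  shows "maximalideal P (R\<lparr>carrier := V\<rparr>) \<longleftrightarrow> P = nonunits V"
proof -
  have proper: "nonunits V \<noteq> V" "nonunits V \<subseteq> V"
    using one_not_nonunit[OF V] subringE(3)[OF valuation_ringD(1)[OF V]]
    by blast (auto simp: nonunits_def)
  show ?thesis
  proof
    assume "maximalideal P (R\<lparr>carrier := V\<rparr>)"
    then interpret P: maximalideal P "R\<lparr>carrier := V\<rparr>" .
    have "P \<subseteq> nonunits V"
      using proper_ideal_subset_nonunits[OF V P.ideal_axioms] P.I_notcarr by simp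
    then show "P = nonunits V" using P.I_maximal[OF nonunits_ideal[OF V]] proper by auto
  next
    assume P: "P = nonunits V"
    show "maximalideal P (R\<lparr>carrier := V\<rparr>)" unfolding P
    proof (rule maximalidealI[OF nonunits_ideal[OF V]])
      fix J assume "ideal J (R\<lparr>carrier := V\<rparr>)" "nonunits V \<subseteq> J" "J \<subseteq> carrier (R\<lparr>carrier := V\<rparr>)"
      then show "J = nonunits V \<or> J = carrier (R\<lparr>carrier := V\<rparr>)"
        using proper_ideal_subset_nonunits[OF V] by auto
    qed (use proper in auto)
  qed
qed

lemma valuation_ring_from_nonunits:
  assumes V: "valuation_ring R C V"
  shows "V = {z \<in> carrier R. z = \<zero> \<or> inv z \<notin> nonunits V}"
proof (intro equalityI subsetI)
  fix z assume "z \<in> V"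
  then show "z \<in> {z \<in> carrier R. z = \<zero> \<or> inv z \<notin> nonunits V}"
    using valuation_ringD(3)[OF V] nonzero_imp_inverse_nonzero nonzero_inverse_inverse_eq
    by (auto simp: nonunits_def)
next
  fix z assume "z \<in> {z \<in> carrier R. z = \<zero> \<or> inv z \<notin> nonunits V}"
  then show "z \<in> V"
    using valuation_ringD(5)[OF V, of z] subringE(2)[OF valuation_ringD(1)[OF V]] nonzero_inverse_inverse_eq[of z]
    by (cases "z = \<zero>") (auto simp: nonunits_def)
qed

lemma nonunits_inj:
  "valuation_ring R C V \<Longrightarrow> valuation_ring R C V' \<Longrightarrow> nonunits V = nonunits V' \<Longrightarrow> V = V'"
  using valuation_ring_from_nonunits[of C V] valuation_ring_from_nonunits[of C V'] by simp

lemma places_eq: "places R C = nonunits ` {V. valuation_ring R C V}"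
  unfolding places_def using maximalideal_iff_nonunits by blast

lemma place_ring_nonunits:
  assumes V: "valuation_ring R C V" shows "place_ring R C (nonunits V) = R\<lparr>carrier := V\<rparr>"
proof -
  have "(THE W. valuation_ring R C W \<and> maximalideal (nonunits V) (R\<lparr>carrier := W\<rparr>)) = V"
  proof (rule the_equality)
    show "valuation_ring R C V \<and> maximalideal (nonunits V) (R\<lparr>carrier := V\<rparr>)"
      using V maximalideal_iff_nonunits[OF V] by simp
    fix W assume "valuation_ring R C W \<and> maximalideal (nonunits V) (R\<lparr>carrier := W\<rparr>)"
    then show "W = V" using nonunits_inj[of C W V] V maximalideal_iff_nonunits[of C W] by metis
  qed
  then show ?thesis by (simp add: place_ring_def)
qed

end

lemma (in ring) inj_on_line_extension:
  assumes K: "subfield K R" and E: "dimension n K E" and v: "v \<in> carrier R" "v \<notin> E"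
  shows "inj_on (\<lambda>(k, e). k \<otimes> v \<oplus> e) (K \<times> E)"
proof (rule inj_onI, clarify)
  note space = space_subgroup_props[OF K E]
  fix k e k' e' assume coords: "k \<in> K" "k' \<in> K" "e \<in> E" "e' \<in> E" and sums: "k \<otimes> v \<oplus> e = k' \<otimes> v \<oplus> e'"
  have closed: "k \<in> carrier R" "k' \<in> carrier R" "e \<in> carrier R" "e' \<in> carrier R"
    using coords subfieldE(3)[OF K] space(1) by auto
  have "(k' \<ominus> k) \<otimes> v = e \<ominus> e'"
    using diff_eq_diff_of_sum_eq[OF _ _ _ _ sums] closed v
    by (simp add: a_minus_def l_distr l_minus)
  moreover have "e \<ominus> e' \<in> E" using space coords by (simp add: a_minus_def)
  ultimately have "k' \<ominus> k \<notin> K - {\<zero>}" using space(6)[of "k' \<ominus> k" v] v by auto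
  moreover have "k' \<ominus> k \<in> K" unfolding a_minus_def
    using coords subringE(5,7)[OF subfieldE(1)[OF K]] by auto
  ultimately have "k = k'" using closed by auto
  then show "k = k' \<and> e = e'" using add.l_cancel[of "k' \<otimes> v" e e'] sums closed v by auto
qed

lemma (in ring) card_dimension:
  assumes "subfield K R" and "dimension n K E" and "finite K"
  shows "finite E \<and> card E = card K ^ n"
  using assms(2,1,3)
proof (induction n K E rule: dimension.induct)
  case (Suc_dim v E n K)
  have E: "finite E" "card E = card K ^ n" using Suc_dim.IH Suc_dim.prems by auto
  have "line_extension K v E = (\<lambda>(k, e). k \<otimes> v \<oplus> e) ` (K \<times> E)"
    unfolding set_eq_iff line_extension_mem_iff by (fastforce simp: image_def)
  moreover have "inj_on (\<lambda>(k, e). k \<otimes> v \<oplus> e) (K \<times> E)"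
    using inj_on_line_extension[OF Suc_dim.prems(1) Suc_dim.hyps(3,1,2)] .
  ultimately show ?case using E Suc_dim.prems by (simp add: card_image card_cartesian_product)
qed simp

lemma (in ring) dim_by_card:
  assumes K: "subfield K R" and finite_R: "finite (carrier R)" and card: "card (carrier R) = card K ^ e"
  shows "dim K (carrier R) = e"
proof -
  have finite_K: "finite K" using finite_R subfieldE(3)[OF K] finite_subset by blast
  have card_K_gt_1: "card K > 1"
    using subfieldE(6)[OF K] subringE(2,3)[OF subfieldE(1)[OF K]] finite_K card_mono[of K "{\<zero>, \<one>}"] by auto
  obtain xs where xs: "set xs = carrier R" using finite_list[OF finite_R] by blast
  have "Span K xs = carrier R"
    using Span_base_incl[OF K, of xs] Span_in_carrier[of K xs] subfieldE(3)[OF K] xs by auto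
  then have "finite_dimension K (carrier R)" using Span_finite_dimension[OF K, of xs] xs by simp
  then obtain n where n: "dimension n K (carrier R)" by (auto elim: finite_dimensionE')
  then have "card K ^ n = card K ^ e" using card_dimension[OF K n finite_K] card by simp
  then have "n = e" using card_K_gt_1 by (simp add: power_inject_exp)
  then show ?thesis using dimI[OF K n] by (simp add: over_def)
qed

context field
begin

lemma bij_betw_residue_classes:
  assumes V: "valuation_ring R C V" and T: "T \<subseteq> V"
    and exists: "\<And>z. z \<in> V \<Longrightarrow> \<exists>x\<in>T. z \<ominus> x \<in> nonunits V"
    and unique: "\<And>x x'. x \<in> T \<Longrightarrow> x' \<in> T \<Longrightarrow> x \<ominus> x' \<in> nonunits V \<Longrightarrow> x = x'"
  shows "bij_betw (\<lambda>x. nonunits V +>\<^bsub>R\<lparr>carrier := V\<rparr>\<^esub> x) T (carrier (R\<lparr>carrier := V\<rparr> Quot nonunits V))"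
proof -
  let ?V = "R\<lparr>carrier := V\<rparr>"
  let ?h = "\<lambda>x. nonunits V +>\<^bsub>?V\<^esub> x"
  interpret I: ideal "nonunits V" ?V by (rule nonunits_ideal[OF V])
  have class_eq: "?h z = ?h x \<longleftrightarrow> z \<ominus> x \<in> nonunits V" if "z \<in> V" "x \<in> V" for z x
    using I.quotient_eq_iff_same_a_r_cos[OF I.ideal_axioms, of z x] that
      subring_minus(2)[OF valuation_ringD(1)[OF V] that] by simp
  show ?thesis
  proof (rule bij_betw_imageI)
    show "inj_on ?h T"
    proof (rule inj_onI)
      fix x y assume xy: "x \<in> T" "y \<in> T" "?h x = ?h y"
      then have "x \<ominus> y \<in> nonunits V" using class_eq[of x y] T by blast
      then show "x = y" by (rule unique[OF xy(1,2)])
    qed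
    show "?h ` T = carrier (?V Quot nonunits V)"
    proof (intro equalityI subsetI)
      fix Y assume "Y \<in> carrier (?V Quot nonunits V)"
      then obtain z where z: "z \<in> V" "Y = ?h z" by (auto simp: FactRing_def A_RCOSETS_def')
      obtain x where x: "x \<in> T" "z \<ominus> x \<in> nonunits V" using exists[OF z(1)] by blast
      then have "Y = ?h x" using class_eq[OF z(1), of x] z(2) T by blast
      then show "Y \<in> ?h ` T" using x by blast
    qed (use T in \<open>auto simp: FactRing_def A_RCOSETS_def'\<close>)
  qed
qed

lemma place_degree_by_card:
  assumes V: "valuation_ring R C V" and C: "subfield C R" "finite C" "card C > 1"
    and card: "card (carrier (R\<lparr>carrier := V\<rparr> Quot nonunits V)) = card C ^ e"
  shows "place_degree R C (nonunits V) = e"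
proof -
  let ?V = "R\<lparr>carrier := V\<rparr>"
  let ?Q = "?V Quot nonunits V" and ?h = "\<lambda>c. nonunits V +>\<^bsub>?V\<^esub> c"
  interpret I: ideal "nonunits V" ?V by (rule nonunits_ideal[OF V])
  have "maximalideal (nonunits V) ?V" using maximalideal_iff_nonunits[OF V] by simp
  moreover have "domain ?V" using subring_is_domain[OF valuation_ringD(1)[OF V]] .
  ultimately interpret Q: field ?Q by (simp add: maximalideal.quotient_is_field domain_def)
  interpret H: ring_hom_ring ?V ?Q ?h
    by (rule ring_hom_ringI2[OF I.ring_axioms Q.ring_axioms I.rcos_ring_hom])
  have "subfield C ?V" using subfield_iff(2)[OF C(1)] valuation_ringD(2)[OF V]
    by (intro I.subfield_iff(1)) auto
  then have image: "subfield (?h ` C) ?Q" "inj_on ?h C" by (simp_all add: H.img_is_subfield)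
  have "card C ^ e > 0" using C by simp
  then have "finite (carrier ?Q)" using card by (intro card_ge_0_finite) simp
  then have "Q.dim (?h ` C) (carrier ?Q) = e"
    by (rule Q.dim_by_card[OF image(1)]) (use card card_image[OF image(2)] in simp)
  then show ?thesis unfolding place_degree_def place_ring_nonunits[OF V] .
qed

end

locale local_ideal = field R for R (structure) +
  fixes A m :: "'a set"
  assumes A: "subring A R" and m_subset: "m \<subseteq> A" and zero_in_m: "\<zero> \<in> m" and one_notin_m: "\<one> \<notin> m"
    and m_add: "x \<in> m \<Longrightarrow> y \<in> m \<Longrightarrow> x \<oplus> y \<in> m"
    and m_mult: "a \<in> A \<Longrightarrow> x \<in> m \<Longrightarrow> a \<otimes> x \<in> m"
    and m_max: "b \<in> A \<Longrightarrow> b \<notin> m \<Longrightarrow> \<exists>b'\<in>A. b \<otimes> b' \<ominus> \<one> \<in> m"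
begin

lemma A_carrier: "x \<in> A \<Longrightarrow> x \<in> carrier R" using subringE(1)[OF A] by auto

lemmas A_closed = subringE(2,3,5,6,7)[OF A]

lemma m_neg: "x \<in> m \<Longrightarrow> \<ominus> x \<in> m"
  using m_mult[of "\<ominus> \<one>" x] A_closed m_subset A_carrier by (auto simp: l_minus)

lemma m_minus: "x \<in> m \<Longrightarrow> y \<in> m \<Longrightarrow> x \<ominus> y \<in> m"
  unfolding a_minus_def by (intro m_add m_neg)

lemma A_minus: "x \<in> A \<Longrightarrow> y \<in> A \<Longrightarrow> x \<ominus> y \<in> A"
  unfolding a_minus_def using A_closed by auto

lemma m_prime: assumes xy: "x \<in> A" "y \<in> A" "x \<otimes> y \<in> m" shows "x \<in> m \<or> y \<in> m"
proof (rule ccontr)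
  assume "\<not> (x \<in> m \<or> y \<in> m)"
  then obtain x' where x': "x' \<in> A" "x \<otimes> x' \<ominus> \<one> \<in> m" using m_max xy by blast
  have closed: "x \<in> carrier R" "y \<in> carrier R" "x' \<in> carrier R" using xy x' A_carrier by auto
  have "x' \<otimes> (x \<otimes> y) \<ominus> y \<otimes> (x \<otimes> x' \<ominus> \<one>) \<in> m" using m_minus m_mult x' xy by auto
  also have "x' \<otimes> (x \<otimes> y) \<ominus> y \<otimes> (x \<otimes> x' \<ominus> \<one>) = y"
    by (rule eqI_diff, use closed in algebra) (use closed in auto)
  finally show False using \<open>\<not> (x \<in> m \<or> y \<in> m)\<close> by auto
qed

lemma compl_mult: "x \<in> A - m \<Longrightarrow> y \<in> A - m \<Longrightarrow> x \<otimes> y \<in> A - m"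
  using m_prime[of x y] A_closed by auto

lemma compl_nonzero: "x \<in> A - m \<Longrightarrow> x \<noteq> \<zero>" using zero_in_m by auto

lemma one_compl: "\<one> \<in> A - m" using one_notin_m A_closed(2) by auto

definition assoc_power :: "'a \<Rightarrow> 'a \<Rightarrow> bool" where
  "assoc_power \<tau> x \<longleftrightarrow> (\<exists>n::nat. \<exists>a\<in>A - m. \<exists>b\<in>A - m. x \<otimes> b = \<tau> [^] n \<otimes> a)"

lemma assoc_powerI:
  "a \<in> A - m \<Longrightarrow> b \<in> A - m \<Longrightarrow> x \<otimes> b = \<tau> [^] (n::nat) \<otimes> a \<Longrightarrow> assoc_power \<tau> x"
  unfolding assoc_power_def by blast

lemma assoc_power_unit: "x \<in> A - m \<Longrightarrow> assoc_power \<tau> x"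
  using assoc_powerI[of x \<one> x \<tau> 0] one_compl A_carrier by simp

lemma assoc_power_self: "\<tau> \<in> carrier R \<Longrightarrow> assoc_power \<tau> \<tau>"
  using assoc_powerI[of \<one> \<one> \<tau> \<tau> 1] one_compl by simp

lemma assoc_power_mult:
  assumes closed: "x \<in> carrier R" "z \<in> carrier R" "\<tau> \<in> carrier R" and "assoc_power \<tau> x" "assoc_power \<tau> z"
  shows "assoc_power \<tau> (x \<otimes> z)"
proof -
  obtain n a b where x: "a \<in> A - m" "b \<in> A - m" "x \<otimes> b = \<tau> [^] (n::nat) \<otimes> a"
    using assms(4) by (auto simp: assoc_power_def)
  obtain k c d where z: "c \<in> A - m" "d \<in> A - m" "z \<otimes> d = \<tau> [^] (k::nat) \<otimes> c"
    using assms(5) by (auto simp: assoc_power_def)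
  have units: "a \<in> carrier R" "b \<in> carrier R" "c \<in> carrier R" "d \<in> carrier R"
    using x z A_carrier by auto
  have "(x \<otimes> z) \<otimes> (b \<otimes> d) = (x \<otimes> b) \<otimes> (z \<otimes> d)" using closed units by (simp add: m_ac)
  also have "\<dots> = \<tau> [^] (n + k) \<otimes> (a \<otimes> c)"
    unfolding x(3) z(3) using closed units by (simp add: nat_pow_mult [symmetric] m_ac)
  finally show ?thesis by (rule assoc_powerI[OF compl_mult[OF x(1) z(1)] compl_mult[OF x(2) z(2)]])
qed

lemma assoc_power_pow:
  "x \<in> carrier R \<Longrightarrow> \<tau> \<in> carrier R \<Longrightarrow> assoc_power \<tau> x \<Longrightarrow> assoc_power \<tau> (x [^] (n::nat))"
  by (induction n) (auto intro: assoc_power_unit[OF one_compl] assoc_power_mult)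

end

text \<open>A local ring is a valuation ring as soon as every nonzero element is a unit times a power of one
  element \<open>\<tau>\<close>. Here the ring is the localisation of \<open>A\<close> at the ideal \<open>m\<close>.\<close>

locale local_valuation = local_ideal R A m for R (structure) and A m +
  fixes \<tau> :: 'a
  assumes frac: "z \<in> carrier R \<Longrightarrow> \<exists>a\<in>A. \<exists>b\<in>A. b \<noteq> \<zero> \<and> z \<otimes> b = a"
    and \<tau>: "\<tau> \<in> m" "\<tau> \<noteq> \<zero>"
    and factor: "x \<in> A \<Longrightarrow> x \<noteq> \<zero> \<Longrightarrow> assoc_power \<tau> x"
begin

definition localization :: "'a set" where "localization = {z \<in> carrier R. \<exists>a\<in>A. \<exists>b\<in>A - m. z \<otimes> b = a}"

lemma A_localization: "A \<subseteq> localization"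
proof
  fix x assume "x \<in> A"
  then have "x \<otimes> \<one> = x" "x \<in> carrier R" using A_carrier by auto
  then show "x \<in> localization" unfolding localization_def using \<open>x \<in> A\<close> one_compl by blast
qed

lemma localizationI: "a \<in> A \<Longrightarrow> b \<in> A - m \<Longrightarrow> z \<in> carrier R \<Longrightarrow> z \<otimes> b = a \<Longrightarrow> z \<in> localization"
  unfolding localization_def by blast

lemma localizationE: assumes "z \<in> localization" obtains a b
  where "a \<in> A" "b \<in> A - m" "z \<otimes> b = a" "z \<in> carrier R"
  using assms unfolding localization_def by blast

lemma localization_subring: "subring localization R"
proof (rule subringI)
  show "localization \<subseteq> carrier R" by (auto simp: localization_def)
  show "\<one> \<in> localization" using A_localization A_closed by auto
  fix x assume "x \<in> localization"
  then obtain a b where ab: "a \<in> A" "b \<in> A - m" "x \<otimes> b = a" "x \<in> carrier R" by (rule localizationE)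
  show "\<ominus> x \<in> localization"
    by (rule localizationI[of "\<ominus> a" b]) (use ab A_closed A_carrier in \<open>auto simp: l_minus\<close>)
  fix y assume "y \<in> localization"
  then obtain a' b' where ab': "a' \<in> A" "b' \<in> A - m" "y \<otimes> b' = a'" "y \<in> carrier R"
    by (rule localizationE)
  have closed: "x \<in> carrier R" "y \<in> carrier R" "b \<in> carrier R" "b' \<in> carrier R"
    using ab ab' A_carrier by auto
  show "x \<otimes> y \<in> localization"
  proof (rule localizationI[of "a \<otimes> a'" "b \<otimes> b'"])
    have "x \<otimes> y \<otimes> (b \<otimes> b') = (x \<otimes> b) \<otimes> (y \<otimes> b')" using closed by (simp add: m_ac)
    then show "x \<otimes> y \<otimes> (b \<otimes> b') = a \<otimes> a'" using ab ab' by simp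
  qed (use ab ab' A_closed compl_mult in auto)
  show "x \<oplus> y \<in> localization"
  proof (rule localizationI[of "a \<otimes> b' \<oplus> a' \<otimes> b" "b \<otimes> b'"])
    have "(x \<oplus> y) \<otimes> (b \<otimes> b') = (x \<otimes> b) \<otimes> b' \<oplus> (y \<otimes> b') \<otimes> b"
      by (rule eqI_diff, use closed in algebra) (use closed in auto)
    then show "(x \<oplus> y) \<otimes> (b \<otimes> b') = a \<otimes> b' \<oplus> a' \<otimes> b" using ab ab' by simp
  qed (use ab ab' A_closed compl_mult in auto)
qed

lemma \<tau>_inv: "inv \<tau> \<notin> localization"
proof
  assume "inv \<tau> \<in> localization"
  then obtain a b where ab: "a \<in> A" "b \<in> A - m" "inv \<tau> \<otimes> b = a" by (rule localizationE) blast
  have closed: "\<tau> \<in> carrier R" "b \<in> carrier R" using \<tau> m_subset ab A_carrier by auto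
  have "a \<otimes> \<tau> = inv \<tau> \<otimes> \<tau> \<otimes> b" unfolding ab(3) [symmetric]
    using closed \<tau> by (simp add: m_ac del: l_inv r_inv)
  also have "\<dots> = b" using closed \<tau> by simp
  finally show False using m_mult[OF ab(1) \<tau>(1)] ab by simp
qed

lemma \<tau>_pow: "\<tau> [^] (n::nat) \<in> A" "\<tau> [^] (n::nat) \<in> carrier R" "\<tau> [^] (n::nat) \<noteq> \<zero>"
proof -
  have \<tau>_in_A: "\<tau> \<in> A" using \<tau> m_subset by auto
  show "\<tau> [^] n \<in> A" by (induction n) (use \<tau>_in_A A_closed in auto)
  then show "\<tau> [^] n \<in> carrier R" by (rule A_carrier)
  show "\<tau> [^] n \<noteq> \<zero>" using \<tau> A_carrier[OF \<tau>_in_A] by simp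
qed

lemma power_ratio_in_localization:
  fixes k n :: nat
  assumes z: "z \<in> carrier R" and ab: "a \<in> A" "b \<in> A - m" and "k \<le> n"
    and ratio: "z \<otimes> (\<tau> [^] k \<otimes> b) = \<tau> [^] n \<otimes> a"
  shows "z \<in> localization"
proof (rule localizationI)
  have closed: "a \<in> carrier R" "b \<in> carrier R" "\<tau> \<in> carrier R" using ab A_carrier \<tau> m_subset by auto
  have "\<tau> [^] n = \<tau> [^] k \<otimes> \<tau> [^] (n - k)" using \<open>k \<le> n\<close> closed by (simp add: nat_pow_mult)
  then have "\<tau> [^] k \<otimes> (z \<otimes> b) = \<tau> [^] k \<otimes> (\<tau> [^] (n - k) \<otimes> a)"
    using ratio z closed \<tau>_pow by (simp add: m_ac)
  then show "z \<otimes> b = \<tau> [^] (n - k) \<otimes> a" using z closed \<tau>_pow by (subst (asm) m_lcancel) auto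
qed (use assms A_closed \<tau>_pow in auto)

lemma exists_power_ratio:
  assumes z: "z \<in> carrier R" "z \<noteq> \<zero>"
  obtains k n :: nat and a b where "a \<in> A - m" "b \<in> A - m" "z \<otimes> (\<tau> [^] k \<otimes> b) = \<tau> [^] n \<otimes> a"
proof -
  obtain x y where xy: "x \<in> A" "y \<in> A" "y \<noteq> \<zero>" "z \<otimes> y = x" using frac[OF z(1)] by blast
  have closed: "z \<in> carrier R" "x \<in> carrier R" "y \<in> carrier R" using xy z A_carrier by auto
  have "x \<noteq> \<zero>" using xy z closed integral by blast
  then obtain n :: nat and a b where n: "a \<in> A - m" "b \<in> A - m" "x \<otimes> b = \<tau> [^] n \<otimes> a"
    using factor[OF xy(1)] by (auto simp: assoc_power_def)
  obtain k :: nat and a' b' where k: "a' \<in> A - m" "b' \<in> A - m" "y \<otimes> b' = \<tau> [^] k \<otimes> a'"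
    using factor[OF xy(2,3)] by (auto simp: assoc_power_def)
  have units: "a \<in> carrier R" "b \<in> carrier R" "a' \<in> carrier R" "b' \<in> carrier R"
    using n k A_carrier by auto
  have "z \<otimes> (\<tau> [^] k \<otimes> (a' \<otimes> b)) = z \<otimes> (y \<otimes> b') \<otimes> b" using k units z \<tau>_pow by (simp add: m_assoc)
  also have "\<dots> = (z \<otimes> y) \<otimes> b \<otimes> b'" using closed units by (simp add: m_ac)
  also have "\<dots> = \<tau> [^] n \<otimes> (a \<otimes> b')" using xy n units \<tau>_pow by (simp add: m_assoc)
  finally show thesis by (rule that[OF compl_mult[OF n(1) k(2)] compl_mult[OF k(1) n(2)]])
qed

lemma localization_valuation:
  assumes z: "z \<in> carrier R" "z \<noteq> \<zero>" shows "z \<in> localization \<or> inv z \<in> localization"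
proof -
  obtain k n :: nat and a b where ratio: "a \<in> A - m" "b \<in> A - m" "z \<otimes> (\<tau> [^] k \<otimes> b) = \<tau> [^] n \<otimes> a"
    using exists_power_ratio[OF z] .
  have closed: "b \<in> carrier R" "inv z \<in> carrier R" using ratio z A_carrier by auto
  have "inv z \<otimes> (\<tau> [^] n \<otimes> a) = (inv z \<otimes> z) \<otimes> (\<tau> [^] k \<otimes> b)"
    unfolding ratio(3) [symmetric] using z(1) closed \<tau>_pow by (simp add: m_assoc)
  then have "inv z \<otimes> (\<tau> [^] n \<otimes> a) = \<tau> [^] k \<otimes> b" using z closed \<tau>_pow by simp
  then show ?thesis
    using power_ratio_in_localization[OF z(1) _ _ _ ratio(3)] power_ratio_in_localization[OF closed(2), of b a n k] ratio
    by (cases "k \<le> n") auto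
qed

lemma valuation_ring_localization:
  assumes "C \<subset> A" shows "valuation_ring R C localization"
proof -
  have "inv \<tau> \<in> carrier R" using \<tau> m_subset A_carrier by auto
  then have "localization \<noteq> carrier R" using \<tau>_inv by auto
  then show ?thesis
    unfolding valuation_ring_def
    using localization_subring localization_valuation assms A_localization subringE(1)[OF localization_subring]
    by blast
qed

lemma nonunits_localization: "nonunits localization = {z \<in> carrier R. \<exists>a\<in>m. \<exists>b\<in>A - m. z \<otimes> b = a}"
proof (intro equalityI subsetI)
  fix z assume z: "z \<in> nonunits localization"
  then have "z \<in> localization" by (simp add: nonunits_def)
  then obtain a b where ab: "a \<in> A" "b \<in> A - m" "z \<otimes> b = a" "z \<in> carrier R" by (rule localizationE)
  have "a \<in> m"
  proof (rule ccontr)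
    assume a: "a \<notin> m"
    have closed: "a \<in> carrier R" "b \<in> carrier R" using ab A_carrier by auto
    have "a \<noteq> \<zero>" using a zero_in_m by auto
    then have "z \<noteq> \<zero>" using ab closed by auto
    then have "inv z \<otimes> a = b" using ab(3) [symmetric] ab(4) closed
      by (simp add: m_assoc [symmetric])
    then have "inv z \<in> localization" by (intro localizationI[of b a]) (use ab a \<open>z \<noteq> \<zero>\<close> in auto)
    then show False using z \<open>z \<noteq> \<zero>\<close> by (simp add: nonunits_def)
  qed
  then show "z \<in> {z \<in> carrier R. \<exists>a\<in>m. \<exists>b\<in>A - m. z \<otimes> b = a}" using ab by auto
next
  fix z assume "z \<in> {z \<in> carrier R. \<exists>a\<in>m. \<exists>b\<in>A - m. z \<otimes> b = a}"
  then obtain a b where ab: "a \<in> m" "b \<in> A - m" "z \<otimes> b = a" "z \<in> carrier R" by auto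
  have "inv z \<notin> localization" if "z \<noteq> \<zero>"
  proof
    assume "inv z \<in> localization"
    then obtain a' b' where ab': "a' \<in> A" "b' \<in> A - m" "inv z \<otimes> b' = a'"
      by (rule localizationE) blast
    have closed: "b \<in> carrier R" "b' \<in> carrier R" "inv z \<in> carrier R"
      using ab ab' A_carrier that by auto
    have "a' \<otimes> a = (inv z \<otimes> z) \<otimes> (b' \<otimes> b)"
      unfolding ab(3) [symmetric] ab'(3) [symmetric]
      using closed ab(4) by (simp add: m_ac del: l_inv)
    then have "a' \<otimes> a = b' \<otimes> b" using closed ab(4) that by simp
    then show False using m_mult[OF ab'(1) ab(1)] compl_mult[OF ab'(2) ab(2)] by simp
  qed
  moreover have "z \<in> localization" using ab m_subset by (intro localizationI[of a b]) auto
  ultimately show "z \<in> nonunits localization" by (auto simp: nonunits_def)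
qed

lemma nonunits_localization_A: "x \<in> A \<Longrightarrow> x \<in> nonunits localization \<longleftrightarrow> x \<in> m"
proof
  assume x: "x \<in> A" "x \<in> nonunits localization"
  then obtain a b where "a \<in> m" "b \<in> A - m" "x \<otimes> b = a" by (auto simp: nonunits_localization)
  then show "x \<in> m" using m_prime[of x b] x by auto
next
  assume x: "x \<in> A" "x \<in> m"
  then have "x \<otimes> \<one> = x" "x \<in> carrier R" using A_carrier by auto
  then show "x \<in> nonunits localization" unfolding nonunits_localization using x one_compl by blast
qed

lemma localization_unique:
  assumes W: "valuation_ring R C W" and A_W: "A \<subseteq> W" and N: "\<And>x. x \<in> A \<Longrightarrow> x \<in> nonunits W \<longleftrightarrow> x \<in> m"
  shows "W = localization"
proof (intro equalityI subsetI)
  note WD = valuation_ringD[OF W]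
  have unit: "inv b \<in> W" if "b \<in> A - m" for b
    using N[of b] that A_W compl_nonzero[OF that] by (auto simp: nonunits_def)
  have solve: "z = inv b \<otimes> a" if "z \<otimes> b = a" "z \<in> carrier R" "b \<in> A - m" for z a b
    using that compl_nonzero[OF that(3)] A_carrier by (auto simp: m_assoc m_comm[of "inv b"])
  show "z \<in> W" if "z \<in> localization" for z
  proof -
    obtain a b where ab: "a \<in> A" "b \<in> A - m" "z \<otimes> b = a" "z \<in> carrier R"
      using \<open>z \<in> localization\<close> by (rule localizationE)
    have "inv b \<otimes> a \<in> W" using subringE(6)[OF WD(1) unit[OF ab(2)]] A_W ab(1) by blast
    then show ?thesis using solve[OF ab(3,4,2)] by simp
  qed
  fix z assume z: "z \<in> W"
  show "z \<in> localization"
  proof (rule ccontr)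
    assume not_local: "z \<notin> localization"
    have z_closed: "z \<in> carrier R" using z WD(3) by auto
    have z_nonzero: "z \<noteq> \<zero>" using not_local A_localization A_closed by auto
    have inv_z: "inv z \<in> carrier R" "inv z \<noteq> \<zero>" "inv (inv z) = z"
      using z_closed z_nonzero nonzero_imp_inverse_nonzero nonzero_inverse_inverse_eq by auto
    have "inv z \<in> nonunits localization"
      using localization_valuation[OF z_closed z_nonzero] not_local inv_z
      by (simp add: nonunits_def)
    then obtain a b where ab: "a \<in> m" "b \<in> A - m" "inv z \<otimes> b = a"
      by (auto simp: nonunits_localization)
    have "a \<in> nonunits W" using N[of a] ab(1) m_subset by auto
    then have "inv b \<otimes> a \<in> nonunits W" by (rule nonunits_mult[OF W unit[OF ab(2)]])
    then have "inv z \<in> nonunits W" using solve[OF ab(3) inv_z(1) ab(2)] by simp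
    then show False using z inv_z by (simp add: nonunits_def)
  qed
qed

lemma card_residue_field_localization:
  assumes C: "C \<subset> A" and T: "T \<subseteq> A"
    and exists: "\<And>z. z \<in> A \<Longrightarrow> \<exists>x\<in>T. z \<ominus> x \<in> m"
    and unique: "\<And>x x'. x \<in> T \<Longrightarrow> x' \<in> T \<Longrightarrow> x \<ominus> x' \<in> m \<Longrightarrow> x = x'"
  shows "card (carrier (R\<lparr>carrier := localization\<rparr> Quot nonunits localization)) = card T"
proof -
  have "bij_betw (\<lambda>x. nonunits localization +>\<^bsub>R\<lparr>carrier := localization\<rparr>\<^esub> x) T
      (carrier (R\<lparr>carrier := localization\<rparr> Quot nonunits localization))"
  proof (rule bij_betw_residue_classes[OF valuation_ring_localization[OF C]])
    show "T \<subseteq> localization" using T A_localization by auto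
    show "x = x'" if x: "x \<in> T" "x' \<in> T" "x \<ominus> x' \<in> nonunits localization" for x x'
    proof -
      have "x \<ominus> x' \<in> A" using x T by (intro A_minus) auto
      then have "x \<ominus> x' \<in> m" using nonunits_localization_A x(3) by blast
      then show ?thesis by (rule unique[OF x(1,2)])
    qed
    fix z assume "z \<in> localization"
    then obtain a b where ab: "a \<in> A" "b \<in> A - m" "z \<otimes> b = a" "z \<in> carrier R"
      by (rule localizationE)
    obtain b' where b': "b' \<in> A" "b \<otimes> b' \<ominus> \<one> \<in> m" using m_max ab by blast
    obtain x where x: "x \<in> T" "a \<otimes> b' \<ominus> x \<in> m" using exists[of "a \<otimes> b'"] ab b' A_closed by auto
    have closed: "b \<in> carrier R" "b' \<in> carrier R" "x \<in> carrier R" "z \<in> carrier R"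
      using ab b' x T A_carrier by auto
    have "(z \<ominus> x) \<otimes> b = b \<otimes> (a \<otimes> b' \<ominus> x) \<ominus> a \<otimes> (b \<otimes> b' \<ominus> \<one>)"
      unfolding ab(3) [symmetric] by (rule eqI_diff, use closed in algebra) (use closed in auto)
    moreover have "b \<otimes> (a \<otimes> b' \<ominus> x) \<ominus> a \<otimes> (b \<otimes> b' \<ominus> \<one>) \<in> m"
      using m_minus m_mult x b' ab by auto
    ultimately have "z \<ominus> x \<in> nonunits localization"
      using ab closed unfolding nonunits_localization by auto
    then show "\<exists>x\<in>T. z \<ominus> x \<in> nonunits localization" using x by blast
  qed
  then show ?thesis by (simp add: bij_betw_same_card)
qed

end

section \<open>Quadratic extensions of a fraction field\<close>

locale quad_ext = field R + A: domain A for R (structure) and A (structure) +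
  fixes \<iota> :: "'c \<Rightarrow> 'a" and y :: 'a and f :: 'c
  assumes \<iota>_hom: "\<iota> \<in> ring_hom A R" and y [simp]: "y \<in> carrier R" and f [simp]: "f \<in> carrier A"
    and y_sq: "y \<otimes> y = \<iota> f"
    and rep: "z \<in> carrier R \<Longrightarrow> \<exists>u\<in>carrier A. \<exists>v\<in>carrier A. \<exists>w\<in>carrier A. w \<noteq> \<zero>\<^bsub>A\<^esub> \<and> z \<otimes> \<iota> w = \<iota> u \<oplus> \<iota> v \<otimes> y"
    and indep: "u \<in> carrier A \<Longrightarrow> v \<in> carrier A \<Longrightarrow> \<iota> u \<oplus> \<iota> v \<otimes> y = \<zero> \<Longrightarrow> u = \<zero>\<^bsub>A\<^esub> \<and> v = \<zero>\<^bsub>A\<^esub>"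
    and two_unit: "\<one>\<^bsub>A\<^esub> \<oplus>\<^bsub>A\<^esub> \<one>\<^bsub>A\<^esub> \<in> Units A"
begin

abbreviation Amult (infixl ".*" 70) where "u .* v \<equiv> u \<otimes>\<^bsub>A\<^esub> v"
abbreviation Aadd (infixl ".+" 65) where "u .+ v \<equiv> u \<oplus>\<^bsub>A\<^esub> v"
abbreviation Asub (infixl ".-" 65) where "u .- v \<equiv> u \<ominus>\<^bsub>A\<^esub> v"
abbreviation Aneg (".~ _" [81] 80) where ".~ u \<equiv> \<ominus>\<^bsub>A\<^esub> u"
abbreviation Apow (infixr ".^" 75) where "u .^ (n::nat) \<equiv> u [^]\<^bsub>A\<^esub> n"
abbreviation "zA \<equiv> \<zero>\<^bsub>A\<^esub>"
abbreviation "oA \<equiv> \<one>\<^bsub>A\<^esub>"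

abbreviation "cA \<equiv> carrier A"

sublocale I: ring_hom_ring A R \<iota>
  by (rule ring_hom_ringI2) (auto simp: ring_axioms A.ring_axioms \<iota>_hom)

lemma \<iota>_minus: "u \<in> cA \<Longrightarrow> v \<in> cA \<Longrightarrow> \<iota> (u .- v) = \<iota> u \<ominus> \<iota> v"
  by (simp add: a_minus_def)

definition lin :: "'c \<Rightarrow> 'c \<Rightarrow> 'a" where "lin u v = \<iota> u \<oplus> \<iota> v \<otimes> y"

definition adjoin_y :: "'a set" where "adjoin_y = {lin u v | u v. u \<in> cA \<and> v \<in> cA}"

lemma lin_closed [simp]: "u \<in> cA \<Longrightarrow> v \<in> cA \<Longrightarrow> lin u v \<in> carrier R"
  by (simp add: lin_def)

lemma lin_add: "u \<in> cA \<Longrightarrow> v \<in> cA \<Longrightarrow> u' \<in> cA \<Longrightarrow> v' \<in> cA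
   \<Longrightarrow> lin u v \<oplus> lin u' v' = lin (u .+ u') (v .+ v')"
  unfolding lin_def using linear_add_linear(1)[of "\<iota> u" "\<iota> v" "\<iota> u'" "\<iota> v'" y] by simp

lemma lin_minus: "u \<in> cA \<Longrightarrow> v \<in> cA \<Longrightarrow> u' \<in> cA \<Longrightarrow> v' \<in> cA
   \<Longrightarrow> lin u v \<ominus> lin u' v' = lin (u .- u') (v .- v')"
  unfolding lin_def using linear_add_linear(2)[of "\<iota> u" "\<iota> v" "\<iota> u'" "\<iota> v'" y]
  by (simp add: \<iota>_minus)

lemma lin_uminus: "u \<in> cA \<Longrightarrow> v \<in> cA \<Longrightarrow> \<ominus> lin u v = lin (.~ u) (.~ v)"
  unfolding lin_def using uminus_linear[of "\<iota> u" "\<iota> v" y] by simp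

lemma lin_mult: "u \<in> cA \<Longrightarrow> v \<in> cA \<Longrightarrow> u' \<in> cA \<Longrightarrow> v' \<in> cA
   \<Longrightarrow> lin u v \<otimes> lin u' v' = lin (u .* u' .+ f .* (v .* v')) (u .* v' .+ v .* u')"
  unfolding lin_def using linear_mult_linear[of "\<iota> u" "\<iota> v" "\<iota> u'" "\<iota> v'" y "\<iota> f"] y_sq by simp

lemma \<iota>_mult_lin: "c \<in> cA \<Longrightarrow> u \<in> cA \<Longrightarrow> v \<in> cA \<Longrightarrow> \<iota> c \<otimes> lin u v = lin (c .* u) (c .* v)"
  by (simp add: lin_def r_distr m_assoc)

lemma lin_zero_iff: "u \<in> cA \<Longrightarrow> v \<in> cA \<Longrightarrow> lin u v = \<zero> \<longleftrightarrow> u = zA \<and> v = zA"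
  using indep[of u v] by (auto simp: lin_def)

lemma lin_inj:
  assumes "u \<in> cA" "v \<in> cA" "u' \<in> cA" "v' \<in> cA" "lin u v = lin u' v'"
  shows "u = u' \<and> v = v'"
proof -
  have "lin u v \<ominus> lin u' v' = \<zero>" using assms by simp
  then have "lin (u .- u') (v .- v') = \<zero>" using assms(1-4) lin_minus[of u v u' v'] by simp
  then show ?thesis using assms by (subst (asm) lin_zero_iff) auto
qed

lemma lin_zero_right [simp]: "u \<in> cA \<Longrightarrow> lin u zA = \<iota> u" and lin_y [simp]: "lin zA oA = y"
  by (simp_all add: lin_def)

lemma \<iota>_nonzero: "u \<in> cA \<Longrightarrow> u \<noteq> zA \<Longrightarrow> \<iota> u \<noteq> \<zero>"
  using lin_zero_iff[of u zA] by simp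

lemma inj_on_\<iota>: "inj_on \<iota> cA"
proof (rule inj_onI)
  fix u u' assume "u \<in> cA" "u' \<in> cA" "\<iota> u = \<iota> u'"
  then show "u = u'" using lin_inj[of u zA u' zA] by simp
qed

lemma lin_in_adjoin_y: "u \<in> cA \<Longrightarrow> v \<in> cA \<Longrightarrow> lin u v \<in> adjoin_y" by (auto simp: adjoin_y_def)

lemma \<iota>_in_adjoin_y: "u \<in> cA \<Longrightarrow> \<iota> u \<in> adjoin_y" using lin_in_adjoin_y[of u zA] by simp

lemma adjoin_yE: assumes "x \<in> adjoin_y" obtains u v where "u \<in> cA" "v \<in> cA" "x = lin u v"
  using assms by (auto simp: adjoin_y_def)

lemma adjoin_y_subring: "subring adjoin_y R"
proof (rule subringI)
  show "adjoin_y \<subseteq> carrier R" by (auto simp: adjoin_y_def)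
  show "\<one> \<in> adjoin_y" using \<iota>_in_adjoin_y[of oA] by simp
  fix x assume "x \<in> adjoin_y"
  then obtain u v where x: "u \<in> cA" "v \<in> cA" "x = lin u v" by (rule adjoin_yE)
  show "\<ominus> x \<in> adjoin_y" using x lin_uminus lin_in_adjoin_y by simp
  fix z assume "z \<in> adjoin_y"
  then obtain u' v' where z: "u' \<in> cA" "v' \<in> cA" "z = lin u' v'" by (rule adjoin_yE)
  show "x \<otimes> z \<in> adjoin_y" using x z lin_mult lin_in_adjoin_y by simp
  show "x \<oplus> z \<in> adjoin_y" using x z lin_add lin_in_adjoin_y by simp
qed

lemma adjoin_y_frac:
  assumes "z \<in> carrier R" shows "\<exists>a\<in>adjoin_y. \<exists>b\<in>adjoin_y. b \<noteq> \<zero> \<and> z \<otimes> b = a"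
proof -
  obtain u v w where "u \<in> cA" "v \<in> cA" "w \<in> cA" "w \<noteq> zA" "z \<otimes> \<iota> w = lin u v"
    using rep[OF assms] unfolding lin_def by blast
  then show ?thesis using \<iota>_in_adjoin_y \<iota>_nonzero lin_in_adjoin_y by metis
qed

lemma psubset_adjoin_y: assumes "C \<subseteq> \<iota> ` cA" shows "C \<subset> adjoin_y"
proof -
  have "y \<notin> \<iota> ` cA"
  proof
    assume "y \<in> \<iota> ` cA"
    then obtain u where u: "u \<in> cA" "y = \<iota> u" by blast
    have "lin zA oA = lin u zA" unfolding lin_y lin_zero_right[OF u(1)] by (rule u(2))
    with u(1) have "oA = zA" using lin_inj[of zA oA u zA] by blast
    then show False by simp
  qed
  moreover have "y \<in> adjoin_y" using lin_in_adjoin_y[of zA oA] by simp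
  ultimately show ?thesis using assms \<iota>_in_adjoin_y by blast
qed

definition lin_norm :: "'c \<Rightarrow> 'c \<Rightarrow> 'c" where "lin_norm u v = u .* u .- f .* (v .* v)"

lemma lin_norm_closed [simp]: "u \<in> cA \<Longrightarrow> v \<in> cA \<Longrightarrow> lin_norm u v \<in> cA"
  by (simp add: lin_norm_def)

lemma lin_mult_conj:
  assumes uv: "u \<in> cA" "v \<in> cA" shows "lin u v \<otimes> lin u (.~ v) = \<iota> (lin_norm u v)"
proof -
  have "u .* u .+ f .* (v .* .~ v) = lin_norm u v" using uv
    by (simp add: lin_norm_def a_minus_def A.r_minus)
  moreover have "u .* .~ v .+ v .* u = zA" using uv by (simp add: A.r_minus A.m_comm A.l_neg)
  ultimately show ?thesis using uv by (simp add: lin_mult)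
qed

end

text \<open>\<open>\<delta>\<close> plays the role of the degree: it decreases when the prime \<open>\<pi>\<close> is cancelled.\<close>

locale quad_place = quad_ext R A \<iota> y f
  for R (structure) and A (structure) and \<iota> y f +
  fixes \<pi> :: 'c and \<delta> :: "'c \<Rightarrow> nat" and reps :: "'c set"
  assumes \<pi> [simp]: "\<pi> \<in> carrier A" and \<pi>_nonzero: "\<pi> \<noteq> \<zero>\<^bsub>A\<^esub>" and \<pi>_not_unit: "\<not> \<pi> divides\<^bsub>A\<^esub> \<one>\<^bsub>A\<^esub>"
    and inverse_mod: "u \<in> carrier A \<Longrightarrow> \<not> \<pi> divides\<^bsub>A\<^esub> u \<Longrightarrow> \<exists>w\<in>carrier A. \<pi> divides\<^bsub>A\<^esub> (u \<otimes>\<^bsub>A\<^esub> w \<ominus>\<^bsub>A\<^esub> \<one>\<^bsub>A\<^esub>)"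
    and \<delta>_less: "w \<in> carrier A \<Longrightarrow> w \<noteq> \<zero>\<^bsub>A\<^esub> \<Longrightarrow> \<delta> w < \<delta> (\<pi> \<otimes>\<^bsub>A\<^esub> w)"
    and f_squarefree: "\<not> (\<pi> \<otimes>\<^bsub>A\<^esub> \<pi>) divides\<^bsub>A\<^esub> f"
    and reps: "reps \<subseteq> carrier A"
    and reps_exists: "u \<in> carrier A \<Longrightarrow> \<exists>x\<in>reps. \<pi> divides\<^bsub>A\<^esub> (u \<ominus>\<^bsub>A\<^esub> x)"
    and reps_unique: "x \<in> reps \<Longrightarrow> x' \<in> reps \<Longrightarrow> \<pi> divides\<^bsub>A\<^esub> (x \<ominus>\<^bsub>A\<^esub> x') \<Longrightarrow> x = x'"
begin

definition pi_dvd :: "'c \<Rightarrow> bool" where "pi_dvd u \<longleftrightarrow> \<pi> divides\<^bsub>A\<^esub> u"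

lemma pi_dvdE: assumes "pi_dvd u" "u \<in> cA" obtains w where "w \<in> cA" "u = \<pi> .* w"
  using assms by (auto simp: pi_dvd_def factor_def)

lemma pi_dvdI: "w \<in> cA \<Longrightarrow> pi_dvd (\<pi> .* w)" by (auto simp: pi_dvd_def factor_def)

lemma pi_dvd_self: "pi_dvd \<pi>" using pi_dvdI[of oA] by simp

lemma pi_dvd_zero [simp]: "pi_dvd zA" using pi_dvdI[of zA] by simp

lemma pi_dvd_one: "\<not> pi_dvd oA" using \<pi>_not_unit by (simp add: pi_dvd_def)

lemma pi_dvd_mult_right: "u \<in> cA \<Longrightarrow> w \<in> cA \<Longrightarrow> pi_dvd u \<Longrightarrow> pi_dvd (u .* w)"
  using pi_dvdI by (auto elim!: pi_dvdE simp: A.m_assoc)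

lemma pi_dvd_mult_left: "u \<in> cA \<Longrightarrow> w \<in> cA \<Longrightarrow> pi_dvd u \<Longrightarrow> pi_dvd (w .* u)"
  using pi_dvd_mult_right[of u w] by (simp add: A.m_comm)

lemma pi_dvd_add: assumes "u \<in> cA" "w \<in> cA" "pi_dvd u" "pi_dvd w" shows "pi_dvd (u .+ w)"
proof -
  obtain u' w' where "u' \<in> cA" "u = \<pi> .* u'" "w' \<in> cA" "w = \<pi> .* w'"
    using assms by (metis pi_dvdE)
  then show ?thesis using pi_dvdI[of "u' .+ w'"] by (simp add: A.r_distr)
qed

lemma pi_dvd_uminus: assumes "u \<in> cA" "pi_dvd u" shows "pi_dvd (.~ u)"
proof -
  obtain u' where "u' \<in> cA" "u = \<pi> .* u'" using assms by (metis pi_dvdE)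
  then show ?thesis using pi_dvdI[of ".~ u'"] by (simp add: A.r_minus)
qed

lemma pi_dvd_minus: "u \<in> cA \<Longrightarrow> w \<in> cA \<Longrightarrow> pi_dvd u \<Longrightarrow> pi_dvd w \<Longrightarrow> pi_dvd (u .- w)"
  unfolding a_minus_def by (intro pi_dvd_add pi_dvd_uminus) auto

lemma pi_dvd_cong: assumes uw: "u \<in> cA" "w \<in> cA" and diff: "pi_dvd (u .- w)"
  shows "pi_dvd u \<longleftrightarrow> pi_dvd w"
proof
  assume "pi_dvd w"
  then have "pi_dvd ((u .- w) .+ w)" using uw diff pi_dvd_add[of "u .- w" w] by simp
  then show "pi_dvd u" using uw by (simp add: A.diff_add_cancel)
next
  assume "pi_dvd u"
  then have "pi_dvd (u .- (u .- w))" using uw diff pi_dvd_minus[of u "u .- w"] by simp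
  then show "pi_dvd w" using uw by (simp add: A.diff_diff_cancel)
qed

lemma pi_dvd_prime: assumes uw: "u \<in> cA" "w \<in> cA" "pi_dvd (u .* w)" shows "pi_dvd u \<or> pi_dvd w"
proof (rule ccontr)
  assume "\<not> (pi_dvd u \<or> pi_dvd w)"
  then obtain u' where u': "u' \<in> cA" "pi_dvd (u .* u' .- oA)" and w: "\<not> pi_dvd w"
    using inverse_mod[OF uw(1)] by (auto simp: pi_dvd_def)
  have "pi_dvd (u' .* (u .* w) .- w .* (u .* u' .- oA))"
    by (rule pi_dvd_minus[OF _ _ pi_dvd_mult_left pi_dvd_mult_left]) (use uw u' in auto)
  also have "u' .* (u .* w) .- w .* (u .* u' .- oA) = w"
    by (rule A.eqI_diff, use uw(1,2) u'(1) in algebra) (use uw u' in auto)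
  finally show False using w by simp
qed

lemma pi_dvd_double: assumes u: "u \<in> cA" "pi_dvd (u .+ u)" shows "pi_dvd u"
proof -
  let ?two = "oA .+ oA"
  have two: "?two \<in> cA" "inv\<^bsub>A\<^esub> ?two \<in> cA" "?two .* inv\<^bsub>A\<^esub> ?two = oA"
    using two_unit A.Units_r_inv A.Units_inv_closed by auto
  have "u .+ u = ?two .* u" using u by (simp add: A.l_distr)
  then have "pi_dvd ?two \<or> pi_dvd u" using pi_dvd_prime[OF two(1) u(1)] u(2) by simp
  moreover have "\<not> pi_dvd ?two" using pi_dvd_mult_right[OF two(1,2)] two(3) pi_dvd_one by auto
  ultimately show ?thesis by simp
qed

lemma \<pi>_pow: "\<pi> .^ (n::nat) \<in> cA" "\<pi> .^ n \<noteq> zA"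
  using \<pi>_nonzero by (auto simp: A.nat_pow_eq_0_iff)

lemma exists_primitive_pair:
  assumes "u \<in> cA" "v \<in> cA" "\<not> (u = zA \<and> v = zA)"
  shows "\<exists>n::nat. \<exists>u0\<in>cA. \<exists>v0\<in>cA. u = \<pi> .^ n .* u0 \<and> v = \<pi> .^ n .* v0 \<and> \<not> (pi_dvd u0 \<and> pi_dvd v0)"
  using assms
proof (induction "(if u = zA then 0 else \<delta> u) + (if v = zA then 0 else \<delta> v)" arbitrary: u v rule: less_induct)
  case less
  show ?case
  proof (cases "pi_dvd u \<and> pi_dvd v")
    case False
    have "u = \<pi> .^ (0::nat) .* u \<and> v = \<pi> .^ (0::nat) .* v" using less by simp
    then show ?thesis using False less.prems by blast
  next
    case True
    obtain u' v' where uv': "u' \<in> cA" "u = \<pi> .* u'" "v' \<in> cA" "v = \<pi> .* v'"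
      using True less.prems by (metis pi_dvdE)
    have nonzero: "\<not> (u' = zA \<and> v' = zA)" using less.prems uv' by auto
    have "\<delta> u' < \<delta> u" if "u' \<noteq> zA" using that \<delta>_less[of u'] uv' by simp
    moreover have "\<delta> v' < \<delta> v" if "v' \<noteq> zA" using that \<delta>_less[of v'] uv' by simp
    moreover have "u = zA \<longleftrightarrow> u' = zA" "v = zA \<longleftrightarrow> v' = zA"
      using uv' \<pi>_nonzero A.integral[of \<pi> u'] A.integral[of \<pi> v'] by auto
    ultimately have "(if u' = zA then 0 else \<delta> u') + (if v' = zA then 0 else \<delta> v')
        < (if u = zA then 0 else \<delta> u) + (if v = zA then 0 else \<delta> v)"
      using nonzero by auto
    then obtain n :: nat and u0 v0 where primitive: "u0 \<in> cA" "v0 \<in> cA" "u' = \<pi> .^ n .* u0"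
      "v' = \<pi> .^ n .* v0" "\<not> (pi_dvd u0 \<and> pi_dvd v0)"
      using less.hyps[OF _ uv'(1,3) nonzero] by blast
    then have "u = \<pi> .^ Suc n .* u0" "v = \<pi> .^ Suc n .* v0"
      unfolding uv'(2,4) by (simp_all add: A.m_ac)
    then show ?thesis using primitive by blast
  qed
qed

lemma exists_coprime_factor:
  assumes "u \<in> cA" "u \<noteq> zA"
  shows "\<exists>n::nat. \<exists>u0\<in>cA. u = \<pi> .^ n .* u0 \<and> \<not> pi_dvd u0"
proof -
  obtain n :: nat and u0 v0
    where uv: "u0 \<in> cA" "v0 \<in> cA" "u = \<pi> .^ n .* u0" "zA = \<pi> .^ n .* v0" "\<not> (pi_dvd u0 \<and> pi_dvd v0)"
    using exists_primitive_pair[of u zA] assms by auto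
  have "v0 = zA" using uv(4) [symmetric] uv(2) A.integral[of "\<pi> .^ n" v0] \<pi>_pow[of n] by auto
  then show ?thesis using uv by auto
qed

lemma local_valuation_adjoin_yI:
  assumes "local_ideal R adjoin_y m" and \<tau>: "\<tau> \<in> m" "\<tau> \<noteq> \<zero>"
    and \<pi>_assoc: "local_ideal.assoc_power R adjoin_y m \<tau> (\<iota> \<pi>)"
    and primitive_assoc: "\<And>u v. u \<in> cA \<Longrightarrow> v \<in> cA \<Longrightarrow> \<not> (pi_dvd u \<and> pi_dvd v)
      \<Longrightarrow> local_ideal.assoc_power R adjoin_y m \<tau> (lin u v)"
  shows "local_valuation R adjoin_y m \<tau>"
proof -
  interpret M: local_ideal R adjoin_y m by (rule assms(1))
  have "M.assoc_power \<tau> x" if x: "x \<in> adjoin_y" "x \<noteq> \<zero>" for x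
  proof -
    obtain u v where uv: "u \<in> cA" "v \<in> cA" "x = lin u v" using adjoin_yE[OF x(1)] .
    then have "\<not> (u = zA \<and> v = zA)" using x lin_zero_iff by auto
    then obtain n :: nat and u0 v0 where uv0: "u0 \<in> cA" "v0 \<in> cA" "u = \<pi> .^ n .* u0" "v = \<pi> .^ n .* v0"
      "\<not> (pi_dvd u0 \<and> pi_dvd v0)" using exists_primitive_pair[OF uv(1,2)] by blast
    have "x = \<iota> \<pi> [^] n \<otimes> lin u0 v0"
      using uv(3) uv0 \<iota>_mult_lin[OF \<pi>_pow(1)[of n] uv0(1,2)] by (simp add: I.hom_nat_pow)
    moreover have "\<tau> \<in> carrier R" using M.A_carrier M.m_subset \<tau> by auto
    ultimately show ?thesis
      using M.assoc_power_mult M.assoc_power_pow \<pi>_assoc primitive_assoc[OF uv0(1,2,5)] uv0(1,2) by simp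
  qed
  then show ?thesis
    by (intro local_valuation.intro M.local_ideal_axioms local_valuation_axioms.intro adjoin_y_frac \<tau>)
qed

text \<open>If \<open>s\<close> is a square root of \<open>f\<close> modulo \<open>\<pi>\<close>, then \<open>split_ideal s\<close> is the kernel of the map to
  \<open>A / \<pi>\<close> sending \<open>y\<close> to \<open>s\<close>.\<close>

definition split_ideal :: "'c \<Rightarrow> 'a set" where
  "split_ideal s = {lin u v | u v. u \<in> cA \<and> v \<in> cA \<and> pi_dvd (u .+ v .* s)}"

definition inert_ideal :: "'a set" where
  "inert_ideal = {lin u v | u v. u \<in> cA \<and> v \<in> cA \<and> pi_dvd u \<and> pi_dvd v}"

lemma split_ideal_iff: "u \<in> cA \<Longrightarrow> v \<in> cA \<Longrightarrow> lin u v \<in> split_ideal s \<longleftrightarrow> pi_dvd (u .+ v .* s)"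
  unfolding split_ideal_def using lin_inj by blast

lemma inert_ideal_iff: "u \<in> cA \<Longrightarrow> v \<in> cA \<Longrightarrow> lin u v \<in> inert_ideal \<longleftrightarrow> pi_dvd u \<and> pi_dvd v"
  unfolding inert_ideal_def using lin_inj by blast

lemma \<iota>_in_split_ideal_iff: "u \<in> cA \<Longrightarrow> s \<in> cA \<Longrightarrow> \<iota> u \<in> split_ideal s \<longleftrightarrow> pi_dvd u"
  using split_ideal_iff[of u zA s] by simp

lemma \<iota>_in_inert_ideal_iff: "u \<in> cA \<Longrightarrow> \<iota> u \<in> inert_ideal \<longleftrightarrow> pi_dvd u"
  using inert_ideal_iff[of u zA] by simp

abbreviation "split_ring s \<equiv> local_valuation.localization R adjoin_y (split_ideal s)"
abbreviation "inert_ring \<equiv> local_valuation.localization R adjoin_y inert_ideal"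

lemma sqrt_mod_cong:
  assumes closed: "r \<in> cA" "t \<in> cA" and congruent: "pi_dvd (r .- t)" and root: "pi_dvd (r .* r .- f)"
  shows "pi_dvd (t .* t .- f)"
proof -
  have f_closed: "f \<in> cA" by simp
  have "(r .* r .- f) .- (t .* t .- f) = (r .- t) .* (r .+ t)"
    by (rule A.eqI_diff, use closed f_closed in algebra) (use closed in auto)
  then have "pi_dvd ((r .* r .- f) .- (t .* t .- f))"
    using pi_dvd_mult_right[OF _ _ congruent] closed by simp
  then show ?thesis using pi_dvd_cong[of "r .* r .- f" "t .* t .- f"] root closed by simp
qed

context
  fixes s
  assumes s: "s \<in> cA" and root: "pi_dvd (s .* s .- f)"
begin

lemma split_ideal_mult_iff:
  assumes closed: "u \<in> cA" "v \<in> cA" "u' \<in> cA" "v' \<in> cA"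
  shows "lin u v \<otimes> lin u' v' \<in> split_ideal s \<longleftrightarrow> pi_dvd ((u .+ v .* s) .* (u' .+ v' .* s))"
proof -
  have f_closed: "f \<in> cA" by simp
  have "((u .* u' .+ f .* (v .* v')) .+ (u .* v' .+ v .* u') .* s) .- ((u .+ v .* s) .* (u' .+ v' .* s))
      = (.~ (v .* v')) .* (s .* s .- f)"
    by (rule A.eqI_diff, use closed s f_closed in algebra) (use closed s in auto)
  moreover have "pi_dvd ((.~ (v .* v')) .* (s .* s .- f))"
    using closed s root by (intro pi_dvd_mult_left) auto
  ultimately have "pi_dvd ((u .* u' .+ f .* (v .* v')) .+ (u .* v' .+ v .* u') .* s)
      \<longleftrightarrow> pi_dvd ((u .+ v .* s) .* (u' .+ v' .* s))"
    using closed s by (intro pi_dvd_cong) auto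
  then show ?thesis using closed by (simp add: lin_mult split_ideal_iff)
qed

lemma exists_inverse_mod_split_ideal:
  assumes "x \<in> adjoin_y" "x \<notin> split_ideal s" shows "\<exists>w\<in>adjoin_y. x \<otimes> w \<ominus> \<one> \<in> split_ideal s"
proof -
  obtain u v where uv: "u \<in> cA" "v \<in> cA" "x = lin u v" using adjoin_yE[OF assms(1)] .
  have "\<not> pi_dvd (u .+ v .* s)" using assms(2) uv split_ideal_iff by blast
  then obtain w where w: "w \<in> cA" "pi_dvd ((u .+ v .* s) .* w .- oA)"
    using inverse_mod[of "u .+ v .* s"] uv s by (auto simp: pi_dvd_def)
  have "x \<otimes> \<iota> w \<ominus> \<one> = lin (w .* u) (w .* v) \<ominus> lin oA zA"
    using uv w \<iota>_mult_lin[of w u v] by (simp add: m_comm)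
  also have "\<dots> = lin (w .* u .- oA) (w .* v)"
    using lin_minus[of "w .* u" "w .* v" oA zA] uv w by (simp add: a_minus_def)
  finally have difference: "x \<otimes> \<iota> w \<ominus> \<one> = lin (w .* u .- oA) (w .* v)" .
  have "(w .* u .- oA) .+ (w .* v) .* s = (u .+ v .* s) .* w .- oA"
    by (rule A.eqI_diff, use uv(1,2) w(1) s in algebra) (use uv w s in auto)
  then have "x \<otimes> \<iota> w \<ominus> \<one> \<in> split_ideal s" unfolding difference
    using uv w by (simp add: split_ideal_iff)
  then show ?thesis using \<iota>_in_adjoin_y[OF w(1)] by blast
qed

lemma local_ideal_split: "local_ideal R adjoin_y (split_ideal s)"
proof (intro local_ideal.intro local_ideal_axioms.intro field_axioms adjoin_y_subring exists_inverse_mod_split_ideal)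
  show "split_ideal s \<subseteq> adjoin_y" using lin_in_adjoin_y by (auto simp: split_ideal_def)
  show "\<zero> \<in> split_ideal s" "\<one> \<notin> split_ideal s"
    using \<iota>_in_split_ideal_iff[of zA s] \<iota>_in_split_ideal_iff[of oA s] s pi_dvd_one by simp_all
  fix x z assume z: "z \<in> split_ideal s"
  then obtain u' v' where uv': "u' \<in> cA" "v' \<in> cA" "pi_dvd (u' .+ v' .* s)" "z = lin u' v'"
    by (auto simp: split_ideal_def)
  {
    assume "x \<in> split_ideal s"
    then obtain u v where uv: "u \<in> cA" "v \<in> cA" "pi_dvd (u .+ v .* s)" "x = lin u v"
      by (auto simp: split_ideal_def)
    have "pi_dvd ((u .+ v .* s) .+ (u' .+ v' .* s))" by (rule pi_dvd_add) (use uv uv' s in auto)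
    then show "x \<oplus> z \<in> split_ideal s"
      using uv uv' s by (simp add: lin_add split_ideal_iff A.linear_add_linear(1))
  }
  assume "x \<in> adjoin_y"
  then obtain u v where uv: "u \<in> cA" "v \<in> cA" "x = lin u v" by (rule adjoin_yE)
  have "pi_dvd ((u .+ v .* s) .* (u' .+ v' .* s))" using uv uv' s by (intro pi_dvd_mult_left) auto
  then show "x \<otimes> z \<in> split_ideal s" using uv uv' by (simp add: split_ideal_mult_iff)
qed

interpretation M: local_ideal R adjoin_y "split_ideal s" by (rule local_ideal_split)

lemma \<iota>_coprime_in_compl: "u \<in> cA \<Longrightarrow> \<not> pi_dvd u \<Longrightarrow> \<iota> u \<in> adjoin_y - split_ideal s"
  using \<iota>_in_adjoin_y \<iota>_in_split_ideal_iff s by auto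

text \<open>When \<open>2 s\<close> is a unit modulo \<open>\<pi>\<close>, the conjugate of a primitive element of the ideal lies outside it,
  so the element is associated to its norm.\<close>

lemma assoc_power_split_unramified:
  assumes unram: "\<not> pi_dvd s" and uv: "u \<in> cA" "v \<in> cA" "\<not> (pi_dvd u \<and> pi_dvd v)"
  shows "M.assoc_power (\<iota> \<pi>) (lin u v)"
proof (cases "lin u v \<in> split_ideal s")
  case False
  then show ?thesis using lin_in_adjoin_y uv by (intro M.assoc_power_unit) auto
next
  case True
  then have split: "pi_dvd (u .+ v .* s)" using split_ideal_iff uv by blast
  have conj_notin: "lin u (.~ v) \<notin> split_ideal s"
  proof
    assume "lin u (.~ v) \<in> split_ideal s"
    then have "pi_dvd (u .+ .~ v .* s)" using split_ideal_iff uv by simp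
    then have "pi_dvd ((u .+ v .* s) .+ (u .+ .~ v .* s))"
      by (rule pi_dvd_add[rotated 3]) (use split uv s in auto)
    also have "(u .+ v .* s) .+ (u .+ .~ v .* s) = u .+ u"
      by (rule A.eqI_diff, use uv(1,2) s in algebra) (use uv s in auto)
    finally have "pi_dvd u" using pi_dvd_double uv by blast
    then have "pi_dvd (v .* s)" using pi_dvd_minus[OF _ _ split \<open>pi_dvd u\<close>] uv s
      by (simp add: A.add_diff_cancel_left')
    then have "pi_dvd v" using pi_dvd_prime[OF uv(2) s] unram by blast
    then show False using \<open>pi_dvd u\<close> uv by blast
  qed
  let ?N = "lin_norm u v"
  have "lin u v \<noteq> \<zero>" "lin u (.~ v) \<noteq> \<zero>"
    using lin_zero_iff[OF uv(1,2)] uv(3) M.zero_in_m conj_notin by auto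
  then have "\<iota> ?N \<noteq> \<zero>" unfolding lin_mult_conj[OF uv(1,2), symmetric]
    using uv by (simp add: integral_iff)
  then have "?N \<noteq> zA" by auto
  then obtain k :: nat and c where c: "c \<in> cA" "?N = \<pi> .^ k .* c" "\<not> pi_dvd c"
    using exists_coprime_factor[of ?N] uv by auto
  show ?thesis
  proof (rule M.assoc_powerI)
    show "\<iota> c \<in> adjoin_y - split_ideal s" using \<iota>_coprime_in_compl c by blast
    show "lin u (.~ v) \<in> adjoin_y - split_ideal s" using conj_notin lin_in_adjoin_y uv by simp
    show "lin u v \<otimes> lin u (.~ v) = \<iota> \<pi> [^] k \<otimes> \<iota> c"
      unfolding lin_mult_conj[OF uv(1,2)] c(2) using c(1) by (simp add: I.hom_nat_pow)
  qed
qed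

lemma pi_dvd_f_iff: "pi_dvd f \<longleftrightarrow> pi_dvd s"
proof -
  have "pi_dvd (s .* s) \<longleftrightarrow> pi_dvd f" by (rule pi_dvd_cong) (use s root in auto)
  then show ?thesis using pi_dvd_prime[OF s s] pi_dvd_mult_right[OF s s] by auto
qed

context
  assumes ram: "pi_dvd s"
begin

lemma exists_cofactor_f: obtains g where "g \<in> cA" "f = \<pi> .* g" "\<not> pi_dvd g"
proof -
  obtain g where g: "g \<in> cA" "f = \<pi> .* g" using pi_dvdE[OF pi_dvd_f_iff[THEN iffD2, OF ram] f] .
  have "\<not> pi_dvd g"
  proof
    assume "pi_dvd g"
    then obtain h where "h \<in> cA" "g = \<pi> .* h" using g by (metis pi_dvdE)
    then have "f = (\<pi> .* \<pi>) .* h" using g by (simp add: A.m_assoc)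
    then show False using f_squarefree \<open>h \<in> cA\<close> by (auto simp: factor_def)
  qed
  then show thesis using that g by blast
qed

lemma assoc_power_\<pi>_ramified: "M.assoc_power y (\<iota> \<pi>)"
proof -
  obtain g where g: "g \<in> cA" "f = \<pi> .* g" "\<not> pi_dvd g" by (rule exists_cofactor_f)
  then have "\<iota> \<pi> \<otimes> \<iota> g = y [^] (2::nat) \<otimes> \<one>" using y_sq by (simp add: power2_eq_square)
  then show ?thesis using M.assoc_powerI[OF M.one_compl \<iota>_coprime_in_compl] g by blast
qed

text \<open>If \<open>\<pi>\<close> divides \<open>u\<close>, then \<open>u + v y\<close> is divisible by \<open>y\<close> after multiplication by the unit \<open>f / \<pi>\<close>.\<close>

lemma assoc_power_split_ramified:
  assumes uv: "u \<in> cA" "v \<in> cA" "\<not> (pi_dvd u \<and> pi_dvd v)"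
  shows "M.assoc_power y (lin u v)"
proof (cases "pi_dvd u")
  case False
  have "pi_dvd (u .+ v .* s .- u)" using pi_dvd_mult_left[OF s uv(2) ram] uv s
    by (simp add: A.add_diff_cancel_left')
  then have "\<not> pi_dvd (u .+ v .* s)" using pi_dvd_cong[of "u .+ v .* s" u] False uv s by simp
  then show ?thesis using split_ideal_iff lin_in_adjoin_y uv by (intro M.assoc_power_unit) auto
next
  case True
  obtain g where g: "g \<in> cA" "f = \<pi> .* g" "\<not> pi_dvd g" by (rule exists_cofactor_f)
  obtain w where w: "w \<in> cA" "u = \<pi> .* w" using pi_dvdE[OF True uv(1)] .
  have "lin u v \<otimes> \<iota> g = lin (g .* u) (g .* v)"
    using \<iota>_mult_lin[OF g(1) uv(1,2)] uv g by (simp add: m_comm)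
  also have "g .* u = f .* w" unfolding w(2) g(2) using w g by (simp add: A.m_ac)
  also have "lin (f .* w) (g .* v) = y [^] (1::nat) \<otimes> lin (g .* v) w"
    using lin_mult[of zA oA "g .* v" w] w g uv by simp
  finally have "lin u v \<otimes> \<iota> g = y [^] (1::nat) \<otimes> lin (g .* v) w" .
  moreover have "lin (g .* v) w \<notin> split_ideal s"
  proof
    assume "lin (g .* v) w \<in> split_ideal s"
    then have "pi_dvd (g .* v .+ w .* s)" using split_ideal_iff w g uv by simp
    then have "pi_dvd (g .* v .+ w .* s .- w .* s)"
      by (rule pi_dvd_minus[rotated 2]) (use pi_dvd_mult_left[OF s w(1) ram] w g uv s in auto)
    then have "pi_dvd (g .* v)" using w g uv s by (simp add: A.add_diff_cancel)
    then show False using pi_dvd_prime[OF g(1) uv(2)] g uv True by blast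
  qed
  then have "lin (g .* v) w \<in> adjoin_y - split_ideal s" using lin_in_adjoin_y w g uv by simp
  ultimately show ?thesis using M.assoc_powerI[OF _ \<iota>_coprime_in_compl[OF g(1,3)]] by blast
qed

end

lemma local_valuation_split: "local_valuation R adjoin_y (split_ideal s) (if pi_dvd s then y else \<iota> \<pi>)"
proof (rule local_valuation_adjoin_yI[OF local_ideal_split])
  show "(if pi_dvd s then y else \<iota> \<pi>) \<in> split_ideal s"
    using split_ideal_iff[of zA oA s] \<iota>_in_split_ideal_iff[of \<pi> s] s pi_dvd_self by simp
  show "(if pi_dvd s then y else \<iota> \<pi>) \<noteq> \<zero>"
    using lin_zero_iff[of zA oA] \<iota>_nonzero[OF \<pi> \<pi>_nonzero] by auto
qed (use assoc_power_\<pi>_ramified assoc_power_split_ramified assoc_power_split_unramified M.assoc_power_self in auto)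

end

end

context field
begin

lemma nonunits_closed:
  assumes V: "valuation_ring R C V"
  shows "x \<in> nonunits V \<Longrightarrow> z \<in> V \<Longrightarrow> x \<otimes> z \<in> nonunits V" "x \<in> nonunits V \<Longrightarrow> \<ominus> x \<in> nonunits V"
proof -
  interpret N: ideal "nonunits V" "R\<lparr>carrier := V\<rparr>" by (rule nonunits_ideal[OF V])
  show "x \<in> nonunits V \<Longrightarrow> z \<in> V \<Longrightarrow> x \<otimes> z \<in> nonunits V" using N.I_r_closed[of x z] by simp
  assume x: "x \<in> nonunits V"
  then have "x \<in> V" "x \<in> carrier R" using valuation_ringD(3)[OF V] by (auto simp: nonunits_def)
  moreover have "\<ominus> \<one> \<in> V" using subringE(3,5)[OF valuation_ringD(1)[OF V]] by auto
  ultimately show "\<ominus> x \<in> nonunits V" using nonunits_mult[OF V _ x, of "\<ominus> \<one>"] by (simp add: l_minus)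
qed

lemma nonunits_cong:
  assumes V: "valuation_ring R C V" and closed: "x \<in> carrier R" "z \<in> carrier R" and diff: "x \<ominus> z \<in> nonunits V"
  shows "x \<in> nonunits V \<longleftrightarrow> z \<in> nonunits V"
proof
  assume "z \<in> nonunits V"
  then have "(x \<ominus> z) \<oplus> z \<in> nonunits V" by (rule nonunits_add[OF V diff])
  then show "x \<in> nonunits V" using closed by (simp add: diff_add_cancel)
next
  assume "x \<in> nonunits V"
  then have "x \<oplus> \<ominus> (x \<ominus> z) \<in> nonunits V"
    using nonunits_add[OF V] nonunits_closed(2)[OF V] diff by blast
  then show "z \<in> nonunits V" using diff_diff_cancel[OF closed] by (simp add: a_minus_def)
qed

lemma nonunits_prime:
  assumes V: "valuation_ring R C V" and x: "x \<in> V" "z \<in> V" "x \<otimes> z \<in> nonunits V"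
  shows "x \<in> nonunits V \<or> z \<in> nonunits V"
proof (rule ccontr)
  assume neither: "\<not> ?thesis"
  then have inv_x: "inv x \<in> V" "x \<noteq> \<zero>" using x by (auto simp: nonunits_def)
  have "inv x \<otimes> (x \<otimes> z) \<in> nonunits V" using nonunits_mult[OF V inv_x(1)] x by simp
  moreover have "x \<in> carrier R" "z \<in> carrier R" using x valuation_ringD(3)[OF V] by auto
  ultimately show False using neither inv_x by (simp add: m_assoc [symmetric])
qed

lemma valuation_ring_sqrt:
  assumes V: "valuation_ring R C V" and z: "z \<in> carrier R" "z \<otimes> z \<in> V" shows "z \<in> V"
proof (rule ccontr)
  note VD = valuation_ringD[OF V]
  assume notin: "z \<notin> V"
  then have nonzero: "z \<noteq> \<zero>" using subringE(2)[OF VD(1)] by auto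
  then have "inv z \<in> V" using VD(5)[OF z(1)] notin by blast
  then have "(z \<otimes> z) \<otimes> inv z \<in> V" using subringE(6)[OF VD(1)] z by blast
  then show False using notin z nonzero by (simp add: m_assoc)
qed

end

context quad_ext
begin

lemma \<iota>_in_above: "\<iota> ` cA \<subseteq> W \<Longrightarrow> u \<in> cA \<Longrightarrow> \<iota> u \<in> W" by auto

context
  fixes C W
  assumes W: "valuation_ring R C W" and A_W: "\<iota> ` cA \<subseteq> W"
begin

lemma y_in_above: "y \<in> W"
  using valuation_ring_sqrt[OF W y] \<iota>_in_above[OF A_W f] unfolding y_sq by blast

lemma adjoin_y_subset_above: "adjoin_y \<subseteq> W"
  using y_in_above subringE(6,7)[OF valuation_ringD(1)[OF W]] \<iota>_in_above[OF A_W]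
  by (auto simp: adjoin_y_def lin_def)

end

end

context quad_place
begin

lemma \<iota>_nonunit_iff:
  assumes W: "valuation_ring R C W" and A_W: "\<iota> ` cA \<subseteq> W"
    and \<pi>_W: "\<iota> \<pi> \<in> nonunits W" and u: "u \<in> cA" shows "\<iota> u \<in> nonunits W \<longleftrightarrow> pi_dvd u"
proof -
  have dvd_nonunit: "\<iota> c \<in> nonunits W" if "c \<in> cA" "pi_dvd c" for c
  proof -
    obtain w where "w \<in> cA" "c = \<pi> .* w" using \<open>pi_dvd c\<close> \<open>c \<in> cA\<close> by (rule pi_dvdE)
    then show ?thesis using nonunits_closed(1)[OF W \<pi>_W \<iota>_in_above[OF A_W]] by simp
  qed
  have "pi_dvd u" if "\<iota> u \<in> nonunits W"
  proof (rule ccontr)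
    assume "\<not> pi_dvd u"
    then obtain w where w: "w \<in> cA" "pi_dvd (u .* w .- oA)"
      using inverse_mod[OF u] by (auto simp: pi_dvd_def)
    have "\<iota> u \<otimes> \<iota> w \<ominus> \<one> \<in> nonunits W" using dvd_nonunit[OF _ w(2)] u w by (simp add: \<iota>_minus)
    then have "\<iota> u \<otimes> \<iota> w \<in> nonunits W \<longleftrightarrow> \<one> \<in> nonunits W"
      using u w by (intro nonunits_cong[OF W]) auto
    then show False
      using nonunits_closed(1)[OF W that \<iota>_in_above[OF A_W w(1)]] one_not_nonunit[OF W] by blast
  qed
  then show ?thesis using dvd_nonunit[OF u] by blast
qed

lemma card_residue_split:
  assumes C: "C \<subseteq> \<iota> ` cA" and s: "s \<in> cA" and root: "pi_dvd (s .* s .- f)"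
  shows "card (carrier (R\<lparr>carrier := split_ring s\<rparr> Quot nonunits (split_ring s))) = card reps"
proof -
  interpret L: local_valuation R adjoin_y "split_ideal s" "if pi_dvd s then y else \<iota> \<pi>"
    by (rule local_valuation_split[OF s root])
  have rep_closed: "t \<in> cA" if "t \<in> reps" for t using that reps by auto
  have "card (carrier (R\<lparr>carrier := L.localization\<rparr> Quot nonunits L.localization)) = card (\<iota> ` reps)"
  proof (rule L.card_residue_field_localization[OF psubset_adjoin_y[OF C]])
    show "\<iota> ` reps \<subseteq> adjoin_y" using \<iota>_in_adjoin_y rep_closed by auto
    fix z assume "z \<in> adjoin_y"
    then obtain u v where uv: "u \<in> cA" "v \<in> cA" "z = lin u v" by (rule adjoin_yE)
    obtain x where x: "x \<in> reps" "pi_dvd (u .+ v .* s .- x)"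
      using reps_exists[of "u .+ v .* s"] uv s by (auto simp: pi_dvd_def)
    note x_closed = rep_closed[OF x(1)]
    have "z \<ominus> \<iota> x = lin (u .- x) v"
      using lin_minus[OF uv(1,2) x_closed A.zero_closed] uv x_closed by (simp add: a_minus_def)
    moreover have "(u .- x) .+ v .* s = u .+ v .* s .- x"
      using uv x_closed s by (simp add: a_minus_def A.a_ac)
    ultimately have "z \<ominus> \<iota> x \<in> split_ideal s"
      using split_ideal_iff[of "u .- x" v s] uv x_closed x by simp
    then show "\<exists>x\<in>\<iota> ` reps. z \<ominus> x \<in> split_ideal s" using x by blast
  next
    fix z z' assume "z \<in> \<iota> ` reps" "z' \<in> \<iota> ` reps" and congruent: "z \<ominus> z' \<in> split_ideal s"
    then obtain x x' where x: "x \<in> reps" "x' \<in> reps" "z = \<iota> x" "z' = \<iota> x'" by auto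
    then have "pi_dvd (x .- x')"
      using congruent \<iota>_in_split_ideal_iff[of "x .- x'" s] rep_closed s by (simp add: \<iota>_minus)
    then show "z = z'" using reps_unique[OF x(1,2)] x by (simp add: pi_dvd_def)
  qed
  also have "\<dots> = card reps" using inj_on_\<iota> reps by (intro card_image) (rule inj_on_subset)
  finally show ?thesis .
qed

lemma above_split:
  assumes W: "valuation_ring R C W" and A_W: "\<iota> ` cA \<subseteq> W" and \<pi>_W: "\<iota> \<pi> \<in> nonunits W"
    and s: "s \<in> cA" and root: "pi_dvd (s .* s .- f)" and y_s: "y \<ominus> \<iota> s \<in> nonunits W"
  shows "W = split_ring s"
proof -
  interpret L: local_valuation R adjoin_y "split_ideal s" "if pi_dvd s then y else \<iota> \<pi>"
    by (rule local_valuation_split[OF s root])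
  show ?thesis
  proof (rule L.localization_unique[OF W adjoin_y_subset_above[OF W A_W]])
    fix x assume "x \<in> adjoin_y"
    then obtain u v where uv: "u \<in> cA" "v \<in> cA" "x = lin u v" by (rule adjoin_yE)
    let ?c = "u .+ v .* s"
    have closed: "\<iota> u \<in> carrier R" "\<iota> v \<in> carrier R" "\<iota> s \<in> carrier R" "y \<in> carrier R"
      using uv s by auto
    have "lin u v \<ominus> \<iota> ?c = (\<iota> u \<oplus> \<iota> v \<otimes> y) \<ominus> (\<iota> u \<oplus> \<iota> v \<otimes> \<iota> s)" using uv s by (simp add: lin_def)
    also have "\<dots> = \<iota> v \<otimes> (y \<ominus> \<iota> s)" by (rule eqI_diff, use closed in algebra) (use closed in auto)
    also have "\<dots> \<in> nonunits W" using nonunits_mult[OF W \<iota>_in_above[OF A_W uv(2)] y_s] .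
    finally have "x \<in> nonunits W \<longleftrightarrow> \<iota> ?c \<in> nonunits W" using nonunits_cong[OF W] uv s by simp
    also have "\<dots> \<longleftrightarrow> pi_dvd ?c" using \<iota>_nonunit_iff[OF W A_W \<pi>_W, of ?c] uv s by blast
    finally show "x \<in> nonunits W \<longleftrightarrow> x \<in> split_ideal s" using split_ideal_iff uv by simp
  qed
qed

lemma exists_split_above:
  assumes W: "valuation_ring R C W" and A_W: "\<iota> ` cA \<subseteq> W" and \<pi>_W: "\<iota> \<pi> \<in> nonunits W"
    and s: "s \<in> cA" and root: "pi_dvd (s .* s .- f)"
  shows "\<exists>t\<in>reps. pi_dvd (t .* t .- f) \<and> W = split_ring t"
proof -
  note nonunit_iff = \<iota>_nonunit_iff[OF W A_W \<pi>_W]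
  have neg_sq: "(.~ s) .* (.~ s) = s .* s" using s by (simp add: A.l_minus A.r_minus)
  have "(y \<ominus> \<iota> s) \<otimes> (y \<oplus> \<iota> s) = \<ominus> \<iota> (s .* s .- f)"
    using s y_sq by (simp add: diff_mult_add \<iota>_minus) (simp add: a_minus_def minus_add a_comm)
  also have "\<dots> \<in> nonunits W"
    using nonunits_closed(2)[OF W] nonunit_iff[of "s .* s .- f"] s root by simp
  finally have "y \<ominus> \<iota> s \<in> nonunits W \<or> y \<oplus> \<iota> s \<in> nonunits W"
    using subringE(5,7)[OF valuation_ringD(1)[OF W]] y_in_above[OF W A_W] \<iota>_in_above[OF A_W s]
    by (intro nonunits_prime[OF W]) (auto simp: a_minus_def)
  then have "y \<ominus> \<iota> s \<in> nonunits W \<or> y \<ominus> \<iota> (.~ s) \<in> nonunits W" using s by (simp add: a_minus_def)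
  then obtain r where r: "r \<in> cA" "pi_dvd (r .* r .- f)" "y \<ominus> \<iota> r \<in> nonunits W"
    using s root neg_sq by (metis A.a_inv_closed)
  obtain t where t: "t \<in> reps" "pi_dvd (r .- t)"
    using reps_exists[OF r(1)] by (auto simp: pi_dvd_def)
  have t_closed: "t \<in> cA" using t reps by auto
  have "y \<ominus> \<iota> t = (y \<ominus> \<iota> r) \<oplus> (\<iota> r \<ominus> \<iota> t)" using r t_closed by (intro diff_eq_diff_add_diff) auto
  also have "\<dots> \<in> nonunits W"
    using nonunits_add[OF W r(3)] nonunit_iff[of "r .- t"] t(2) r(1) t_closed by (simp add: \<iota>_minus)
  finally have "W = split_ring t" using sqrt_mod_cong[OF r(1) t_closed t(2) r(2)] t_closed
    by (intro above_split[OF W A_W \<pi>_W])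
  then show ?thesis using t sqrt_mod_cong[OF r(1) t_closed t(2) r(2)] by blast
qed

lemma split_ring_valuation:
  assumes C: "C \<subseteq> \<iota> ` cA" and s: "s \<in> cA" and root: "pi_dvd (s .* s .- f)"
  shows "valuation_ring R C (split_ring s)" "\<iota> ` cA \<subseteq> split_ring s" "\<iota> \<pi> \<in> nonunits (split_ring s)"
proof -
  interpret L: local_valuation R adjoin_y "split_ideal s" "if pi_dvd s then y else \<iota> \<pi>"
    by (rule local_valuation_split[OF s root])
  show "valuation_ring R C L.localization"
    by (rule L.valuation_ring_localization[OF psubset_adjoin_y[OF C]])
  show "\<iota> ` cA \<subseteq> L.localization" using L.A_localization \<iota>_in_adjoin_y by auto
  show "\<iota> \<pi> \<in> nonunits L.localization"
    using L.nonunits_localization_A[OF \<iota>_in_adjoin_y[OF \<pi>]] \<iota>_in_split_ideal_iff[OF \<pi> s] pi_dvd_self by simp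
qed

lemma inj_split_ring: "inj_on split_ring {s \<in> reps. pi_dvd (s .* s .- f)}"
proof (rule inj_onI)
  fix s t assume "s \<in> {s \<in> reps. pi_dvd (s .* s .- f)}"
    "t \<in> {s \<in> reps. pi_dvd (s .* s .- f)}" and rings_eq: "split_ring s = split_ring t"
  then have st: "s \<in> reps" "pi_dvd (s .* s .- f)" "t \<in> reps" "pi_dvd (t .* t .- f)" by auto
  then have closed: "s \<in> cA" "t \<in> cA" using reps by auto
  interpret S: local_valuation R adjoin_y "split_ideal s" "if pi_dvd s then y else \<iota> \<pi>"
    by (rule local_valuation_split[OF closed(1) st(2)])
  interpret T: local_valuation R adjoin_y "split_ideal t" "if pi_dvd t then y else \<iota> \<pi>"
    by (rule local_valuation_split[OF closed(2) st(4)])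
  let ?x = "lin (.~ s) oA"
  have x: "?x \<in> adjoin_y" using lin_in_adjoin_y closed by simp
  have "?x \<in> split_ideal s" using split_ideal_iff[of ".~ s" oA s] closed by (simp add: A.l_neg)
  then have "?x \<in> split_ideal t"
    using S.nonunits_localization_A[OF x] T.nonunits_localization_A[OF x] rings_eq by simp
  then have "pi_dvd (t .- s)" using split_ideal_iff[of ".~ s" oA t] closed
    by (simp add: a_minus_def A.a_comm)
  then show "s = t" using reps_unique st by (auto simp: pi_dvd_def)
qed

context
  assumes no_sqrt: "\<And>s. s \<in> cA \<Longrightarrow> \<not> pi_dvd (s .* s .- f)"
begin

lemma pi_dvd_lin_normD:
  assumes uv: "u \<in> cA" "v \<in> cA" and norm: "pi_dvd (lin_norm u v)"
  shows "pi_dvd u \<and> pi_dvd v"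
proof -
  have f_closed: "f \<in> cA" by simp
  have "pi_dvd v"
  proof (rule ccontr)
    assume "\<not> pi_dvd v"
    then obtain w where w: "w \<in> cA" "pi_dvd (v .* w .- oA)"
      using inverse_mod[OF uv(2)] by (auto simp: pi_dvd_def)
    have "pi_dvd ((w .* w) .* lin_norm u v .+ (f .* (v .* w .+ oA)) .* (v .* w .- oA))"
      by (rule pi_dvd_add[OF _ _ pi_dvd_mult_left pi_dvd_mult_left]) (use uv w norm in auto)
    also have "(w .* w) .* lin_norm u v .+ (f .* (v .* w .+ oA)) .* (v .* w .- oA)
        = (u .* w) .* (u .* w) .- f"
      unfolding lin_norm_def
      by (rule A.eqI_diff, use uv w(1) f_closed in algebra) (use uv w in auto)
    finally show False using no_sqrt[of "u .* w"] uv w by simp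
  qed
  moreover have "pi_dvd (u .* u) \<longleftrightarrow> pi_dvd (f .* (v .* v))"
    using uv norm by (intro pi_dvd_cong) (auto simp: lin_norm_def)
  moreover have "pi_dvd (f .* (v .* v))" using \<open>pi_dvd v\<close> uv by (intro pi_dvd_mult_left) auto
  ultimately show ?thesis using pi_dvd_prime[OF uv(1,1)] by blast
qed

lemma exists_inverse_mod_inert_ideal:
  assumes "x \<in> adjoin_y" "x \<notin> inert_ideal" shows "\<exists>w\<in>adjoin_y. x \<otimes> w \<ominus> \<one> \<in> inert_ideal"
proof -
  obtain u v where uv: "u \<in> cA" "v \<in> cA" "x = lin u v" using adjoin_yE[OF assms(1)] .
  have "\<not> pi_dvd (lin_norm u v)"
    using pi_dvd_lin_normD[OF uv(1,2)] assms uv inert_ideal_iff by blast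
  then obtain w where w: "w \<in> cA" "pi_dvd (lin_norm u v .* w .- oA)"
    using inverse_mod[of "lin_norm u v"] uv by (auto simp: pi_dvd_def)
  let ?w = "lin u (.~ v) \<otimes> \<iota> w"
  have "x \<otimes> ?w \<ominus> \<one> = \<iota> (lin_norm u v .* w .- oA)"
    using uv w lin_mult_conj[OF uv(1,2)] by (simp add: m_assoc [symmetric] \<iota>_minus)
  also have "\<dots> \<in> inert_ideal" using uv w \<iota>_in_inert_ideal_iff by simp
  finally have "x \<otimes> ?w \<ominus> \<one> \<in> inert_ideal" .
  moreover have "?w \<in> adjoin_y"
    using subringE(6)[OF adjoin_y_subring] lin_in_adjoin_y[of u ".~ v"] \<iota>_in_adjoin_y[OF w(1)] uv by simp
  ultimately show ?thesis by blast
qed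

lemma local_ideal_inert: "local_ideal R adjoin_y inert_ideal"
proof (intro local_ideal.intro local_ideal_axioms.intro field_axioms adjoin_y_subring exists_inverse_mod_inert_ideal)
  show "inert_ideal \<subseteq> adjoin_y" using lin_in_adjoin_y by (auto simp: inert_ideal_def)
  show "\<zero> \<in> inert_ideal" "\<one> \<notin> inert_ideal"
    using \<iota>_in_inert_ideal_iff[of zA] \<iota>_in_inert_ideal_iff[of oA] pi_dvd_one by simp_all
  fix x z assume z: "z \<in> inert_ideal"
  then obtain u' v' where uv': "u' \<in> cA" "v' \<in> cA" "pi_dvd u'" "pi_dvd v'" "z = lin u' v'"
    by (auto simp: inert_ideal_def)
  {
    assume "x \<in> inert_ideal"
    then obtain u v where uv: "u \<in> cA" "v \<in> cA" "pi_dvd u" "pi_dvd v" "x = lin u v"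
      by (auto simp: inert_ideal_def)
    then show "x \<oplus> z \<in> inert_ideal" using uv' pi_dvd_add by (simp add: lin_add inert_ideal_iff)
  }
  assume "x \<in> adjoin_y"
  then obtain u v where uv: "u \<in> cA" "v \<in> cA" "x = lin u v" by (rule adjoin_yE)
  have "pi_dvd (u .* u' .+ f .* (v .* v'))" "pi_dvd (u .* v' .+ v .* u')"
    using uv uv' by (auto intro!: pi_dvd_add pi_dvd_mult_left)
  then show "x \<otimes> z \<in> inert_ideal" using uv uv' by (simp add: lin_mult inert_ideal_iff)
qed

lemma local_valuation_inert: "local_valuation R adjoin_y inert_ideal (\<iota> \<pi>)"
proof (rule local_valuation_adjoin_yI[OF local_ideal_inert])
  interpret M: local_ideal R adjoin_y inert_ideal by (rule local_ideal_inert)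
  show "\<iota> \<pi> \<in> inert_ideal" "\<iota> \<pi> \<noteq> \<zero>"
    using \<iota>_in_inert_ideal_iff[OF \<pi>] pi_dvd_self \<iota>_nonzero[OF \<pi> \<pi>_nonzero] by auto
  show "M.assoc_power (\<iota> \<pi>) (\<iota> \<pi>)" by (rule M.assoc_power_self) simp
  show "M.assoc_power (\<iota> \<pi>) (lin u v)" if "u \<in> cA" "v \<in> cA" "\<not> (pi_dvd u \<and> pi_dvd v)" for u v
    using that inert_ideal_iff lin_in_adjoin_y by (intro M.assoc_power_unit) auto
qed

lemma card_residue_inert:
  assumes C: "C \<subseteq> \<iota> ` cA"
  shows "card (carrier (R\<lparr>carrier := inert_ring\<rparr> Quot nonunits inert_ring)) = card reps ^ 2"
proof -
  interpret L: local_valuation R adjoin_y inert_ideal "\<iota> \<pi>" by (rule local_valuation_inert)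
  have rep_closed: "t \<in> cA" if "t \<in> reps" for t using that reps by auto
  let ?T = "(\<lambda>(u, v). lin u v) ` (reps \<times> reps)"
  have "card (carrier (R\<lparr>carrier := L.localization\<rparr> Quot nonunits L.localization)) = card ?T"
  proof (rule L.card_residue_field_localization[OF psubset_adjoin_y[OF C]])
    show "?T \<subseteq> adjoin_y" using lin_in_adjoin_y rep_closed by auto
    fix z assume "z \<in> adjoin_y"
    then obtain u v where uv: "u \<in> cA" "v \<in> cA" "z = lin u v" by (rule adjoin_yE)
    obtain x where x: "x \<in> reps" "pi_dvd (u .- x)"
      using reps_exists[of u] uv by (auto simp: pi_dvd_def)
    obtain x' where x': "x' \<in> reps" "pi_dvd (v .- x')"
      using reps_exists[of v] uv by (auto simp: pi_dvd_def)
    have "z \<ominus> lin x x' \<in> inert_ideal"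
      using lin_minus[of u v x x'] uv x x' inert_ideal_iff[of "u .- x" "v .- x'"] rep_closed by simp
    then show "\<exists>x\<in>?T. z \<ominus> x \<in> inert_ideal" using x x' by blast
  next
    fix z z' assume "z \<in> ?T" "z' \<in> ?T" and congruent: "z \<ominus> z' \<in> inert_ideal"
    then obtain u v u' v'
      where x: "u \<in> reps" "v \<in> reps" "u' \<in> reps" "v' \<in> reps" "z = lin u v" "z' = lin u' v'" by auto
    have "pi_dvd (u .- u')" "pi_dvd (v .- v')"
      using congruent lin_minus[of u v u' v'] x rep_closed inert_ideal_iff[of "u .- u'" "v .- v'"] by auto
    then show "z = z'" using reps_unique[OF x(1,3)] reps_unique[OF x(2,4)] x
      by (simp add: pi_dvd_def)
  qed
  also have "\<dots> = card (reps \<times> reps)"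
  proof (intro card_image inj_onI, clarify)
    fix u v u' v' assume "u \<in> reps" "v \<in> reps" "u' \<in> reps" "v' \<in> reps" "lin u v = lin u' v'"
    then show "u = u' \<and> v = v'" using lin_inj[of u v u' v'] rep_closed by simp
  qed
  finally show ?thesis by (simp add: card_cartesian_product Power.power2_eq_square)
qed

lemma above_inert:
  assumes W: "valuation_ring R C W" and A_W: "\<iota> ` cA \<subseteq> W" and \<pi>_W: "\<iota> \<pi> \<in> nonunits W"
  shows "W = inert_ring"
proof -
  note adjoin_W = adjoin_y_subset_above[OF W A_W] and nonunit_iff = \<iota>_nonunit_iff[OF W A_W \<pi>_W]
  interpret L: local_valuation R adjoin_y inert_ideal "\<iota> \<pi>" by (rule local_valuation_inert)
  show ?thesis
  proof (rule L.localization_unique[OF W adjoin_W])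
    fix x assume "x \<in> adjoin_y"
    then obtain u v where uv: "u \<in> cA" "v \<in> cA" "x = lin u v" by (rule adjoin_yE)
    show "x \<in> nonunits W \<longleftrightarrow> x \<in> inert_ideal"
    proof
      assume "x \<in> nonunits W"
      moreover have "lin u (.~ v) \<in> W" using adjoin_W lin_in_adjoin_y uv by auto
      ultimately have "\<iota> (lin_norm u v) \<in> nonunits W"
        using nonunits_closed(1)[OF W, of x "lin u (.~ v)"] lin_mult_conj[OF uv(1,2)] uv(3) by simp
      then have "pi_dvd (lin_norm u v)" using nonunit_iff uv by simp
      then show "x \<in> inert_ideal"
        using pi_dvd_lin_normD[OF uv(1,2)] inert_ideal_iff[OF uv(1,2)] uv(3) by blast
    next
      assume "x \<in> inert_ideal"
      then have "\<iota> u \<in> nonunits W" "\<iota> v \<in> nonunits W" using inert_ideal_iff uv nonunit_iff by auto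
      then show "x \<in> nonunits W"
        unfolding uv(3) lin_def
        using nonunits_add[OF W] nonunits_closed(1)[OF W] y_in_above[OF W A_W] by auto
    qed
  qed
qed

lemma inert_ring_valuation:
  assumes C: "C \<subseteq> \<iota> ` cA"
  shows "valuation_ring R C inert_ring" "\<iota> ` cA \<subseteq> inert_ring" "\<iota> \<pi> \<in> nonunits inert_ring"
proof -
  interpret L: local_valuation R adjoin_y inert_ideal "\<iota> \<pi>" by (rule local_valuation_inert)
  show "valuation_ring R C L.localization"
    by (rule L.valuation_ring_localization[OF psubset_adjoin_y[OF C]])
  show "\<iota> ` cA \<subseteq> L.localization" using L.A_localization \<iota>_in_adjoin_y by auto
  show "\<iota> \<pi> \<in> nonunits L.localization"
    using L.nonunits_localization_A[OF \<iota>_in_adjoin_y[OF \<pi>]] \<iota>_in_inert_ideal_iff[OF \<pi>] pi_dvd_self by simp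
qed

end

end

section \<open>Fraction fields\<close>

lemma UN_pairs_const:
  assumes "p \<in> S" "p' \<in> T" "\<And>a b c d. (a, b) \<in> S \<Longrightarrow> (c, d) \<in> T \<Longrightarrow> g a b c d = Z"
  shows "(\<Union>(a, b)\<in>S. \<Union>(c, d)\<in>T. g a b c d) = Z"
proof -
  have "(\<Union>(a, b)\<in>S. \<Union>(c, d)\<in>T. g a b c d) = (\<Union>x\<in>S. \<Union>y\<in>T. Z)"
    using assms(3) by (intro SUP_cong refl) (auto split: prod.splits)
  then show ?thesis using assms(1,2) by auto
qed

context domain
begin

lemma frac_class_eq:
  "a \<in> carrier R \<Longrightarrow> b \<in> carrier R - {\<zero>} \<Longrightarrow>
   frac_class R a b = {(c, d). c \<in> carrier R \<and> d \<in> carrier R - {\<zero>} \<and> a \<otimes> d = c \<otimes> b}"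
  unfolding frac_class_def frac_rel_def by auto

lemma frac_class_eq_iff:
  assumes "a \<in> carrier R" "b \<in> carrier R - {\<zero>}" "c \<in> carrier R" "d \<in> carrier R - {\<zero>}"
  shows "frac_class R a b = frac_class R c d \<longleftrightarrow> a \<otimes> d = c \<otimes> b"
proof
  assume "frac_class R a b = frac_class R c d"
  moreover have "(c, d) \<in> frac_class R c d" using assms by (simp add: frac_class_eq)
  ultimately have "(c, d) \<in> frac_class R a b" by simp
  then show "a \<otimes> d = c \<otimes> b" using assms by (simp add: frac_class_eq)
next
  have cross_trans: "c \<otimes> g = e \<otimes> d"
    if cross: "a \<in> carrier R" "b \<in> carrier R - {\<zero>}" "c \<in> carrier R" "d \<in> carrier R - {\<zero>}" "a \<otimes> d = c \<otimes> b"
      "e \<in> carrier R" "g \<in> carrier R - {\<zero>}" "a \<otimes> g = e \<otimes> b" for a b c d e g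
  proof -
    have "b \<otimes> (c \<otimes> g) = (c \<otimes> b) \<otimes> g" using cross by (simp add: m_ac)
    also have "\<dots> = (a \<otimes> g) \<otimes> d" unfolding cross(5) [symmetric]
      using cross(1-4,6,7) by (simp add: m_ac)
    also have "\<dots> = b \<otimes> (e \<otimes> d)" unfolding cross(8) using cross(1-4,6,7) by (simp add: m_ac)
    finally show ?thesis using cross by (simp add: m_lcancel)
  qed
  assume cross_eq: "a \<otimes> d = c \<otimes> b"
  show "frac_class R a b = frac_class R c d"
    unfolding frac_class_eq[OF assms(1,2)] frac_class_eq[OF assms(3,4)]
    using cross_trans[OF assms cross_eq] cross_trans[OF assms(3,4,1,2) cross_eq[symmetric]] by blast
qed

lemma frac_class_mem:
  "a \<in> carrier R \<Longrightarrow> b \<in> carrier R - {\<zero>} \<Longrightarrow> (a', b') \<in> frac_class R a b \<longleftrightarrow>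
   a' \<in> carrier R \<and> b' \<in> carrier R - {\<zero>} \<and> a \<otimes> b' = a' \<otimes> b"
  by (simp add: frac_class_eq)

lemma nonzero_mult: "b \<in> carrier R - {\<zero>} \<Longrightarrow> d \<in> carrier R - {\<zero>} \<Longrightarrow> b \<otimes> d \<in> carrier R - {\<zero>}"
  using integral by auto

lemma frac_mult:
  assumes "a \<in> carrier R" "b \<in> carrier R - {\<zero>}" "c \<in> carrier R" "d \<in> carrier R - {\<zero>}"
  shows "frac_class R a b \<otimes>\<^bsub>fraction_field R\<^esub> frac_class R c d = frac_class R (a \<otimes> c) (b \<otimes> d)"
proof -
  have well_defined: "frac_class R (a' \<otimes> c') (b' \<otimes> d') = frac_class R (a \<otimes> c) (b \<otimes> d)"
    if "(a', b') \<in> frac_class R a b" "(c', d') \<in> frac_class R c d" for a' b' c' d'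
  proof (subst frac_class_eq_iff)
    have reps: "a' \<in> carrier R" "b' \<in> carrier R - {\<zero>}" "a \<otimes> b' = a' \<otimes> b"
      "c' \<in> carrier R" "d' \<in> carrier R - {\<zero>}" "c \<otimes> d' = c' \<otimes> d"
        using that assms by (auto simp: frac_class_mem)
    then show "a' \<otimes> c' \<in> carrier R" "b' \<otimes> d' \<in> carrier R - {\<zero>}" "a \<otimes> c \<in> carrier R" "b \<otimes> d \<in> carrier R - {\<zero>}"
      using assms nonzero_mult by auto
    have "(a' \<otimes> c') \<otimes> (b \<otimes> d) = (a' \<otimes> b) \<otimes> (c' \<otimes> d)" using reps(1,2,4,5) assms by (simp add: m_ac)
    also have "\<dots> = (a \<otimes> c) \<otimes> (b' \<otimes> d')" unfolding reps(3) [symmetric] reps(6) [symmetric]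
      using reps(1,2,4,5) assms by (simp add: m_ac)
    finally show "a' \<otimes> c' \<otimes> (b \<otimes> d) = a \<otimes> c \<otimes> (b' \<otimes> d')" .
  qed
  have members: "(a, b) \<in> frac_class R a b" "(c, d) \<in> frac_class R c d"
    using assms by (auto simp: frac_class_mem)
  show ?thesis
    unfolding fraction_field_def by (simp, rule UN_pairs_const[OF members well_defined])
qed

lemma frac_add:
  assumes "a \<in> carrier R" "b \<in> carrier R - {\<zero>}" "c \<in> carrier R" "d \<in> carrier R - {\<zero>}"
  shows "frac_class R a b \<oplus>\<^bsub>fraction_field R\<^esub> frac_class R c d = frac_class R (a \<otimes> d \<oplus> c \<otimes> b) (b \<otimes> d)"
proof -
  have well_defined: "frac_class R (a' \<otimes> d' \<oplus> c' \<otimes> b') (b' \<otimes> d') = frac_class R (a \<otimes> d \<oplus> c \<otimes> b) (b \<otimes> d)"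
    if "(a', b') \<in> frac_class R a b" "(c', d') \<in> frac_class R c d" for a' b' c' d'
  proof (subst frac_class_eq_iff)
    have reps: "a' \<in> carrier R" "b' \<in> carrier R - {\<zero>}" "a \<otimes> b' = a' \<otimes> b"
      "c' \<in> carrier R" "d' \<in> carrier R - {\<zero>}" "c \<otimes> d' = c' \<otimes> d"
        using that assms by (auto simp: frac_class_mem)
    then show "a' \<otimes> d' \<oplus> c' \<otimes> b' \<in> carrier R" "b' \<otimes> d' \<in> carrier R - {\<zero>}"
      "a \<otimes> d \<oplus> c \<otimes> b \<in> carrier R" "b \<otimes> d \<in> carrier R - {\<zero>}"
      using assms nonzero_mult by auto
    have "(a' \<otimes> d' \<oplus> c' \<otimes> b') \<otimes> (b \<otimes> d) = (a' \<otimes> b) \<otimes> (d \<otimes> d') \<oplus> (c' \<otimes> d) \<otimes> (b \<otimes> b')"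
      using reps(1,2,4,5) assms by (simp add: l_distr r_distr m_ac)
    also have "\<dots> = (a \<otimes> d \<oplus> c \<otimes> b) \<otimes> (b' \<otimes> d')"
      unfolding reps(3) [symmetric] reps(6) [symmetric]
      using reps(1,2,4,5) assms by (simp add: l_distr r_distr m_ac)
    finally show "(a' \<otimes> d' \<oplus> c' \<otimes> b') \<otimes> (b \<otimes> d) = (a \<otimes> d \<oplus> c \<otimes> b) \<otimes> (b' \<otimes> d')" .
  qed
  have members: "(a, b) \<in> frac_class R a b" "(c, d) \<in> frac_class R c d"
    using assms by (auto simp: frac_class_mem)
  show ?thesis
    unfolding fraction_field_def by (simp, rule UN_pairs_const[OF members well_defined])
qed

lemma frac_carrier: "carrier (fraction_field R)
    = {frac_class R a b | a b. a \<in> carrier R \<and> b \<in> carrier R - {\<zero>}}"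
  and frac_zero: "\<zero>\<^bsub>fraction_field R\<^esub> = frac_class R \<zero> \<one>"
  and frac_one: "\<one>\<^bsub>fraction_field R\<^esub> = frac_class R \<one> \<one>"
  by (simp_all add: fraction_field_def)

lemma frac_closed: "a \<in> carrier R \<Longrightarrow> b \<in> carrier R - {\<zero>} \<Longrightarrow> frac_class R a b \<in> carrier (fraction_field R)"
  unfolding frac_carrier by blast

lemma fracE:
  assumes "z \<in> carrier (fraction_field R)"
  obtains a b where "a \<in> carrier R" "b \<in> carrier R - {\<zero>}" "z = frac_class R a b"
  using assms unfolding frac_carrier by blast

lemma one_nonzero: "\<one> \<in> carrier R - {\<zero>}" by simp

lemma add_cross_closed:
  "a \<in> carrier R \<Longrightarrow> b \<in> carrier R - {\<zero>} \<Longrightarrow> c \<in> carrier R \<Longrightarrow> d \<in> carrier R - {\<zero>} \<Longrightarrow> a \<otimes> d \<oplus> c \<otimes> b \<in> carrier R"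
  by auto

lemma abelian_group_fraction_field: "abelian_group (fraction_field R)"
proof (rule abelian_groupI)
  let ?F = "fraction_field R"
  fix x y assume "x \<in> carrier ?F" "y \<in> carrier ?F"
  then obtain a b c d where xy: "a \<in> carrier R" "b \<in> carrier R - {\<zero>}" "c \<in> carrier R" "d \<in> carrier R - {\<zero>}"
    "x = frac_class R a b" "y = frac_class R c d" by (metis fracE)
  show "x \<oplus>\<^bsub>?F\<^esub> y \<in> carrier ?F" unfolding xy(5,6) frac_add[OF xy(1-4)]
    by (intro frac_closed add_cross_closed nonzero_mult xy)
  show "x \<oplus>\<^bsub>?F\<^esub> y = y \<oplus>\<^bsub>?F\<^esub> x"
    unfolding xy(5,6) frac_add[OF xy(1-4)] frac_add[OF xy(3,4,1,2)]
    using xy by (simp add: m_comm a_comm)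
  fix z assume "z \<in> carrier ?F"
  then obtain e g where z: "e \<in> carrier R" "g \<in> carrier R - {\<zero>}" "z = frac_class R e g"
    by (rule fracE)
  have "x \<oplus>\<^bsub>?F\<^esub> y \<oplus>\<^bsub>?F\<^esub> z = frac_class R ((a \<otimes> d \<oplus> c \<otimes> b) \<otimes> g \<oplus> e \<otimes> (b \<otimes> d)) ((b \<otimes> d) \<otimes> g)"
    unfolding xy(5,6) z(3) frac_add[OF xy(1-4)]
    by (intro frac_add add_cross_closed nonzero_mult xy z)
  moreover have "x \<oplus>\<^bsub>?F\<^esub> (y \<oplus>\<^bsub>?F\<^esub> z) = frac_class R (a \<otimes> (d \<otimes> g) \<oplus> (c \<otimes> g \<oplus> e \<otimes> d) \<otimes> b) (b \<otimes> (d \<otimes> g))"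
    unfolding xy(5,6) z(3) frac_add[OF xy(3,4) z(1,2)]
    by (intro frac_add add_cross_closed nonzero_mult xy z)
  moreover have "(a \<otimes> d \<oplus> c \<otimes> b) \<otimes> g \<oplus> e \<otimes> (b \<otimes> d) = a \<otimes> (d \<otimes> g) \<oplus> (c \<otimes> g \<oplus> e \<otimes> d) \<otimes> b"
    using xy z by (simp add: l_distr r_distr m_ac a_ac)
  ultimately show "x \<oplus>\<^bsub>?F\<^esub> y \<oplus>\<^bsub>?F\<^esub> z = x \<oplus>\<^bsub>?F\<^esub> (y \<oplus>\<^bsub>?F\<^esub> z)" using xy z by (simp add: m_assoc)
next
  let ?F = "fraction_field R"
  show "\<zero>\<^bsub>?F\<^esub> \<in> carrier ?F" unfolding frac_zero by (rule frac_closed) auto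
  fix x assume "x \<in> carrier ?F"
  then obtain a b where x: "a \<in> carrier R" "b \<in> carrier R - {\<zero>}" "x = frac_class R a b"
    by (rule fracE)
  show "\<zero>\<^bsub>?F\<^esub> \<oplus>\<^bsub>?F\<^esub> x = x"
    unfolding x(3) frac_zero frac_add[OF zero_closed one_nonzero x(1,2)] using x by simp
  have "frac_class R (\<ominus> a) b \<oplus>\<^bsub>?F\<^esub> x = frac_class R (\<ominus> a \<otimes> b \<oplus> a \<otimes> b) (b \<otimes> b)"
    unfolding x(3) by (intro frac_add x a_inv_closed)
  also have "\<dots> = \<zero>\<^bsub>?F\<^esub>"
    unfolding frac_zero using x nonzero_mult[OF x(2,2)]
    by (subst frac_class_eq_iff) (auto simp: l_minus l_neg)
  finally show "\<exists>y\<in>carrier ?F. y \<oplus>\<^bsub>?F\<^esub> x = \<zero>\<^bsub>?F\<^esub>" using frac_closed[of "\<ominus> a" b] x by auto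
qed

lemma comm_monoid_fraction_field: "comm_monoid (fraction_field R)"
proof (rule comm_monoidI)
  let ?F = "fraction_field R"
  fix x y assume "x \<in> carrier ?F" "y \<in> carrier ?F"
  then obtain a b c d where xy: "a \<in> carrier R" "b \<in> carrier R - {\<zero>}" "c \<in> carrier R" "d \<in> carrier R - {\<zero>}"
    "x = frac_class R a b" "y = frac_class R c d" by (metis fracE)
  show "x \<otimes>\<^bsub>?F\<^esub> y \<in> carrier ?F" unfolding xy(5,6) frac_mult[OF xy(1-4)]
    by (intro frac_closed m_closed nonzero_mult xy)
  show "x \<otimes>\<^bsub>?F\<^esub> y = y \<otimes>\<^bsub>?F\<^esub> x"
    unfolding xy(5,6) frac_mult[OF xy(1-4)] frac_mult[OF xy(3,4,1,2)] using xy by (simp add: m_comm)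
  fix z assume "z \<in> carrier ?F"
  then obtain e g where z: "e \<in> carrier R" "g \<in> carrier R - {\<zero>}" "z = frac_class R e g"
    by (rule fracE)
  have "x \<otimes>\<^bsub>?F\<^esub> y \<otimes>\<^bsub>?F\<^esub> z = frac_class R (a \<otimes> c \<otimes> e) (b \<otimes> d \<otimes> g)"
    unfolding xy(5,6) z(3) frac_mult[OF xy(1-4)] by (intro frac_mult m_closed nonzero_mult xy z)
  moreover have "x \<otimes>\<^bsub>?F\<^esub> (y \<otimes>\<^bsub>?F\<^esub> z) = frac_class R (a \<otimes> (c \<otimes> e)) (b \<otimes> (d \<otimes> g))"
    unfolding xy(5,6) z(3) frac_mult[OF xy(3,4) z(1,2)]
    by (intro frac_mult m_closed nonzero_mult xy z)
  ultimately show "x \<otimes>\<^bsub>?F\<^esub> y \<otimes>\<^bsub>?F\<^esub> z = x \<otimes>\<^bsub>?F\<^esub> (y \<otimes>\<^bsub>?F\<^esub> z)" using xy z by (simp add: m_assoc)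
next
  let ?F = "fraction_field R"
  show "\<one>\<^bsub>?F\<^esub> \<in> carrier ?F" unfolding frac_one by (rule frac_closed) auto
  fix x assume "x \<in> carrier ?F"
  then obtain a b where x: "a \<in> carrier R" "b \<in> carrier R - {\<zero>}" "x = frac_class R a b"
    by (rule fracE)
  show "\<one>\<^bsub>?F\<^esub> \<otimes>\<^bsub>?F\<^esub> x = x"
    unfolding x(3) frac_one frac_mult[OF one_closed one_nonzero x(1,2)] using x by simp
qed

lemma cring_fraction_field: "cring (fraction_field R)"
proof (rule cringI[OF abelian_group_fraction_field comm_monoid_fraction_field])
  let ?F = "fraction_field R"
  fix x y z assume "x \<in> carrier ?F" "y \<in> carrier ?F" "z \<in> carrier ?F"
  then obtain a b c d e g
    where xyz: "a \<in> carrier R" "b \<in> carrier R - {\<zero>}" "c \<in> carrier R" "d \<in> carrier R - {\<zero>}"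
    "e \<in> carrier R" "g \<in> carrier R - {\<zero>}"
    "x = frac_class R a b" "y = frac_class R c d" "z = frac_class R e g" by (metis fracE)
  have "(x \<oplus>\<^bsub>?F\<^esub> y) \<otimes>\<^bsub>?F\<^esub> z = frac_class R ((a \<otimes> d \<oplus> c \<otimes> b) \<otimes> e) (b \<otimes> d \<otimes> g)"
    unfolding xyz(7-9) frac_add[OF xyz(1-4)] by (intro frac_mult add_cross_closed nonzero_mult xyz)
  also have "\<dots> = frac_class R ((a \<otimes> e) \<otimes> (d \<otimes> g) \<oplus> (c \<otimes> e) \<otimes> (b \<otimes> g)) ((b \<otimes> g) \<otimes> (d \<otimes> g))"
    by (subst frac_class_eq_iff) (use xyz nonzero_mult in \<open>auto simp: l_distr r_distr m_ac integral_iff\<close>)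
  also have "\<dots> = x \<otimes>\<^bsub>?F\<^esub> z \<oplus>\<^bsub>?F\<^esub> y \<otimes>\<^bsub>?F\<^esub> z"
    unfolding xyz(7-9) frac_mult[OF xyz(1,2,5,6)] frac_mult[OF xyz(3-6)]
    by (rule frac_add[symmetric]) (intro m_closed nonzero_mult xyz)+
  finally show "(x \<oplus>\<^bsub>?F\<^esub> y) \<otimes>\<^bsub>?F\<^esub> z = x \<otimes>\<^bsub>?F\<^esub> z \<oplus>\<^bsub>?F\<^esub> y \<otimes>\<^bsub>?F\<^esub> z" .
qed

theorem field_fraction_field: "field (fraction_field R)"
proof (rule cring.cring_fieldI2[OF cring_fraction_field])
  let ?F = "fraction_field R"
  show "\<zero>\<^bsub>?F\<^esub> \<noteq> \<one>\<^bsub>?F\<^esub>" unfolding frac_zero frac_one by (subst frac_class_eq_iff) auto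
  fix x assume x: "x \<in> carrier ?F" "x \<noteq> \<zero>\<^bsub>?F\<^esub>"
  obtain a b where ab: "a \<in> carrier R" "b \<in> carrier R - {\<zero>}" "x = frac_class R a b"
    using fracE[OF x(1)] .
  have a: "a \<in> carrier R - {\<zero>}" using x(2) ab unfolding frac_zero by (auto simp: frac_class_eq_iff)
  have "x \<otimes>\<^bsub>?F\<^esub> frac_class R b a = frac_class R (a \<otimes> b) (b \<otimes> a)"
    unfolding ab(3) using ab a by (intro frac_mult) auto
  also have "\<dots> = \<one>\<^bsub>?F\<^esub>"
    unfolding frac_one using ab a nonzero_mult[OF ab(2) a]
    by (subst frac_class_eq_iff) (auto simp: m_comm)
  finally show "\<exists>y\<in>carrier ?F. x \<otimes>\<^bsub>?F\<^esub> y = \<one>\<^bsub>?F\<^esub>" using frac_closed[of b a] ab a by auto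
qed

lemma frac_hom: "(\<lambda>c. frac_class R c \<one>) \<in> ring_hom R (fraction_field R)"
proof (rule ring_hom_memI)
  fix c d assume cd: "c \<in> carrier R" "d \<in> carrier R"
  show "frac_class R c \<one> \<in> carrier (fraction_field R)" using cd by (intro frac_closed) auto
  show "frac_class R (c \<otimes> d) \<one> = frac_class R c \<one> \<otimes>\<^bsub>fraction_field R\<^esub> frac_class R d \<one>"
    using frac_mult[OF cd(1) one_nonzero cd(2) one_nonzero] by simp
  show "frac_class R (c \<oplus> d) \<one> = frac_class R c \<one> \<oplus>\<^bsub>fraction_field R\<^esub> frac_class R d \<one>"
    using frac_add[OF cd(1) one_nonzero cd(2) one_nonzero] cd by simp
qed (simp add: frac_one)

lemma frac_hom_zero_iff: "c \<in> carrier R \<Longrightarrow> frac_class R c \<one> = \<zero>\<^bsub>fraction_field R\<^esub> \<longleftrightarrow> c = \<zero>"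
  unfolding frac_zero by (subst frac_class_eq_iff) auto

lemma frac_rep:
  assumes "z \<in> carrier (fraction_field R)"
  shows "\<exists>c\<in>carrier R. \<exists>d\<in>carrier R - {\<zero>}. z \<otimes>\<^bsub>fraction_field R\<^esub> frac_class R d \<one> = frac_class R c \<one>"
proof -
  obtain c d where cd: "c \<in> carrier R" "d \<in> carrier R - {\<zero>}" "z = frac_class R c d"
    using fracE[OF assms] .
  have d: "d \<in> carrier R" using cd by simp
  have "z \<otimes>\<^bsub>fraction_field R\<^esub> frac_class R d \<one> = frac_class R (c \<otimes> d) (d \<otimes> \<one>)"
    unfolding cd(3) by (rule frac_mult[OF cd(1,2) d one_nonzero])
  also have "\<dots> = frac_class R c \<one>" by (subst frac_class_eq_iff) (use cd in auto)
  finally show ?thesis using cd by blast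
qed

end

locale quad_ring = Q: cring Q + A: domain A for Q (structure) and A (structure) +
  fixes j :: "'c \<Rightarrow> 'a" and y :: 'a and f :: 'c
  assumes j_hom: "j \<in> ring_hom A Q" and y [simp]: "y \<in> carrier Q" and f [simp]: "f \<in> carrier A"
    and y_sq: "y \<otimes>\<^bsub>Q\<^esub> y = j f"
    and rep: "z \<in> carrier Q \<Longrightarrow> \<exists>u\<in>carrier A. \<exists>v\<in>carrier A. z = j u \<oplus>\<^bsub>Q\<^esub> j v \<otimes>\<^bsub>Q\<^esub> y"
    and indep: "u \<in> carrier A \<Longrightarrow> v \<in> carrier A \<Longrightarrow> j u \<oplus>\<^bsub>Q\<^esub> j v \<otimes>\<^bsub>Q\<^esub> y = \<zero>\<^bsub>Q\<^esub> \<Longrightarrow> u = \<zero>\<^bsub>A\<^esub> \<and> v = \<zero>\<^bsub>A\<^esub>"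
    and aniso: "u \<in> carrier A \<Longrightarrow> v \<in> carrier A \<Longrightarrow> u \<otimes>\<^bsub>A\<^esub> u = f \<otimes>\<^bsub>A\<^esub> (v \<otimes>\<^bsub>A\<^esub> v) \<Longrightarrow> u = \<zero>\<^bsub>A\<^esub> \<and> v = \<zero>\<^bsub>A\<^esub>"
    and two_unit: "\<one>\<^bsub>A\<^esub> \<oplus>\<^bsub>A\<^esub> \<one>\<^bsub>A\<^esub> \<in> Units A"
begin

sublocale J: ring_hom_ring A Q j
  by (rule ring_hom_ringI2) (auto simp: Q.ring_axioms A.ring_axioms j_hom)

lemma exists_conjugate:
  assumes z: "z \<in> carrier Q" "z \<noteq> \<zero>\<^bsub>Q\<^esub>"
  shows "\<exists>z'\<in>carrier Q. \<exists>n\<in>carrier A. n \<noteq> \<zero>\<^bsub>A\<^esub> \<and> z \<otimes>\<^bsub>Q\<^esub> z' = j n"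
proof -
  obtain u v where uv: "u \<in> carrier A" "v \<in> carrier A" "z = j u \<oplus>\<^bsub>Q\<^esub> j v \<otimes>\<^bsub>Q\<^esub> y"
    using rep[OF z(1)] by blast
  let ?n = "u \<otimes>\<^bsub>A\<^esub> u \<ominus>\<^bsub>A\<^esub> f \<otimes>\<^bsub>A\<^esub> (v \<otimes>\<^bsub>A\<^esub> v)"
  let ?z = "j u \<oplus>\<^bsub>Q\<^esub> \<ominus>\<^bsub>Q\<^esub> j v \<otimes>\<^bsub>Q\<^esub> y"
  have "z \<otimes>\<^bsub>Q\<^esub> ?z = (j u \<otimes>\<^bsub>Q\<^esub> j u \<oplus>\<^bsub>Q\<^esub> j f \<otimes>\<^bsub>Q\<^esub> (j v \<otimes>\<^bsub>Q\<^esub> \<ominus>\<^bsub>Q\<^esub> j v)) \<oplus>\<^bsub>Q\<^esub> (j u \<otimes>\<^bsub>Q\<^esub> \<ominus>\<^bsub>Q\<^esub> j v \<oplus>\<^bsub>Q\<^esub> j v \<otimes>\<^bsub>Q\<^esub> j u) \<otimes>\<^bsub>Q\<^esub> y"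
    unfolding uv(3) using uv y_sq by (intro Q.linear_mult_linear) auto
  also have "j u \<otimes>\<^bsub>Q\<^esub> \<ominus>\<^bsub>Q\<^esub> j v \<oplus>\<^bsub>Q\<^esub> j v \<otimes>\<^bsub>Q\<^esub> j u = \<zero>\<^bsub>Q\<^esub>" using uv by (simp add: Q.r_minus Q.m_comm Q.l_neg)
  also have "(j u \<otimes>\<^bsub>Q\<^esub> j u \<oplus>\<^bsub>Q\<^esub> j f \<otimes>\<^bsub>Q\<^esub> (j v \<otimes>\<^bsub>Q\<^esub> \<ominus>\<^bsub>Q\<^esub> j v)) \<oplus>\<^bsub>Q\<^esub> \<zero>\<^bsub>Q\<^esub> \<otimes>\<^bsub>Q\<^esub> y = j ?n"
    using uv by (simp add: a_minus_def Q.r_minus)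
  finally have "z \<otimes>\<^bsub>Q\<^esub> ?z = j ?n" .
  moreover have "?n \<noteq> \<zero>\<^bsub>A\<^esub>"
  proof
    assume "?n = \<zero>\<^bsub>A\<^esub>"
    then have "u = \<zero>\<^bsub>A\<^esub> \<and> v = \<zero>\<^bsub>A\<^esub>" using uv by (intro aniso) auto
    then show False using uv z by simp
  qed
  moreover have "?z \<in> carrier Q" "?n \<in> carrier A" using uv by auto
  ultimately show ?thesis by blast
qed

lemma j_mult_eq_zeroD:
  assumes "n \<in> carrier A" "n \<noteq> \<zero>\<^bsub>A\<^esub>" "z \<in> carrier Q" "j n \<otimes>\<^bsub>Q\<^esub> z = \<zero>\<^bsub>Q\<^esub>" shows "z = \<zero>\<^bsub>Q\<^esub>"
proof -
  obtain u v where uv: "u \<in> carrier A" "v \<in> carrier A" "z = j u \<oplus>\<^bsub>Q\<^esub> j v \<otimes>\<^bsub>Q\<^esub> y"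
    using rep[OF assms(3)] by blast
  have "j (n \<otimes>\<^bsub>A\<^esub> u) \<oplus>\<^bsub>Q\<^esub> j (n \<otimes>\<^bsub>A\<^esub> v) \<otimes>\<^bsub>Q\<^esub> y = j n \<otimes>\<^bsub>Q\<^esub> z" unfolding uv(3)
    using uv(1,2) assms(1) by (simp add: Q.r_distr Q.m_assoc)
  then have "n \<otimes>\<^bsub>A\<^esub> u = \<zero>\<^bsub>A\<^esub> \<and> n \<otimes>\<^bsub>A\<^esub> v = \<zero>\<^bsub>A\<^esub>" using assms uv by (intro indep) auto
  then have "u = \<zero>\<^bsub>A\<^esub>" "v = \<zero>\<^bsub>A\<^esub>" using A.integral[of n u] A.integral[of n v] assms uv by auto
  then show ?thesis using uv by simp
qed

lemma domain_Q: "domain Q"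
proof (rule domain.intro[OF Q.cring_axioms], unfold_locales)
  show "\<one>\<^bsub>Q\<^esub> \<noteq> \<zero>\<^bsub>Q\<^esub>" using indep[of "\<one>\<^bsub>A\<^esub>" "\<zero>\<^bsub>A\<^esub>"] by auto
  fix x z assume xz: "x \<otimes>\<^bsub>Q\<^esub> z = \<zero>\<^bsub>Q\<^esub>" "x \<in> carrier Q" "z \<in> carrier Q"
  show "x = \<zero>\<^bsub>Q\<^esub> \<or> z = \<zero>\<^bsub>Q\<^esub>"
  proof (cases "x = \<zero>\<^bsub>Q\<^esub>")
    case False
    then obtain x' n where conj: "x' \<in> carrier Q" "n \<in> carrier A" "n \<noteq> \<zero>\<^bsub>A\<^esub>" "x \<otimes>\<^bsub>Q\<^esub> x' = j n"
      using exists_conjugate[OF xz(2)] by blast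
    have "j n \<otimes>\<^bsub>Q\<^esub> z = x' \<otimes>\<^bsub>Q\<^esub> (x \<otimes>\<^bsub>Q\<^esub> z)" unfolding conj(4) [symmetric]
      using conj(1) xz by (simp add: Q.m_ac)
    then have "j n \<otimes>\<^bsub>Q\<^esub> z = \<zero>\<^bsub>Q\<^esub>" using xz conj by simp
    then show ?thesis using j_mult_eq_zeroD conj xz by blast
  qed simp
qed

abbreviation "\<iota> u \<equiv> frac_class Q (j u) \<one>\<^bsub>Q\<^esub>"

theorem quad_ext_fraction_field: "quad_ext (fraction_field Q) A \<iota> (frac_class Q y \<one>\<^bsub>Q\<^esub>) f"
proof -
  interpret D: domain Q by (rule domain_Q)
  interpret F: field "fraction_field Q" by (rule D.field_fraction_field)
  let ?h = "\<lambda>c. frac_class Q c \<one>\<^bsub>Q\<^esub>"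
  let ?F = "fraction_field Q"
  interpret H: ring_hom_ring Q ?F ?h
    by (rule ring_hom_ringI2) (auto simp: Q.ring_axioms F.ring_axioms D.frac_hom)
  show ?thesis
  proof (intro quad_ext.intro quad_ext_axioms.intro F.field_axioms A.domain_axioms f two_unit)
    show "\<iota> \<in> ring_hom A ?F" using ring_hom_trans[OF j_hom D.frac_hom] by (simp add: comp_def)
    show "?h y \<in> carrier ?F" by simp
    show "?h y \<otimes>\<^bsub>?F\<^esub> ?h y = \<iota> f" using H.hom_mult[of y y] y_sq by simp
    fix u v assume uv: "u \<in> carrier A" "v \<in> carrier A" "\<iota> u \<oplus>\<^bsub>?F\<^esub> \<iota> v \<otimes>\<^bsub>?F\<^esub> ?h y = \<zero>\<^bsub>?F\<^esub>"
    then have "?h (j u \<oplus>\<^bsub>Q\<^esub> j v \<otimes>\<^bsub>Q\<^esub> y) = \<zero>\<^bsub>?F\<^esub>" by simp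
    then have "j u \<oplus>\<^bsub>Q\<^esub> j v \<otimes>\<^bsub>Q\<^esub> y = \<zero>\<^bsub>Q\<^esub>" using uv(1,2) by (subst (asm) D.frac_hom_zero_iff) auto
    then show "u = \<zero>\<^bsub>A\<^esub> \<and> v = \<zero>\<^bsub>A\<^esub>" by (rule indep[OF uv(1,2)])
  next
    fix z assume z: "z \<in> carrier ?F"
    then obtain c d where cd: "c \<in> carrier Q" "d \<in> carrier Q" "d \<noteq> \<zero>\<^bsub>Q\<^esub>" "z \<otimes>\<^bsub>?F\<^esub> ?h d = ?h c"
      using D.frac_rep by blast
    obtain d' n where conj: "d' \<in> carrier Q" "n \<in> carrier A" "n \<noteq> \<zero>\<^bsub>A\<^esub>" "d \<otimes>\<^bsub>Q\<^esub> d' = j n"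
      using exists_conjugate[OF cd(2,3)] by blast
    obtain u v where uv: "u \<in> carrier A" "v \<in> carrier A" "c \<otimes>\<^bsub>Q\<^esub> d' = j u \<oplus>\<^bsub>Q\<^esub> j v \<otimes>\<^bsub>Q\<^esub> y"
      using rep[of "c \<otimes>\<^bsub>Q\<^esub> d'"] cd conj by auto
    have "z \<otimes>\<^bsub>?F\<^esub> \<iota> n = (z \<otimes>\<^bsub>?F\<^esub> ?h d) \<otimes>\<^bsub>?F\<^esub> ?h d'" unfolding conj(4) [symmetric]
      using cd(1,2) conj(1) z by (simp add: F.m_assoc)
    also have "\<dots> = ?h (c \<otimes>\<^bsub>Q\<^esub> d')" unfolding cd(4) using cd conj by simp
    also have "\<dots> = \<iota> u \<oplus>\<^bsub>?F\<^esub> \<iota> v \<otimes>\<^bsub>?F\<^esub> ?h y" unfolding uv(3) using uv(1,2) by simp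
    finally show "\<exists>u\<in>carrier A. \<exists>v\<in>carrier A. \<exists>w\<in>carrier A. w \<noteq> \<zero>\<^bsub>A\<^esub> \<and> z \<otimes>\<^bsub>?F\<^esub> \<iota> w = \<iota> u \<oplus>\<^bsub>?F\<^esub> \<iota> v \<otimes>\<^bsub>?F\<^esub> ?h y"
      using uv conj by blast
  qed
qed

end

section \<open>The function field of the curve\<close>

locale quadratic_quotient = domain R for R (structure) +
  fixes f assumes f [simp]: "f \<in> carrier R"
begin

abbreviation "B \<equiv> poly_ring R"
abbreviation "Y \<equiv> [\<one>, \<zero>]"
abbreviation "G \<equiv> [\<one>, \<zero>, \<ominus> f]"
abbreviation "I \<equiv> PIdl\<^bsub>B\<^esub> G"
abbreviation "Q \<equiv> B Quot I"
abbreviation proj where "proj p \<equiv> I +>\<^bsub>B\<^esub> p"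

lemma poly_ring_carrier_iff: "p \<in> carrier B \<longleftrightarrow> p = [] \<or> (set p \<subseteq> carrier R \<and> hd p \<noteq> \<zero>)"
  unfolding univ_poly_carrier [symmetric] polynomial_def by simp

lemma gens_closed [simp]: "G \<in> carrier B" "Y \<in> carrier B"
  by (simp_all add: poly_ring_carrier_iff)

sublocale B: domain B by (rule univ_poly_is_domain[OF carrier_is_subring])

sublocale I: ideal I B by (rule B.cgenideal_ideal) simp

sublocale PC: ring_hom_ring R B poly_of_const
  using canonical_embedding_is_hom[OF carrier_is_subring]
  by (intro ring_hom_ringI2) (auto simp: ring_axioms B.ring_axioms)

sublocale Q: cring Q by (rule I.quotient_is_cring[OF B.is_cring])

sublocale H: ring_hom_ring B Q proj by (rule I.rcos_ring_hom_ring)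

lemma eval_var: "p \<in> carrier B \<Longrightarrow> p = B.eval (map poly_of_const p) Y"
  using eval_rewrite[OF carrier_is_subring, of p] by (simp add: var_def)

lemma G_eq: "G = Y \<otimes>\<^bsub>B\<^esub> Y \<ominus>\<^bsub>B\<^esub> poly_of_const f"
  by (subst eval_var[OF gens_closed(1)]) (simp add: numeral_eq_Suc a_minus_def)

lemma linear_eq:
  assumes "u \<in> carrier R" "v \<in> carrier R"
  shows "poly_of_const u \<oplus>\<^bsub>B\<^esub> poly_of_const v \<otimes>\<^bsub>B\<^esub> Y = (if v \<noteq> \<zero> then [v, u] else if u \<noteq> \<zero> then [u] else [])"
proof (cases "v = \<zero>")
  case True
  then have "poly_of_const u \<oplus>\<^bsub>B\<^esub> poly_of_const v \<otimes>\<^bsub>B\<^esub> Y = poly_of_const u" using assms by simp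
  then show ?thesis using True assms by (simp add: poly_of_const_def)
next
  case False
  then have "[v, u] \<in> carrier B" using assms by (simp add: poly_ring_carrier_iff)
  then have "[v, u] = poly_of_const u \<oplus>\<^bsub>B\<^esub> poly_of_const v \<otimes>\<^bsub>B\<^esub> Y"
    by (subst eval_var) (use assms in \<open>simp_all add: B.a_comm\<close>)
  then show ?thesis using False by simp
qed

lemma proj_linear:
  "u \<in> carrier R \<Longrightarrow> v \<in> carrier R \<Longrightarrow> proj (poly_of_const u) \<oplus>\<^bsub>Q\<^esub> proj (poly_of_const v) \<otimes>\<^bsub>Q\<^esub> proj Y
    = proj (poly_of_const u \<oplus>\<^bsub>B\<^esub> poly_of_const v \<otimes>\<^bsub>B\<^esub> Y)"
  by simp

lemma proj_G_mult: "h \<in> carrier B \<Longrightarrow> proj (G \<otimes>\<^bsub>B\<^esub> h) = \<zero>\<^bsub>Q\<^esub>"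
  using I.I_r_closed[OF B.cgenideal_self[OF gens_closed(1)]] I.rcos_zero_iff[of "G \<otimes>\<^bsub>B\<^esub> h"] by simp

lemma proj_Y_sq: "proj Y \<otimes>\<^bsub>Q\<^esub> proj Y = proj (poly_of_const f)"
proof -
  have "proj Y \<otimes>\<^bsub>Q\<^esub> proj Y \<ominus>\<^bsub>Q\<^esub> proj (poly_of_const f) = proj G"
    unfolding arg_cong[OF G_eq, of proj] by (simp add: a_minus_def)
  also have "\<dots> = \<zero>\<^bsub>Q\<^esub>" using I.rcos_zero_iff[of G] B.cgenideal_self[of G] by simp
  finally show ?thesis by simp
qed

lemma exists_linear_remainder:
  assumes "p \<in> carrier B"
  shows "\<exists>h\<in>carrier B. \<exists>u\<in>carrier R. \<exists>v\<in>carrier R.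
    p = G \<otimes>\<^bsub>B\<^esub> h \<oplus>\<^bsub>B\<^esub> (poly_of_const u \<oplus>\<^bsub>B\<^esub> poly_of_const v \<otimes>\<^bsub>B\<^esub> Y)"
proof -
  have "\<exists>q r. polynomial (carrier R) q \<and> polynomial (carrier R) r \<and>
      p = (G \<otimes>\<^bsub>B\<^esub> q) \<oplus>\<^bsub>B\<^esub> r \<and> (r = [] \<or> degree r < degree G)"
    by (rule long_division_theorem[OF carrier_is_subring]) (use assms in \<open>auto simp: univ_poly_carrier poly_ring_carrier_iff\<close>)
  then obtain h r where division: "h \<in> carrier B" "r \<in> carrier B" "p = G \<otimes>\<^bsub>B\<^esub> h \<oplus>\<^bsub>B\<^esub> r" "r = [] \<or> degree r < 2"
    by (auto simp: univ_poly_carrier)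
  consider "r = []" | u where "r = [u]" | v u where "r = [v, u]"
    using division(4) by (cases r; cases "tl r") auto
  then have "\<exists>u\<in>carrier R. \<exists>v\<in>carrier R. r = poly_of_const u \<oplus>\<^bsub>B\<^esub> poly_of_const v \<otimes>\<^bsub>B\<^esub> Y"
  proof cases
    case 1
    then show ?thesis using linear_eq[of \<zero> \<zero>] by (metis zero_closed)
  next
    case (2 u)
    then have "u \<in> carrier R" "u \<noteq> \<zero>" using division(2) by (auto simp: poly_ring_carrier_iff)
    then show ?thesis using 2 linear_eq[of u \<zero>] by (metis zero_closed)
  next
    case (3 v u)
    then have "u \<in> carrier R" "v \<in> carrier R" "v \<noteq> \<zero>"
      using division(2) by (auto simp: poly_ring_carrier_iff)
    then show ?thesis using 3 linear_eq[of u v] by metis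
  qed
  then show ?thesis using division by blast
qed

lemma exists_linear_rep:
  assumes "z \<in> carrier Q"
  shows "\<exists>u\<in>carrier R. \<exists>v\<in>carrier R. z = proj (poly_of_const u) \<oplus>\<^bsub>Q\<^esub> proj (poly_of_const v) \<otimes>\<^bsub>Q\<^esub> proj Y"
proof -
  obtain p where p: "p \<in> carrier B" "z = proj p" using I.rcosE[OF assms] .
  obtain h u v where closed: "h \<in> carrier B" "u \<in> carrier R" "v \<in> carrier R"
    and division: "p = G \<otimes>\<^bsub>B\<^esub> h \<oplus>\<^bsub>B\<^esub> (poly_of_const u \<oplus>\<^bsub>B\<^esub> poly_of_const v \<otimes>\<^bsub>B\<^esub> Y)"
    using exists_linear_remainder[OF p(1)] by blast
  have "z = proj (G \<otimes>\<^bsub>B\<^esub> h) \<oplus>\<^bsub>Q\<^esub> proj (poly_of_const u \<oplus>\<^bsub>B\<^esub> poly_of_const v \<otimes>\<^bsub>B\<^esub> Y)"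
    unfolding p(2) division by (rule H.hom_add) (use closed in auto)
  also have "\<dots> = proj (poly_of_const u) \<oplus>\<^bsub>Q\<^esub> proj (poly_of_const v) \<otimes>\<^bsub>Q\<^esub> proj Y"
    unfolding proj_G_mult[OF closed(1)] using closed by simp
  finally show ?thesis using closed by blast
qed

lemma linear_indep:
  assumes uv: "u \<in> carrier R" "v \<in> carrier R"
    and zero: "proj (poly_of_const u) \<oplus>\<^bsub>Q\<^esub> proj (poly_of_const v) \<otimes>\<^bsub>Q\<^esub> proj Y = \<zero>\<^bsub>Q\<^esub>"
  shows "u = \<zero> \<and> v = \<zero>"
proof -
  define w where "w = poly_of_const u \<oplus>\<^bsub>B\<^esub> poly_of_const v \<otimes>\<^bsub>B\<^esub> Y"
  have w: "w \<in> carrier B" "w = (if v \<noteq> \<zero> then [v, u] else if u \<noteq> \<zero> then [u] else [])"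
    unfolding w_def by (use uv in simp) (rule linear_eq[OF uv])
  have "w \<in> I" using zero[unfolded proj_linear[OF uv]] I.rcos_zero_iff[OF w(1)] by (simp add: w_def)
  then obtain h where h: "h \<in> carrier B" "w = h \<otimes>\<^bsub>B\<^esub> G" unfolding cgenideal_def by blast
  have "w = []"
  proof (rule ccontr)
    assume nonzero: "w \<noteq> []"
    have "h \<noteq> []"
    proof
      assume "h = []"
      then have "h = \<zero>\<^bsub>B\<^esub>" by (simp add: univ_poly_zero)
      then have "w = \<zero>\<^bsub>B\<^esub>" using h by simp
      then show False using nonzero by (simp add: univ_poly_zero)
    qed
    then have "degree w = degree h + 2"
      using poly_mult_degree_eq[OF carrier_is_subring, of h G] h gens_closed(1)
      by (simp add: univ_poly_carrier univ_poly_mult)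
    then show False using w(2) nonzero by (auto split: if_splits)
  qed
  then show ?thesis using w(2) by (auto split: if_splits)
qed

theorem quad_ring_quotient:
  assumes "\<And>u v. u \<in> carrier R \<Longrightarrow> v \<in> carrier R \<Longrightarrow> u \<otimes> u = f \<otimes> (v \<otimes> v) \<Longrightarrow> u = \<zero> \<and> v = \<zero>"
    and "\<one> \<oplus> \<one> \<in> Units R"
  shows "quad_ring Q R (\<lambda>u. proj (poly_of_const u)) (proj Y) f"
proof (intro quad_ring.intro quad_ring_axioms.intro Q.cring_axioms domain_axioms f proj_Y_sq exists_linear_rep assms(2))
  fix u v assume uv: "u \<in> carrier R" "v \<in> carrier R"
  show "u = \<zero> \<and> v = \<zero>" if "u \<otimes> u = f \<otimes> (v \<otimes> v)" by (rule assms(1)[OF uv that])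
  show "u = \<zero> \<and> v = \<zero>"
    if "proj (poly_of_const u) \<oplus>\<^bsub>Q\<^esub> proj (poly_of_const v) \<otimes>\<^bsub>Q\<^esub> proj Y = \<zero>\<^bsub>Q\<^esub>"
    by (rule linear_indep[OF uv that])
next
  show "(\<lambda>u. proj (poly_of_const u)) \<in> ring_hom R Q"
    using ring_hom_trans[OF PC.homh H.homh] by (simp add: comp_def)
qed simp

end

context curve_field
begin

definition embed_poly :: "'a list \<Rightarrow> ('a list list set \<times> 'a list list set) set" where
  "embed_poly u
      = frac_class (coordinate_ring R a b) (curve_ideal R a b +>\<^bsub>bivariate R\<^esub> ring.poly_of_const (poly_ring R) u) \<one>\<^bsub>coordinate_ring R a b\<^esub>"

definition coord_y :: "('a list list set \<times> 'a list list set) set" where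
  "coord_y
      = frac_class (coordinate_ring R a b) (curve_ideal R a b +>\<^bsub>bivariate R\<^esub> [\<one>\<^bsub>poly_ring R\<^esub>, \<zero>\<^bsub>poly_ring R\<^esub>]) \<one>\<^bsub>coordinate_ring R a b\<^esub>"

lemma function_field_quad_ext: "quad_ext (function_field R a b) (poly_ring R) embed_poly coord_y cubic_poly"
proof -
  interpret V: quadratic_quotient "poly_ring R" cubic_poly
    by (intro quadratic_quotient.intro quadratic_quotient_axioms.intro UP.domain_axioms cubic_poly_carrier)
  have "quad_ring V.Q (poly_ring R) (\<lambda>u. V.proj (UP.poly_of_const u)) (V.proj V.Y) cubic_poly"
  proof (rule V.quad_ring_quotient)
    show "u = zP \<and> v = zP" if "u \<in> kX" "v \<in> kX" "u .* u = cubic_poly .* (v .* v)" for u v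
      using odd_degree_aniso[OF cubic_poly_carrier _ _ that] by simp
  qed (rule poly_two_unit[OF two_nonzero])
  from quad_ring.quad_ext_fraction_field[OF this] show ?thesis
    by (simp add: function_field_def coordinate_ring_def curve_ideal_def embed_poly_def [abs_def] coord_y_def)
qed

abbreviation "A \<equiv> poly_ring R"
abbreviation "F \<equiv> function_field R a b"
abbreviation "C \<equiv> constant_field R a b"

abbreviation Fmult (infixl ":*" 70) where "u :* v \<equiv> u \<otimes>\<^bsub>function_field R a b\<^esub> v"
abbreviation Fadd (infixl ":+" 65) where "u :+ v \<equiv> u \<oplus>\<^bsub>function_field R a b\<^esub> v"
abbreviation Fpow (infixr ":^" 75) where "u :^ (n::nat) \<equiv> u [^]\<^bsub>function_field R a b\<^esub> n"
abbreviation "zF \<equiv> \<zero>\<^bsub>function_field R a b\<^esub>"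
abbreviation "oF \<equiv> \<one>\<^bsub>function_field R a b\<^esub>"

sublocale FF: quad_ext F A embed_poly coord_y cubic_poly by (rule function_field_quad_ext)

lemma cubic_poly_square_factor:
  assumes e: "e \<in> carrier R" "g \<in> carrier R" and factors: "cubic_poly = ([\<one>, e] .* [\<one>, e]) .* [\<one>, g]"
  shows "g = \<ominus> (e \<oplus> e)" "a = e \<otimes> g \<oplus> e \<otimes> (g \<oplus> e)" "b = e \<otimes> (e \<otimes> g)"
proof -
  have linear: "[\<one>, e] \<in> kX" "[\<one>, g] \<in> kX" using e by (auto simp: poly_carrier_iff)
  have "cubic_poly = [\<one>, e] .* ([\<one>, e] .* [\<one>, g])"
    unfolding factors by (rule UP.m_assoc[OF linear(1,1,2)])
  also have "\<dots> = [\<one>, (g \<oplus> e) \<oplus> e, (e \<otimes> g) \<oplus> e \<otimes> (g \<oplus> e), e \<otimes> (e \<otimes> g)]"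
    using e by (simp only: mult_linear_linear) (intro mult_linear_quadratic, auto)
  finally have coeffs: "(g \<oplus> e) \<oplus> e = \<zero>" and "a = e \<otimes> g \<oplus> e \<otimes> (g \<oplus> e)" "b = e \<otimes> (e \<otimes> g)" by auto
  then show "a = e \<otimes> g \<oplus> e \<otimes> (g \<oplus> e)" "b = e \<otimes> (e \<otimes> g)" by blast+
  show "g = \<ominus> (e \<oplus> e)" using coeffs e minus_equality[of g "e \<oplus> e"] by (simp add: a_assoc)
qed

lemma cubic_poly_squarefree:
  assumes P: "P \<in> monic_irreds" shows "\<not> (P .* P) .| cubic_poly"
proof
  assume "(P .* P) .| cubic_poly"
  note PD = monic_irredD[OF P] and PP_monic = monic_mult[OF monic_irredD(1)[OF P] monic_irredD(1)[OF P]]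
  obtain h where h: "h \<in> monics" "cubic_poly = (P .* P) .* h"
    using monic_divides_cofactor[OF PP_monic monics_degD(1)[OF cubic_poly_monic] \<open>(P .* P) .| cubic_poly\<close>] .
  have "3 = degree P + degree P + degree h"
    using monic_degree_mult[OF PP_monic h(1)] monic_degree_mult[OF PD(1,1)]
    unfolding h(2) [symmetric] by simp
  moreover from this have "degree P = 1" using PD(3) by linarith
  ultimately have "degree P = 1" "degree h = 1" by auto
  then have "P \<in> monics_deg 1" "h \<in> monics_deg 1" using PD(1) h(1) by (auto simp: monics_deg_def)
  then obtain e g where coeffs: "e \<in> carrier R" "g \<in> carrier R" "P = [\<one>, e]" "h = [\<one>, g]"
    by (metis monics_deg_1E)
  note factor = cubic_poly_square_factor[OF coeffs(1,2) h(2)[unfolded coeffs(3,4)]]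
  have "\<guillemotleft>4\<guillemotright> \<otimes> a [^] (3::nat) \<oplus> \<guillemotleft>27\<guillemotright> \<otimes> b [^] (2::nat) = \<zero>"
    unfolding factor(2,3) unfolding factor(1) by (rule cubic_disc_double_root[OF coeffs(1)])
  then show False using disc by simp
qed

lemma quad_place_poly:
  assumes Q: "quad_ext F A i y f" and P: "P \<in> monic_irreds" and squarefree: "\<not> (P .* P) .| f"
  shows "quad_place F A i y f P length (polys_below (degree P))"
proof (intro quad_place.intro quad_place_axioms.intro Q squarefree)
  note PD = monic_irredD[OF P]
  have P_deg: "P \<in> monics_deg (degree P)" using PD by (simp add: monics_deg_def)
  show "P \<in> kX" "P \<noteq> zP" using PD by auto
  show "\<not> P .| oP" using PD(2,6) UP.divides_unit by auto
  show "polys_below (degree P) \<subseteq> kX" using polys_below_carrier by auto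
  show "\<exists>w\<in>kX. P .| (u .* w .- oP)" if "u \<in> kX" "\<not> P .| u" for u
    by (rule monic_irred_inverse_mod[OF P that])
  show "length w < length (P .* w)" if w: "w \<in> kX" "w \<noteq> zP" for w
    using poly_degree_mult(1,3)[OF PD(2) w(1) PD(5)] w PD(3) by (cases w; cases "P .* w") auto
  show "\<exists>x\<in>polys_below (degree P). P .| (u .- x)" if "u \<in> kX" for u
    using polys_below_exists[OF P_deg that] by blast
  show "x = x'" if "x \<in> polys_below (degree P)" "x' \<in> polys_below (degree P)" "P .| (x .- x')" for x x'
    by (rule polys_below_unique[OF P_deg that])
qed

lemma quad_place_finite: "P \<in> monic_irreds \<Longrightarrow>
    quad_place F A embed_poly coord_y cubic_poly P length (polys_below (degree P))"
  by (intro quad_place_poly function_field_quad_ext cubic_poly_squarefree)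

definition embed_const :: "'a \<Rightarrow> ('a list list set \<times> 'a list list set) set"
  where "embed_const c = embed_poly (poly_of_const c)"

sublocale E: poly_eval_hom R F embed_const
proof (intro poly_eval_hom.intro poly_eval_hom_axioms.intro field_polys_axioms field_polys.intro FF.field_axioms)
  show "embed_const \<in> ring_hom R F" using ring_hom_trans[OF poly_const_hom FF.\<iota>_hom]
    by (simp add: comp_def embed_const_def [abs_def])
qed

lemma C_eq: "C = embed_const ` carrier R"
  unfolding constant_field_def embed_const_def embed_poly_def ..

lemma C_subfield: "subfield C F" unfolding C_eq
  by (rule E.S.img_is_subfield(2)[OF carrier_is_subfield]) simp

lemma C_card: "finite C" "card C = order R"
  unfolding C_eq order_def using finite_carrier card_image[OF E.inj_on_\<sigma>] by auto

lemma C_subset_embed_poly: "C \<subseteq> embed_poly ` kX" unfolding C_eq embed_const_def by auto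

definition coord_x where "coord_x = embed_poly [\<one>, \<zero>]"

definition inv_x where "inv_x = inv\<^bsub>F\<^esub> coord_x"

lemma X_carrier [simp]: "[\<one>, \<zero>] \<in> kX" by (simp add: poly_carrier_iff)

lemma X_sq_nonzero: "[\<one>, \<zero>] .* [\<one>, \<zero>] \<noteq> []"
  using UP.integral[of "[\<one>, \<zero>]" "[\<one>, \<zero>]"] by auto

lemma embed_poly_zero_iff: "u \<in> kX \<Longrightarrow> embed_poly u = zF \<longleftrightarrow> u = []"
  using FF.lin_zero_iff[OF _ UP.zero_closed, of u] FF.lin_zero_right[of u] by simp

lemma coord_x_inv_x [simp]: "coord_x \<in> carrier F" "inv_x \<in> carrier F"
    "coord_x :* inv_x = oF" "inv_x :* coord_x = oF" "coord_x \<noteq> zF" "inv_x \<noteq> zF"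
proof -
  show x: "coord_x \<in> carrier F" "coord_x \<noteq> zF" by (simp_all add: coord_x_def embed_poly_zero_iff)
  then show "inv_x \<in> carrier F" "coord_x :* inv_x = oF" "inv_x :* coord_x = oF" "inv_x \<noteq> zF"
    by (simp_all add: inv_x_def FF.nonzero_imp_inverse_nonzero)
qed

lemma inv_inv_x: "inv\<^bsub>F\<^esub> inv_x = coord_x" by (simp add: inv_x_def FF.nonzero_inverse_inverse_eq)

lemma embed_poly_ev: assumes p: "p \<in> kX" shows "embed_poly p = E.ev coord_x p"
proof -
  have coeffs: "set (map poly_of_const p) \<subseteq> kX" using poly_set_carrier[OF p] by auto
  have "embed_poly p = embed_poly (UP.eval (map poly_of_const p) [\<one>, \<zero>])"
    using eval_rewrite[OF carrier_is_subring p] by (simp add: var_def)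
  also have "\<dots> = FF.eval (map embed_poly (map poly_of_const p)) coord_x"
    unfolding coord_x_def by (rule FF.I.eval_hom'[OF X_carrier coeffs])
  finally have "embed_poly p = FF.eval (map (\<lambda>c. embed_poly (poly_of_const c)) p) coord_x"
    by (simp add: comp_def)
  then show ?thesis unfolding E.ev_def by (simp add: embed_const_def cong: map_cong)
qed

lemma ev_X [simp]: "t \<in> carrier F \<Longrightarrow> E.ev t [\<one>, \<zero>] = t" by (simp add: E.ev_def)

lemma ev_const: "t \<in> carrier F \<Longrightarrow> c \<in> carrier R \<Longrightarrow> E.ev t (poly_of_const c) = embed_const c"
  by (auto simp: E.ev_def poly_of_const_eq)

lemma ev_Cons: "t \<in> carrier F \<Longrightarrow> E.ev t (c # p) = embed_const c :* t :^ length p :+ E.ev t p"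
  by (simp add: E.ev_def)

lemma embed_const_closed [simp]: "c \<in> carrier R \<Longrightarrow> embed_const c \<in> carrier F" by simp

lemma pow_cancel: assumes "s \<in> carrier F" "t \<in> carrier F" "s :* t = oF"
  shows "s :^ (n::nat) :* t :^ n = oF"
  using FF.nat_pow_distrib[OF assms(1,2), of n] assms(3) by simp

text \<open>Reversing the coefficients turns a polynomial in \<open>s\<close> into a polynomial in \<open>t = 1 / s\<close>.\<close>

lemma ev_reverse:
  assumes st: "s \<in> carrier F" "t \<in> carrier F" "s :* t = oF" and p: "set p \<subseteq> carrier R" "length p \<le> n"
  shows "\<exists>r\<in>kX. E.ev s p :* t :^ n = E.ev t ([\<one>, \<zero>] .* r)"
  using p
proof (induction p)
  case Nil
  have "E.ev s [] :* t :^ n = E.ev t ([\<one>, \<zero>] .* zP)"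
    using st UP.r_null[OF X_carrier] by (simp add: E.ev_def)
  then show ?case using UP.zero_closed by blast
next
  interpret H: ring_hom_ring A F "E.ev t" by (rule E.ev_hom[OF st(2)])
  case (Cons c p)
  then obtain r where r: "r \<in> kX" "E.ev s p :* t :^ n = E.ev t ([\<one>, \<zero>] .* r)" by auto
  have cp: "c \<in> carrier R" "set p \<subseteq> carrier R" using Cons by auto
  have "length p < n" using Cons.prems(2) by simp
  then obtain m where m: "n = length p + Suc m" by (auto dest: less_imp_Suc_add)
  let ?q = "poly_of_const c .* [\<one>, \<zero>] .^ m"
  have q: "?q \<in> kX" using cp by simp
  have "embed_const c :* s :^ length p :* t :^ n
      = embed_const c :* (s :^ length p :* t :^ length p) :* t :^ Suc m"
    unfolding m using st cp by (simp add: FF.m_assoc FF.nat_pow_mult [symmetric])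
  also have "\<dots> = t :* (embed_const c :* t :^ m)"
    unfolding pow_cancel[OF st] using st cp by (simp add: FF.m_ac)
  also have "\<dots> = E.ev t ([\<one>, \<zero>] .* ?q)" using q cp st by (simp add: H.hom_nat_pow ev_const)
  finally have head: "embed_const c :* s :^ length p :* t :^ n = E.ev t ([\<one>, \<zero>] .* ?q)" .
  have "E.ev s (c # p) :* t :^ n = E.ev t ([\<one>, \<zero>] .* ?q) :+ E.ev t ([\<one>, \<zero>] .* r)"
    unfolding head [symmetric] r(2) [symmetric] ev_Cons[OF st(1)]
    using cp st E.ev_closed[OF st(1) cp(2)] by (simp add: FF.l_distr)
  also have "\<dots> = E.ev t ([\<one>, \<zero>] .* (?q .+ r))" using q r(1) by (simp add: UP.r_distr)
  finally show ?case using q r(1) by blast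
qed

lemma ev_reverse_poly:
  assumes "s \<in> carrier F" "t \<in> carrier F" "s :* t = oF" and "p \<in> kX" "length p \<le> n"
  obtains r where "r \<in> kX" "E.ev s p :* t :^ n = E.ev t r"
  using ev_reverse[OF assms(1-3) poly_set_carrier[OF assms(4)] assms(5)] UP.m_closed[OF X_carrier]
  by metis

lemma eval_X_mult: assumes "r \<in> kX" shows "eval ([\<one>, \<zero>] .* r) \<zero> = \<zero>"
proof -
  interpret H: ring_hom_ring A R "\<lambda>p. eval p \<zero>" by (rule eval_poly_hom) simp
  show ?thesis using H.hom_mult[OF X_carrier assms] H.hom_closed[OF assms] by simp
qed

lemma ev_inv_x_zero: assumes p: "p \<in> kX" and zero: "E.ev inv_x p = zF" shows "p = []"
proof (cases p)
  case (Cons c p')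
  then have cp: "c \<in> carrier R" "set p' \<subseteq> carrier R" "c \<noteq> \<zero>"
    using p by (auto simp: poly_carrier_iff)
  obtain r where r: "r \<in> kX" "E.ev inv_x p' :* coord_x :^ length p' = E.ev coord_x ([\<one>, \<zero>] .* r)"
    using ev_reverse[of inv_x coord_x p' "length p'"] cp by auto
  let ?g = "poly_of_const c .+ [\<one>, \<zero>] .* r"
  have "zF = E.ev inv_x (c # p') :* coord_x :^ length p'" using zero Cons by simp
  also have "\<dots>
      = embed_const c :* (inv_x :^ length p' :* coord_x :^ length p') :+ E.ev inv_x p' :* coord_x :^ length p'"
    unfolding ev_Cons[OF coord_x_inv_x(2)]
    using cp E.ev_closed[OF coord_x_inv_x(2) cp(2)] by (simp add: FF.l_distr FF.m_assoc)
  also have "\<dots> = embed_poly (poly_of_const c) :+ embed_poly ([\<one>, \<zero>] .* r)"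
    unfolding r(2) pow_cancel[OF coord_x_inv_x(2,1,4)]
    using cp r(1) embed_poly_ev[of "[\<one>, \<zero>] .* r"] by (simp add: embed_const_def)
  also have "\<dots> = embed_poly ?g" using cp r(1) by simp
  finally have "embed_poly ?g = zF" ..
  then have "?g = []" using embed_poly_zero_iff[of ?g] cp(1) r(1) by simp
  interpret H: ring_hom_ring A R "\<lambda>p. eval p \<zero>" by (rule eval_poly_hom) simp
  have "eval ?g \<zero> = eval (poly_of_const c) \<zero> \<oplus> eval ([\<one>, \<zero>] .* r) \<zero>"
    by (rule H.hom_add) (use cp r in auto)
  then have "c = \<zero>" using \<open>?g = []\<close> eval_X_mult[OF r(1)] cp by (simp add: poly_of_const_eq)
  then show ?thesis using cp by simp
qed simp

text \<open>Near the point at infinity the curve has the equation \<open>v\<^sup>2 = t (1 + a t\<^sup>2 + b t\<^sup>3)\<close> with \<open>t = 1 / x\<close> and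
  \<open>v = y / x\<^sup>2\<close>.\<close>

definition y_inf where "y_inf = coord_y :* (inv_x :* inv_x)"

definition unit_inf
  where "unit_inf = oP .+ [\<one>, \<zero>] .* ([\<one>, \<zero>] .* (poly_of_const a .+ poly_of_const b .* [\<one>, \<zero>]))"

definition cubic_inf where "cubic_inf = [\<one>, \<zero>] .* unit_inf"

lemma cubic_inf_carrier [simp]: "unit_inf \<in> kX" "cubic_inf \<in> kX"
  by (simp_all add: unit_inf_def cubic_inf_def)

lemma y_inf_closed [simp]: "y_inf \<in> carrier F" by (simp add: y_inf_def)

lemma y_inf_mult_x_sq: "y_inf :* (coord_x :* coord_x) = coord_y"
proof -
  have "y_inf :* (coord_x :* coord_x) = coord_y :* ((inv_x :* coord_x) :* (inv_x :* coord_x))"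
    unfolding y_inf_def by (simp add: FF.m_ac del: coord_x_inv_x(3,4))
  then show ?thesis by simp
qed

lemma y_inf_sq: "y_inf :* y_inf = E.ev inv_x cubic_inf"
proof -
  interpret H: ring_hom_ring A F "E.ev inv_x" by (rule E.ev_hom) simp
  have "coord_y :* coord_y = coord_x :^ (3::nat) :+ embed_const a :* coord_x :+ embed_const b"
    using FF.y_sq embed_poly_ev[OF cubic_poly_carrier]
    by (simp add: E.ev_def FF.a_assoc numeral_eq_Suc)
  then show ?thesis
    unfolding y_inf_def
    by (subst FF.weierstrass_at_infinity[of coord_x inv_x "embed_const a" "embed_const b"])
      (simp_all add: cubic_inf_def unit_inf_def ev_const)
qed

lemma rep_infinity:
  assumes z: "z \<in> carrier F"
  shows "\<exists>u\<in>kX. \<exists>v\<in>kX. \<exists>w\<in>kX. w \<noteq> zP \<and> z :* E.ev inv_x w = E.ev inv_x u :+ E.ev inv_x v :* y_inf"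
proof -
  interpret H: ring_hom_ring A F "E.ev inv_x" by (rule E.ev_hom) simp
  obtain u v w
    where uvw: "u \<in> kX" "v \<in> kX" "w \<in> kX" "w \<noteq> []"
      "z :* embed_poly w = embed_poly u :+ embed_poly v :* coord_y"
    using FF.rep[OF z] by auto
  define n where "n = length u + length v + length w"
  have reverse: "\<exists>r\<in>kX. embed_poly p :* inv_x :^ n = E.ev inv_x r" if p: "p \<in> kX" "length p \<le> n" for p
    unfolding embed_poly_ev[OF p(1)] using ev_reverse_poly[OF coord_x_inv_x(1-3) p] by metis
  obtain u' where u': "u' \<in> kX" "embed_poly u :* inv_x :^ n = E.ev inv_x u'"
    using reverse[OF uvw(1)] by (auto simp: n_def)
  obtain v' where v': "v' \<in> kX" "embed_poly v :* inv_x :^ n = E.ev inv_x v'"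
    using reverse[OF uvw(2)] by (auto simp: n_def)
  obtain w' where w': "w' \<in> kX" "embed_poly w :* inv_x :^ n = E.ev inv_x w'"
    using reverse[OF uvw(3)] by (auto simp: n_def)
  let ?XX = "[\<one>, \<zero>] .* [\<one>, \<zero>]"
  have power: "inv_x :^ n \<in> carrier F" "inv_x :^ n \<noteq> zF" by auto
  have embedded: "embed_poly u \<in> carrier F" "embed_poly v \<in> carrier F" "embed_poly w \<in> carrier F"
    using uvw by auto
  have "z :* E.ev inv_x (w' .* ?XX) = (z :* embed_poly w) :* (inv_x :^ n :* (inv_x :* inv_x))"
    using w'(1) z power embedded by (simp add: w'(2) [symmetric] FF.m_assoc)
  also have "\<dots> = (embed_poly u :* inv_x :^ n) :* (inv_x :* inv_x) :+ (embed_poly v :* inv_x :^ n) :* y_inf"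
    unfolding uvw(5) y_inf_def using power embedded by (simp add: FF.l_distr FF.r_distr FF.m_ac)
  also have "\<dots> = E.ev inv_x (u' .* ?XX) :+ E.ev inv_x v' :* y_inf" using u' v' by simp
  finally have "z :* E.ev inv_x (w' .* ?XX) = E.ev inv_x (u' .* ?XX) :+ E.ev inv_x v' :* y_inf" .
  moreover have "w' .* ?XX \<noteq> zP"
  proof
    assume "w' .* ?XX = zP"
    then have "w' = zP" using UP.integral[of w' ?XX] w'(1) X_sq_nonzero by auto
    then have "embed_poly w :* inv_x :^ n = zF" using w' by (simp add: E.ev_def)
    then have "embed_poly w = zF" using FF.integral[OF _ embedded(3) power(1)] power by auto
    then show False using uvw embed_poly_zero_iff by simp
  qed
  ultimately show ?thesis using u'(1) v'(1) w'(1) UP.m_closed X_carrier by meson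
qed

lemma indep_infinity:
  assumes uv: "u \<in> kX" "v \<in> kX" and zero: "E.ev inv_x u :+ E.ev inv_x v :* y_inf = zF"
  shows "u = zP \<and> v = zP"
proof -
  define n where "n = length u + length v"
  have reverse: "\<exists>r\<in>kX. E.ev inv_x p :* coord_x :^ n = embed_poly r" if p: "p \<in> kX" "length p \<le> n" for p
    using ev_reverse_poly[OF coord_x_inv_x(2,1,4) p] embed_poly_ev by metis
  obtain u' where u': "u' \<in> kX" "E.ev inv_x u :* coord_x :^ n = embed_poly u'"
    using reverse[OF uv(1)] by (auto simp: n_def)
  obtain v' where v': "v' \<in> kX" "E.ev inv_x v :* coord_x :^ n = embed_poly v'"
    using reverse[OF uv(2)] by (auto simp: n_def)
  let ?XX = "[\<one>, \<zero>] .* [\<one>, \<zero>]"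
  have power: "coord_x :^ n \<in> carrier F" "coord_x :^ n \<noteq> zF" by auto
  have evals: "E.ev inv_x u \<in> carrier F" "E.ev inv_x v \<in> carrier F"
    using uv E.ev_poly_closed by auto
  have "embed_poly (u' .* ?XX) :+ embed_poly v' :* coord_y
      = (E.ev inv_x u :+ E.ev inv_x v :* y_inf) :* (coord_x :^ n :* (coord_x :* coord_x))"
    using u'(1) v'(1) evals power by (simp add: u'(2) [symmetric] v'(2) [symmetric] y_inf_mult_x_sq [symmetric]
        coord_x_def [symmetric] FF.l_distr FF.r_distr FF.m_ac)
  then have "embed_poly (u' .* ?XX) :+ embed_poly v' :* coord_y = zF"
    unfolding zero using power by simp
  then have "u' .* ?XX = zP" "v' = zP" using FF.indep[of "u' .* ?XX" v'] u' v' by auto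
  then have "u' = zP" using UP.integral[of u' ?XX] u'(1) X_sq_nonzero by auto
  then have "E.ev inv_x u = zF" "E.ev inv_x v = zF"
    using u' v' \<open>v' = zP\<close> FF.integral[OF _ evals(1) power(1)] FF.integral[OF _ evals(2) power(1)] power embed_poly_zero_iff by auto
  then show ?thesis using ev_inv_x_zero uv by simp
qed

lemma quad_ext_infinity: "quad_ext F A (E.ev inv_x) y_inf cubic_inf"
  by (intro quad_ext.intro quad_ext_axioms.intro FF.field_axioms UP.domain_axioms cubic_inf_carrier(2) FF.two_unit
      ring_hom_ring.homh[OF E.ev_hom] coord_x_inv_x y_inf_closed y_inf_sq rep_infinity indep_infinity)

lemma X_monic_irred: "[\<one>, \<zero>] \<in> monic_irreds" by (rule linear_monic_irred) simp

lemma cubic_inf_squarefree: "\<not> ([\<one>, \<zero>] .* [\<one>, \<zero>]) .| cubic_inf"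
proof
  assume "([\<one>, \<zero>] .* [\<one>, \<zero>]) .| cubic_inf"
  then obtain h where h: "h \<in> kX" "cubic_inf = [\<one>, \<zero>] .* [\<one>, \<zero>] .* h" by (auto simp: factor_def)
  then have "[\<one>, \<zero>] .* unit_inf = [\<one>, \<zero>] .* ([\<one>, \<zero>] .* h)" by (simp add: cubic_inf_def UP.m_assoc)
  then have factor: "unit_inf = [\<one>, \<zero>] .* h" using h by (subst (asm) UP.m_lcancel) auto
  interpret H: ring_hom_ring A R "\<lambda>p. eval p \<zero>" by (rule eval_poly_hom) simp
  have "eval unit_inf \<zero> = \<one>" unfolding unit_inf_def by (subst H.hom_add) (simp_all add: eval_X_mult)
  moreover have "eval unit_inf \<zero> = \<zero>" unfolding factor using eval_X_mult h by simp
  ultimately show False by simp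
qed

lemma quad_place_infinity: "quad_place F A (E.ev inv_x) y_inf cubic_inf [\<one>, \<zero>] length (polys_below 1)"
  using quad_place_poly[OF quad_ext_infinity X_monic_irred cubic_inf_squarefree] by simp

end

section \<open>Places of the function field\<close>

context curve_field
begin

definition lying_over :: "'a list \<Rightarrow> ('a list list set \<times> 'a list list set) set set set" where
  "lying_over P = {W. valuation_ring F C W \<and> embed_poly ` kX \<subseteq> W \<and> embed_poly P \<in> FF.nonunits W}"

lemma lying_overD:
  assumes "W \<in> lying_over P"
  shows "valuation_ring F C W" "embed_poly ` kX \<subseteq> W" "embed_poly P \<in> FF.nonunits W"
  using assms by (simp_all add: lying_over_def)

abbreviation "places_over P \<equiv> FF.nonunits ` lying_over P"

lemma place_degree_lying_over:
  assumes "valuation_ring F C W" "card (carrier (F\<lparr>carrier := W\<rparr> Quot FF.nonunits W)) = order R ^ n"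
  shows "place_degree F C (FF.nonunits W) = n"
  using FF.place_degree_by_card[OF assms(1) C_subfield C_card(1)] assms(2) C_card order_gt_1 by simp

context
  fixes P
  assumes P: "P \<in> monic_irreds"
begin

interpretation Q: quad_place F A embed_poly coord_y cubic_poly P length "polys_below (degree P)"
  by (rule quad_place_finite[OF P])

lemma cubic_sqrts_eq: "cubic_sqrts P = {s \<in> polys_below (degree P). Q.pi_dvd (s .* s .- cubic_poly)}"
  by (simp add: cubic_sqrts_def Q.pi_dvd_def)

lemma cubic_sqrtsD: "s \<in> cubic_sqrts P \<Longrightarrow> s \<in> kX" "s \<in> cubic_sqrts P \<Longrightarrow> Q.pi_dvd (s .* s .- cubic_poly)"
  using polys_below_carrier by (auto simp: cubic_sqrts_eq)

lemma lying_over_split: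
  assumes "cubic_sqrts P \<noteq> {}" shows "lying_over P = Q.split_ring ` cubic_sqrts P"
proof (intro equalityI subsetI)
  obtain s where s: "s \<in> cubic_sqrts P" using assms by blast
  fix W assume "W \<in> lying_over P"
  then show "W \<in> Q.split_ring ` cubic_sqrts P"
    using Q.exists_split_above[OF lying_overD cubic_sqrtsD[OF s]] unfolding cubic_sqrts_eq by blast
next
  fix W assume "W \<in> Q.split_ring ` cubic_sqrts P"
  then obtain s where "s \<in> cubic_sqrts P" "W = Q.split_ring s" by blast
  then show "W \<in> lying_over P"
    using Q.split_ring_valuation[OF C_subset_embed_poly cubic_sqrtsD] by (simp add: lying_over_def)
qed

lemma card_lying_over_split: "cubic_sqrts P \<noteq> {} \<Longrightarrow> card (lying_over P) = card (cubic_sqrts P)"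
  using card_image[OF Q.inj_split_ring] by (simp add: lying_over_split cubic_sqrts_eq)

lemma place_degree_split:
  assumes "cubic_sqrts P \<noteq> {}" "W \<in> lying_over P"
  shows "place_degree F C (FF.nonunits W) = degree P"
proof (rule place_degree_lying_over[OF lying_overD(1)[OF assms(2)]])
  obtain s where s: "s \<in> cubic_sqrts P" "W = Q.split_ring s" using assms lying_over_split by blast
  then show "card (carrier (F\<lparr>carrier := W\<rparr> Quot FF.nonunits W)) = order R ^ degree P"
    using Q.card_residue_split[OF C_subset_embed_poly cubic_sqrtsD[OF s(1)]] card_polys_below(2) by simp
qed

lemma no_sqrt_mod:
  assumes "cubic_sqrts P = {}" "s \<in> kX" shows "\<not> Q.pi_dvd (s .* s .- cubic_poly)"
proof
  assume root: "Q.pi_dvd (s .* s .- cubic_poly)"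
  obtain t where t: "t \<in> polys_below (degree P)" "Q.pi_dvd (s .- t)"
    using Q.reps_exists[OF assms(2)] by (auto simp: Q.pi_dvd_def)
  have "Q.pi_dvd (t .* t .- cubic_poly)"
    by (rule Q.sqrt_mod_cong[OF assms(2) polys_below_carrier[OF t(1)] t(2) root])
  then show False using assms(1) t(1) by (auto simp: cubic_sqrts_eq)
qed

lemma lying_over_inert: assumes "cubic_sqrts P = {}" shows "lying_over P = {Q.inert_ring}"
proof -
  note no_sqrt = no_sqrt_mod[OF assms]
  have "W = Q.inert_ring" if "W \<in> lying_over P" for W
    by (rule Q.above_inert[OF no_sqrt lying_overD[OF that]])
  moreover have "Q.inert_ring \<in> lying_over P"
    unfolding lying_over_def mem_Collect_eq
    using Q.inert_ring_valuation[OF no_sqrt C_subset_embed_poly] by blast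
  ultimately show ?thesis by blast
qed

lemma place_degree_inert:
  assumes "cubic_sqrts P = {}" "W \<in> lying_over P"
  shows "place_degree F C (FF.nonunits W) = 2 * degree P"
proof (rule place_degree_lying_over[OF lying_overD(1)[OF assms(2)]])
  have "W = Q.inert_ring" using lying_over_inert assms by blast
  then show "card (carrier (F\<lparr>carrier := W\<rparr> Quot FF.nonunits W)) = order R ^ (2 * degree P)"
    using Q.card_residue_inert[OF no_sqrt_mod[OF assms(1)] C_subset_embed_poly] card_polys_below(2)
    by (simp add: power_mult [symmetric] mult.commute)
qed

lemma card_places_over:
  "finite (places_over P)" "card (places_over P) = (if cubic_sqrts P = {} then 1 else card (cubic_sqrts P))"
proof -
  have "inj_on FF.nonunits (lying_over P)"
    by (rule inj_onI) (use FF.nonunits_inj lying_overD(1) in blast)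
  then have "card (places_over P) = card (lying_over P)" by (rule card_image)
  then show "card (places_over P) = (if cubic_sqrts P = {} then 1 else card (cubic_sqrts P))"
    using card_lying_over_split lying_over_inert by simp
  show "finite (places_over P)"
    using lying_over_split lying_over_inert finite_cubic_sqrts[of P]
    by (cases "cubic_sqrts P = {}") auto
qed

lemma place_degree_places_over:
  "v \<in> places_over P \<Longrightarrow> place_degree F C v = (if cubic_sqrts P = {} then 2 * degree P else degree P)"
  using place_degree_split place_degree_inert by auto

lemma lying_over_unique:
  assumes "P' \<in> monic_irreds" "W \<in> lying_over P" "W \<in> lying_over P'" shows "P = P'"
proof -
  have "Q.pi_dvd P'"
    using Q.\<iota>_nonunit_iff[OF lying_overD[OF assms(2)] monic_irredD(2)[OF assms(1)]] lying_overD(3)[OF assms(3)]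
    by blast
  then show ?thesis using monic_irred_divides_eq[OF P assms(1)] by (simp add: Q.pi_dvd_def)
qed

end

lemma ev_in_subring:
  assumes W: "subring W F" "C \<subseteq> W" "t \<in> W" and "set p \<subseteq> carrier R" shows "E.ev t p \<in> W"
proof -
  have t: "t \<in> carrier F" using subringE(1)[OF W(1)] W(3) by auto
  have power: "t :^ (n::nat) \<in> W" for n by (induction n) (use W subringE(3,6)[OF W(1)] in auto)
  show ?thesis using assms(4)
  proof (induction p)
    case Nil
    then show ?case using subringE(2)[OF W(1)] by (simp add: E.ev_def)
  next
    case (Cons c p)
    then have "embed_const c \<in> W" using W(2) C_eq by auto
    then show ?case unfolding ev_Cons[OF t] using Cons power subringE(6,7)[OF W(1)] by simp
  qed
qed

sublocale Inf: quad_place F A "E.ev inv_x" y_inf cubic_inf "[\<one>, \<zero>]" length "polys_below 1"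
  by (rule quad_place_infinity)

lemma C_subset_ev_inv_x: "C \<subseteq> E.ev inv_x ` kX"
proof
  fix c assume "c \<in> C"
  then obtain r where "r \<in> carrier R" "c = E.ev inv_x (poly_of_const r)"
    using C_eq ev_const[OF coord_x_inv_x(2)] by auto
  then show "c \<in> E.ev inv_x ` kX" by auto
qed

lemma nil_closed: "[] \<in> kX" "[] \<in> polys_below 1"
  using UP.zero_closed by (auto simp: polys_below_def)

lemma pi_dvd_cubic_inf: "Inf.pi_dvd cubic_inf" unfolding cubic_inf_def by (rule Inf.pi_dvdI) simp

lemma sqrt_infinity: "Inf.pi_dvd ([] .* [] .- cubic_inf)"
  using Inf.pi_dvd_minus[of "[]" cubic_inf] Inf.pi_dvd_zero pi_dvd_cubic_inf nil_closed(1) UP.r_null[OF nil_closed(1)] by simp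

lemma sqrt_infinity_unique:
  assumes s: "s \<in> polys_below 1" and root: "Inf.pi_dvd (s .* s .- cubic_inf)" shows "s = []"
proof -
  have s_closed: "s \<in> kX" using polys_below_carrier[OF s] .
  have "Inf.pi_dvd (s .* s)"
    using Inf.pi_dvd_cong[of "s .* s" cubic_inf] s_closed root pi_dvd_cubic_inf by simp
  then have "[\<one>, \<zero>] .| s" using Inf.pi_dvd_prime[OF s_closed s_closed]
    by (auto simp: Inf.pi_dvd_def)
  moreover have "[\<one>, \<zero>] \<in> monics_deg 1"
    using monic_irredD(1)[OF X_monic_irred] by (simp add: monics_deg_def)
  ultimately show ?thesis using polys_below_zero s by blast
qed

abbreviation "infinite_ring \<equiv> Inf.split_ring []"

lemmas infinite_ring_valuation = Inf.split_ring_valuation[OF C_subset_ev_inv_x nil_closed(1) sqrt_infinity]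

lemma coord_x_notin_infinite_ring: "coord_x \<notin> infinite_ring"
  using infinite_ring_valuation(3) inv_inv_x by (simp add: FF.nonunits_def)

lemma infinite_ring_unique:
  assumes W: "valuation_ring F C W" "coord_x \<notin> W" shows "W = infinite_ring"
proof -
  note WD = FF.valuation_ringD[OF W(1)]
  have "inv_x \<in> W" using WD(5)[OF coord_x_inv_x(1,5)] W(2) by (simp add: inv_x_def)
  then have "inv_x \<in> FF.nonunits W" "E.ev inv_x ` kX \<subseteq> W"
    using W(2) inv_inv_x ev_in_subring[OF WD(1,2)] poly_set_carrier by (auto simp: FF.nonunits_def)
  then obtain s where "s \<in> polys_below 1" "Inf.pi_dvd (s .* s .- cubic_inf)" "W = Inf.split_ring s"
    using Inf.exists_split_above[OF W(1) _ _ nil_closed(1) sqrt_infinity] by auto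
  then show ?thesis using sqrt_infinity_unique by blast
qed

lemma place_degree_infinite_ring: "place_degree F C (FF.nonunits infinite_ring) = 1"
  using Inf.card_residue_split[OF C_subset_ev_inv_x nil_closed(1) sqrt_infinity] card_polys_below(2)[of 1]
  by (intro place_degree_lying_over infinite_ring_valuation(1)) simp

lemma embed_const_notin_nonunits:
  assumes W: "valuation_ring F C W" and c: "c \<in> carrier R" "c \<noteq> \<zero>"
  shows "embed_const c \<notin> FF.nonunits W"
proof
  assume "embed_const c \<in> FF.nonunits W"
  moreover have "embed_const (inv c) \<in> W" using FF.valuation_ringD(2)[OF W] C_eq c by auto
  ultimately have "embed_const (inv c) :* embed_const c \<in> FF.nonunits W"
    by (rule FF.nonunits_mult[OF W, rotated])
  moreover have "embed_const (inv c) :* embed_const c = oF"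
    using E.S.hom_mult[of "inv c" c] c by simp
  ultimately show False using FF.one_not_nonunit[OF W] by simp
qed

context
  fixes W
  assumes W: "valuation_ring F C W" and coord_x_W: "coord_x \<in> W"
begin

lemma embed_poly_subset: "embed_poly ` kX \<subseteq> W"
  using ev_in_subring[OF FF.valuation_ringD(1,2)[OF W] coord_x_W] poly_set_carrier embed_poly_ev by auto

lemma exists_monic_irred_nonunit:
  assumes "u \<in> kX" "u \<noteq> []" "embed_poly u \<in> FF.nonunits W"
  shows "\<exists>P\<in>monic_irreds. embed_poly P \<in> FF.nonunits W"
  using assms
proof (induction "length u" arbitrary: u rule: less_induct)
  case less
  show ?case
  proof (cases "degree u > 0")
    case True
    then obtain P w where factor: "P \<in> monic_irreds" "w \<in> kX" "w \<noteq> []" "u = P .* w" "length w < length u"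
      using exists_monic_irred_factor less.prems by metis
    have P: "P \<in> kX" using monic_irredD(2)[OF factor(1)] .
    then have "embed_poly P \<in> W" "embed_poly w \<in> W" "embed_poly P :* embed_poly w \<in> FF.nonunits W"
      using embed_poly_subset factor less.prems by auto
    then show ?thesis using FF.nonunits_prime[OF W] less.hyps[OF factor(5,2,3)] factor(1) by blast
  next
    case False
    then obtain c where c: "u = [c]" using less.prems by (cases u) auto
    then have "c \<in> carrier R" "c \<noteq> \<zero>" using less.prems by (auto simp: poly_carrier_iff)
    then show ?thesis
      using embed_const_notin_nonunits[OF W] less.prems(3) c
      by (auto simp: embed_const_def poly_of_const_eq)
  qed
qed

lemma exists_poly_nonunit: "\<exists>u\<in>kX. u \<noteq> [] \<and> embed_poly u \<in> FF.nonunits W"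
proof (rule ccontr)
  note WD = FF.valuation_ringD[OF W]
  assume no_nonunit: "\<not> ?thesis"
  have y: "coord_y \<in> W" using FF.y_in_above[OF W embed_poly_subset] .
  have "z \<in> W" if z: "z \<in> carrier F" for z
  proof -
    obtain u v w
      where uvw: "u \<in> kX" "v \<in> kX" "w \<in> kX" "w \<noteq> []"
        "z :* embed_poly w = embed_poly u :+ embed_poly v :* coord_y"
      using FF.rep[OF z] by auto
    have w: "embed_poly w \<noteq> zF" "embed_poly w \<in> carrier F" using embed_poly_zero_iff uvw by auto
    have "inv\<^bsub>F\<^esub> embed_poly w \<in> W" using no_nonunit embed_poly_subset uvw w
      by (auto simp: FF.nonunits_def)
    moreover have "embed_poly u :+ embed_poly v :* coord_y \<in> W"
      using subsetD[OF embed_poly_subset imageI] uvw y subringE(6,7)[OF WD(1)] by simp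
    ultimately have "(z :* embed_poly w) :* inv\<^bsub>F\<^esub> embed_poly w \<in> W"
      unfolding uvw(5) using subringE(6)[OF WD(1)] by blast
    then show ?thesis using z w by (simp add: FF.m_assoc)
  qed
  then show False using WD(3,4) by blast
qed

lemma exists_lying_over: "\<exists>P\<in>monic_irreds. W \<in> lying_over P"
  using exists_poly_nonunit exists_monic_irred_nonunit W embed_poly_subset
  by (auto simp: lying_over_def)

end

definition infinite_place where "infinite_place = FF.nonunits infinite_ring"

lemma places_eq: "places F C = insert infinite_place (\<Union>P\<in>monic_irreds. places_over P)"
proof -
  have "{W. valuation_ring F C W} = insert infinite_ring (\<Union>P\<in>monic_irreds. lying_over P)"
  proof (intro equalityI subsetI)
    fix W assume "W \<in> {W. valuation_ring F C W}"
    then show "W \<in> insert infinite_ring (\<Union>P\<in>monic_irreds. lying_over P)"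
      using exists_lying_over[of W] infinite_ring_unique[of W] by (cases "coord_x \<in> W") auto
  qed (use lying_overD(1) infinite_ring_valuation(1) in auto)
  then show ?thesis unfolding FF.places_eq infinite_place_def by (simp only: image_insert image_UN)
qed

lemma infinite_place_notin: "infinite_place \<notin> (\<Union>P\<in>monic_irreds. places_over P)"
proof -
  have "coord_x \<in> W" if "W \<in> lying_over P" for W P
    using lying_overD(2)[OF that] by (auto simp: coord_x_def)
  then show ?thesis
    using FF.nonunits_inj[OF infinite_ring_valuation(1) lying_overD(1)] coord_x_notin_infinite_ring
    unfolding infinite_place_def by blast
qed

lemma disjoint_places_over:
  "P \<in> monic_irreds \<Longrightarrow> P' \<in> monic_irreds \<Longrightarrow> P \<noteq> P' \<Longrightarrow> places_over P \<inter> places_over P' = {}"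
  using FF.nonunits_inj[OF lying_overD(1) lying_overD(1)] lying_over_unique by blast

end

section \<open>Residue fields of number fields\<close>

lemma (in cring) add_pow_eq_of_integer: "x \<in> carrier R \<Longrightarrow> add_pow R (n::nat) x = \<guillemotleft>int n\<guillemotright> \<otimes> x"
  by (induction n) (simp_all add: l_distr a_comm)

lemma (in cring) add_pow_int_one: "add_pow R (i::int) \<one> = \<guillemotleft>i\<guillemotright>"
proof (cases i)
  case (nonneg n)
  then show ?thesis using add_pow_eq_of_integer[of \<one> n] by (simp add: add_pow_int_ge)
next
  case (neg n)
  then have "add_pow R i \<one> = \<ominus> add_pow R (nat (- i)) \<one>" by (intro add_pow_int_lt) simp
  also have "\<dots> = \<ominus> \<guillemotleft>- i\<guillemotright>" using add_pow_eq_of_integer[of \<one> "nat (- i)"] neg by simp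
  finally show ?thesis by simp
qed

abbreviation (in ring) int_combine :: "int list \<Rightarrow> 'a list \<Rightarrow> 'a" where
  "int_combine ms xs \<equiv> combine (map (\<lambda>i. \<guillemotleft>i\<guillemotright>) ms) xs"

lemma (in cring) int_combine_closed: "set xs \<subseteq> carrier R \<Longrightarrow> int_combine ms xs \<in> carrier R"
  by (rule combine_in_carrier) auto

lemma (in cring) int_combine_scale:
  "set xs \<subseteq> carrier R \<Longrightarrow> \<guillemotleft>c\<guillemotright> \<otimes> int_combine ms xs = int_combine (map ((*) c) ms) xs"
proof (induction ms arbitrary: xs)
  case (Cons m ms)
  then show ?case using int_combine_closed by (cases xs) (auto simp: r_distr m_assoc)
qed simp

lemma (in cring) of_integer_mod: assumes "\<guillemotleft>l\<guillemotright> = \<zero>" shows "\<guillemotleft>i mod l\<guillemotright> = \<guillemotleft>i\<guillemotright>"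
proof -
  have "\<guillemotleft>i\<guillemotright> = \<guillemotleft>i mod l + l * (i div l)\<guillemotright>" by simp
  also have "\<dots> = \<guillemotleft>i mod l\<guillemotright>" unfolding of_int_add of_int_mult assms by simp
  finally show ?thesis by simp
qed

lemma (in cring) of_integer_inverse_mod:
  assumes "coprime m l" "\<guillemotleft>l\<guillemotright> = \<zero>" obtains m' where "\<guillemotleft>m' * m\<guillemotright> = \<one>"
proof -
  obtain m' v where "m' * m + v * l = 1" using assms(1) bezout_int[of m l] by auto
  then have "\<guillemotleft>m' * m\<guillemotright> = \<guillemotleft>1 - v * l\<guillemotright>" by (metis add_diff_cancel_right')
  also have "\<dots> = \<one>" unfolding of_int_diff of_int_mult assms(2) by (simp add: a_minus_def)
  finally show thesis by (rule that)
qed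

lemma (in domain) exists_prime_characteristic:
  assumes "n > 0" "\<guillemotleft>n\<guillemotright> = \<zero>" shows "\<exists>l. normalization_semidom_class.prime l \<and> \<guillemotleft>l::int\<guillemotright> = \<zero>"
  using assms
proof (induction "nat n" arbitrary: n rule: less_induct)
  case less
  show ?case
  proof (cases "n = 1")
    case True
    then show ?thesis using less.prems by simp
  next
    case False
    then obtain l where l: "normalization_semidom_class.prime l" "l dvd n"
      using prime_divisor_exists[of n] less.prems by auto
    then obtain m where m: "n = l * m" by auto
    have "\<guillemotleft>l\<guillemotright> = \<zero> \<or> \<guillemotleft>m\<guillemotright> = \<zero>" using integral[of "\<guillemotleft>l\<guillemotright>" "\<guillemotleft>m\<guillemotright>"] less.prems m by simp
    moreover have "m > 0" "m < n" using m less.prems prime_gt_1_int[OF l(1)]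
      by (auto simp: zero_less_mult_iff)
    ultimately show ?thesis using l less.hyps[of m] by auto
  qed
qed

definition (in ring) independent_mod :: "int \<Rightarrow> 'a list \<Rightarrow> bool" where
  "independent_mod l xs \<longleftrightarrow> set xs \<subseteq> carrier R \<and>
    (\<forall>ms. length ms = length xs \<longrightarrow> int_combine ms xs = \<zero> \<longrightarrow> (\<forall>m\<in>set ms. l dvd m))"

context domain
begin

lemma independent_mod_tl: assumes "independent_mod l (x # xs)" shows "independent_mod l xs"
proof -
  have closed: "x \<in> carrier R" "set xs \<subseteq> carrier R" using assms by (auto simp: independent_mod_def)
  have "\<forall>m\<in>set ms. l dvd m" if ms: "length ms = length xs" "int_combine ms xs = \<zero>" for ms
  proof -
    have "int_combine (0 # ms) (x # xs) = \<zero>" using closed ms int_combine_closed by simp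
    moreover have "length (0 # ms) = length (x # xs)" using ms by simp
    ultimately have "\<forall>m\<in>set (0 # ms). l dvd m" using assms unfolding independent_mod_def by blast
    then show ?thesis by simp
  qed
  then show ?thesis using closed by (simp add: independent_mod_def)
qed

lemma independent_mod_shorten:
  "independent_mod l xs \<Longrightarrow> n \<le> length xs \<Longrightarrow> \<exists>ys. independent_mod l ys \<and> length ys = n"
proof (induction xs)
  case (Cons x xs)
  then show ?case using independent_mod_tl[of l x xs] by (cases "n = Suc (length xs)") auto
qed auto

lemma dependent_mod_combine:
  assumes l: "normalization_semidom_class.prime l" "\<guillemotleft>l\<guillemotright> = \<zero>"
    and xs: "independent_mod l xs" and z: "z \<in> carrier R" "\<not> independent_mod l (z # xs)"
  shows "\<exists>ms. set ms \<subseteq> {0..<l} \<and> length ms = length xs \<and> z = int_combine ms xs"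
proof -
  have xs_carrier: "set xs \<subseteq> carrier R" using xs by (simp add: independent_mod_def)
  then obtain ms'
    where ms': "length ms' = Suc (length xs)" "int_combine ms' (z # xs) = \<zero>" "\<exists>m\<in>set ms'. \<not> l dvd m"
    using z by (auto simp: independent_mod_def)
  then obtain m ms where ms: "ms' = m # ms" "length ms = length xs" by (cases ms') auto
  let ?c = "int_combine ms xs"
  have c: "?c \<in> carrier R" by (rule int_combine_closed[OF xs_carrier])
  have relation: "\<guillemotleft>m\<guillemotright> \<otimes> z \<oplus> ?c = \<zero>" using ms' ms by simp
  have "\<not> l dvd m"
  proof
    assume dvd: "l dvd m"
    then have "\<guillemotleft>m\<guillemotright> = \<zero>" using l(2) by (auto elim!: dvdE)
    then have "?c = \<zero>" using relation z(1) c by simp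
    then show False using xs ms ms'(3) dvd unfolding independent_mod_def by auto
  qed
  then have "coprime m l" using l(1) by (metis coprime_commute prime_imp_coprime)
  then obtain m' where m': "\<guillemotleft>m' * m\<guillemotright> = \<one>" using of_integer_inverse_mod l(2) by blast
  have "\<guillemotleft>m'\<guillemotright> \<otimes> (\<guillemotleft>m\<guillemotright> \<otimes> z \<oplus> ?c) = \<guillemotleft>m' * m\<guillemotright> \<otimes> z \<oplus> \<guillemotleft>m'\<guillemotright> \<otimes> ?c"
    using z(1) c by (simp add: r_distr m_assoc)
  then have "z \<oplus> \<guillemotleft>m'\<guillemotright> \<otimes> ?c = \<zero>" unfolding relation m' using z(1) by simp
  then have "z = \<guillemotleft>- m'\<guillemotright> \<otimes> ?c"
    using z(1) c
    by (simp add: l_minus) (metis m_closed of_int_closed minus_equality a_comm minus_minus)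
  also have "\<dots> = int_combine (map ((*) (- m')) ms) xs" by (rule int_combine_scale[OF xs_carrier])
  also have "\<dots> = int_combine (map (\<lambda>i. - m' * i mod l) ms) xs"
    by (simp only: map_map comp_def of_integer_mod[OF l(2)])
  finally have "z = int_combine (map (\<lambda>i. - m' * i mod l) ms) xs" .
  moreover have "set (map (\<lambda>i. - m' * i mod l) ms) \<subseteq> {0..<l}" using prime_gt_0_int[OF l(1)] by auto
  ultimately show ?thesis using ms(2) by (metis length_map)
qed

text \<open>The argument that a space in which any \<open>n + 1\<close> vectors are dependent is spanned by at most \<open>n\<close> of them,
  for the prime field of characteristic \<open>l\<close>.\<close>

lemma finite_if_dependent_mod:
  assumes l: "normalization_semidom_class.prime l" "\<guillemotleft>l\<guillemotright> = \<zero>"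
    and dependent: "\<And>xs. length xs = Suc n \<Longrightarrow> \<not> independent_mod l xs"
  shows "finite (carrier R)"
proof -
  have length_le: "length xs \<le> n" if "independent_mod l xs" for xs
    using independent_mod_shorten[OF that, of "Suc n"] dependent not_less_eq_eq by blast
  have "independent_mod l []" by (simp add: independent_mod_def)
  then obtain xs where xs: "independent_mod l xs" "\<And>ys. independent_mod l ys \<Longrightarrow> length ys \<le> length xs"
    using ex_has_greatest_nat[of "independent_mod l" "[]" length "Suc n"] length_le
    by (metis le_imp_less_Suc)
  let ?M = "{ms. set ms \<subseteq> {0..<l} \<and> length ms = length xs}"
  have "carrier R \<subseteq> (\<lambda>ms. int_combine ms xs) ` ?M"
  proof
    fix z assume z: "z \<in> carrier R"
    have "\<not> independent_mod l (z # xs)" using xs(2)[of "z # xs"] by auto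
    then show "z \<in> (\<lambda>ms. int_combine ms xs) ` ?M" using dependent_mod_combine[OF l xs(1) z] by blast
  qed
  moreover have "finite ?M" by (rule finite_lists_length_eq) simp
  ultimately show ?thesis by (meson finite_imageI finite_subset)
qed

end

locale char_zero_field = field R for R (structure) +
  assumes of_integer_nonzero: "n \<noteq> 0 \<Longrightarrow> \<guillemotleft>n::int\<guillemotright> \<noteq> \<zero>"
begin

lemma prime_field_carrier: "h \<in> generate_field R {} \<Longrightarrow> h \<in> carrier R"
  using generate_field_in_carrier[of "{}"] by simp

lemma prime_field_fraction:
  "h \<in> generate_field R {} \<Longrightarrow> \<exists>d m. d \<noteq> 0 \<and> \<guillemotleft>d::int\<guillemotright> \<otimes> h = \<guillemotleft>m\<guillemotright>"
proof (induction rule: generate_field.induct)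
  case one
  have "\<guillemotleft>1\<guillemotright> \<otimes> \<one> = \<guillemotleft>1\<guillemotright>" by simp
  then show ?case by (metis zero_neq_one)
next
  case (a_inv h)
  then obtain d m where dm: "d \<noteq> 0" "\<guillemotleft>d::int\<guillemotright> \<otimes> h = \<guillemotleft>m\<guillemotright>" by blast
  have "\<guillemotleft>d\<guillemotright> \<otimes> \<ominus> h = \<guillemotleft>- m\<guillemotright>" using prime_field_carrier[OF a_inv(1)] dm by (simp add: r_minus)
  then show ?case using dm by blast
next
  case (m_inv h)
  then obtain d m where dm: "d \<noteq> 0" "\<guillemotleft>d::int\<guillemotright> \<otimes> h = \<guillemotleft>m\<guillemotright>" by blast
  have h: "h \<in> carrier R" by (rule prime_field_carrier[OF m_inv(1)])
  then have "m \<noteq> 0" using dm m_inv(2) of_integer_nonzero[of d] integral[of "\<guillemotleft>d\<guillemotright>" h] by auto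
  moreover have "\<guillemotleft>m\<guillemotright> \<otimes> inv h = \<guillemotleft>d\<guillemotright>" unfolding dm(2) [symmetric]
    using h m_inv(2) by (simp add: m_assoc)
  ultimately show ?case by blast
next
  case (eng_add h1 h2)
  then obtain d m d' m' where dm: "d \<noteq> 0" "\<guillemotleft>d::int\<guillemotright> \<otimes> h1 = \<guillemotleft>m\<guillemotright>" "d' \<noteq> 0" "\<guillemotleft>d'::int\<guillemotright> \<otimes> h2 = \<guillemotleft>m'\<guillemotright>"
    by blast
  have "\<guillemotleft>d * d'\<guillemotright> \<otimes> (h1 \<oplus> h2) = \<guillemotleft>d'\<guillemotright> \<otimes> (\<guillemotleft>d\<guillemotright> \<otimes> h1) \<oplus> \<guillemotleft>d\<guillemotright> \<otimes> (\<guillemotleft>d'\<guillemotright> \<otimes> h2)"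
    using eng_add(1,2)[THEN prime_field_carrier] by (simp add: r_distr m_ac)
  also have "\<dots> = \<guillemotleft>d' * m + d * m'\<guillemotright>" unfolding dm by simp
  finally show ?case using dm by (metis mult_eq_0_iff)
next
  case (eng_mult h1 h2)
  then obtain d m d' m' where dm: "d \<noteq> 0" "\<guillemotleft>d::int\<guillemotright> \<otimes> h1 = \<guillemotleft>m\<guillemotright>" "d' \<noteq> 0" "\<guillemotleft>d'::int\<guillemotright> \<otimes> h2 = \<guillemotleft>m'\<guillemotright>"
    by blast
  have "\<guillemotleft>d * d'\<guillemotright> \<otimes> (h1 \<otimes> h2) = (\<guillemotleft>d\<guillemotright> \<otimes> h1) \<otimes> (\<guillemotleft>d'\<guillemotright> \<otimes> h2)"
    using eng_mult(1,2)[THEN prime_field_carrier] by (simp add: m_ac)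
  also have "\<dots> = \<guillemotleft>m * m'\<guillemotright>" unfolding dm by simp
  finally show ?case using dm by (metis mult_eq_0_iff)
qed simp

lemma clear_denominators:
  assumes "set Ks \<subseteq> generate_field R {}"
  shows "\<exists>d ms. d \<noteq> 0 \<and> map (\<lambda>k. \<guillemotleft>d::int\<guillemotright> \<otimes> k) Ks = map (\<lambda>i. \<guillemotleft>i\<guillemotright>) ms"
  using assms
proof (induction Ks)
  case Nil
  then show ?case by (intro exI[of _ 1] exI[of _ "[]"]) simp
next
  case (Cons k Ks)
  then obtain d ms where dm: "d \<noteq> 0" "map (\<lambda>k. \<guillemotleft>d::int\<guillemotright> \<otimes> k) Ks = map (\<lambda>i. \<guillemotleft>i\<guillemotright>) ms" by auto
  have k: "k \<in> carrier R" "set Ks \<subseteq> carrier R" using Cons.prems prime_field_carrier by auto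
  obtain d' m' where dm': "d' \<noteq> 0" "\<guillemotleft>d'::int\<guillemotright> \<otimes> k = \<guillemotleft>m'\<guillemotright>"
    using prime_field_fraction[of k] Cons.prems by auto
  have "map (\<lambda>k. \<guillemotleft>d' * d\<guillemotright> \<otimes> k) Ks = map (\<lambda>x. \<guillemotleft>d'\<guillemotright> \<otimes> x) (map (\<lambda>k. \<guillemotleft>d\<guillemotright> \<otimes> k) Ks)"
    using k by (auto simp: m_assoc)
  also have "\<dots> = map (\<lambda>i. \<guillemotleft>i\<guillemotright>) (map ((*) d') ms)" unfolding dm(2) by simp
  finally have "map (\<lambda>k. \<guillemotleft>d' * d\<guillemotright> \<otimes> k) Ks = map (\<lambda>i. \<guillemotleft>i\<guillemotright>) (map ((*) d') ms)" .
  moreover have "\<guillemotleft>d' * d\<guillemotright> \<otimes> k = \<guillemotleft>d * m'\<guillemotright>" using k by (simp add: dm'(2) [symmetric] m_ac)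
  ultimately have "map (\<lambda>k. \<guillemotleft>d' * d\<guillemotright> \<otimes> k) (k # Ks) = map (\<lambda>i. \<guillemotleft>i\<guillemotright>) (d * m' # map ((*) d') ms)"
    by simp
  then show ?case using dm dm' by (metis mult_eq_0_iff)
qed

lemma primitive_relation:
  assumes us: "set us \<subseteq> carrier R" and relation: "int_combine ms us = \<zero>" and nonzero: "\<not> set ms \<subseteq> {0}"
  shows "\<exists>ms'. int_combine ms' us = \<zero> \<and> length ms' = length ms \<and> Gcd (set ms') = 1"
proof (intro exI conjI)
  let ?g = "Gcd (set ms)" and ?ms = "map (\<lambda>m. m div Gcd (set ms)) ms"
  have ms: "map ((*) ?g) ?ms = ms" by (auto intro!: nth_equalityI)
  have g: "?g \<noteq> 0" using nonzero by (simp add: Gcd_0_iff)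
  have "\<guillemotleft>?g\<guillemotright> \<otimes> int_combine ?ms us = \<zero>"
    using int_combine_scale[OF us, of ?g ?ms] unfolding ms relation .
  then show "int_combine ?ms us = \<zero>"
    using integral[OF _ of_int_closed int_combine_closed[OF us]] of_integer_nonzero[OF g] by blast
  have "?g * Gcd (set ?ms) = ?g" using Gcd_mult[of ?g "set ?ms"] ms by (simp add: image_image)
  then show "Gcd (set ?ms) = 1" using g by simp
qed simp

lemma integer_relation:
  assumes dim: "dimension n (generate_field R {}) (carrier R)"
    and us: "set us \<subseteq> carrier R" "length us = Suc n"
  shows "\<exists>ms. length ms = Suc n \<and> int_combine ms us = \<zero> \<and> Gcd (set ms) = 1"
proof -
  let ?Q = "generate_field R {}"
  have Q: "subfield ?Q R" by (rule generate_field_is_subfield) simp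
  have "dependent ?Q us" using independent_length_le_dimension[OF Q dim, of us] us by auto
  then obtain Ks where Ks: "length Ks = length us" "combine Ks us = \<zero>" "set Ks \<subseteq> ?Q" "set Ks \<noteq> {\<zero>}"
    using dependent_imp_non_trivial_combine[OF Q us(1)] by blast
  then have Ks_carrier: "set Ks \<subseteq> carrier R" using prime_field_carrier by blast
  obtain e ms where ms: "e \<noteq> 0" "map (\<lambda>k. \<guillemotleft>e::int\<guillemotright> \<otimes> k) Ks = map (\<lambda>i. \<guillemotleft>i\<guillemotright>) ms"
    using clear_denominators[OF Ks(3)] by blast
  have "int_combine ms us = \<guillemotleft>e\<guillemotright> \<otimes> combine Ks us"
    unfolding ms(2) [symmetric]
    by (rule combine_r_distr[OF Ks_carrier us(1) of_int_closed, symmetric])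
  then have relation: "int_combine ms us = \<zero>" using Ks(2) by simp
  have length: "length ms = length us" using ms(2) Ks(1) by (metis length_map)
  have "\<not> set ms \<subseteq> {0}"
  proof
    assume "set ms \<subseteq> {0}"
    then have "set (map (\<lambda>k. \<guillemotleft>e\<guillemotright> \<otimes> k) Ks) \<subseteq> {\<zero>}" unfolding ms(2) by auto
    then have "k = \<zero>" if "k \<in> set Ks" for k
      using that Ks_carrier integral[of "\<guillemotleft>e\<guillemotright>" k] of_integer_nonzero[OF ms(1)] by auto
    moreover have "Ks \<noteq> []" using Ks(1) us(2) by auto
    ultimately show False using Ks(4)
      by (metis subsetI singletonI singletonD set_empty subset_singletonD)
  qed
  then show ?thesis using primitive_relation[OF us(1) relation] length us(2) by auto
qed

end

locale number_field_prime =
  fixes K :: "('a, 'm) ring_scheme" and p :: "'a set"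
  assumes K: "number_field K" and p: "primeideal p (ring_of_integers K)" and p_nonzero: "p \<noteq> {\<zero>\<^bsub>K\<^esub>}"
begin

abbreviation "\<O> \<equiv> ring_of_integers K"
abbreviation "k \<equiv> residue_field K p"

sublocale K: char_zero_field K
proof -
  interpret field K using K by (simp add: number_field_def)
  have of_positive: "\<guillemotleft>int m\<guillemotright>\<^bsub>K\<^esub> \<noteq> \<zero>\<^bsub>K\<^esub>" if "m > 0" for m
    using K that add_pow_eq_of_integer[OF one_closed, of m] by (auto simp: number_field_def)
  show "char_zero_field K"
  proof
    fix n :: int assume "n \<noteq> 0"
    then have "\<guillemotleft>\<bar>n\<bar>\<guillemotright>\<^bsub>K\<^esub> \<noteq> \<zero>\<^bsub>K\<^esub>" using of_positive[of "nat \<bar>n\<bar>"] by simp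
    then show "\<guillemotleft>n\<guillemotright>\<^bsub>K\<^esub> \<noteq> \<zero>\<^bsub>K\<^esub>" by (auto simp: abs_if split: if_splits)
  qed
qed

sublocale p: primeideal p \<O> by (rule p)

sublocale k: domain k unfolding residue_field_def by (rule p.quotient_is_domain)

lemma integers_simps: "\<one>\<^bsub>\<O>\<^esub> = \<one>\<^bsub>K\<^esub>" "\<zero>\<^bsub>\<O>\<^esub> = \<zero>\<^bsub>K\<^esub>" "x \<otimes>\<^bsub>\<O>\<^esub> y = x \<otimes>\<^bsub>K\<^esub> y" "x \<oplus>\<^bsub>\<O>\<^esub> y = x \<oplus>\<^bsub>K\<^esub> y"
  by (simp_all add: ring_of_integers_def)

lemma integers_carrier_iff: "x \<in> carrier \<O> \<longleftrightarrow> x \<in> carrier K \<and> integral_element K x"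
  by (simp add: ring_of_integers_def)

lemma inclusion_hom: "ring_hom_ring \<O> K (\<lambda>x. x)"
  by (rule ring_hom_ringI2[OF p.ring_axioms K.ring_axioms])
     (auto intro!: ring_hom_memI simp: integers_carrier_iff integers_simps)

sublocale red: ring_hom_ring \<O> k "reduce K p"
proof -
  have "reduce K p = (+>\<^bsub>\<O>\<^esub>) p" by (simp add: fun_eq_iff reduce_def)
  then show "ring_hom_ring \<O> k (reduce K p)"
    unfolding residue_field_def using p.rcos_ring_hom_ring by simp
qed

lemma reduce_surj: "x \<in> carrier k \<Longrightarrow> \<exists>y\<in>carrier \<O>. x = reduce K p y"
  using p.rcosE[of x] unfolding residue_field_def reduce_def by metis

lemma reduce_zero_iff: "x \<in> carrier \<O> \<Longrightarrow> reduce K p x = \<zero>\<^bsub>k\<^esub> \<longleftrightarrow> x \<in> p"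
  unfolding reduce_def residue_field_def by (rule p.rcos_zero_iff)

lemma of_integer_integers: "\<guillemotleft>n\<guillemotright>\<^bsub>\<O>\<^esub> = \<guillemotleft>n\<guillemotright>\<^bsub>K\<^esub>" using ring_hom_ring.hom_of_integer[OF inclusion_hom] .

lemma integer_range: "c \<in> range (\<lambda>n::int. add_pow K n \<one>\<^bsub>K\<^esub>) \<Longrightarrow> \<exists>n. c = \<guillemotleft>n\<guillemotright>\<^bsub>\<O>\<^esub>"
  using K.add_pow_int_one of_integer_integers by auto

lemma integral_constant_term:
  assumes "x \<in> carrier \<O>" "x \<noteq> \<zero>\<^bsub>K\<^esub>"
    and "f \<noteq> []" "hd f = \<one>\<^bsub>K\<^esub>" "\<And>c. c \<in> set f \<Longrightarrow> \<exists>n. c = \<guillemotleft>n\<guillemotright>\<^bsub>\<O>\<^esub>" "K.eval f x = \<zero>\<^bsub>K\<^esub>"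
  shows "\<exists>n w. n \<noteq> 0 \<and> w \<in> carrier \<O> \<and> \<guillemotleft>n\<guillemotright>\<^bsub>\<O>\<^esub> = \<ominus>\<^bsub>\<O>\<^esub> (w \<otimes>\<^bsub>\<O>\<^esub> x)"
  using assms(3-6)
proof (induction f rule: rev_induct)
  case (snoc c g)
  have x: "x \<in> carrier K" using assms(1) integers_carrier_iff by simp
  have "set (g @ [c]) \<subseteq> carrier \<O>" using snoc.prems(3) p.of_int_closed by (metis subsetI)
  then have g: "set g \<subseteq> carrier \<O>" "set g \<subseteq> carrier K" and c: "c \<in> carrier K" "c \<in> carrier \<O>"
    using integers_carrier_iff by auto
  have g_integral: "p.eval g x \<in> carrier \<O>" by (rule p.eval_in_carrier[OF g(1) assms(1)])
  have eval_eq: "p.eval g x = K.eval g x"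
    using ring_hom_ring.eval_hom'[OF inclusion_hom assms(1) g(1)] by simp
  have g_closed: "K.eval g x \<in> carrier K" using g_integral eval_eq integers_carrier_iff by simp
  have root: "K.eval g x \<otimes>\<^bsub>K\<^esub> x \<oplus>\<^bsub>K\<^esub> c = \<zero>\<^bsub>K\<^esub>"
    using snoc.prems(4) K.eval_append_aux[OF g(2) c(1) x] by simp
  obtain n where n: "c = \<guillemotleft>n\<guillemotright>\<^bsub>\<O>\<^esub>" using snoc.prems(3)[of c] by auto
  show ?case
  proof (cases "n = 0")
    case True
    then have c_zero: "c = \<zero>\<^bsub>K\<^esub>" using n of_integer_integers[of 0] by simp
    then have "K.eval g x = \<zero>\<^bsub>K\<^esub>" using root g_closed x assms(2) K.integral[of "K.eval g x" x] by auto
    moreover have "g \<noteq> []" using snoc.prems(2) c_zero by auto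
    ultimately show ?thesis using snoc by auto
  next
    case False
    have "c \<oplus>\<^bsub>\<O>\<^esub> p.eval g x \<otimes>\<^bsub>\<O>\<^esub> x = \<zero>\<^bsub>\<O>\<^esub>"
      using root eval_eq g_closed x c by (simp add: K.a_comm integers_simps)
    then have "c = \<ominus>\<^bsub>\<O>\<^esub> (p.eval g x \<otimes>\<^bsub>\<O>\<^esub> x)"
      by (rule p.minus_equality[symmetric, OF _ p.m_closed[OF g_integral assms(1)] c(2)])
    then show ?thesis using False g_integral n by metis
  qed
qed simp

lemma residue_char_positive: "\<exists>n > 0. \<guillemotleft>n::int\<guillemotright>\<^bsub>k\<^esub> = \<zero>\<^bsub>k\<^esub>"
proof -
  obtain x where x: "x \<in> p" "x \<noteq> \<zero>\<^bsub>K\<^esub>"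
    using p_nonzero additive_subgroup.zero_closed[OF p.additive_subgroup_axioms]
    by (auto simp: integers_simps)
  have x_integral: "x \<in> carrier \<O>" using x p.a_subset by auto
  then obtain f where f: "f \<noteq> []" "hd f = \<one>\<^bsub>K\<^esub>" "set f \<subseteq> range (\<lambda>n::int. add_pow K n \<one>\<^bsub>K\<^esub>)" "K.eval f x = \<zero>\<^bsub>K\<^esub>"
    unfolding integers_carrier_iff integral_element_def by blast
  obtain n w where n: "n \<noteq> 0" "w \<in> carrier \<O>" "\<guillemotleft>n\<guillemotright>\<^bsub>\<O>\<^esub> = \<ominus>\<^bsub>\<O>\<^esub> (w \<otimes>\<^bsub>\<O>\<^esub> x)"
    using integral_constant_term[OF x_integral x(2) f(1,2) integer_range[OF subsetD[OF f(3)]] f(4)]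
    by blast
  have "reduce K p (w \<otimes>\<^bsub>\<O>\<^esub> x) = \<zero>\<^bsub>k\<^esub>"
    using reduce_zero_iff[OF p.m_closed[OF n(2) x_integral]] p.I_l_closed[OF x(1) n(2)] by blast
  then have "reduce K p \<guillemotleft>n\<guillemotright>\<^bsub>\<O>\<^esub> = \<zero>\<^bsub>k\<^esub>" unfolding n(3) using p.m_closed[OF n(2) x_integral] by simp
  then have "\<guillemotleft>\<bar>n\<bar>\<guillemotright>\<^bsub>k\<^esub> = \<zero>\<^bsub>k\<^esub>" using red.hom_of_integer by (simp add: abs_if)
  then show ?thesis using n(1) by (intro exI[of _ "\<bar>n\<bar>"]) simp
qed

lemma residue_relation:
  assumes dim: "K.dimension n (generate_field K {}) (carrier K)"
    and xs: "set xs \<subseteq> carrier k" "length xs = Suc n"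
  shows "\<exists>ms. length ms = Suc n \<and> k.int_combine ms xs = \<zero>\<^bsub>k\<^esub> \<and> Gcd (set ms) = 1"
proof -
  obtain lift where lift: "\<And>x. x \<in> carrier k \<Longrightarrow> lift x \<in> carrier \<O> \<and> x = reduce K p (lift x)"
    using reduce_surj by metis
  let ?ys = "map lift xs"
  have ys: "set ?ys \<subseteq> carrier \<O>" "map (reduce K p) ?ys = xs"
    using lift xs(1) by (auto intro!: map_idI)
  then have "set ?ys \<subseteq> carrier K" using integers_carrier_iff by auto
  then obtain ms where ms: "length ms = Suc n" "K.int_combine ms ?ys = \<zero>\<^bsub>K\<^esub>" "Gcd (set ms) = 1"
    using K.integer_relation[OF dim, of ?ys] xs(2) by auto
  have coeffs: "set (map (\<lambda>i. \<guillemotleft>i\<guillemotright>\<^bsub>\<O>\<^esub>) ms) \<subseteq> carrier \<O>" by auto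
  have "p.int_combine ms ?ys = \<zero>\<^bsub>\<O>\<^esub>"
    using ring_hom_ring.combine_hom[OF inclusion_hom coeffs ys(1)] ms(2)
    by (simp add: comp_def of_integer_integers integers_simps)
  then have "k.int_combine ms xs = \<zero>\<^bsub>k\<^esub>"
    using red.combine_hom[OF coeffs ys(1)] ys(2) by (simp add: comp_def red.hom_of_integer)
  then show ?thesis using ms by blast
qed

theorem finite_residue_field: "finite (carrier k)"
proof -
  obtain l :: int where l: "normalization_semidom_class.prime l" "\<guillemotleft>l\<guillemotright>\<^bsub>k\<^esub> = \<zero>\<^bsub>k\<^esub>"
    using residue_char_positive k.exists_prime_characteristic by blast
  obtain n where dim: "K.dimension n (generate_field K {}) (carrier K)"
    using K unfolding number_field_def by (auto elim: K.finite_dimensionE')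
  have "\<not> k.independent_mod l xs" if xs: "length xs = Suc n" for xs
  proof
    assume indep: "k.independent_mod l xs"
    then obtain ms where ms: "length ms = Suc n" "k.int_combine ms xs = \<zero>\<^bsub>k\<^esub>" "Gcd (set ms) = 1"
      using residue_relation[OF dim _ xs] unfolding k.independent_mod_def by blast
    then have "l dvd Gcd (set ms)" using indep xs
      by (intro Gcd_greatest) (auto simp: k.independent_mod_def)
    then show False using ms(3) not_prime_unit l(1) by metis
  qed
  then show ?thesis by (rule k.finite_if_dependent_mod[OF l])
qed

theorem curve_field_residue:
  assumes ab: "a \<in> carrier \<O>" "b \<in> carrier \<O>" and good: "\<not> PIdl\<^bsub>\<O>\<^esub> (discriminant \<O> a b) \<subseteq> p"
  shows "curve_field k (reduce K p a) (reduce K p b)"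
proof -
  interpret F: field k by (rule k.finite_domain_is_field[OF finite_residue_field])
  let ?\<Delta> = "\<lambda>S a b. \<guillemotleft>4\<guillemotright>\<^bsub>S\<^esub> \<otimes>\<^bsub>S\<^esub> a [^]\<^bsub>S\<^esub> (3::nat) \<oplus>\<^bsub>S\<^esub> \<guillemotleft>27\<guillemotright>\<^bsub>S\<^esub> \<otimes>\<^bsub>S\<^esub> b [^]\<^bsub>S\<^esub> (2::nat)"
  have ab_red: "reduce K p a \<in> carrier k" "reduce K p b \<in> carrier k" using ab by auto
  have \<Delta>_closed: "?\<Delta> \<O> a b \<in> carrier \<O>"
    using ab by (intro p.a_closed p.m_closed p.of_int_closed p.nat_pow_closed)
  have \<Delta>_red_closed: "?\<Delta> k (reduce K p a) (reduce K p b) \<in> carrier k"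
    using ab_red by (intro k.a_closed k.m_closed k.of_int_closed k.nat_pow_closed)
  have disc: "discriminant \<O> a b = \<ominus>\<^bsub>\<O>\<^esub> (\<guillemotleft>16\<guillemotright>\<^bsub>\<O>\<^esub> \<otimes>\<^bsub>\<O>\<^esub> ?\<Delta> \<O> a b)"
    unfolding discriminant_def using ab \<Delta>_closed
    by (simp only: p.add_pow_eq_of_integer p.nat_pow_closed of_nat_numeral)
  have "discriminant \<O> a b \<notin> p" using good p.cgenideal_minimal[OF p.ideal_axioms] by blast
  moreover have "discriminant \<O> a b \<in> carrier \<O>"
    unfolding disc using \<Delta>_closed by (intro p.a_inv_closed p.m_closed p.of_int_closed)
  moreover have "reduce K p (discriminant \<O> a b) = \<ominus>\<^bsub>k\<^esub> (\<guillemotleft>16\<guillemotright>\<^bsub>k\<^esub> \<otimes>\<^bsub>k\<^esub> ?\<Delta> k (reduce K p a) (reduce K p b))"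
    unfolding disc using ab by (simp add: red.hom_of_integer red.hom_nat_pow)
  ultimately have "\<guillemotleft>16\<guillemotright>\<^bsub>k\<^esub> \<otimes>\<^bsub>k\<^esub> ?\<Delta> k (reduce K p a) (reduce K p b) \<noteq> \<zero>\<^bsub>k\<^esub>" using reduce_zero_iff by auto
  then have disc_nonzero: "\<guillemotleft>16\<guillemotright>\<^bsub>k\<^esub> \<noteq> \<zero>\<^bsub>k\<^esub>" "?\<Delta> k (reduce K p a) (reduce K p b) \<noteq> \<zero>\<^bsub>k\<^esub>"
    using k.r_null[OF k.of_int_closed] k.l_null \<Delta>_red_closed by metis+
  have "\<guillemotleft>16\<guillemotright>\<^bsub>k\<^esub> = \<guillemotleft>2\<guillemotright>\<^bsub>k\<^esub> \<otimes>\<^bsub>k\<^esub> \<guillemotleft>8\<guillemotright>\<^bsub>k\<^esub>" using k.of_int_mult[of 2 8] by simp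
  then have two: "\<one>\<^bsub>k\<^esub> \<oplus>\<^bsub>k\<^esub> \<one>\<^bsub>k\<^esub> \<noteq> \<zero>\<^bsub>k\<^esub>" using disc_nonzero(1) by (auto simp: k.of_int_2 [symmetric])
  show ?thesis
    by (intro curve_field.intro curve_field_axioms.intro odd_finite_field.intro odd_finite_field_axioms.intro
        finite_field.intro finite_field_axioms.intro field_polys.intro
        F.field_axioms finite_residue_field two disc_nonzero(2) ab_red)
qed

end

section \<open>The Euler product of the curve\<close>

lemma stable_quadratic_real_root:
  fixes x :: real
  assumes root: "x\<^sup>2 + \<alpha> * x + \<beta> = 0" and "0 < \<beta>" "\<beta> < 1" "\<bar>\<alpha>\<bar> < 1 + \<beta>"
  shows "\<bar>x\<bar> < 1"
proof -
  have "x < 1"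
  proof (rule ccontr)
    assume "\<not> x < 1"
    then have "(x - 1) * (x - \<beta>) \<ge> 0" "(1 + \<beta> + \<alpha>) * x > 0"
      using assms by (auto intro!: mult_nonneg_nonneg mult_pos_pos)
    then show False using root by (simp add: algebra_simps power2_eq_square)
  qed
  moreover have "x > -1"
  proof (rule ccontr)
    assume "\<not> x > -1"
    then have "(- x - 1) * (- x - \<beta>) \<ge> 0" "(1 + \<beta> - \<alpha>) * x < 0"
      using assms by (auto intro!: mult_nonneg_nonneg mult_pos_neg)
    then show False using root by (simp add: algebra_simps power2_eq_square)
  qed
  ultimately show ?thesis by simp
qed

lemma stable_quadratic_root:
  fixes z :: complex
  assumes root: "z ^ 2 + of_real \<alpha> * z + of_real \<beta> = 0" and \<beta>: "0 < \<beta>" "\<beta> < 1" and \<alpha>: "\<bar>\<alpha>\<bar> < 1 + \<beta>"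
  shows "norm z < 1"
proof -
  define x y where "x = Re z" and "y = Im z"
  have re: "x\<^sup>2 - y\<^sup>2 + \<alpha> * x + \<beta> = 0" and im: "2 * (y * x) + \<alpha> * y = 0"
    using root by (auto simp: complex_eq_iff x_def y_def power2_eq_square)
  have "x\<^sup>2 + y\<^sup>2 < 1"
  proof (cases "y = 0")
    case True
    then show ?thesis using stable_quadratic_real_root[OF _ \<beta> \<alpha>, of x] re
      by (simp add: abs_square_less_1)
  next
    case False
    have "(2 * x + \<alpha>) * y = 0" using im by (simp add: algebra_simps)
    then have "\<alpha> = - 2 * x" using False by simp
    then have "x\<^sup>2 + y\<^sup>2 = \<beta>" using re by (simp add: power2_eq_square)
    then show ?thesis using \<beta> by simp
  qed
  then show ?thesis unfolding cmod_def x_def y_def by simp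
qed

lemma quadratic_roots:
  fixes \<alpha> \<beta> :: complex obtains z w where "z + w = - \<alpha>" "z * w = \<beta>"
proof
  define s where "s = csqrt (\<alpha>\<^sup>2 - 4 * \<beta>)"
  have "s\<^sup>2 = \<alpha>\<^sup>2 - 4 * \<beta>" by (simp add: s_def)
  then show "(- \<alpha> + s) / 2 * ((- \<alpha> - s) / 2) = \<beta>" by (simp add: field_simps power2_eq_square)
  show "(- \<alpha> + s) / 2 + (- \<alpha> - s) / 2 = - \<alpha>" by (simp add: field_simps)
qed

lemma inverse_one_minus_const_X: "inverse (1 - fps_const c * fps_X) = (Abs_fps (\<lambda>n. c ^ n) :: 'a::field fps)"
proof (rule fps_inverse_unique, rule fps_ext)
  fix n
  have "(1 - fps_const c * fps_X) * Abs_fps (\<lambda>n. c ^ n)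
      = Abs_fps (\<lambda>n. c ^ n) - fps_const c * (fps_X * Abs_fps (\<lambda>n. c ^ n))"
    by (simp add: algebra_simps)
  then show "((1 - fps_const c * fps_X) * Abs_fps (\<lambda>n. c ^ n)) $ n = 1 $ n" by (cases n) simp_all
qed

definition fps_of_reals :: "real fps \<Rightarrow> complex fps" where
  "fps_of_reals f = Abs_fps (\<lambda>n. complex_of_real (f $ n))"

lemma fps_of_reals_mult: "fps_of_reals (f * g) = fps_of_reals f * fps_of_reals g"
  by (rule fps_ext) (simp add: fps_of_reals_def fps_mult_nth)

lemma fps_of_reals_one: "fps_of_reals 1 = 1" by (rule fps_ext) (simp add: fps_of_reals_def)

lemma l1_bound_fps_of_reals: "l1_bound (fps_of_reals f) B \<longleftrightarrow> l1_bound f B"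
  by (simp add: l1_bound_def fps_of_reals_def)

lemma inverse_quadratic_l1:
  fixes \<alpha> \<beta> :: real
  assumes \<beta>: "0 < \<beta>" "\<beta> < 1" and \<alpha>: "\<bar>\<alpha>\<bar> < 1 + \<beta>"
  shows "\<exists>B. l1_bound (inverse (1 + fps_const \<alpha> * fps_X + fps_const \<beta> * fps_X ^ 2)) B"
proof -
  let ?L = "1 + fps_const \<alpha> * fps_X + fps_const \<beta> * fps_X ^ 2"
  let ?z = "\<lambda>z :: complex. 1 - fps_const z * fps_X"
  obtain z w where zw: "z + w = - complex_of_real \<alpha>" "z * w = of_real \<beta>"
    using quadratic_roots by metis
  have "z ^ 2 + - (z + w) * z + z * w = 0" "w ^ 2 + - (z + w) * w + z * w = 0"
    by (simp_all add: algebra_simps power2_eq_square)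
  then have norm: "norm z < 1" "norm w < 1" unfolding zw
    using stable_quadratic_root[OF _ \<beta> \<alpha>] by simp_all
  have "?z z * ?z w = 1 - fps_const (z + w) * fps_X + fps_const (z * w) * fps_X ^ 2"
    by (simp add: algebra_simps power2_eq_square fps_const_add [symmetric] fps_const_mult [symmetric] del: fps_const_add fps_const_mult)
  also have "\<dots> = fps_of_reals ?L" unfolding zw
    by (rule fps_ext) (auto simp: fps_of_reals_def fps_X_power_nth)
  finally have "?z z * ?z w * fps_of_reals (inverse ?L) = fps_of_reals (?L * inverse ?L)"
    by (simp only: fps_of_reals_mult)
  also have "\<dots> = 1" by (simp add: inverse_mult_eq_1' fps_of_reals_one)
  finally have "inverse (?z z * ?z w) = fps_of_reals (inverse ?L)" by (rule fps_inverse_unique)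
  then have "fps_of_reals (inverse ?L) = Abs_fps (\<lambda>n. z ^ n) * Abs_fps (\<lambda>n. w ^ n)"
    by (simp only: fps_inverse_mult inverse_one_minus_const_X)
  then have "l1_bound (inverse ?L) (1 / (1 - norm z) * (1 / (1 - norm w)))"
    using l1_bound_mult[OF l1_bound_geometric[OF norm(1)] l1_bound_geometric[OF norm(2)]] l1_bound_fps_of_reals
    by metis
  then show ?thesis by blast
qed

definition L_series :: "real \<Rightarrow> real \<Rightarrow> real fps" where
  "L_series q t = 1 + fps_const (t / q) * fps_X + fps_const (1 / q) * fps_X ^ 2"

definition H_series :: "real \<Rightarrow> real \<Rightarrow> real fps" where
  "H_series q t = euler_factor (1 / q) 1 * inverse (L_series q t)"

lemma H_series_nth_1: assumes "q \<noteq> 0" shows "((1 - fps_X) * H_series q t) $ 1 = - ((1 + q + t) / q)"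
proof -
  have inverse_0: "inverse (L_series q t) $ 0 = 1" by (simp add: L_series_def)
  moreover have "(inverse (L_series q t) * L_series q t) $ 1 = 0"
    by (simp add: L_series_def inverse_mult_eq_1)
  moreover have "L_series q t $ 0 = 1" "L_series q t $ 1 = t / q"
    by (simp_all add: L_series_def fps_X_power_nth)
  ultimately have "inverse (L_series q t) $ 1 = - (t / q)" by (simp add: fps_mult_nth_1)
  then show ?thesis using inverse_0 assms by (simp add: H_series_def fps_mult_nth_1 field_simps)
qed

context
  fixes q t :: real
  assumes q_gt_1: "q > 1" and abs_t: "\<bar>t\<bar> \<le> q"
begin

lemma H_series_l1: "\<exists>B. l1_bound (H_series q t) B"
proof -
  have "\<bar>t / q\<bar> \<le> 1" using abs_t q_gt_1 by (simp add: abs_divide)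
  moreover have "0 < 1 / q" "1 / q < 1" using q_gt_1 by simp_all
  ultimately have "\<exists>B. l1_bound (inverse (L_series q t)) B"
    unfolding L_series_def by (intro inverse_quadratic_l1) linarith+
  moreover have "l1_bound (1 + fps_const (- (1 / q)) * fps_X ^ 1) (1 + norm (- (1 / q)))"
    by (intro l1_bound_add l1_bound_one l1_bound_monomial)
  then have "l1_bound (euler_factor (1 / q) 1) (1 + norm (- (1 / q)))" by (simp flip: fps_const_neg)
  ultimately show ?thesis unfolding H_series_def using l1_bound_mult by blast
qed

lemma inverse_H_series_bounded: "\<exists>C. \<forall>n. inverse ((1 - fps_X) * H_series q t) $ n \<le> C"
proof -
  let ?l = "inverse (euler_factor (1 / q) 1)"
  have "inverse (inverse (L_series q t)) = L_series q t"
    by (rule fps_inverse_idempotent) (simp add: L_series_def)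
  then have inverse_eq: "inverse ((1 - fps_X) * H_series q t) = (?l * L_series q t) * Abs_fps (\<lambda>n. 1)"
    by (simp only: H_series_def fps_inverse_mult fps_inverse_one_minus_fps_X mult_ac)
  have "l1_bound (L_series q t) (1 + norm (t / q) + norm (1 / q))"
    unfolding L_series_def
    using l1_bound_add[OF l1_bound_add[OF l1_bound_one l1_bound_monomial[of "t / q" 1]] l1_bound_monomial[of "1 / q" 2]] by simp
  moreover have "l1_bound ?l (1 / (1 - 1 / q))" using q_gt_1 by (intro inverse_euler_factor) auto
  ultimately obtain B where B: "l1_bound (?l * L_series q t) B" using l1_bound_mult by blast
  have "norm (inverse ((1 - fps_X) * H_series q t) $ n) \<le> B * 1" for n
    unfolding inverse_eq by (rule norm_mult_nth_le[OF B]) simp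
  then show ?thesis using abs_le_D1 by (metis mult_1_right real_norm_def)
qed

end

context curve_field
begin

abbreviation "q \<equiv> real (order R)"

lemma q_gt_1: "q > 1" using order_gt_1 by simp

definition trace_sum :: real where "trace_sum = (\<Sum>x\<in>carrier R. qchar (cubic x))"

lemma card_ec_points: "real (card (ec_points R a b)) = 1 + q + trace_sum"
proof -
  let ?S = "{(x, y). x \<in> carrier R \<and> y \<in> carrier R \<and> y [^] (2::nat) = x [^] (3::nat) \<oplus> a \<otimes> x \<oplus> b}"
  have S_eq: "?S = (SIGMA x:carrier R. {y \<in> carrier R. y \<otimes> y = cubic x})"
    by (auto simp: cubic_def numeral_eq_Suc)
  have "finite ?S" unfolding S_eq using finite_carrier by auto
  then have "card (ec_points R a b) = Suc (card (Some ` ?S))"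
    unfolding ec_points_def by (subst card_insert_disjoint) auto
  also have "card (Some ` ?S) = card ?S" by (rule card_image) simp
  finally have "real (card (ec_points R a b)) = 1 + real (card ?S)" by simp
  also have "real (card ?S) = (\<Sum>x\<in>carrier R. real (card {y \<in> carrier R. y \<otimes> y = cubic x}))"
    unfolding S_eq using finite_carrier by (subst card_SigmaI) auto
  also have "\<dots> = (\<Sum>x\<in>carrier R. 1 + qchar (cubic x))" by (rule sum.cong) (simp_all add: card_sqrt)
  finally show ?thesis by (simp add: sum.distrib order_def trace_sum_def)
qed

lemma abs_trace_sum: "\<bar>trace_sum\<bar> \<le> q"
proof -
  have "\<bar>trace_sum\<bar> \<le> (\<Sum>x\<in>carrier R. \<bar>qchar (cubic x)\<bar>)" unfolding trace_sum_def by (rule sum_abs)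
  also have "\<dots> \<le> (\<Sum>x\<in>carrier R. 1)" by (rule sum_mono) (simp add: power_char_def)
  finally show ?thesis by (simp add: order_def)
qed

abbreviation "place_factor v \<equiv> euler_factor (1 / q ^ place_degree F C v) (place_degree F C v)"

abbreviation norm_weight :: "'a list \<Rightarrow> real" where "norm_weight g \<equiv> 1 / q ^ degree g"

end

context curve_character
begin

abbreviation char_weight :: "'a list \<Rightarrow> real" where "char_weight g \<equiv> \<chi> g / q ^ degree g"

lemma card_places_over_le_2: assumes "P \<in> monic_irreds" shows "card (places_over P) \<le> 2"
proof -
  have "\<chi> P \<le> 1" using char_range[of P] by auto
  then have "real (card (cubic_sqrts P)) \<le> 2" using card_cubic_sqrts[OF assms] by linarith
  then show ?thesis using card_places_over(2)[OF assms] by simp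
qed

lemma prod_place_factor_places_over:
  assumes P: "P \<in> monic_irreds"
  shows "(\<Prod>v\<in>places_over P. place_factor v)
    = euler_factor (norm_weight P) (degree P) * euler_factor (char_weight P) (degree P)"
proof (cases "cubic_sqrts P = {}")
  case True
  let ?d = "degree P" and ?m = "fps_const (norm_weight P) * fps_X ^ degree P"
  have char: "\<chi> P = -1" using card_cubic_sqrts[OF P] True by simp
  have "(\<Prod>v\<in>places_over P. place_factor v) = (\<Prod>v\<in>places_over P. euler_factor (1 / q ^ (2 * ?d)) (2 * ?d))"
    by (rule prod.cong) (use place_degree_places_over[OF P] True in auto)
  also have "\<dots> = euler_factor (1 / q ^ (2 * ?d)) (2 * ?d)"
    using card_places_over(2)[OF P] True by simp
  also have "fps_const (1 / q ^ (2 * ?d)) * fps_X ^ (2 * ?d) = ?m ^ 2"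
    unfolding power_even_eq by (simp add: power_mult_distrib power_one_over)
  also have "1 - ?m ^ 2 = (1 - ?m) * (1 + ?m)" by (simp add: algebra_simps Power.power2_eq_square)
  also have "1 + ?m = euler_factor (char_weight P) ?d" unfolding char by (simp flip: fps_const_neg)
  finally show ?thesis .
next
  case False
  let ?e = "euler_factor (norm_weight P) (degree P)"
  have "(\<Prod>v\<in>places_over P. place_factor v) = (\<Prod>v\<in>places_over P. ?e)"
    by (rule prod.cong) (use place_degree_places_over[OF P] False in auto)
  also have "\<dots> = ?e ^ card (cubic_sqrts P)" using card_places_over(2)[OF P] False by simp
  finally have prod_eq: "(\<Prod>v\<in>places_over P. place_factor v) = ?e ^ card (cubic_sqrts P)" .
  have "card (cubic_sqrts P) \<noteq> 0" using False finite_cubic_sqrts by simp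
  then consider "\<chi> P = 0" | "\<chi> P = 1" using char_range[of P] card_cubic_sqrts[OF P] by auto
  then show ?thesis
  proof cases
    case 1
    then have "card (cubic_sqrts P) = 1" using card_cubic_sqrts[OF P] by simp
    then show ?thesis unfolding prod_eq 1 by simp
  next
    case 2
    then have "card (cubic_sqrts P) = 2" using card_cubic_sqrts[OF P] by simp
    then show ?thesis unfolding prod_eq 2 by (simp add: Power.power2_eq_square)
  qed
qed

lemma zeta_norm_weight_nth:
  assumes "n \<le> N" shows "zeta_fps norm_weight (monic_irreds_le N) $ n = 1"
proof -
  have "sum norm_weight (monics_deg n) = (\<Sum>g\<in>monics_deg n. 1 / q ^ n)"
    by (rule sum.cong) (auto simp: monics_deg_def)
  also have "\<dots> = 1" using card_monics_deg[of n] q_gt_1 by simp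
  finally show ?thesis using monics_over_monic_irreds_le[OF assms] by (simp add: zeta_fps_def)
qed

lemma zeta_char_weight_nth:
  assumes "n \<le> N" shows "zeta_fps char_weight (monic_irreds_le N) $ n = L_series q trace_sum $ n"
proof -
  have "sum char_weight (monics_deg n) = (\<Sum>g\<in>monics_deg n. \<chi> g) / q ^ n"
    unfolding sum_divide_distrib by (rule sum.cong) (auto simp: monics_deg_def)
  then have zeta: "zeta_fps char_weight (monic_irreds_le N) $ n = (\<Sum>g\<in>monics_deg n. \<chi> g) / q ^ n"
    using monics_over_monic_irreds_le[OF assms] by (simp add: zeta_fps_def)
  consider "n = 0" | "n = 1" | "n = 2" | "n \<ge> 3" by linarith
  then show ?thesis
  proof cases
    case 1
    then show ?thesis unfolding zeta using char_one by (simp add: L_series_def monics_deg_0)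
  next
    case 2
    then show ?thesis
      unfolding zeta using sum_char_1 by (simp add: L_series_def fps_X_power_nth trace_sum_def)
  next
    case 3
    then show ?thesis
      unfolding zeta using sum_char_2 q_gt_1
      by (simp add: L_series_def fps_X_power_nth Power.power2_eq_square)
  next
    case 4
    then show ?thesis unfolding zeta using sum_char_ge_3 by (simp add: L_series_def fps_X_power_nth)
  qed
qed

lemma prod_places_over_eq:
  "(\<Prod>P\<in>monic_irreds_le N. \<Prod>v\<in>places_over P. place_factor v)
    = inverse (zeta_fps norm_weight (monic_irreds_le N)) * inverse (zeta_fps char_weight (monic_irreds_le N))"
proof -
  let ?Y = "monic_irreds_le N"
  have Y: "finite ?Y" "?Y \<subseteq> monic_irreds"
    using finite_monic_irreds_le by (auto simp: monic_irreds_le_def)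
  have "norm_weight (g .* h) = norm_weight g * norm_weight h"
      "char_weight (g .* h) = char_weight g * char_weight h"
    if "g \<in> monics" "h \<in> monics" for g h
    using monic_degree_mult[OF that] char_mult[OF that] by (simp_all add: power_add)
  then have "zeta_fps norm_weight ?Y * (\<Prod>P\<in>?Y. euler_factor (norm_weight P) (degree P)) = 1"
    "zeta_fps char_weight ?Y * (\<Prod>P\<in>?Y. euler_factor (char_weight P) (degree P)) = 1"
    by (intro zeta_fps_euler Y; simp add: char_one)+
  note inverses = this[THEN fps_inverse_unique]
  have "(\<Prod>P\<in>?Y. \<Prod>v\<in>places_over P. place_factor v)
    = (\<Prod>P\<in>?Y. euler_factor (norm_weight P) (degree P) * euler_factor (char_weight P) (degree P))"
    by (rule prod.cong[OF refl], rule prod_place_factor_places_over) (use Y(2) in auto)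
  then show ?thesis by (simp only: inverses prod.distrib)
qed

lemma prod_places_over_nth:
  assumes "n \<le> N"
  shows "(euler_factor (1 / q) 1 * (\<Prod>P\<in>monic_irreds_le N. \<Prod>v\<in>places_over P. place_factor v)) $ n
    = ((1 - fps_X) * H_series q trace_sum) $ n"
proof -
  let ?Y = "monic_irreds_le N"
  have "(euler_factor (1 / q) 1 * (inverse (zeta_fps norm_weight ?Y) * inverse (zeta_fps char_weight ?Y))) $ n
      = (euler_factor (1 / q) 1 * (inverse (Abs_fps (\<lambda>n. 1)) * inverse (L_series q trace_sum))) $ n"
  proof (intro fps_mult_nth_cong refl)
    fix i j assume "i \<le> n" "j \<le> i"
    then have le: "l \<le> N" if "l \<le> j" for l using that assms by simp
    show "inverse (zeta_fps norm_weight ?Y) $ j = inverse (Abs_fps (\<lambda>n. 1)) $ j"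
      by (rule fps_inverse_nth_cong) (use zeta_norm_weight_nth[of _ N] le in auto)
    show "inverse (zeta_fps char_weight ?Y) $ j = inverse (L_series q trace_sum) $ j"
      by (rule fps_inverse_nth_cong) (use zeta_char_weight_nth[of _ N] le in \<open>auto simp: L_series_def\<close>)
  qed
  then show ?thesis unfolding prod_places_over_eq fps_inverse_gp' H_series_def
    by (simp only: mult_ac)
qed

end

context curve_field
begin

definition places_upto :: "nat \<Rightarrow> ('a list list set \<times> 'a list list set) set set set" where
  "places_upto N = insert infinite_place (\<Union>P\<in>monic_irreds_le N. places_over P)"

lemma degree_le_place_degree: "P \<in> monic_irreds \<Longrightarrow> v \<in> places_over P \<Longrightarrow> degree P \<le> place_degree F C v"
  using place_degree_places_over by auto

lemma place_cases:
  assumes "v \<in> places F C"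
  obtains "v = infinite_place" | P where "P \<in> monic_irreds" "v \<in> places_over P"
  using assms unfolding places_eq by blast

lemma finite_places_over_irreds_le: "finite (\<Union>P\<in>monic_irreds_le N. places_over P)"
  using finite_monic_irreds_le[of N] card_places_over(1) by (auto simp: monic_irreds_le_def)

lemma finite_places_upto: "finite (places_upto N)"
  unfolding places_upto_def using finite_places_over_irreds_le by blast

lemma places_upto_subset: "places_upto N \<subseteq> places F C"
  unfolding places_upto_def places_eq by (auto simp: monic_irreds_le_def)

lemma places_le_subset: "{v \<in> places F C. place_degree F C v \<le> N} \<subseteq> places_upto N"
proof
  fix v assume v: "v \<in> {v \<in> places F C. place_degree F C v \<le> N}"
  then have "v \<in> places F C" by simp
  then show "v \<in> places_upto N"
  proof (cases rule: place_cases)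
    case (2 P)
    then have "P \<in> monic_irreds_le N" using degree_le_place_degree[OF 2] v
      by (simp add: monic_irreds_le_def)
    then show ?thesis using 2(2) unfolding places_upto_def by blast
  qed (simp add: places_upto_def)
qed

lemma place_degree_infinite_place: "place_degree F C infinite_place = 1"
  by (simp add: infinite_place_def place_degree_infinite_ring)

sublocale Div: graded_primes "places F C" "place_degree F C" q
proof
  show "place_degree F C v > 0" if "v \<in> places F C" for v
    using that
  proof (cases rule: place_cases)
    case (2 P)
    then show ?thesis using degree_le_place_degree[OF 2] monic_irredD(3)[OF 2(1)] by linarith
  qed (simp add: place_degree_infinite_place)
  show "finite {v \<in> places F C. place_degree F C v = d}" for d
    by (rule finite_subset[OF _ finite_places_upto[of d]]) (use places_le_subset[of d] in auto)
qed (rule q_gt_1)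

lemma prod_places_upto:
  "(\<Prod>v\<in>places_upto N. place_factor v)
    = euler_factor (1 / q) 1 * (\<Prod>P\<in>monic_irreds_le N. \<Prod>v\<in>places_over P. place_factor v)"
proof -
  let ?U = "\<Union>P\<in>monic_irreds_le N. places_over P"
  have "infinite_place \<notin> ?U" using infinite_place_notin by (auto simp: monic_irreds_le_def)
  then have "(\<Prod>v\<in>places_upto N. place_factor v) = place_factor infinite_place * (\<Prod>v\<in>?U. place_factor v)"
    unfolding places_upto_def by (rule prod.insert[OF finite_places_over_irreds_le])
  also have "(\<Prod>v\<in>?U. place_factor v) = (\<Prod>P\<in>monic_irreds_le N. \<Prod>v\<in>places_over P. place_factor v)"
    by (rule prod.UNION_disjoint[OF finite_monic_irreds_le])
       (use card_places_over(1) disjoint_places_over in \<open>auto simp: monic_irreds_le_def\<close>)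
  finally show ?thesis by (simp add: place_degree_infinite_place)
qed

theorem euler_product_nth:
  assumes "n \<le> N"
  shows "((1 - fps_X) * H_series q trace_sum) $ n = (\<Prod>d\<in>{1..N}. Div.factor d) $ n"
proof -
  obtain \<chi> where "curve_character R a b \<chi>" by (rule exists_curve_character)
  then interpret curve_character R a b \<chi> .
  let ?T = "{v \<in> places F C. 0 < place_degree F C v \<and> place_degree F C v \<le> N}"
  let ?E = "places_upto N - ?T"
  have "{1..N} = {0<..N}" by auto
  then have "(\<Prod>d\<in>{1..N}. Div.factor d) $ n = (\<Prod>v\<in>?T. place_factor v) $ n"
    by (simp only: Div.prod_factor_eq)
  also have "\<dots> = ((\<Prod>v\<in>?T. place_factor v) * (\<Prod>v\<in>?E. place_factor v)) $ n"
  proof (rule mult_prod_euler_factors_nth [symmetric])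
    show "n < place_degree F C v" if "v \<in> ?E" for v
      using that places_upto_subset[of N] Div.deg_pos[of v] assms by (auto simp: not_le)
  qed (simp add: finite_places_upto)
  also have "(\<Prod>v\<in>?T. place_factor v) * (\<Prod>v\<in>?E. place_factor v) = (\<Prod>v\<in>places_upto N. place_factor v)"
  proof (subst mult.commute, rule prod.subset_diff [symmetric])
    show "?T \<subseteq> places_upto N" using places_le_subset[of N] by auto
  qed (rule finite_places_upto)
  finally show ?thesis unfolding prod_places_upto prod_places_over_nth[OF assms] ..
qed

lemma prime_count_1: "real (Div.prime_count 1) = real (card (ec_points R a b))"
proof -
  have q_nonzero: "q \<noteq> 0" using q_gt_1 by simp
  have "- (real (Div.prime_count 1) / q) = Div.factor 1 $ 1"
    unfolding Div.factor_def using euler_factor_power_nth_1[of "1 / q" "Div.prime_count 1"] by simp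
  also have "\<dots> = ((1 - fps_X) * H_series q trace_sum) $ 1" using euler_product_nth[of 1 1] by simp
  also have "\<dots> = - ((1 + q + trace_sum) / q)" by (rule H_series_nth_1[OF q_nonzero])
  finally show ?thesis
    by (simp only: Groups.neg_equal_iff_equal divide_cancel_right q_nonzero card_ec_points simp_thms)
qed

abbreviation "places_over_degree d \<equiv> \<Union>P\<in>{P \<in> monic_irreds. degree P = d}. places_over P"

lemma finite_monic_irreds_degree: "finite {P \<in> monic_irreds. degree P = d}"
  by (rule finite_subset[OF _ finite_monic_irreds_le[of d]]) (auto simp: monic_irreds_le_def)

lemma finite_places_over_degree: "finite (places_over_degree d)"
  using finite_monic_irreds_degree card_places_over(1) by auto

lemma card_places_over_degree: assumes "d > 0"
  shows "real (card (places_over_degree d)) * d \<le> 2 * q ^ d"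
proof -
  obtain \<chi> where "curve_character R a b \<chi>" by (rule exists_curve_character)
  then interpret curve_character R a b \<chi> .
  let ?I = "{P \<in> monic_irreds. degree P = d}"
  have "card (places_over_degree d) \<le> (\<Sum>P\<in>?I. card (places_over P))"
    using finite_monic_irreds_degree by (rule card_UN_le)
  also have "\<dots> \<le> (\<Sum>P\<in>?I. 2)" by (rule sum_mono) (use card_places_over_le_2 in auto)
  finally have "card (places_over_degree d) * d \<le> 2 * (card ?I * d)" by simp
  also have "\<dots> \<le> 2 * order R ^ d" using card_monic_irreds_degree[OF assms] by simp
  finally have "card (places_over_degree d) * d \<le> 2 * order R ^ d" .
  from of_nat_mono[OF this, where 'a = real] show ?thesis
    by (simp only: semiring_1_class.of_nat_mult semiring_1_class.of_nat_power of_nat_numeral)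
qed

lemma places_of_degree_subset:
  "{v \<in> places F C. place_degree F C v = d}
    \<subseteq> insert infinite_place (places_over_degree d \<union> (if even d then places_over_degree (d div 2) else {}))"
proof
  fix v assume v: "v \<in> {v \<in> places F C. place_degree F C v = d}"
  then have "v \<in> places F C" by simp
  then show "v
      \<in> insert infinite_place (places_over_degree d \<union> (if even d then places_over_degree (d div 2) else {}))"
  proof (cases rule: place_cases)
    case (2 P)
    then have "d = (if cubic_sqrts P = {} then 2 * degree P else degree P)"
      using place_degree_places_over[OF 2] v by simp
    then show ?thesis using 2 by (cases "cubic_sqrts P = {}") auto
  qed simp
qed

lemma prime_count_le: assumes "d > 0" shows "real (Div.prime_count d) / q ^ d \<le> 7 / real d"
proof -
  let ?E = "if even d then places_over_degree (d div 2) else {}"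
  have "real (card ?E) * d \<le> 4 * q ^ d"
  proof (cases "even d")
    case True
    then obtain e where e: "d = 2 * e" by auto
    then have "real (card (places_over_degree e)) * e \<le> 2 * q ^ e"
      using assms by (intro card_places_over_degree) simp
    moreover have "real (card (places_over_degree e)) * d = 2 * (real (card (places_over_degree e)) * e)"
      by (simp add: e)
    ultimately have "real (card (places_over_degree e)) * d \<le> 4 * q ^ e" by linarith
    also have "q ^ e \<le> q ^ d" using q_gt_1 e by (intro power_increasing) auto
    finally show ?thesis using e by simp
  qed (use q_gt_1 in simp)
  moreover have "d \<le> order R ^ d" using power_gt_expt[of "order R" d] order_gt_1 by simp
  from of_nat_mono[OF this, where 'a = real] have "real d \<le> q ^ d"
    by (simp only: semiring_1_class.of_nat_power)
  moreover have "Div.prime_count d \<le> Suc (card (places_over_degree d) + card ?E)"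
  proof -
    have "Div.prime_count d \<le> card (insert infinite_place (places_over_degree d \<union> ?E))"
      unfolding Div.prime_count_def
      by (rule card_mono[OF _ places_of_degree_subset]) (use finite_places_over_degree in auto)
    also have "\<dots> \<le> Suc (card (places_over_degree d \<union> ?E))" by (rule card_insert_le_m1) auto
    also have "\<dots> \<le> Suc (card (places_over_degree d) + card ?E)"
      unfolding Suc_le_mono by (rule card_Un_le)
    finally show ?thesis .
  qed
  then have "real (Div.prime_count d) * d \<le> (1 + real (card (places_over_degree d)) + real (card ?E)) * d"
    by (intro mult_right_mono) (simp_all flip: of_nat_add of_nat_Suc)
  ultimately have "real (Div.prime_count d) * d \<le> 7 * q ^ d"
    using card_places_over_degree[OF assms] unfolding distrib_right by linarith
  then show ?thesis using assms q_gt_1 by (simp add: field_simps)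
qed

lemma unique_least_nonempty:
  fixes d :: "'p \<Rightarrow> nat"
  shows "D \<noteq> {#} \<and> (\<exists>!p. p \<in># D \<and> (\<forall>r. r \<in># D \<longrightarrow> d p \<le> d r))
    \<longleftrightarrow> (\<exists>!p. p \<in># D \<and> (\<forall>r\<in>#D. d p \<le> d r))"
  by (auto simp: Ball_def)

lemma distinguishable_divisors_iff:
  "D \<in> distinguishable_divisors F C \<longleftrightarrow> set_mset D \<subseteq> places F C \<and> Div.uniquely_least (set_mset D)"
  unfolding distinguishable_divisors_def effective_divisors_def distinguishable_def Div.uniquely_least_def
    mem_Collect_eq unique_least_nonempty ..

theorem sum_distinguishable_function_field:
  "(\<lambda>n. \<Sum>D | D \<in> distinguishable_divisors F C \<and> 2 \<le> div_degree F C D \<and> div_degree F C D \<le> n.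
      real_of_int (div_moebius D) / real (div_norm F C D)) \<longlonglongrightarrow> real (card (ec_points R a b)) / q - 1"
proof -
  obtain B where B: "l1_bound (H_series q trace_sum) B"
    using H_series_l1[OF q_gt_1 abs_trace_sum] by blast
  obtain K where K: "\<And>n. inverse ((1 - fps_X) * H_series q trace_sum) $ n \<le> K"
    using inverse_H_series_bounded[OF q_gt_1 abs_trace_sum] by blast
  have degree: "Div.total_degree D = div_degree F C D" for D
    by (simp add: Div.total_degree_def div_degree_def)
  have norm: "real (div_norm F C D) = q ^ div_degree F C D" for D by (simp add: div_norm_def C_card)
  show ?thesis
    using Div.sum_distinguishable_tendsto[OF prime_count_le B K euler_product_nth]
    unfolding prime_count_1 distinguishable_divisors_iff norm degree conj_assoc by simp
qed

end

theorem theorem6p1: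
  fixes K :: "('a, 'm) ring_scheme" and A B a b :: 'a and p :: "'a set" and ap :: int
  defines "k \<equiv> residue_field K p"
  defines "q \<equiv> order k"
  defines "F \<equiv> function_field k (reduce K p a) (reduce K p b)"
  defines "C \<equiv> constant_field k (reduce K p a) (reduce K p b)"
  assumes "number_field K"
    and "elliptic_curve K A B"
    and "integral_model K A B a b"
    and "good_prime K a b p"
    and "int (card (ec_points k (reduce K p a) (reduce K p b))) = 1 - ap + int q"
  defines "S \<equiv> (\<lambda>n::nat. \<Sum>D | D \<in> distinguishable_divisors F C \<and>
                              2 \<le> div_degree F C D \<and> div_degree F C D \<le> n.
                            real_of_int (div_moebius D) / real (div_norm F C D))"
  shows "convergent S \<and> real_of_int ap = 1 - real q * lim S"
proof -
  interpret number_field_prime K p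
    using \<open>number_field K\<close> \<open>good_prime K a b p\<close>
    by (intro number_field_prime.intro) (auto simp: good_prime_def)
  have curve: "curve_field k (reduce K p a) (reduce K p b)"
    unfolding k_def using \<open>integral_model K A B a b\<close> \<open>good_prime K a b p\<close>
    by (intro curve_field_residue) (auto simp: integral_model_def good_prime_def)
  let ?N = "real (card (ec_points k (reduce K p a) (reduce K p b)))"
  have lim: "S \<longlonglongrightarrow> ?N / real q - 1"
    unfolding S_def F_def C_def q_def
    by (rule curve_field.sum_distinguishable_function_field[OF curve])
  have "?N = real_of_int (1 - ap + int q)"
    using \<open>int (card (ec_points k (reduce K p a) (reduce K p b))) = 1 - ap + int q\<close>
    by (metis of_int_of_nat_eq)
  moreover have "real q > 1" unfolding q_def by (rule curve_field.q_gt_1[OF curve])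
  ultimately have "real_of_int ap = 1 - real q * (?N / real q - 1)"
    by (simp add: right_diff_distrib)
  then show ?thesis using lim by (auto simp: convergent_def limI)
qed

end
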